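(* Let $\boldsymbol{\mu}=[T,d,\rho,\mu]$ and $\boldsymbol{\mu}_n=[T_n,d_n,\rho_n,\mu_n]$, $n\in\mathbb{N}$, be isometry classes in $\mathbb{T}_{\rm min}^{\rm di}$ (with the indicated representatives). Let $r_k\to\infty$ be an increasing sequence of $\boldsymbol{\mu}$-nice radii. For each $n$ and $k$, let $\Diamond_n^{r_k}$ be $\bullet^{r_k}(\mu)$-compatible cut-off points in $\partial B_{T_n}(\rho_n,r_k)$. Let $h,h_n\in(0,\infty)$, $n\in\mathbb{N}$, and suppose that (i) $\boldsymbol{\mu}_n\to\boldsymbol{\mu}$ Gromov-vaguely, and $\big(\mu_n|_{{\rm Cut}(T_n,\Diamond_n^{r_k})}\big)_{n\in\mathbb{N}}$ is b-tight for all $k$; (ii) $h_n\to h$ as $n\to\infty$. Then $\mathscr{E}_{h_n}\boldsymbol{\mu}_n\to\mathscr{E}_h\boldsymbol{\mu}$ Gromov-vaguely, and $\big((\mathscr{E}_h\mu_n)|_{{\rm Cut}(T_n,\Diamond_n^{r_k})}\big)_{n\in\mathbb{N}}$ is b-tight for all $k$.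
   Context: Trees and measures. An $\mathbb{R}$-tree is a pointed metric space $(T,d,\rho)$ (root $\rho$) such that any $\sigma_1,\sigma_2\in T$ are the end points of a unique segment $[\sigma_1,\sigma_2]$ (isometric image of a compact real interval), and whenever two segments satisfy $[\sigma_1,\sigma_0]\cap[\sigma_0,\sigma_2]=\{\sigma_0\}$, their union is a segment with end points $\sigma_1,\sigma_2$. It is Polish if $(T,d)$ is complete and separable. $\theta_\sigma T=\{\sigma'\in T:\sigma\in[\rho,\sigma']\}$. For $r>0$, $\overline B_T(\rho,r)=\{\sigma: d(\rho,\sigma)\le r\}$, $\partial B_T(\rho,r)=\{\sigma:d(\rho,\sigma)=r\}$. $n(\sigma,T)$ is the number of connected components of $T\setminus\{\sigma\}$; ${\rm Lf}(T)=\{\sigma\ne\rho:n(\sigma,T)=1\}$, ${\rm Bp}(T)=\{\sigma\ne\rho: n(\sigma,T)\ge 3\}$. $T$ is discrete if it is complete and $n(\rho,T)+\sum_{\sigma\in{\rm Bp}(T)\cap\overline B_T(\rho,r)}n(\sigma,T)<\infty$ for all $r>0$. A Borel measure is boundedly finite if finite on bounded sets; $\mathscr{M}_{\rm bf}(T)$, $\mathscr{M}_{\rm fin}(T)$ are the sets of boundedly finite and finite Borel measures. ${\rm Skel}(T,\mu)=\{\rho\}\cup\{\sigma:\mu(\theta_\sigma T)=+\infty\}$, $F_\mu(T)=T\setminus{\rm Skel}(T,\mu)$. $\mu\in\mathscr{M}_{\rm bf}(T)$ is discretely infinite if $\mu(T)=+\infty$, ${\rm Skel}(T,\mu)$ is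 a discrete $\mathbb{R}$-tree, and $\mu\big(\bigcup_{\sigma\in\partial B_T(\rho,r)\cap F_\mu(T)}\theta_\sigma T\big)<\infty$ for all $r>0$. $\mathscr{M}_{\rm di}(T)$ is the set of finite or discretely infinite measures. Mass erasure. For a closed rooted subtree $T'\subseteq T$ (closed, connected, containing $\rho$), $f_{T'}(\sigma)$ is the unique point with $[\rho,\sigma]\cap T'=[\rho,f_{T'}(\sigma)]$ and ${\rm Pr}_{T'}\mu=\mu\circ f_{T'}^{-1}$. $R_{\mu,h}(T)=\{\rho\}\cup\{\sigma:\mu(\theta_\sigma T)\ge h\}$ and $R_{\mu,h+}(T)=\overline{\bigcup_{h'>h}R_{\mu,h'}(T)}$. For $h>0$, $\mu\in\mathscr{M}_{\rm di}(T)$ and $R=R_{\mu,h}(T)$: $\mathscr{E}_h\mu=0$ if $\mu(T)<h$, and otherwise $$\mathscr{E}_h\mu={\rm Pr}_R\mu(\,\cdot\cap(R\setminus{\rm Lf}(R)))+\sum_{\sigma\in{\rm Lf}(R)}(\mu(\theta_\sigma T)-h)\delta_\sigma+h(n(\rho,R)-1)\delta_\rho+h\sum_{\sigma\in{\rm Bp}(R)}(n(\sigma,R)-2)\delta_\sigma ,$$ an element of $\mathscr{M}_{\rm di}(T)$. Isometry classes. ${\rm Span}(A)=\{\rho\}\cup\bigcup_{\sigma\in A}[\rho,\sigma]$. A measured Polish $\mathbb{R}$-tree $(T,d,\rho,\mu)$ is minimal if $T=\overline{{\rm Span}({\rm supp}(\mu))}$. Two measured trees are isometric if there is a root-preserving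 bijective isometry pushing one measure to the other. $\mathbb{T}_{\rm min}^{\rm fin}\subseteq\mathbb{T}_{\rm min}^{\rm di}\subseteq\mathbb{T}_{\rm min}^{\rm bf}$ are the sets of isometry classes $[T,d,\rho,\mu]$ of minimal Polish $\mathbb{R}$-trees with $\mu$ in $\mathscr{M}_{\rm fin}(T)$, $\mathscr{M}_{\rm di}(T)$, $\mathscr{M}_{\rm bf}(T)$. For $\boldsymbol\mu=[T,d,\rho,\mu]\in\mathbb{T}_{\rm min}^{\rm di}$ and $h>0$, $\mathscr{E}_h\boldsymbol\mu=[R_{\mu,h+}(T),d,\rho,\mathscr{E}_h\mu]\in\mathbb{T}_{\rm min}^{\rm di}$. Gromov-vague convergence. $d_{\rm GP}$ on $\mathbb{T}_{\rm min}^{\rm fin}$ is the infimum of the Prokhorov distances $\delta_{\rm P}(\mu_1\circ\phi_1^{-1},\mu_2\circ\phi_2^{-1})$ over pointed metric spaces $(\mathscr{Z},\delta,\varrho)$ and root-preserving isometric embeddings $\phi_i:T_i\to\mathscr{Z}$, where for finite measures $\delta_{\rm P}(\mu,\nu)=\inf\{\varepsilon>0:\mu(A)\le\nu(A^\varepsilon)+\varepsilon,\ \nu(A)\le\mu(A^\varepsilon)+\varepsilon\ \forall A\text{ closed}\}$, $A^\varepsilon=\{x:\delta(x,A)\le\varepsilon\}$. With $\mu^{\restriction r}=\mu|_{\overline B_T(\rho,r)}$ and $\boldsymbol\mu^{\restriction r}=[\overline{{\rm Span}({\rm supp}(\mu^{\restriction r}))},d,\rho,\mu^{\restriction r}]$,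 set $d_{\rm GV}(\boldsymbol\mu_1,\boldsymbol\mu_2)=\int_0^\infty e^{-r}(1\wedge d_{\rm GP}(\boldsymbol\mu_1^{\restriction r},\boldsymbol\mu_2^{\restriction r}))\,dr$. Gromov-vague convergence means $d_{\rm GV}\to0$. Cut-off. $\bullet^r(\mu)=\partial B_T(\rho,r)\cap{\rm Skel}(T,\mu)$ (a finite set). Cut-off points at level $r$ are a finite subset $\Diamond^r\subseteq\partial B_T(\rho,r)$, and ${\rm Cut}(T,\Diamond^r)=\overline B_T(\rho,r)\cup\bigcup_{\sigma\in\partial B_T(\rho,r)\setminus\Diamond^r}\theta_\sigma T$. A set $\Diamond_n^r$ of cut-off points in $\partial B_{T_n}(\rho_n,r)$ is $\bullet^r(\mu)$-compatible if $|\Diamond_n^r|=|\bullet^r(\mu)|\wedge|\partial B_{T_n}(\rho_n,r)|$. $r>0$ is $\boldsymbol\mu$-nice if $\mu(\partial B_T(\rho,r))=0$ and $\partial B_T(\rho,r)\cap{\rm Bp}(T)=\emptyset$. Measures $\nu_n$ on $T_n$ form a b-tight sequence if $\lim_{R\to\infty}\limsup_{n\to\infty}\nu_n(T_n\setminus\overline B_{T_n}(\rho_n,R))=0$. *)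

theory Defs
  imports "HOL-Analysis.Analysis"
begin

section \<open>Real trees\<close>

definition is_segment :: "'a metric \<Rightarrow> 'a \<Rightarrow> 'a \<Rightarrow> 'a set \<Rightarrow> bool" where
  "is_segment T x y S \<longleftrightarrow>
     (\<exists>\<phi> l. 0 \<le> l \<and> \<phi> ` {0..l} \<subseteq> mspace T \<and>
        (\<forall>s\<in>{0..l}. \<forall>t\<in>{0..l}. mdist T (\<phi> s) (\<phi> t) = \<bar>s - t\<bar>) \<and>
        \<phi> 0 = x \<and> \<phi> l = y \<and> S = \<phi> ` {0..l::real})"

definition rtree :: "'a metric \<Rightarrow> 'a \<Rightarrow> bool" where
  "rtree T \<rho> \<longleftrightarrow>
     \<rho> \<in> mspace T \<and>
     (\<forall>x\<in>mspace T. \<forall>y\<in>mspace T. \<exists>!S. is_segment T x y S) \<and>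
     (\<forall>x z y S1 S2. is_segment T x z S1 \<and> is_segment T z y S2 \<and> S1 \<inter> S2 = {z}
        \<longrightarrow> is_segment T x y (S1 \<union> S2))"

definition polish_rtree :: "'a metric \<Rightarrow> 'a \<Rightarrow> bool" where
  "polish_rtree T \<rho> \<longleftrightarrow> rtree T \<rho> \<and> mcomplete_of T \<and> separable_space (mtopology_of T)"

definition seg :: "'a metric \<Rightarrow> 'a \<Rightarrow> 'a \<Rightarrow> 'a set" where
  "seg T x y = (THE S. is_segment T x y S)"

definition above :: "'a metric \<Rightarrow> 'a \<Rightarrow> 'a \<Rightarrow> 'a set" \<comment> \<open>\<open>\<theta>\<^sub>\<sigma> T\<close>\<close> where
  "above T \<rho> \<sigma> = {\<sigma>' \<in> mspace T. \<sigma> \<in> seg T \<rho> \<sigma>'}"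

definition msphere_of :: "'a metric \<Rightarrow> 'a \<Rightarrow> real \<Rightarrow> 'a set" where
  "msphere_of T x r = {y \<in> mspace T. mdist T x y = r}"

definition ecard :: "'a set \<Rightarrow> enat" where
  "ecard A = (if finite A then enat (card A) else \<infinity>)"

definition ncomp :: "'a metric \<Rightarrow> 'a \<Rightarrow> enat" \<comment> \<open>\<open>n(\<sigma>, T)\<close>\<close> where
  "ncomp T \<sigma> =
     ecard (connected_components_of (subtopology (mtopology_of T) (mspace T - {\<sigma>})))"

definition Lf :: "'a metric \<Rightarrow> 'a \<Rightarrow> 'a set" where
  "Lf T \<rho> = {\<sigma> \<in> mspace T. \<sigma> \<noteq> \<rho> \<and> ncomp T \<sigma> = 1}"

definition Bp :: "'a metric \<Rightarrow> 'a \<Rightarrow> 'a set" where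
  "Bp T \<rho> = {\<sigma> \<in> mspace T. \<sigma> \<noteq> \<rho> \<and> ncomp T \<sigma> \<ge> 3}"

definition discrete_rtree :: "'a metric \<Rightarrow> 'a \<Rightarrow> bool" where
  "discrete_rtree T \<rho> \<longleftrightarrow>
     rtree T \<rho> \<and> mcomplete_of T \<and>
     (\<forall>r>0. ncomp T \<rho> + (\<Sum>\<^sub>\<infinity>\<sigma>\<in>Bp T \<rho> \<inter> mcball_of T \<rho> r. ncomp T \<sigma>) < \<infinity>)"

definition Span :: "'a metric \<Rightarrow> 'a \<Rightarrow> 'a set \<Rightarrow> 'a set" where
  "Span T \<rho> A = {\<rho>} \<union> (\<Union>\<sigma>\<in>A. seg T \<rho> \<sigma>)"


section \<open>Measures on trees\<close>

definition metric_borel :: "'a metric \<Rightarrow> 'a measure" where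
  "metric_borel T = sigma (mspace T) {U. openin (mtopology_of T) U}"

definition borel_measure_on :: "'a metric \<Rightarrow> 'a measure \<Rightarrow> bool" where
  "borel_measure_on T \<mu> \<longleftrightarrow> space \<mu> = mspace T \<and> sets \<mu> = sets (metric_borel T)"

definition M_fin :: "'a metric \<Rightarrow> 'a measure set" where
  "M_fin T = {\<mu>. borel_measure_on T \<mu> \<and> emeasure \<mu> (mspace T) < \<infinity>}"

definition M_bf :: "'a metric \<Rightarrow> 'a measure set" where
  "M_bf T = {\<mu>. borel_measure_on T \<mu> \<and>
     (\<forall>A\<in>sets \<mu>. Metric_space.mbounded (mspace T) (mdist T) A \<longrightarrow> emeasure \<mu> A < \<infinity>)}"

definition Skel :: "'a metric \<Rightarrow> 'a \<Rightarrow> 'a measure \<Rightarrow> 'a set" where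
  "Skel T \<rho> \<mu> = {\<rho>} \<union> {\<sigma> \<in> mspace T. emeasure \<mu> (above T \<rho> \<sigma>) = \<infinity>}"

definition F_part :: "'a metric \<Rightarrow> 'a \<Rightarrow> 'a measure \<Rightarrow> 'a set" where
  "F_part T \<rho> \<mu> = mspace T - Skel T \<rho> \<mu>"

definition discretely_infinite :: "'a metric \<Rightarrow> 'a \<Rightarrow> 'a measure \<Rightarrow> bool" where
  "discretely_infinite T \<rho> \<mu> \<longleftrightarrow>
     \<mu> \<in> M_bf T \<and> emeasure \<mu> (mspace T) = \<infinity> \<and>
     discrete_rtree (submetric T (Skel T \<rho> \<mu>)) \<rho> \<and>
     (\<forall>r>0. emeasure \<mu> (\<Union>\<sigma>\<in>msphere_of T \<rho> r \<inter> F_part T \<rho> \<mu>. above T \<rho> \<sigma>) < \<infinity>)"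

definition M_di :: "'a metric \<Rightarrow> 'a \<Rightarrow> 'a measure set" where
  "M_di T \<rho> = M_fin T \<union> {\<mu>. discretely_infinite T \<rho> \<mu>}"

definition supp :: "'a metric \<Rightarrow> 'a measure \<Rightarrow> 'a set" where
  "supp T \<mu> = {x \<in> mspace T. \<forall>U. openin (mtopology_of T) U \<and> x \<in> U \<longrightarrow> emeasure \<mu> U > 0}"

definition mrestrict :: "'a measure \<Rightarrow> 'a set \<Rightarrow> 'a measure" where
  \<comment> \<open>\<open>A \<mapsto> \<mu> (A \<inter> B)\<close>, kept as a measure on the whole space of \<open>\<mu>\<close>\<close>
  "mrestrict \<mu> B = density \<mu> (indicator B)"

text \<open>
  A triple \<open>(T, \<rho>, \<mu>)\<close> represents the isometry class \<open>[T, d, \<rho>, \<mu>]\<close>. The operations on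
  classes are given by formulas on representatives; \<open>dGP\<close> and \<open>dGV\<close> below are invariant under
  root- and measure-preserving isometries, also between different carrier types.
\<close>

type_synonym 'a mtree = "'a metric \<times> 'a \<times> 'a measure"

definition T_min_di :: "'a mtree set" where
  "T_min_di = {(T, \<rho>, \<mu>). polish_rtree T \<rho> \<and> \<mu> \<in> M_di T \<rho> \<and>
     mspace T = mtopology_of T closure_of Span T \<rho> (supp T \<mu>)}"


section \<open>Mass erasure\<close>

definition tree_proj :: "'a metric \<Rightarrow> 'a \<Rightarrow> 'a set \<Rightarrow> 'a \<Rightarrow> 'a" where
  "tree_proj T \<rho> T' \<sigma> = (THE p. p \<in> mspace T \<and> seg T \<rho> \<sigma> \<inter> T' = seg T \<rho> p)"

definition Pr :: "'a metric \<Rightarrow> 'a \<Rightarrow> 'a set \<Rightarrow> 'a measure \<Rightarrow> 'a measure" where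
  "Pr T \<rho> T' \<mu> = distr \<mu> (metric_borel T) (tree_proj T \<rho> T')"

definition Rh :: "'a metric \<Rightarrow> 'a \<Rightarrow> 'a measure \<Rightarrow> real \<Rightarrow> 'a set" where
  "Rh T \<rho> \<mu> h = {\<rho>} \<union> {\<sigma> \<in> mspace T. emeasure \<mu> (above T \<rho> \<sigma>) \<ge> ennreal h}"

definition Rh_plus :: "'a metric \<Rightarrow> 'a \<Rightarrow> 'a measure \<Rightarrow> real \<Rightarrow> 'a set" where
  "Rh_plus T \<rho> \<mu> h = mtopology_of T closure_of (\<Union>h'\<in>{h<..}. Rh T \<rho> \<mu> h')"

text \<open>
  The coefficient \<open>h (n(\<rho>, R) - 1)\<close> of \<open>\<delta>\<^sub>\<rho>\<close> equals \<open>-h\<close> when \<open>R = {\<rho>}\<close>, so it cannot be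
  computed in the extended nonnegative reals on its own. The summand \<open>-h \<delta>\<^sub>\<rho>\<close> is therefore
  subtracted last. Truncation never occurs for \<open>h \<le> \<mu>(T)\<close>: the remaining terms give
  \<open>{\<rho>}\<close> mass at least \<open>h n(\<rho>, R)\<close> in general, and mass \<open>\<mu>(T)\<close> if \<open>R = {\<rho>}\<close>.
\<close>

definition erase :: "'a metric \<Rightarrow> 'a \<Rightarrow> real \<Rightarrow> 'a measure \<Rightarrow> 'a measure" where
  "erase T \<rho> h \<mu> =
    (if emeasure \<mu> (mspace T) < ennreal h then null_measure (metric_borel T)
     else
       let R = Rh T \<rho> \<mu> h; TR = submetric T R in
       measure_of (mspace T) {U. openin (mtopology_of T) U}
         (\<lambda>A. emeasure (Pr T \<rho> R \<mu>) (A \<inter> (R - Lf TR \<rho>))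
            + (\<Sum>\<^sub>\<infinity>\<sigma>\<in>Lf TR \<rho> \<inter> A. emeasure \<mu> (above T \<rho> \<sigma>) - ennreal h)
            + ennreal h * (\<Sum>\<^sub>\<infinity>\<sigma>\<in>Bp TR \<rho> \<inter> A. ennreal_of_enat (ncomp TR \<sigma> - 2))
            + ennreal h * ennreal_of_enat (ncomp TR \<rho>) * indicator A \<rho>
            - ennreal h * indicator A \<rho>))"

definition erase_tree :: "real \<Rightarrow> 'a mtree \<Rightarrow> 'a mtree" where
  "erase_tree h = (\<lambda>(T, \<rho>, \<mu>).
     (submetric T (Rh_plus T \<rho> \<mu> h), \<rho>, restrict_space (erase T \<rho> h \<mu>) (Rh_plus T \<rho> \<mu> h)))"


section \<open>Gromov-vague convergence\<close>

definition thicken :: "'z metric \<Rightarrow> 'z set \<Rightarrow> real \<Rightarrow> 'z set" where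
  \<comment> \<open>the distance to the empty set is infinite\<close>
  "thicken Z A \<epsilon> = {x \<in> mspace Z. A \<noteq> {} \<and> (INF a\<in>A. mdist Z x a) \<le> \<epsilon>}"

definition dP :: "'z metric \<Rightarrow> 'z measure \<Rightarrow> 'z measure \<Rightarrow> real" where
  "dP Z \<mu> \<nu> = Inf {\<epsilon>. \<epsilon> > 0 \<and> (\<forall>A. closedin (mtopology_of Z) A \<longrightarrow>
     emeasure \<mu> A \<le> emeasure \<nu> (thicken Z A \<epsilon>) + ennreal \<epsilon> \<and>
     emeasure \<nu> A \<le> emeasure \<mu> (thicken Z A \<epsilon>) + ennreal \<epsilon>)}"

definition rooted_embedding :: "'a metric \<Rightarrow> 'a \<Rightarrow> 'z metric \<Rightarrow> 'z \<Rightarrow> ('a \<Rightarrow> 'z) \<Rightarrow> bool" where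
  "rooted_embedding T \<rho> Z z \<phi> \<longleftrightarrow>
     \<phi> \<in> mspace T \<rightarrow> mspace Z \<and>
     (\<forall>x\<in>mspace T. \<forall>y\<in>mspace T. mdist Z (\<phi> x) (\<phi> y) = mdist T x y) \<and>
     \<phi> \<rho> = z"

text \<open>
  HOL cannot quantify over the carrier type of \<open>Z\<close>. Nothing is lost by taking metric spaces
  carried by subsets of the sum type: replacing \<open>Z\<close> by its subspace \<open>\<phi>1(T1) \<union> \<phi>2(T2)\<close> does not
  change the Prokhorov distance of the image measures, and that subspace is in bijection with a
  subset of the sum type.
\<close>

definition dGP :: "'a mtree \<Rightarrow> 'b mtree \<Rightarrow> real" where
  "dGP = (\<lambda>(T1, \<rho>1, \<mu>1) (T2, \<rho>2, \<mu>2).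
     Inf {dP Z (distr \<mu>1 (metric_borel Z) \<phi>1) (distr \<mu>2 (metric_borel Z) \<phi>2)
          | (Z :: ('a + 'b) metric) z \<phi>1 \<phi>2.
            z \<in> mspace Z \<and> rooted_embedding T1 \<rho>1 Z z \<phi>1 \<and> rooted_embedding T2 \<rho>2 Z z \<phi>2})"

definition trunc_tree :: "real \<Rightarrow> 'a mtree \<Rightarrow> 'a mtree" where
  "trunc_tree r = (\<lambda>(T, \<rho>, \<mu>).
     let \<nu> = mrestrict \<mu> (mcball_of T \<rho> r);
         S = mtopology_of T closure_of Span T \<rho> (supp T \<nu>)
     in (submetric T S, \<rho>, restrict_space \<nu> S))"

definition dGV :: "'a mtree \<Rightarrow> 'b mtree \<Rightarrow> real" where
  "dGV X Y = (LBINT r:{0..}. exp (- r) * min 1 (dGP (trunc_tree r X) (trunc_tree r Y)))"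

definition GV_converges :: "(nat \<Rightarrow> 'b mtree) \<Rightarrow> 'a mtree \<Rightarrow> bool" where
  "GV_converges X Y \<longleftrightarrow> (\<lambda>n. dGV (X n) Y) \<longlonglongrightarrow> 0"


section \<open>Cut-off\<close>

definition skel_sphere :: "'a metric \<Rightarrow> 'a \<Rightarrow> 'a measure \<Rightarrow> real \<Rightarrow> 'a set" where
  "skel_sphere T \<rho> \<mu> r = msphere_of T \<rho> r \<inter> Skel T \<rho> \<mu>"

definition cutoff_points :: "'a metric \<Rightarrow> 'a \<Rightarrow> real \<Rightarrow> 'a set \<Rightarrow> bool" where
  "cutoff_points T \<rho> r D \<longleftrightarrow> finite D \<and> D \<subseteq> msphere_of T \<rho> r"

definition Cut :: "'a metric \<Rightarrow> 'a \<Rightarrow> real \<Rightarrow> 'a set \<Rightarrow> 'a set" where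
  "Cut T \<rho> r D = mcball_of T \<rho> r \<union> (\<Union>\<sigma>\<in>msphere_of T \<rho> r - D. above T \<rho> \<sigma>)"

text \<open>\<open>D\<close> is a set of cut-off points in the sphere of \<open>T'\<close> compatible with the set \<open>P\<close>.\<close>

definition compatible :: "'a set \<Rightarrow> 'b metric \<Rightarrow> 'b \<Rightarrow> real \<Rightarrow> 'b set \<Rightarrow> bool" where
  "compatible P T' \<rho>' r D \<longleftrightarrow>
     cutoff_points T' \<rho>' r D \<and> ecard D = min (ecard P) (ecard (msphere_of T' \<rho>' r))"

definition nice_radius :: "'a mtree \<Rightarrow> real \<Rightarrow> bool" where
  "nice_radius = (\<lambda>(T, \<rho>, \<mu>) r.
     r > 0 \<and> emeasure \<mu> (msphere_of T \<rho> r) = 0 \<and> msphere_of T \<rho> r \<inter> Bp T \<rho> = {})"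

definition b_tight :: "(nat \<Rightarrow> 'a mtree) \<Rightarrow> bool" where
  "b_tight X \<longleftrightarrow>
     ((\<lambda>R. limsup (\<lambda>n. case X n of (T, \<rho>, \<nu>) \<Rightarrow> emeasure \<nu> (mspace T - mcball_of T \<rho> R)))
        \<longlongrightarrow> 0) at_top"

end

theory Submission
  imports Defs
begin

text \<open>
  Let \<open>v\<close> be uniform on \<open>(0, 1)\<close>. For a finite measure \<open>\<mu>\<close>, mass erasure moves the mass at \<open>x\<close> down to
  its projection on \<open>R\<^bsub>\<mu>,h/v\<^esub>\<close> and discards it if \<open>h / v\<close> exceeds the total mass. Indeed, both this
  mixture and \<open>\<E>\<^sub>h \<mu>\<close> give mass \<open>(\<mu>(\<theta>\<^sub>\<sigma>) - h)\<^sup>+\<close> to \<open>\<theta>\<^sub>\<sigma>\<close>, and these sets determine a finite measure.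
  Passing to nearby trees and measures changes the levels \<open>\<mu>(\<theta>\<^sub>\<sigma>)\<close> only slightly; by monotonicity in
  \<open>v\<close> this has the effect of a small shift of \<open>v\<close>, whence continuity in \<open>\<mu>\<close> and \<open>h\<close> for finite measures.

  In the discretely infinite case, fix a nice radius \<open>q\<close> and replace the infinite mass above each of the
  finitely many skeleton points \<open>\<sigma>\<close> at height \<open>q\<close> by an atom of size \<open>2 h\<close> at \<open>\<sigma>\<close>. Below height \<open>q\<close> this does
  not change the erased measure. The mass of \<open>\<mu>\<^sub>n\<close> above the point matching \<open>\<sigma>\<close> exceeds the bounded
  mass of the cut trees, so tightness forces the cut-off points of \<open>T\<^sub>n\<close> to be exactly the matching points.
  Hence the modified finite measures converge, and so do the erased measures on every ball.
\<close>

section \<open>Rooted real trees\<close>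

text \<open>The formula for E_h refers to leaves, branch points and component counts of R, none of
  which is stable under small perturbations. In the mixture they are absent: only the height of the
  projection of each point has to be compared, and on a set of mass m the loss h is accounted for by
  the factor (1 - h/m)^+, the length of {v in (0,1): h <= v m}. Increments of that height under a
  shift of v can be large at single values of v, but their integral over v telescopes.

  Trees enter through heights and the Gromov product at the root, the height at which two points
  separate. Closeness of two trees becomes a relation between their points that nearly preserves
  this product; such a relation, unlike a fixed ambient space, can be enlarged by pairs of ancestors
  and by pairs of matching cut points.

  The atoms have size 2 h because h and eventually every h_n lie below 2 h. Niceness of the radius
  makes the cut stable: above a skeleton point of the sphere there is a single branch, and the
  points that a small perturbation could carry across the cut have small mass.\<close>

definition gprod :: "'a metric \<Rightarrow> 'a \<Rightarrow> 'a \<Rightarrow> 'a \<Rightarrow> real" where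
  "gprod T \<rho> x y = (mdist T \<rho> x + mdist T \<rho> y - mdist T x y) / 2"

lemma is_segmentI:
  assumes "0 \<le> l" "\<And>t. 0 \<le> t \<Longrightarrow> t \<le> l \<Longrightarrow> \<phi> t \<in> mspace T"
    "\<And>s t. 0 \<le> s \<Longrightarrow> s \<le> t \<Longrightarrow> t \<le> l \<Longrightarrow> mdist T (\<phi> s) (\<phi> t) = t - s"
    "\<phi> 0 = x" "\<phi> l = y" "S = \<phi> ` {0..l}"
  shows "is_segment T x y S"
proof -
  have "mdist T (\<phi> s) (\<phi> t) = \<bar>s - t\<bar>" if "s \<in> {0..l}" "t \<in> {0..l}" for s t
  proof (cases "s \<le> t")
    case True
    then show ?thesis using assms(3)[of s t] that by auto
  next
    case False
    then show ?thesis using assms(3)[of t s] that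
      by (auto simp: mdist_commute[of T "\<phi> s"])
  qed
  then show ?thesis
    unfolding is_segment_def using assms by (intro exI[of _ \<phi>] exI[of _ l]) auto
qed

locale rooted_rtree =
  fixes T :: "'a metric" and \<rho> :: 'a
  assumes rtree: "rtree T \<rho>"
begin

abbreviation "ht x \<equiv> mdist T \<rho> x"
abbreviation "gp \<equiv> gprod T \<rho>"

text \<open>The ancestor of \<open>x\<close> at height \<open>t\<close>; specified only for heights
  between 0 and \<open>ht x\<close>.\<close>

definition pt :: "'a \<Rightarrow> real \<Rightarrow> 'a" where
  "pt x t = (THE y. y \<in> seg T \<rho> x \<and> ht y = t)"

lemma root_in [simp, intro]: "\<rho> \<in> mspace T"
  using rtree unfolding rtree_def by (rule conjunct1)

lemma ht_root [simp]: "ht \<rho> = 0"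
  by simp

lemma segment_ex1: "x \<in> mspace T \<Longrightarrow> y \<in> mspace T \<Longrightarrow> \<exists>!S. is_segment T x y S"
  using rtree unfolding rtree_def by (elim conjE) (drule (1) bspec, drule (1) bspec)

lemma is_segment_seg: "x \<in> mspace T \<Longrightarrow> is_segment T \<rho> x (seg T \<rho> x)"
  unfolding seg_def by (rule theI', rule segment_ex1[OF root_in])

lemma is_segment_unique: "is_segment T \<rho> x S \<Longrightarrow> x \<in> mspace T \<Longrightarrow> S = seg T \<rho> x"
  using segment_ex1[OF root_in, of x] is_segment_seg[of x] by blast

lemma seg_param:
  assumes "x \<in> mspace T"
  obtains \<phi> where "\<And>t. 0 \<le> t \<Longrightarrow> t \<le> ht x \<Longrightarrow> \<phi> t \<in> mspace T"
    "\<And>s t. 0 \<le> s \<Longrightarrow> s \<le> t \<Longrightarrow> t \<le> ht x \<Longrightarrow> mdist T (\<phi> s) (\<phi> t) = t - s"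
    "\<phi> 0 = \<rho>" "\<phi> (ht x) = x" "seg T \<rho> x = \<phi> ` {0..ht x}"
    "\<And>t. 0 \<le> t \<Longrightarrow> t \<le> ht x \<Longrightarrow> pt x t = \<phi> t"
proof -
  obtain \<phi> l where \<phi>: "0 \<le> l" "\<phi> ` {0..l} \<subseteq> mspace T"
    "\<forall>s\<in>{0..l}. \<forall>t\<in>{0..l}. mdist T (\<phi> s) (\<phi> t) = \<bar>s - t\<bar>"
    "\<phi> 0 = \<rho>" "\<phi> l = x" "seg T \<rho> x = \<phi> ` {0..l::real}"
    using is_segment_seg[OF assms] unfolding is_segment_def by blast
  have l: "l = ht x"
    using \<phi>(1,3,4,5) by (metis abs_minus_commute abs_of_nonneg atLeastAtMost_iff diff_zero order_refl)
  have h: "ht (\<phi> t) = t" if "0 \<le> t" "t \<le> l" for t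
    using \<phi>(1,3,4) that by (metis abs_minus_commute abs_of_nonneg atLeastAtMost_iff diff_zero order_refl)
  show ?thesis
  proof (rule that[of \<phi>])
    show "mdist T (\<phi> s) (\<phi> t) = t - s" if "0 \<le> s" "s \<le> t" "t \<le> ht x" for s t
      using \<phi>(3) that l by auto
    show "pt x t = \<phi> t" if "0 \<le> t" "t \<le> ht x" for t
      unfolding pt_def \<phi>(6) using h that l by (intro the_equality) auto
  qed (use \<phi> l in auto)
qed

lemma
  assumes "x \<in> mspace T"
  shows pt_in: "0 \<le> t \<Longrightarrow> t \<le> ht x \<Longrightarrow> pt x t \<in> mspace T"
    and dist_pt: "0 \<le> s \<Longrightarrow> s \<le> t \<Longrightarrow> t \<le> ht x \<Longrightarrow> mdist T (pt x s) (pt x t) = t - s"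
    and pt_0: "pt x 0 = \<rho>"
    and pt_ht: "pt x (ht x) = x"
    and ht_pt: "0 \<le> t \<Longrightarrow> t \<le> ht x \<Longrightarrow> ht (pt x t) = t"
    and seg_eq: "seg T \<rho> x = pt x ` {0..ht x}"
proof -
  obtain \<phi> where \<phi>: "\<And>t. 0 \<le> t \<Longrightarrow> t \<le> ht x \<Longrightarrow> \<phi> t \<in> mspace T"
    "\<And>s t. 0 \<le> s \<Longrightarrow> s \<le> t \<Longrightarrow> t \<le> ht x \<Longrightarrow> mdist T (\<phi> s) (\<phi> t) = t - s"
    "\<phi> 0 = \<rho>" "\<phi> (ht x) = x" "seg T \<rho> x = \<phi> ` {0..ht x}"
    "\<And>t. 0 \<le> t \<Longrightarrow> t \<le> ht x \<Longrightarrow> pt x t = \<phi> t"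
    using seg_param[OF assms] by blast
  have [simp]: "0 \<le> ht x" by simp
  show "0 \<le> t \<Longrightarrow> t \<le> ht x \<Longrightarrow> pt x t \<in> mspace T" using \<phi> by auto
  show "0 \<le> s \<Longrightarrow> s \<le> t \<Longrightarrow> t \<le> ht x \<Longrightarrow> mdist T (pt x s) (pt x t) = t - s" using \<phi> by auto
  show "pt x 0 = \<rho>" "pt x (ht x) = x" using \<phi> by auto
  show "0 \<le> t \<Longrightarrow> t \<le> ht x \<Longrightarrow> ht (pt x t) = t" using \<phi>(2)[of 0 t] \<phi> by auto
  show "seg T \<rho> x = pt x ` {0..ht x}" using \<phi>(5,6) by (auto simp: image_iff)
qed

lemma pt_pt:
  assumes x: "x \<in> mspace T" and "0 \<le> s" "s \<le> t" "t \<le> ht x"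
  shows "pt (pt x t) s = pt x s"
proof -
  have t: "pt x t \<in> mspace T" "ht (pt x t) = t" using assms by (auto simp: pt_in ht_pt)
  have "is_segment T \<rho> (pt x t) (pt x ` {0..t})"
    by (rule is_segmentI[of t "pt x"]) (use assms in \<open>auto simp: pt_in dist_pt pt_0\<close>)
  then have "seg T \<rho> (pt x t) = pt x ` {0..t}" using is_segment_unique t by blast
  then have "pt x s \<in> seg T \<rho> (pt x t)" using assms by auto
  then obtain u where "u \<in> {0..t}" "pt x s = pt (pt x t) u"
    using seg_eq[OF t(1)] t(2) by auto
  moreover have "ht (pt x s) = s" using assms by (auto simp: ht_pt)
  moreover have "ht (pt (pt x t) u) = u" using calculation t by (auto simp: ht_pt)
  ultimately show ?thesis by metis
qed

lemma gp_sym: "gp x y = gp y x"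
  by (simp add: gprod_def mdist_commute)

lemma gp_self: "x \<in> mspace T \<Longrightarrow> gp x x = ht x"
  by (simp add: gprod_def)

lemma gp_le1: "x \<in> mspace T \<Longrightarrow> y \<in> mspace T \<Longrightarrow> gp x y \<le> ht x"
  using mdist_triangle[of \<rho> T x y] by (simp add: gprod_def)

lemma gp_le2: "x \<in> mspace T \<Longrightarrow> y \<in> mspace T \<Longrightarrow> gp x y \<le> ht y"
  using gp_le1[of y x] by (simp add: gp_sym)

lemma gp_nonneg: "x \<in> mspace T \<Longrightarrow> y \<in> mspace T \<Longrightarrow> 0 \<le> gp x y"
  using mdist_triangle[of x T \<rho> y] unfolding gprod_def mdist_commute[of T x \<rho>] by simp

text \<open>The heights at which the two segments agree form an interval [0,p]. Their remainders
  meet only in the separation point, so the tree axiom joins them to a segment from \<open>x\<close>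
  to \<open>y\<close>; additivity of the distance at the separation point then gives p =
  \<open>gp x y\<close>.\<close>

lemma pt_eq_iff:
  assumes x: "x \<in> mspace T" and y: "y \<in> mspace T" and "0 \<le> t" "t \<le> ht x" "t \<le> ht y"
  shows "pt x t = pt y t \<longleftrightarrow> t \<le> gp x y"
proof -
  define m where "m = min (ht x) (ht y)"
  have m0: "0 \<le> m" by (simp add: m_def)
  define E where "E = {t. 0 \<le> t \<and> t \<le> m \<and> pt x t = pt y t}"
  have down: "s \<in> E" if "t \<in> E" "0 \<le> s" "s \<le> t" for s t
  proof -
    have "pt (pt x t) s = pt x s" "pt (pt y t) s = pt y s"
      using that x y pt_pt[of x s t] pt_pt[of y s t] by (simp_all add: E_def m_def)
    then show ?thesis using that by (auto simp: E_def)
  qed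
  have E0: "0 \<in> E" using m0 x y by (auto simp: E_def pt_0)
  have bdd: "bdd_above E" by (auto simp: E_def bdd_above_def)
  define p where "p = Sup E"
  have p0: "0 \<le> p" using E0 bdd cSup_upper by (auto simp: p_def)
  have pm: "p \<le> m" unfolding p_def using E0 by (intro cSup_least) (auto simp: E_def)
  \<comment> \<open>The supremum is attained: a height t in \<open>E\<close> close to p places
    \<open>pt x p\<close> and \<open>pt y p\<close> within 2 (p - t) of each other.\<close>
  have pE: "p \<in> E"
  proof -
    have "mdist T (pt x p) (pt y p) \<le> e" if e: "e > 0" for e
    proof -
      obtain t where t: "t \<in> E" "p - e/2 < t"
        using less_cSupD[of E "p - e/2"] E0 e unfolding p_def by force
      have tp: "t \<le> p" using t bdd cSup_upper by (auto simp: p_def)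
      have in1: "pt x p \<in> mspace T" "pt y p \<in> mspace T" "pt x t \<in> mspace T"
        using t p0 pm x y by (auto simp: E_def m_def intro!: pt_in)
      have "mdist T (pt x p) (pt y p) \<le> mdist T (pt x p) (pt x t) + mdist T (pt x t) (pt y p)"
        using in1 by (intro mdist_triangle) auto
      also have "mdist T (pt x p) (pt x t) = p - t"
          using t tp pm dist_pt[OF x, of t p] mdist_commute[of T "pt x t"] by (simp add: E_def m_def)
      also have "mdist T (pt x t) (pt y p) = p - t"
          using t tp pm dist_pt[OF y, of t p] by (simp add: E_def m_def)
      finally show ?thesis using t by simp
    qed
    then have "mdist T (pt x p) (pt y p) \<le> 0" by (rule field_le_epsilon[of _ 0, simplified])
    moreover have "pt x p \<in> mspace T" "pt y p \<in> mspace T"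
      using p0 pm x y by (auto simp: m_def intro!: pt_in)
    ultimately have "pt x p = pt y p" by (metis mdist_nonneg mdist_zero order_antisym)
    then show ?thesis using p0 pm by (auto simp: E_def)
  qed
  have Eeq: "t \<in> E \<longleftrightarrow> 0 \<le> t \<and> t \<le> p" for t
    using down[OF pE, of t] cSup_upper[OF _ bdd, of t] by (auto simp: p_def E_def)
  define c where "c = pt x p"
  have cy: "c = pt y p" using pE by (simp add: c_def E_def)
  have pmx: "p \<le> ht x" "p \<le> ht y" using pm by (auto simp: m_def)
  \<comment> \<open>Parametrised downwards from \<open>x\<close>, so that this piece ends where the
    next one begins.\<close>
  have s1: "is_segment T x c (pt x ` {p..ht x})"
  proof (rule is_segmentI[of "ht x - p" "\<lambda>s. pt x (ht x - s)"])
    show "pt x ` {p..ht x} = (\<lambda>s. pt x (ht x - s)) ` {0..ht x - p}"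
    proof -
      have "(\<lambda>s. ht x - s) ` {0..ht x - p} = {p..ht x}" by (simp)
      then show ?thesis by (metis image_image)
    qed
    show "mdist T (pt x (ht x - s)) (pt x (ht x - t)) = t - s" if "0 \<le> s" "s \<le> t" "t \<le> ht x - p" for s t
      using that dist_pt[OF x, of "ht x - t" "ht x - s"] p0
      by (subst mdist_commute) simp
  qed (use x p0 pmx in \<open>auto simp: pt_in pt_ht c_def\<close>)
  have s2: "is_segment T c y (pt y ` {p..ht y})"
  proof (rule is_segmentI[of "ht y - p" "\<lambda>s. pt y (p + s)"])
    show "pt y ` {p..ht y} = (\<lambda>s. pt y (p + s)) ` {0..ht y - p}"
    proof -
      have "(\<lambda>s. p + s) ` {0..ht y - p} = {p..ht y}" by (simp)
      then show ?thesis by (metis image_image)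
    qed
  qed (use y p0 pmx in \<open>auto simp: pt_in dist_pt pt_ht cy\<close>)
  have int: "pt x ` {p..ht x} \<inter> pt y ` {p..ht y} = {c}"
  proof -
    have "z = c" if z: "z \<in> pt x ` {p..ht x}" "z \<in> pt y ` {p..ht y}" for z
    proof -
      obtain s s' where s: "p \<le> s" "s \<le> ht x" "z = pt x s" "p \<le> s'" "s' \<le> ht y" "z = pt y s'"
        using z by auto
      have "s = ht z" "s' = ht z" using s p0 ht_pt[OF x, of s] ht_pt[OF y, of s'] by simp_all
      then have "s \<in> E" using s p0 by (auto simp: E_def m_def)
      then have "s = p" using Eeq s by auto
      then show ?thesis using s by (simp add: c_def)
    qed
    moreover have "c \<in> pt x ` {p..ht x}" "c \<in> pt y ` {p..ht y}"
      using pmx by (simp add: c_def, simp add: cy)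
    ultimately show ?thesis by blast
  qed
  have "is_segment T x y (pt x ` {p..ht x} \<union> pt y ` {p..ht y})"
    using rtree s1 s2 int unfolding rtree_def by metis
  then obtain \<psi> l where \<psi>: "0 \<le> l" "\<psi> ` {0..l} \<subseteq> mspace T"
    "\<forall>s\<in>{0..l}. \<forall>t\<in>{0..l}. mdist T (\<psi> s) (\<psi> t) = \<bar>s - t\<bar>"
    "\<psi> 0 = x" "\<psi> l = y" "pt x ` {p..ht x} \<union> pt y ` {p..ht y} = \<psi> ` {0..l::real}"
    unfolding is_segment_def by blast
  have "c \<in> \<psi> ` {0..l}" using int \<psi>(6) by blast
  then obtain u where u: "0 \<le> u" "u \<le> l" "c = \<psi> u" by auto
  have "mdist T (\<psi> 0) (\<psi> u) = u" "mdist T (\<psi> u) (\<psi> l) = l - u" "mdist T (\<psi> 0) (\<psi> l) = l"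
    using \<psi>(1,3) u by auto
  then have "mdist T x c + mdist T c y = mdist T x y" using \<psi>(4,5) u(3) by simp
  moreover have "mdist T x c = ht x - p"
    using dist_pt[OF x, of p "ht x"] p0 pmx x by (simp add: c_def pt_ht mdist_commute)
  moreover have "mdist T c y = ht y - p"
    using dist_pt[OF y, of p "ht y"] p0 pmx y by (simp add: cy pt_ht mdist_commute)
  ultimately have "p = gp x y" by (simp add: gprod_def)
  then show ?thesis using Eeq[of t] assms by (auto simp: E_def m_def)
qed

lemma pt_gp: "x \<in> mspace T \<Longrightarrow> y \<in> mspace T \<Longrightarrow> pt x (gp x y) = pt y (gp x y)"
  by (rule pt_eq_iff[THEN iffD2]) (auto intro: gp_nonneg gp_le1 gp_le2)

lemma gp_pt:
  assumes x: "x \<in> mspace T" and y: "y \<in> mspace T" and s: "0 \<le> s" "s \<le> ht x"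
  shows "gp (pt x s) y = min s (gp x y)"
proof -
  let ?z = "pt x s"
  have z: "?z \<in> mspace T" "ht ?z = s" using assms by (auto simp: pt_in ht_pt)
  have iff: "t \<le> gp ?z y \<longleftrightarrow> t \<le> gp x y" if t: "0 \<le> t" "t \<le> s" "t \<le> ht y" for t
  proof -
    have "pt ?z t = pt x t" using assms t by (simp add: pt_pt)
    then show ?thesis
      using pt_eq_iff[OF z(1) y, of t] pt_eq_iff[OF x y, of t] t z s by auto
  qed
  have a: "gp ?z y \<le> s" "gp ?z y \<le> ht y" "0 \<le> gp ?z y" "gp x y \<le> ht y" "0 \<le> gp x y"
    using gp_le1[OF z(1) y] gp_le2[OF z(1) y] gp_nonneg[OF z(1) y] z gp_le2[OF x y] gp_nonneg[OF x y]
    by auto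
  show ?thesis
    using iff[of "gp ?z y"] iff[of "min s (gp x y)"] a s by (auto simp: min_def split: if_splits)
qed

text \<open>The right-hand side is 1-Lipschitz in the maximum norm, which is why approximate
  preservation of Gromov products survives the passage to ancestors.\<close>

lemma gp_pt2:
  assumes "x \<in> mspace T" "y \<in> mspace T" "0 \<le> s" "s \<le> ht x" "0 \<le> t" "t \<le> ht y"
  shows "gp (pt x s) (pt y t) = min (min s t) (gp x y)"
proof -
  have "gp (pt x s) (pt y t) = min s (gp x (pt y t))"
    by (rule gp_pt) (use assms in \<open>auto intro: pt_in\<close>)
  also have "gp x (pt y t) = gp (pt y t) x" by (rule gp_sym)
  also have "gp (pt y t) x = min t (gp y x)" by (rule gp_pt) (use assms in auto)
  also have "gp y x = gp x y" by (rule gp_sym)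
  finally show ?thesis by (simp only: min.assoc)
qed

text \<open>Hyperbolicity with constant 0: up to the smaller of the two heights, \<open>x\<close>
  has the same ancestors as \<open>y\<close>, and \<open>y\<close> the same as
  \<open>z\<close>.\<close>

lemma gp_ultra:
  assumes "x \<in> mspace T" "y \<in> mspace T" "z \<in> mspace T"
  shows "min (gp x y) (gp y z) \<le> gp x z"
proof -
  let ?t = "min (gp x y) (gp y z)"
  have t: "0 \<le> ?t" "?t \<le> ht x" "?t \<le> ht y" "?t \<le> ht z"
    by (rule min.boundedI[OF gp_nonneg[OF assms(1,2)] gp_nonneg[OF assms(2,3)]]
        min.coboundedI1[OF gp_le1[OF assms(1,2)]] min.coboundedI1[OF gp_le2[OF assms(1,2)]]
        min.coboundedI2[OF gp_le2[OF assms(2,3)]])+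
  have le: "?t \<le> gp x y" "?t \<le> gp y z" by (rule min.cobounded1, rule min.cobounded2)
  have "pt x ?t = pt y ?t" by (rule pt_eq_iff[THEN iffD2, OF assms(1,2) t(1,2,3) le(1)])
  also have "pt y ?t = pt z ?t" by (rule pt_eq_iff[THEN iffD2, OF assms(2,3) t(1,3,4) le(2)])
  finally show ?thesis by (rule pt_eq_iff[THEN iffD1, OF assms(1,3) t(1,2,4)])
qed

lemma gp_lipschitz:
  assumes "x \<in> mspace T" "y \<in> mspace T" "z \<in> mspace T"
  shows "\<bar>gp z x - gp z y\<bar> \<le> mdist T x y"
proof -
  have "ht x \<le> ht y + mdist T x y" "ht y \<le> ht x + mdist T x y"
     "mdist T z x \<le> mdist T z y + mdist T x y" "mdist T z y \<le> mdist T z x + mdist T x y"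
    using assms mdist_triangle[of \<rho> T y x] mdist_triangle[of \<rho> T x y] mdist_triangle[of z T y x]
      mdist_triangle[of z T x y] unfolding mdist_commute[of T y x] by simp_all
  then show ?thesis unfolding gprod_def by argo
qed

lemma ht_lipschitz:
  assumes "x \<in> mspace T" "y \<in> mspace T"
  shows "\<bar>ht x - ht y\<bar> \<le> mdist T x y"
  using assms mdist_triangle[of \<rho> T y x] mdist_triangle[of \<rho> T x y] unfolding mdist_commute[of T y x]
  by (simp add: abs_le_iff)

lemma dist_gp: "mdist T x y = ht x + ht y - 2 * gp x y"
  by (simp add: gprod_def field_simps)

text \<open>Presents theta_sigma as a superlevel set of the Lipschitz function
  \<open>gp \<sigma>\<close>. Its closedness and its behaviour under approximate isometries both
  come from this form.\<close>

lemma above_iff: "x \<in> above T \<rho> \<sigma> \<longleftrightarrow> \<sigma> \<in> mspace T \<and> x \<in> mspace T \<and> ht \<sigma> \<le> gp \<sigma> x"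
proof (cases "x \<in> mspace T \<and> \<sigma> \<in> mspace T")
  case True
  then have x: "x \<in> mspace T" and s: "\<sigma> \<in> mspace T" by auto
  have "\<sigma> \<in> seg T \<rho> x \<longleftrightarrow> ht \<sigma> \<le> ht x \<and> pt x (ht \<sigma>) = \<sigma>"
  proof
    assume "\<sigma> \<in> seg T \<rho> x"
    then obtain t where "0 \<le> t" "t \<le> ht x" "\<sigma> = pt x t" using seg_eq[OF x] by auto
    then show "ht \<sigma> \<le> ht x \<and> pt x (ht \<sigma>) = \<sigma>" using ht_pt[OF x] by simp
  next
    assume "ht \<sigma> \<le> ht x \<and> pt x (ht \<sigma>) = \<sigma>"
    then show "\<sigma> \<in> seg T \<rho> x"
      unfolding seg_eq[OF x] by (intro image_eqI[of _ _ "ht \<sigma>"]) auto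
  qed
  also have "\<dots> \<longleftrightarrow> ht \<sigma> \<le> gp \<sigma> x"
    using pt_eq_iff[OF s x, of "ht \<sigma>"] pt_ht[OF s] gp_le2[OF s x] mdist_nonneg[of T \<rho> \<sigma>]
    by (metis order_refl order_trans)
  finally show ?thesis using True by (simp add: above_def)
next
  case False
  moreover have "\<sigma> \<in> mspace T" if "\<sigma> \<in> seg T \<rho> x" "x \<in> mspace T"
    using seg_eq[OF that(2)] that by (auto intro: pt_in)
  ultimately show ?thesis by (auto simp: above_def)
qed

lemma above_iff': "x \<in> above T \<rho> \<sigma> \<longleftrightarrow> x \<in> mspace T \<and> \<sigma> \<in> mspace T \<and> ht \<sigma> \<le> ht x \<and> pt x (ht \<sigma>) = \<sigma>"
  unfolding above_iff using pt_eq_iff[of \<sigma> x "ht \<sigma>"] pt_ht[of \<sigma>] gp_le2[of \<sigma> x] mdist_nonneg[of T \<rho> \<sigma>]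
  by (metis order_refl order_trans)

lemma above_gp: "x \<in> above T \<rho> \<sigma> \<Longrightarrow> gp \<sigma> x = ht \<sigma>"
  unfolding above_iff using gp_le1 order_antisym by blast

lemma above_sub: "above T \<rho> \<sigma> \<subseteq> mspace T"
  by (auto simp: above_def)

lemma above_refl: "x \<in> mspace T \<Longrightarrow> x \<in> above T \<rho> x"
  by (simp add: above_iff gp_self)

lemma above_ht: "x \<in> above T \<rho> \<sigma> \<Longrightarrow> ht \<sigma> \<le> ht x"
  by (simp add: above_iff')

lemma above_antisym: "x \<in> above T \<rho> \<sigma> \<Longrightarrow> ht x \<le> ht \<sigma> \<Longrightarrow> x = \<sigma>"
  unfolding above_iff' by (metis order_antisym pt_ht)

lemma above_trans:
  assumes "y \<in> above T \<rho> x" "z \<in> above T \<rho> y"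
  shows "z \<in> above T \<rho> x"
proof -
  have "pt (pt z (ht y)) (ht x) = pt z (ht x)"
    using assms pt_pt[of z "ht x" "ht y"] unfolding above_iff' by simp
  then show ?thesis using assms unfolding above_iff' by simp
qed

lemma above_mono: "y \<in> above T \<rho> x \<Longrightarrow> above T \<rho> y \<subseteq> above T \<rho> x"
  using above_trans by blast

lemma above_root: "above T \<rho> \<rho> = mspace T"
proof -
  have "x \<in> mspace T \<Longrightarrow> x \<in> above T \<rho> \<rho>" for x
    unfolding above_iff' ht_root by (simp add: pt_0)
  then show ?thesis using above_sub by blast
qed

lemma above_pt: "x \<in> mspace T \<Longrightarrow> 0 \<le> t \<Longrightarrow> t \<le> ht x \<Longrightarrow> x \<in> above T \<rho> (pt x t)"
  by (simp add: above_iff' ht_pt pt_in)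

lemma above_pt_iff:
  "x \<in> mspace T \<Longrightarrow> y \<in> mspace T \<Longrightarrow> 0 \<le> t \<Longrightarrow> t \<le> ht x \<Longrightarrow> y \<in> above T \<rho> (pt x t) \<longleftrightarrow> t \<le> gp x y"
  unfolding above_iff using ht_pt[of x t] pt_in[of x t] gp_pt[of x y t] by auto

text \<open>The ancestors of a point lie on one segment and therefore form a chain.\<close>

lemma above_comparable:
  assumes "z \<in> above T \<rho> x" "z \<in> above T \<rho> y" "ht x \<le> ht y"
  shows "y \<in> above T \<rho> x"
proof -
  have "pt (pt z (ht y)) (ht x) = pt z (ht x)"
    using assms pt_pt[of z "ht x" "ht y"] unfolding above_iff' by simp
  then show ?thesis using assms unfolding above_iff' by simp
qed

lemma above_Int_pt:
  assumes "x \<in> above T \<rho> \<sigma>" "ht \<sigma> \<le> t" "t \<le> ht x"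
  shows "pt x t \<in> above T \<rho> \<sigma>"
proof -
  have x: "x \<in> mspace T" using assms(1) above_sub by blast
  have t: "0 \<le> t" by (rule order_trans[OF mdist_nonneg assms(2)])
  show ?thesis
    by (rule above_comparable[OF assms(1) above_pt[OF x t assms(3)]])
      (simp only: ht_pt[OF x t assms(3)] assms(2))
qed

lemma ht_0: "x \<in> mspace T \<Longrightarrow> ht x = 0 \<longleftrightarrow> x = \<rho>"
  by (subst mdist_zero) auto

end

section \<open>Borel sets and branches\<close>

lemma openin_metric_iff:
  "openin (mtopology_of T) U \<longleftrightarrow>
     U \<subseteq> mspace T \<and> (\<forall>x\<in>U. \<exists>e>0. \<forall>y\<in>mspace T. mdist T x y < e \<longrightarrow> y \<in> U)"
proof -
  have "U \<subseteq> mspace T \<Longrightarrow> x \<in> U \<Longrightarrow> Metric_space.mball (mspace T) (mdist T) x e \<subseteq> U \<longleftrightarrow>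
      (\<forall>y\<in>mspace T. mdist T x y < e \<longrightarrow> y \<in> U)" for x e
    unfolding Metric_space.mball_def[OF Metric_space_mspace_mdist] by blast
  then show ?thesis
    unfolding mtopology_of_def Metric_space.openin_mtopology[OF Metric_space_mspace_mdist] by metis
qed

lemma openin_subset_mspace: "openin (mtopology_of T) U \<Longrightarrow> U \<subseteq> mspace T"
  using openin_subset by force

lemma space_metric_borel [simp]: "space (metric_borel T) = mspace T"
  unfolding metric_borel_def by (rule space_measure_of) (use openin_subset_mspace in blast)

lemma sets_metric_borel:
  "sets (metric_borel T) = sigma_sets (mspace T) {U. openin (mtopology_of T) U}"
  unfolding metric_borel_def by (rule sets_measure_of) (use openin_subset_mspace in blast)

lemma open_in_metric_borel: "openin (mtopology_of T) U \<Longrightarrow> U \<in> sets (metric_borel T)"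
  unfolding sets_metric_borel by (rule sigma_sets.Basic) simp

lemma closed_in_metric_borel:
  assumes "closedin (mtopology_of T) U" shows "U \<in> sets (metric_borel T)"
proof -
  have "mspace T - (mspace T - U) \<in> sets (metric_borel T)"
    using assms openin_topspace[of "mtopology_of T"]
    by (intro sets.Diff open_in_metric_borel) (simp_all add: closedin_def)
  moreover have "mspace T - (mspace T - U) = U"
    using closedin_subset[OF assms] by auto
  ultimately show ?thesis by simp
qed

lemma openin_less_lipschitz:
  assumes "\<And>x y. x \<in> mspace T \<Longrightarrow> y \<in> mspace T \<Longrightarrow> \<bar>f x - f y\<bar> \<le> mdist T x y"
  shows "openin (mtopology_of T) {x\<in>mspace T. f x < (c::real)}"
  unfolding openin_metric_iff
proof (intro conjI ballI)
  fix x assume x: "x \<in> {x\<in>mspace T. f x < c}"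
  have "y \<in> {x\<in>mspace T. f x < c}" if "y \<in> mspace T" "mdist T x y < c - f x" for y
    using assms[of x y] that x by auto
  then show "\<exists>e>0. \<forall>y\<in>mspace T. mdist T x y < e \<longrightarrow> y \<in> {x\<in>mspace T. f x < c}"
    using x by (intro exI[of _ "c - f x"]) auto
qed auto

lemma openin_greater_lipschitz:
  assumes "\<And>x y. x \<in> mspace T \<Longrightarrow> y \<in> mspace T \<Longrightarrow> \<bar>f x - f y\<bar> \<le> mdist T x y"
  shows "openin (mtopology_of T) {x\<in>mspace T. (c::real) < f x}"
proof -
  have "openin (mtopology_of T) {x\<in>mspace T. - f x < - c}"
    by (rule openin_less_lipschitz) (metis abs_minus_cancel assms minus_diff_minus)
  then show ?thesis by simp
qed

lemma closedin_ge_lipschitz: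
  assumes "\<And>x y. x \<in> mspace T \<Longrightarrow> y \<in> mspace T \<Longrightarrow> \<bar>f x - f y\<bar> \<le> mdist T x y"
  shows "closedin (mtopology_of T) {x\<in>mspace T. (c::real) \<le> f x}"
proof -
  have "mspace T - {x\<in>mspace T. c \<le> f x} = {x\<in>mspace T. f x < c}" by auto
  then show ?thesis using openin_less_lipschitz[of T f c] assms by (simp add: closedin_def subset_iff)
qed

lemma closedin_le_lipschitz:
  assumes "\<And>x y. x \<in> mspace T \<Longrightarrow> y \<in> mspace T \<Longrightarrow> \<bar>f x - f y\<bar> \<le> mdist T x y"
  shows "closedin (mtopology_of T) {x\<in>mspace T. f x \<le> (c::real)}"
proof -
  have "mspace T - {x\<in>mspace T. f x \<le> c} = {x\<in>mspace T. c < f x}" by auto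
  then show ?thesis using openin_greater_lipschitz[of T f c] assms by (simp add: closedin_def subset_iff)
qed

lemma mdist_lipschitz:
  assumes "z \<in> mspace T" "x \<in> mspace T" "y \<in> mspace T"
  shows "\<bar>mdist T z x - mdist T z y\<bar> \<le> mdist T x y"
  using mdist_triangle[of z T y x] mdist_triangle[of z T x y] assms
  unfolding mdist_commute[of T y x] by (simp add: abs_le_iff)

lemma mcball_of_eq: "x \<in> mspace T \<Longrightarrow> mcball_of T x r = {y\<in>mspace T. mdist T x y \<le> r}"
  by auto

lemma closedin_mcball_of: "x \<in> mspace T \<Longrightarrow> closedin (mtopology_of T) (mcball_of T x r)"
  unfolding mcball_of_eq by (rule closedin_le_lipschitz) (rule mdist_lipschitz)

lemma mcball_of_borel: "x \<in> mspace T \<Longrightarrow> mcball_of T x r \<in> sets (metric_borel T)"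
  by (rule closed_in_metric_borel[OF closedin_mcball_of])

lemma msphere_of_borel:
  assumes "x \<in> mspace T" shows "msphere_of T x r \<in> sets (metric_borel T)"
proof -
  have "closedin (mtopology_of T) {y\<in>mspace T. mdist T x y \<le> r}"
    by (rule closedin_le_lipschitz) (rule mdist_lipschitz[OF assms])
  moreover have "closedin (mtopology_of T) {y\<in>mspace T. r \<le> mdist T x y}"
    by (rule closedin_ge_lipschitz) (rule mdist_lipschitz[OF assms])
  ultimately have "closedin (mtopology_of T) ({y\<in>mspace T. mdist T x y \<le> r} \<inter> {y\<in>mspace T. r \<le> mdist T x y})"
    by (rule closedin_Int)
  moreover have "\<dots> = msphere_of T x r" by (auto simp: msphere_of_def)
  ultimately show ?thesis by (metis closed_in_metric_borel)
qed

lemma separable_metric_dense: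
  assumes "separable_space (mtopology_of T)"
  obtains Q where "countable Q" "Q \<subseteq> mspace T"
    "\<And>x e. x \<in> mspace T \<Longrightarrow> e > 0 \<Longrightarrow> \<exists>q\<in>Q. mdist T x q < e"
proof -
  obtain Q where Q: "countable Q" "Q \<subseteq> mspace T" "mtopology_of T closure_of Q = mspace T"
    using assms unfolding separable_space_def by auto
  have "\<exists>q\<in>Q. mdist T x q < e" if "x \<in> mspace T" "e > 0" for x e
  proof -
    have "x \<in> mtopology_of T closure_of Q" using Q that by simp
    then have "\<forall>r>0. \<exists>y\<in>Q. y \<in> Metric_space.mball (mspace T) (mdist T) x r"
      unfolding mtopology_of_def Metric_space.metric_closure_of[OF Metric_space_mspace_mdist] by simp
    then have "\<exists>y\<in>Q. y \<in> Metric_space.mball (mspace T) (mdist T) x e" using that(2) by blast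
    then show ?thesis by (auto simp: Metric_space.mball_def[OF Metric_space_mspace_mdist])
  qed
  then show ?thesis using that Q by blast
qed

section \<open>Components of a tree minus a point\<close>

lemma connected_components_of_partition:
  assumes un: "\<Union>\<C> = topspace X"
    and op: "\<And>C. C \<in> \<C> \<Longrightarrow> openin X C" and con: "\<And>C. C \<in> \<C> \<Longrightarrow> connectedin X C"
    and ne: "{} \<notin> \<C>" and dis: "\<And>C D. C \<in> \<C> \<Longrightarrow> D \<in> \<C> \<Longrightarrow> C \<inter> D \<noteq> {} \<Longrightarrow> C = D"
  shows "connected_components_of X = \<C>"
proof -
  \<comment> \<open>The complement of a member is the union of the other members, so all members are
    clopen and no connected set meets two of them.\<close>
  have cl: "closedin X C" if "C \<in> \<C>" for C
  proof -
    have "topspace X - C = \<Union>(\<C> - {C})" using un dis[OF that] by blast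
    moreover have "openin X (\<Union>(\<C> - {C}))" using op by (intro openin_Union) auto
    ultimately show ?thesis using openin_subset[OF op[OF that]] by (simp add: closedin_def)
  qed
  have eq: "connected_component_of_set X x = C" if "C \<in> \<C>" "x \<in> C" for C x
  proof (intro equalityI subsetI)
    fix y assume "y \<in> C" then show "y \<in> connected_component_of_set X x"
      using con that by (auto simp: connected_component_of_def)
  next
    fix y assume "y \<in> connected_component_of_set X x"
    then obtain S where S: "connectedin X S" "x \<in> S" "y \<in> S" by (auto simp: connected_component_of_def)
    then have "S \<subseteq> C \<or> disjnt S C" using connectedin_clopen_cases cl op that by metis
    then show "y \<in> C" using S that by (auto simp: disjnt_def)
  qed
  show ?thesis
  proof (intro equalityI subsetI)
    fix D assume "D \<in> connected_components_of X"
    then obtain x where x: "x \<in> topspace X" "D = connected_component_of_set X x"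
      by (auto simp: connected_components_of_def)
    then obtain C where "C \<in> \<C>" "x \<in> C" using un by blast
    then show "D \<in> \<C>" using eq x by simp
  next
    fix C assume C: "C \<in> \<C>"
    then obtain x where "x \<in> C" using ne by (metis equals0I)
    moreover have "x \<in> topspace X" using un C \<open>x \<in> C\<close> by blast
    ultimately show "C \<in> connected_components_of X"
      using eq[OF C] by (auto simp: connected_components_of_def)
  qed
qed

text \<open>For \<open>y\<close> strictly above sigma this is the component of \<open>y\<close> in
  the tree minus sigma: the points whose segment from the root agrees with that of \<open>y\<close>
  beyond the height of sigma. The strict inequality makes it open.\<close>

definition branch :: "'a metric \<Rightarrow> 'a \<Rightarrow> 'a \<Rightarrow> 'a \<Rightarrow> 'a set" where
  "branch T \<rho> \<sigma> y = {z\<in>mspace T. mdist T \<rho> \<sigma> < gprod T \<rho> y z}"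

text \<open>Only branches represented by a point of \<open>R\<close> are listed, but as subsets of
  the whole tree; in this form the branches of two different subtrees at the same point can be
  compared directly.\<close>

definition branches :: "'a metric \<Rightarrow> 'a \<Rightarrow> 'a set \<Rightarrow> 'a \<Rightarrow> 'a set set" where
  "branches T \<rho> R \<sigma> = branch T \<rho> \<sigma> ` (R \<inter> above T \<rho> \<sigma> - {\<sigma>})"

context rooted_rtree
begin

lemma closedin_above: "closedin (mtopology_of T) (above T \<rho> \<sigma>)"
proof (cases "\<sigma> \<in> mspace T")
  case True
  have "above T \<rho> \<sigma> = {x\<in>mspace T. ht \<sigma> \<le> gp \<sigma> x}" using True by (auto simp: above_iff)
  moreover have "closedin (mtopology_of T) {x\<in>mspace T. ht \<sigma> \<le> gp \<sigma> x}"
    by (rule closedin_ge_lipschitz) (rule gp_lipschitz[OF _ _ True])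
  ultimately show ?thesis by simp
next
  case False
  then have "above T \<rho> \<sigma> = {}" by (auto simp: above_iff)
  then show ?thesis by simp
qed

lemma above_borel [measurable]: "above T \<rho> \<sigma> \<in> sets (metric_borel T)"
  by (rule closed_in_metric_borel[OF closedin_above])

text \<open>Closure under ancestors together with the root describes the rooted subtrees;
  topological closedness is kept as a separate condition.\<close>

definition rsub :: "'a set \<Rightarrow> bool" where
  "rsub R \<longleftrightarrow> R \<subseteq> mspace T \<and> \<rho> \<in> R \<and> (\<forall>x\<in>R. \<forall>t. 0 \<le> t \<longrightarrow> t \<le> ht x \<longrightarrow> pt x t \<in> R)"

lemma connectedin_pt_image:
  assumes x: "x \<in> mspace T" and ab: "0 \<le> a" "b \<le> ht x"
  shows "connectedin (mtopology_of T) (pt x ` {a..b})"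
proof -
  interpret Metric_space "mspace T" "mdist T" by (rule Metric_space_mspace_mdist)
  have "continuous_map (top_of_set {a..b}) (mtopology_of T) (pt x)"
    unfolding mtopology_of_def
  proof (subst continuous_map_to_metric, intro ballI allI impI)
    fix t e :: real assume t: "t \<in> topspace (top_of_set {a..b})" and e: "e > 0"
    show "\<exists>U. openin (top_of_set {a..b}) U \<and> t \<in> U \<and> (\<forall>s\<in>U. pt x s \<in> mball (pt x t) e)"
    proof (intro exI conjI ballI)
      show "openin (top_of_set {a..b}) ({a..b} \<inter> ball t e)" by (rule openin_open_Int) simp
      show "t \<in> {a..b} \<inter> ball t e" using t e by auto
      fix s assume s: "s \<in> {a..b} \<inter> ball t e"
      have "pt x s \<in> mspace T" "pt x t \<in> mspace T" using s t ab x by (auto intro!: pt_in)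
      moreover have "mdist T (pt x t) (pt x s) < e"
      proof (cases "s \<le> t")
        case True
        then show ?thesis using s t ab dist_pt[OF x, of s t] by (subst mdist_commute) (auto simp: dist_real_def)
      next
        case False
        then show ?thesis using s t ab dist_pt[OF x, of t s] by (auto simp: dist_real_def)
      qed
      ultimately show "pt x s \<in> mball (pt x t) e" by simp
    qed
  qed
  moreover have "connectedin (top_of_set {a..b}) {a..b}" by simp
  ultimately show ?thesis by (rule connectedin_continuous_map_image)
qed

text \<open>By \<open>gp_ultra\<close>, separating strictly above sigma is an equivalence relation
  on the points strictly above sigma; branches are its classes.\<close>

lemma branch_eq_iff:
  assumes "x \<in> above T \<rho> \<sigma>" "y \<in> above T \<rho> \<sigma>" "x \<noteq> \<sigma>"
  shows "branch T \<rho> \<sigma> x = branch T \<rho> \<sigma> y \<longleftrightarrow> ht \<sigma> < gp x y"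
proof
  have x: "x \<in> mspace T" and y: "y \<in> mspace T" using assms above_sub by auto
  have "ht \<sigma> < ht x" using assms above_antisym[of x \<sigma>] by force
  then have "x \<in> branch T \<rho> \<sigma> x" using x by (simp add: branch_def gp_self)
  then show "ht \<sigma> < gp x y" if "branch T \<rho> \<sigma> x = branch T \<rho> \<sigma> y"
    using that gp_sym[of x y] by (auto simp: branch_def)
  show "branch T \<rho> \<sigma> x = branch T \<rho> \<sigma> y" if l: "ht \<sigma> < gp x y"
  proof -
    have "ht \<sigma> < gp x z \<longleftrightarrow> ht \<sigma> < gp y z" if z: "z \<in> mspace T" for z
      using gp_ultra[OF x y z] gp_ultra[OF y x z] l gp_sym[of y x] by auto
    then show ?thesis by (auto simp: branch_def)
  qed
qed

lemma branch_above:
  assumes "y \<in> above T \<rho> \<sigma>" "z \<in> branch T \<rho> \<sigma> y"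
  shows "z \<in> above T \<rho> \<sigma>" "z \<noteq> \<sigma>"
proof -
  have y: "y \<in> mspace T" "\<sigma> \<in> mspace T" and z: "z \<in> mspace T" "ht \<sigma> < gp y z"
    using assms by (auto simp: branch_def above_iff)
  have g: "ht \<sigma> \<le> gp \<sigma> y" using assms by (simp add: above_iff)
  show "z \<in> above T \<rho> \<sigma>" using gp_ultra[OF y(2,1) z(1)] g z y by (auto simp: above_iff)
  show "z \<noteq> \<sigma>" using gp_le2[OF y(1) z(1)] z by auto
qed

lemma branch_refl:
  assumes "y \<in> above T \<rho> \<sigma>" "y \<noteq> \<sigma>" shows "y \<in> branch T \<rho> \<sigma> y"
proof -
  have y: "y \<in> mspace T" using assms above_sub by auto
  then show ?thesis using assms above_antisym[of y \<sigma>] by (force simp: branch_def gp_self)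
qed

lemma branch_memb:
  assumes "y \<in> above T \<rho> \<sigma>" "z \<in> branch T \<rho> \<sigma> y"
  shows "branch T \<rho> \<sigma> z = branch T \<rho> \<sigma> y"
proof -
  have z: "z \<in> above T \<rho> \<sigma>" "z \<noteq> \<sigma>" using branch_above[OF assms] by auto
  show ?thesis using branch_eq_iff[OF z(1) assms(1) z(2)] assms(2) gp_sym[of z y] by (simp add: branch_def)
qed

text \<open>From each \<open>z\<close> one can walk down to the height \<open>gp y z\<close> and
  then up to \<open>y\<close>, so \<open>C\<close> is a union of connected sets through
  \<open>y\<close>. Only heights from \<open>gp y z\<close> on are demanded, because a branch does
  not contain the lower ancestors of its points.\<close>

lemma connectedin_subtree:
  assumes y: "y \<in> C" and C: "C \<subseteq> mspace T"
    and cl: "\<And>z t. z \<in> C \<Longrightarrow> gp y z \<le> t \<Longrightarrow> t \<le> ht z \<Longrightarrow> pt z t \<in> C \<and> (t \<le> ht y \<longrightarrow> pt y t \<in> C)"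
      "\<And>z t. z \<in> C \<Longrightarrow> gp y z \<le> t \<Longrightarrow> t \<le> ht y \<Longrightarrow> pt y t \<in> C"
  shows "connectedin (mtopology_of T) C"
proof -
  define S where "S z = pt z ` {gp y z..ht z} \<union> pt y ` {gp y z..ht y}" for z
  have yM: "y \<in> mspace T" using y C by auto
  have "connectedin (mtopology_of T) (S z)" "y \<in> S z" "z \<in> S z" "S z \<subseteq> C" if z: "z \<in> C" for z
  proof -
    have zM: "z \<in> mspace T" using z C by auto
    note g = gp_le1[OF yM zM] gp_le2[OF yM zM] gp_nonneg[OF yM zM]
    show "connectedin (mtopology_of T) (S z)" unfolding S_def
    proof (rule connectedin_Un)
      show "connectedin (mtopology_of T) (pt z ` {gp y z..ht z})"
        by (rule connectedin_pt_image[OF zM]) (use g in auto)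
      show "connectedin (mtopology_of T) (pt y ` {gp y z..ht y})"
        by (rule connectedin_pt_image[OF yM]) (use g in auto)
      have "pt z (gp y z) = pt y (gp y z)" using pt_gp[OF yM zM] by simp
      moreover have "pt z (gp y z) \<in> pt z ` {gp y z..ht z}" "pt y (gp y z) \<in> pt y ` {gp y z..ht y}" using g by auto
      ultimately show "pt z ` {gp y z..ht z} \<inter> pt y ` {gp y z..ht y} \<noteq> {}" by force
    qed
    have "pt y (ht y) \<in> S z" "pt z (ht z) \<in> S z" using g unfolding S_def by auto
    then show "y \<in> S z" "z \<in> S z" using pt_ht yM zM by auto
    show "S z \<subseteq> C" using cl[OF z] by (auto simp: S_def)
  qed note S = this
  have "connectedin (mtopology_of T) (\<Union>(S ` C))"
    by (rule connectedin_Union) (use S(1,2) in blast)+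
  moreover have "\<Union>(S ` C) = C" using S by blast
  ultimately show ?thesis by simp
qed

text \<open>Besides the branches above sigma there is exactly one more component, that of the root;
  it disappears when sigma is the root.\<close>

lemma components_minus_point:
  assumes R: "rsub R" and \<sigma>: "\<sigma> \<in> R"
  shows "connected_components_of (subtopology (mtopology_of T) (R - {\<sigma>})) =
    (\<lambda>B. B \<inter> R) ` branches T \<rho> R \<sigma> \<union> (if \<sigma> = \<rho> then {} else {R - above T \<rho> \<sigma>})"
    (is "connected_components_of ?X = ?C1 \<union> ?C2")
proof (rule connected_components_of_partition)
  have RM: "R \<subseteq> mspace T" and \<rho>R: "\<rho> \<in> R" and Rpt: "\<And>x t. x \<in> R \<Longrightarrow> 0 \<le> t \<Longrightarrow> t \<le> ht x \<Longrightarrow> pt x t \<in> R"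
    using R by (auto simp: rsub_def)
  have \<sigma>M: "\<sigma> \<in> mspace T" using \<sigma> RM by auto
  have top: "topspace ?X = R - {\<sigma>}" using RM by auto
  have C1: "\<exists>y. y \<in> R \<and> y \<in> above T \<rho> \<sigma> \<and> y \<noteq> \<sigma> \<and> C = branch T \<rho> \<sigma> y \<inter> R" if "C \<in> ?C1" for C
    using that by (auto simp: branches_def)
  have C2: "\<sigma> \<noteq> \<rho> \<and> C = R - above T \<rho> \<sigma>" if "C \<in> ?C2" for C
    using that by (auto split: if_splits)
  show "\<Union>(?C1 \<union> ?C2) = topspace ?X"
  proof (intro equalityI subsetI)
    fix x assume "x \<in> \<Union>(?C1 \<union> ?C2)"
    then obtain C where C: "x \<in> C" "C \<in> ?C1 \<or> C \<in> ?C2" by blast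
    from C(2) show "x \<in> topspace ?X"
    proof
      assume "C \<in> ?C1" then show ?thesis using C(1) C1[of C] branch_above(2) unfolding top by blast
    next
      assume "C \<in> ?C2" then show ?thesis using C(1) C2[of C] above_refl[OF \<sigma>M] unfolding top by blast
    qed
  next
    fix x assume "x \<in> topspace ?X"
    then have x: "x \<in> R" "x \<noteq> \<sigma>" unfolding top by auto
    show "x \<in> \<Union>(?C1 \<union> ?C2)"
    proof (cases "x \<in> above T \<rho> \<sigma>")
      case True
      then have "x \<in> branch T \<rho> \<sigma> x \<inter> R" "branch T \<rho> \<sigma> x \<inter> R \<in> ?C1"
        using x branch_refl by (auto simp: branches_def)
      then show ?thesis by blast
    next
      case False
      then have "\<sigma> \<noteq> \<rho>" using above_root x RM by auto
      then show ?thesis using False x by auto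
    qed
  qed
  show "openin ?X C" if "C \<in> ?C1 \<union> ?C2" for C
    using that
  proof
    assume "C \<in> ?C1"
    then obtain y where y: "y \<in> R" "y \<in> above T \<rho> \<sigma>" "y \<noteq> \<sigma>" "C = branch T \<rho> \<sigma> y \<inter> R" using C1 by blast
    have yM: "y \<in> mspace T" using y RM by auto
    have "openin (mtopology_of T) (branch T \<rho> \<sigma> y)"
      unfolding branch_def by (rule openin_greater_lipschitz) (rule gp_lipschitz[OF _ _ yM])
    moreover have "C = branch T \<rho> \<sigma> y \<inter> (R - {\<sigma>})" using y branch_above(2) by blast
    ultimately show ?thesis unfolding openin_subtopology by blast
  next
    assume "C \<in> ?C2"
    then have "C = R - above T \<rho> \<sigma>" using C2 by blast
    then have "C = (mspace T - above T \<rho> \<sigma>) \<inter> (R - {\<sigma>})" using RM above_refl[OF \<sigma>M] by blast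
    moreover have "openin (mtopology_of T) (mspace T - above T \<rho> \<sigma>)"
      using closedin_above[of \<sigma>] by (simp add: closedin_def)
    ultimately show ?thesis unfolding openin_subtopology by blast
  qed
  show "connectedin ?X C" if "C \<in> ?C1 \<union> ?C2" for C
    using that
  proof
    assume "C \<in> ?C1"
    then obtain y where y: "y \<in> R" "y \<in> above T \<rho> \<sigma>" "y \<noteq> \<sigma>" and Cy: "C = branch T \<rho> \<sigma> y \<inter> R" using C1 by blast
    have yM: "y \<in> mspace T" using y RM by auto
    have yC: "y \<in> C" using y branch_refl Cy by auto
    have "connectedin (mtopology_of T) C"
    proof (rule connectedin_subtree[OF yC])
      show "C \<subseteq> mspace T" using Cy RM by auto
      have key: "pt y t \<in> C" if z: "z \<in> C" and t: "gp y z \<le> t" "t \<le> ht y" for z t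
      proof -
        have zM: "z \<in> mspace T" and s: "ht \<sigma> < gp y z" using z Cy by (auto simp: branch_def)
        have t0: "0 \<le> t" using t s by (meson less_le_not_le mdist_nonneg order_trans)
        have "gp y (pt y t) = t" using gp_pt[OF yM yM, of t] t t0 gp_self[OF yM] gp_sym[of y "pt y t"] by simp
        then show ?thesis using Rpt[OF y(1) t0 t(2)] s t RM unfolding Cy branch_def by auto
      qed
      show "pt z t \<in> C \<and> (t \<le> ht y \<longrightarrow> pt y t \<in> C)" if z: "z \<in> C" and t: "gp y z \<le> t" "t \<le> ht z" for z t
      proof -
        have zM: "z \<in> mspace T" and s: "ht \<sigma> < gp y z" and zR: "z \<in> R" using z Cy by (auto simp: branch_def)
        have t0: "0 \<le> t" using t s by (meson less_le_not_le mdist_nonneg order_trans)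
        have "gp y (pt z t) = gp y z"
          using gp_pt[OF zM yM, of t] t t0 gp_sym[of y "pt z t"] gp_sym[of y z] by simp
        then have "pt z t \<in> C" using Rpt[OF zR t0 t(2)] s t RM unfolding Cy branch_def by auto
        then show ?thesis using key[OF z t(1)] by blast
      qed
      show "pt y t \<in> C" if "z \<in> C" "gp y z \<le> t" "t \<le> ht y" for z t using key that by blast
    qed
    moreover have "C \<subseteq> R - {\<sigma>}" using Cy y branch_above(2) by blast
    ultimately show ?thesis by (simp add: connectedin_subtopology)
  next
    assume "C \<in> ?C2"
    then have Ce: "C = R - above T \<rho> \<sigma>" and ne: "\<sigma> \<noteq> \<rho>" using C2 by blast+
    have "\<rho> \<notin> above T \<rho> \<sigma>" using ne above_antisym[of \<rho> \<sigma>] by auto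
    then have \<rho>C: "\<rho> \<in> C" using Ce \<rho>R by auto
    have pz: "pt z t \<in> C" if z: "z \<in> C" and t: "0 \<le> t" "t \<le> ht z" for z t
    proof -
      have zM: "z \<in> mspace T" using z Ce RM by auto
      have "pt z t \<notin> above T \<rho> \<sigma>" using above_pt[OF zM t] above_trans z Ce by blast
      then show ?thesis using Rpt t z Ce by auto
    qed
    have "connectedin (mtopology_of T) C"
    proof (rule connectedin_subtree[OF \<rho>C])
      show "C \<subseteq> mspace T" using Ce RM by auto
      have g0: "gp \<rho> z = 0" if "z \<in> C" for z unfolding gprod_def by simp
      show "pt z t \<in> C \<and> (t \<le> ht \<rho> \<longrightarrow> pt \<rho> t \<in> C)" if z: "z \<in> C" and t: "gp \<rho> z \<le> t" "t \<le> ht z" for z t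
        using pz[OF z] pz[OF \<rho>C, of t] t g0[OF z] by simp
      show "pt \<rho> t \<in> C" if z: "z \<in> C" and t: "gp \<rho> z \<le> t" "t \<le> ht \<rho>" for z t
        using pz[OF \<rho>C, of t] t g0[OF z] by simp
    qed
    moreover have "C \<subseteq> R - {\<sigma>}" using Ce above_refl[OF \<sigma>M] by blast
    ultimately show ?thesis by (simp add: connectedin_subtopology)
  qed
  show "{} \<notin> ?C1 \<union> ?C2"
  proof
    assume "{} \<in> ?C1 \<union> ?C2"
    then show False
    proof
      assume "{} \<in> ?C1"
      then obtain y where "y \<in> R" "y \<in> above T \<rho> \<sigma>" "y \<noteq> \<sigma>" "{} = branch T \<rho> \<sigma> y \<inter> R" using C1 by blast
      then show False using branch_refl by blast
    next
      assume "{} \<in> ?C2"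
      then have "\<sigma> \<noteq> \<rho>" "{} = R - above T \<rho> \<sigma>" using C2 by blast+
      then have "\<rho> \<in> above T \<rho> \<sigma>" "\<sigma> \<noteq> \<rho>" using \<rho>R by auto
      then show False using above_antisym[of \<rho> \<sigma>] by auto
    qed
  qed
  show "C = D" if CD: "C \<in> ?C1 \<union> ?C2" "D \<in> ?C1 \<union> ?C2" and ne: "C \<inter> D \<noteq> {}" for C D
  proof -
    obtain x where x: "x \<in> C" "x \<in> D" using ne by blast
    show ?thesis
    proof (cases "x \<in> above T \<rho> \<sigma>")
      case True
      then have "C \<in> ?C1" "D \<in> ?C1" using CD x C2 by blast+
      then obtain y y' where y: "y \<in> above T \<rho> \<sigma>" "C = branch T \<rho> \<sigma> y \<inter> R"
         "y' \<in> above T \<rho> \<sigma>" "D = branch T \<rho> \<sigma> y' \<inter> R" using C1[of C] C1[of D] by blast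
      have "branch T \<rho> \<sigma> x = branch T \<rho> \<sigma> y" "branch T \<rho> \<sigma> x = branch T \<rho> \<sigma> y'"
        using branch_memb[of y \<sigma> x] branch_memb[of y' \<sigma> x] y x by blast+
      then show ?thesis using y by simp
    next
      case False
      have "E \<in> ?C2" if "E \<in> ?C1 \<union> ?C2" "x \<in> E" for E
      proof (rule ccontr)
        assume "E \<notin> ?C2"
        then have "E \<in> ?C1" using that(1) by (simp only: Un_iff simp_thms)
        then obtain y where "y \<in> above T \<rho> \<sigma>" "E = branch T \<rho> \<sigma> y \<inter> R" using C1[of E] by metis
        then show False using branch_above(1)[of y \<sigma> x] that(2) False by blast
      qed
      then have "C \<in> ?C2" "D \<in> ?C2" using CD x by (simp_all only:)
      then show ?thesis using C2[of C] C2[of D] by blast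
    qed
  qed
qed

lemma ncomp_branches:
  assumes R: "rsub R" and \<sigma>: "\<sigma> \<in> R"
  shows "ncomp (submetric T R) \<sigma> = ecard (branches T \<rho> R \<sigma>) + (if \<sigma> = \<rho> then 0 else 1)"
proof -
  have RM: "R \<subseteq> mspace T" and \<rho>R: "\<rho> \<in> R" using R by (auto simp: rsub_def)
  have \<sigma>M: "\<sigma> \<in> mspace T" using \<sigma> RM by auto
  have "R \<inter> (R \<inter> mspace T - {\<sigma>}) = R - {\<sigma>}" using RM by auto
  then have eq: "subtopology (mtopology_of (submetric T R)) (mspace (submetric T R) - {\<sigma>})
      = subtopology (mtopology_of T) (R - {\<sigma>})"
    by (simp add: mtopology_of_submetric subtopology_subtopology)
  let ?f = "\<lambda>B. B \<inter> R"
  \<comment> \<open>A listed branch contains a point of \<open>R\<close> that determines it, so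
    intersecting with \<open>R\<close> loses nothing.\<close>
  have inj: "inj_on ?f (branches T \<rho> R \<sigma>)"
  proof (rule inj_onI)
    fix B B' assume B: "B \<in> branches T \<rho> R \<sigma>" "B' \<in> branches T \<rho> R \<sigma>" "B \<inter> R = B' \<inter> R"
    obtain y y' where y: "y \<in> R" "y \<in> above T \<rho> \<sigma>" "y \<noteq> \<sigma>" "B = branch T \<rho> \<sigma> y"
      "y' \<in> above T \<rho> \<sigma>" "B' = branch T \<rho> \<sigma> y'" using B by (auto simp: branches_def)
    have "y \<in> B'" using B(3) y branch_refl by blast
    then show "B = B'" using y branch_memb[of y' \<sigma> y] by simp
  qed
  have e: "ecard (?f ` branches T \<rho> R \<sigma>) = ecard (branches T \<rho> R \<sigma>)"
    using inj by (auto simp: ecard_def card_image finite_image_iff)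
  show ?thesis
  proof (cases "\<sigma> = \<rho>")
    case True
    then show ?thesis unfolding ncomp_def eq components_minus_point[OF R \<sigma>] using e by simp
  next
    case False
    have "R - above T \<rho> \<sigma> \<notin> ?f ` branches T \<rho> R \<sigma>"
    proof
      assume "R - above T \<rho> \<sigma> \<in> ?f ` branches T \<rho> R \<sigma>"
      then obtain y where y: "y \<in> above T \<rho> \<sigma>" "R - above T \<rho> \<sigma> = branch T \<rho> \<sigma> y \<inter> R"
        by (auto simp: branches_def)
      have "\<rho> \<notin> above T \<rho> \<sigma>" using False above_antisym[of \<rho> \<sigma>] by auto
      then have "\<rho> \<in> branch T \<rho> \<sigma> y" using y \<rho>R by blast
      then show False using branch_above(1)[OF y(1)] \<open>\<rho> \<notin> above T \<rho> \<sigma>\<close> by blast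
    qed
    then have "ecard (insert (R - above T \<rho> \<sigma>) (?f ` branches T \<rho> R \<sigma>)) = ecard (?f ` branches T \<rho> R \<sigma>) + 1"
      by (auto simp: ecard_def one_enat_def)
    then show ?thesis unfolding ncomp_def eq components_minus_point[OF R \<sigma>] using e False by simp
  qed
qed

end

section \<open>The sets theta_sigma as generators of the Borel sets\<close>

locale separable_rtree = rooted_rtree +
  assumes separable: "separable_space (mtopology_of T)"
begin

text \<open>For 0 < t <= \<open>ht q\<close> the superlevel set of \<open>gp q\<close> at t is theta
  of the ancestor \<open>pt q t\<close>; for other t it is everything or empty.\<close>

lemma gp_borel_above:
  assumes q: "q \<in> mspace T"
  shows "gp q \<in> borel_measurable (sigma (mspace T) (above T \<rho> ` mspace T))"
proof -
  let ?N = "sigma (mspace T) (above T \<rho> ` mspace T)"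
  have sp: "space ?N = mspace T" and st: "sets ?N = sigma_sets (mspace T) (above T \<rho> ` mspace T)"
    using above_sub by (auto intro!: space_measure_of sets_measure_of)
  show ?thesis
  proof (subst borel_measurable_iff_ge, intro allI)
    fix t
    have "{x\<in>space ?N. t \<le> gp q x} \<in> sets ?N"
    proof (cases "t \<le> 0")
      case True
      then have "{x\<in>space ?N. t \<le> gp q x} = space ?N"
        using gp_nonneg[OF q] unfolding sp by force
      then show ?thesis by simp
    next
      case False
      show ?thesis
      proof (cases "t \<le> ht q")
        case True
        then have "{x\<in>space ?N. t \<le> gp q x} = above T \<rho> (pt q t)"
          unfolding sp using False above_sub[of "pt q t"] by (auto simp: above_pt_iff[OF q])
        moreover have "pt q t \<in> mspace T" using q True False by (auto intro: pt_in)
        ultimately show ?thesis unfolding st by auto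
      next
        case F: False
        then have "{x\<in>space ?N. t \<le> gp q x} = {}"
          unfolding sp using gp_le1[OF q] by force
        then show ?thesis by (simp only: sets.empty_sets)
      qed
    qed
    then show "{x\<in>space ?N. t \<le> gp q x} \<in> sets ?N" .
  qed
qed

text \<open>The distance to q is a combination of two heights and \<open>gp q\<close>. Once heights
  are measurable, so are balls, and separability writes every open set as a countable union of
  balls.\<close>

lemma sets_metric_borel_above: "sets (metric_borel T) = sigma_sets (mspace T) (above T \<rho> ` mspace T)"
proof -
  let ?N = "sigma (mspace T) (above T \<rho> ` mspace T)"
  have sp: "space ?N = mspace T" and st: "sets ?N = sigma_sets (mspace T) (above T \<rho> ` mspace T)"
    using above_sub by (auto intro!: space_measure_of sets_measure_of)
  obtain Q where Q: "countable Q" "Q \<subseteq> mspace T"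
    "\<And>x e. x \<in> mspace T \<Longrightarrow> e > 0 \<Longrightarrow> \<exists>q\<in>Q. mdist T x q < e"
    using separable_metric_dense[OF separable] by blast
  have Q0: "Q \<noteq> {}" using Q(3)[OF root_in, of 1] by auto
  \<comment> \<open>Heights are not superlevel functions of a single theta_sigma, but a point q
    close to x has \<open>gp q x\<close> close to \<open>ht x\<close>, so a countable supremum
    suffices.\<close>
  have ht_eq: "ht x = (SUP q\<in>Q. gp q x)" if x: "x \<in> mspace T" for x
  proof (rule antisym)
    have bdd: "bdd_above ((\<lambda>q. gp q x) ` Q)"
      using gp_le2[OF _ x] Q(2) by (auto intro!: bdd_aboveI[of _ "ht x"])
    show "(SUP q\<in>Q. gp q x) \<le> ht x" using Q0 gp_le2[OF _ x] Q(2) by (intro cSUP_least) auto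
    show "ht x \<le> (SUP q\<in>Q. gp q x)"
    proof (rule field_le_epsilon)
      fix e :: real assume e: "e > 0"
      obtain q where q: "q \<in> Q" "mdist T x q < e" using Q(3)[OF x e] by blast
      have "\<bar>gp x x - gp x q\<bar> \<le> mdist T x q" using gp_lipschitz[of x q x] q Q(2) x by auto
      then have "ht x \<le> gp q x + e" using q gp_self[OF x] gp_sym[of x q] by auto
      also have "gp q x \<le> (SUP q\<in>Q. gp q x)" using bdd q by (intro cSUP_upper)
      finally show "ht x \<le> (SUP q\<in>Q. gp q x) + e" by simp
    qed
  qed
  have ht_meas: "(\<lambda>x. ht x) \<in> borel_measurable ?N"
  proof -
    have "(\<lambda>x. SUP q\<in>Q. gp q x) \<in> borel_measurable ?N"
      by (rule borel_measurable_cSUP[OF Q(1)])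
        (use Q(2) gp_borel_above gp_le2 sp in \<open>auto intro!: bdd_aboveI2\<close>)
    then show ?thesis by (rule measurable_cong[THEN iffD1, rotated]) (simp add: sp ht_eq)
  qed
  have ball: "{x\<in>mspace T. mdist T q x < e} \<in> sets ?N" if q: "q \<in> mspace T" for q e
  proof -
    have "(\<lambda>x. ht q + ht x - 2 * gp q x) \<in> borel_measurable ?N"
      using ht_meas gp_borel_above[OF q] by measurable
    then have "(\<lambda>x. mdist T q x) \<in> borel_measurable ?N"
      by (simp add: dist_gp[of q])
    then have "{x\<in>space ?N. mdist T q x < e} \<in> sets ?N" by measurable
    then show ?thesis by (simp add: sp)
  qed
  have op: "U \<in> sets ?N" if U: "openin (mtopology_of T) U" for U
  proof -
    define I where "I = {(q, e). q \<in> Q \<and> e \<in> \<rat> \<and> {x\<in>mspace T. mdist T q x < e} \<subseteq> U}"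
    have "I \<subseteq> Q \<times> \<rat>" by (auto simp: I_def)
    then have cI: "countable I" by (rule countable_subset) (intro countable_SIGMA Q(1) countable_rat)
    have "U = (\<Union>(q,e)\<in>I. {x\<in>mspace T. mdist T q x < e})"
    proof (intro equalityI subsetI)
      fix x assume xU: "x \<in> U"
      then have x: "x \<in> mspace T" using openin_subset[OF U] by auto
      obtain d where d: "d > 0" "\<forall>y\<in>mspace T. mdist T x y < d \<longrightarrow> y \<in> U"
        using U xU unfolding openin_metric_iff by blast
      obtain q where q: "q \<in> Q" "mdist T x q < d/2" using Q(3)[OF x, of "d/2"] d by auto
      obtain e where e: "e \<in> \<rat>" "mdist T x q < e" "e < d/2" using q Rats_dense_in_real by blast
      have qM: "q \<in> mspace T" using q Q by auto
      have "y \<in> U" if "y \<in> mspace T" "mdist T q y < e" for y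
        using d(2) mdist_triangle[OF x qM that(1)] that q e by (smt (verit) field_sum_of_halves)
      then have "(q, e) \<in> I" using q e by (auto simp: I_def)
      moreover have "mdist T q x < e" using e by (simp add: mdist_commute)
      ultimately show "x \<in> (\<Union>(q,e)\<in>I. {x\<in>mspace T. mdist T q x < e})" using x by blast
    qed (auto simp: I_def)
    moreover have "(\<Union>(q,e)\<in>I. {x\<in>mspace T. mdist T q x < e}) \<in> sets ?N"
      using cI Q(2) ball by (intro sets.countable_UN') (auto simp: I_def)
    ultimately show ?thesis by simp
  qed
  show ?thesis
  proof (rule equalityI)
    show "sets (metric_borel T) \<subseteq> sigma_sets (mspace T) (above T \<rho> ` mspace T)"
      unfolding sets_metric_borel st[symmetric]
      using sets.sigma_sets_subset[of "{U. openin (mtopology_of T) U}" ?N] op sp by auto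
    show "sigma_sets (mspace T) (above T \<rho> ` mspace T) \<subseteq> sets (metric_borel T)"
      using sets.sigma_sets_subset[of "above T \<rho> ` mspace T" "metric_borel T"]
      by (simp add: image_subset_iff)
  qed
qed

lemma measurable_above:
  assumes "\<And>\<omega>. \<omega> \<in> space N \<Longrightarrow> F \<omega> \<in> mspace T"
    and "\<And>\<sigma>. \<sigma> \<in> mspace T \<Longrightarrow> {\<omega>\<in>space N. F \<omega> \<in> above T \<rho> \<sigma>} \<in> sets N"
  shows "F \<in> measurable N (metric_borel T)"
proof (rule measurable_sigma_sets[OF sets_metric_borel_above])
  show "above T \<rho> ` mspace T \<subseteq> Pow (mspace T)" using above_sub by auto
  show "F \<in> space N \<rightarrow> mspace T" using assms by auto
  fix A assume "A \<in> above T \<rho> ` mspace T"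
  then obtain \<sigma> where "\<sigma> \<in> mspace T" "A = above T \<rho> \<sigma>" by auto
  moreover have "F -` above T \<rho> \<sigma> \<inter> space N = {\<omega>\<in>space N. F \<omega> \<in> above T \<rho> \<sigma>}" by auto
  ultimately show "F -` A \<inter> space N \<in> sets N" using assms by simp
qed

text \<open>Two sets theta_sigma are nested or disjoint, so with the empty set they form a
  pi-system; it contains the whole space as theta of the root.\<close>

lemma measure_eq_above:
  assumes M: "sets M = sets (metric_borel T)" and N: "sets N = sets (metric_borel T)"
    and fin: "emeasure M (mspace T) \<noteq> \<infinity>"
    and eq: "\<And>\<sigma>. \<sigma> \<in> mspace T \<Longrightarrow> emeasure M (above T \<rho> \<sigma>) = emeasure N (above T \<rho> \<sigma>)"
  shows "M = N"
proof (rule measure_eqI_generator_eq)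
  let ?E = "insert {} (above T \<rho> ` mspace T)"
  show "Int_stable ?E"
  proof (rule Int_stableI)
    fix A B assume AB: "A \<in> ?E" "B \<in> ?E"
    show "A \<inter> B \<in> ?E"
    proof (cases "A \<inter> B = {}")
      case False
      then obtain x \<sigma> \<tau> where x: "x \<in> A" "x \<in> B" "A = above T \<rho> \<sigma>" "B = above T \<rho> \<tau>" using AB by blast
      then have "A \<subseteq> B \<or> B \<subseteq> A"
        using above_comparable[of x \<sigma> \<tau>] above_comparable[of x \<tau> \<sigma>] above_mono by (meson linear)
      then have "A \<inter> B = A \<or> A \<inter> B = B" by blast
      then show ?thesis using AB by auto
    qed simp
  qed
  show "?E \<subseteq> Pow (mspace T)" using above_sub by auto
  have "sigma_sets (mspace T) ?E = sigma_sets (mspace T) (above T \<rho> ` mspace T)"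
    by (rule sigma_sets_eqI) (auto intro: sigma_sets.Empty sigma_sets.Basic)
  then show "sets M = sigma_sets (mspace T) ?E" "sets N = sigma_sets (mspace T) ?E"
    using M N sets_metric_borel_above by auto
  show "range (\<lambda>i::nat. above T \<rho> \<rho>) \<subseteq> ?E" by auto
  show "(\<Union>i::nat. above T \<rho> \<rho>) = mspace T" by (simp add: above_root)
  show "emeasure M (above T \<rho> \<rho>) \<noteq> \<infinity>" using fin by (simp add: above_root)
qed (use eq in auto)

end

section \<open>Measures and projections\<close>

lemma ennreal_infsum_Un:
  fixes f :: "'a \<Rightarrow> ennreal"
  assumes "A \<inter> B = {}"
  shows "infsum f (A \<union> B) = infsum f A + infsum f B"
  by (rule infsum_Un_disjoint[OF _ _ assms]) (auto intro: nonneg_summable_on_complete)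

lemma ennreal_infsum_mono_set:
  fixes f :: "'a \<Rightarrow> ennreal"
  assumes "A \<subseteq> B"
  shows "infsum f A \<le> infsum f B"
  by (rule infsum_mono_neutral) (use assms in \<open>auto intro: nonneg_summable_on_complete\<close>)

lemma countably_additive_infsum:
  fixes f :: "'a \<Rightarrow> ennreal"
  shows "countably_additive M (\<lambda>A. infsum f (X \<inter> A))"
proof (rule countably_additiveI)
  fix A :: "nat \<Rightarrow> 'a set" assume disj: "disjoint_family A"
  have fin: "(\<Sum>i<n. infsum f (X \<inter> A i)) = infsum f (X \<inter> (\<Union>i<n. A i))" for n
  proof (induction n)
    case (Suc n)
    have "A i \<inter> A n = {}" if "i < n" for i using disj that by (auto simp: disjoint_family_on_def)
    then have "(\<Union>i<n. A i) \<inter> A n = {}" by blast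
    then have "(X \<inter> (\<Union>i<n. A i)) \<inter> (X \<inter> A n) = {}" by blast
    then have "infsum f ((X \<inter> (\<Union>i<n. A i)) \<union> (X \<inter> A n)) = infsum f (X \<inter> (\<Union>i<n. A i)) + infsum f (X \<inter> A n)"
      by (rule ennreal_infsum_Un)
    moreover have "(X \<inter> (\<Union>i<n. A i)) \<union> (X \<inter> A n) = X \<inter> (\<Union>i<Suc n. A i)"
      by (auto simp: lessThan_Suc)
    ultimately show ?case using Suc by simp
  qed simp
  show "(\<Sum>i. infsum f (X \<inter> A i)) = infsum f (X \<inter> (\<Union>i. A i))"
  proof (rule antisym)
    show "(\<Sum>i. infsum f (X \<inter> A i)) \<le> infsum f (X \<inter> (\<Union>i. A i))"
      unfolding suminf_eq_SUP fin by (intro SUP_least ennreal_infsum_mono_set) auto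
    \<comment> \<open>A finite set in the countable union already lies in a finite partial union, so
      each finite partial sum of the infinite sum is bounded by a partial sum of the series.\<close>
    have "sum f F \<le> (\<Sum>i. infsum f (X \<inter> A i))" if F: "finite F" "F \<subseteq> X \<inter> (\<Union>i. A i)" for F
    proof -
      have "\<forall>x\<in>F. \<exists>i. x \<in> A i" using F by auto
      then obtain g where g: "\<forall>x\<in>F. x \<in> A (g x)" by metis
      define n where "n = Suc (Max (insert 0 (g ` F)))"
      have "F \<subseteq> X \<inter> (\<Union>i<n. A i)"
      proof
        fix x assume x: "x \<in> F"
        then have "g x < n" using F(1) by (auto simp: n_def less_Suc_eq_le intro!: Max_ge)
        then show "x \<in> X \<inter> (\<Union>i<n. A i)" using g x F by auto
      qed
      then have "infsum f F \<le> infsum f (X \<inter> (\<Union>i<n. A i))" by (rule ennreal_infsum_mono_set)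
      then have "sum f F \<le> (\<Sum>i<n. infsum f (X \<inter> A i))" using F fin by simp
      also have "\<dots> \<le> (\<Sum>i. infsum f (X \<inter> A i))" by (rule sum_le_suminf) auto
      finally show ?thesis .
    qed
    then show "infsum f (X \<inter> (\<Union>i. A i)) \<le> (\<Sum>i. infsum f (X \<inter> A i))"
      by (subst nonneg_infsum_complete) (auto intro!: SUP_least)
  qed
qed

lemma countably_additive_add:
  fixes f g :: "'a set \<Rightarrow> ennreal"
  assumes "countably_additive M f" "countably_additive M g"
  shows "countably_additive M (\<lambda>A. f A + g A)"
  using assms unfolding countably_additive_def by (auto simp: suminf_add[symmetric])

lemma countably_additive_cmult:
  fixes f :: "'a set \<Rightarrow> ennreal"
  assumes "countably_additive M f"
  shows "countably_additive M (\<lambda>A. c * f A)"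
  using assms unfolding countably_additive_def by auto

lemma countably_additive_Int:
  fixes f :: "'a set \<Rightarrow> ennreal"
  assumes "countably_additive M f" and cl: "\<And>A. A \<in> M \<Longrightarrow> A \<inter> B \<in> M"
  shows "countably_additive M (\<lambda>A. f (A \<inter> B))"
proof (rule countably_additiveI)
  fix A :: "nat \<Rightarrow> 'a set" assume A: "range A \<subseteq> M" "disjoint_family A" "(\<Union>i. A i) \<in> M"
  have "(\<Sum>i. f (A i \<inter> B)) = f (\<Union>i. A i \<inter> B)"
  proof (rule assms(1)[unfolded countably_additive_def, rule_format])
    show "range (\<lambda>i. A i \<inter> B) \<subseteq> M" using A cl by auto
    show "disjoint_family (\<lambda>i. A i \<inter> B)" using A by (auto simp: disjoint_family_on_def)
    have "(\<Union>i. A i \<inter> B) = (\<Union>i. A i) \<inter> B" by auto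
    then show "(\<Union>i. A i \<inter> B) \<in> M" using cl[OF A(3)] by simp
  qed
  moreover have "(\<Union>i. A i \<inter> B) = (\<Union>i. A i) \<inter> B" by auto
  ultimately show "(\<Sum>i. f (A i \<inter> B)) = f ((\<Union>i. A i) \<inter> B)" by simp
qed

lemma countably_additive_cindicator:
  "countably_additive M (\<lambda>A. c * indicator A x :: ennreal)"
proof (rule countably_additive_cmult, rule countably_additiveI)
  fix A :: "nat \<Rightarrow> 'a set" assume "disjoint_family A"
  then show "(\<Sum>i. indicator (A i) x) = (indicator (\<Union>i. A i) x :: ennreal)"
    by (rule suminf_indicator)
qed

section \<open>Boundedly finite measures and closedness of R_h\<close>

lemma M_bfI:
  assumes "borel_measure_on T \<mu>" "\<rho> \<in> mspace T" "\<And>r. emeasure \<mu> (mcball_of T \<rho> r) < \<infinity>"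
  shows "\<mu> \<in> M_bf T"
proof -
  interpret Metric_space "mspace T" "mdist T" by (rule Metric_space_mspace_mdist)
  have st: "sets \<mu> = sets (metric_borel T)" using assms by (simp add: borel_measure_on_def)
  have "emeasure \<mu> A < \<infinity>" if A: "A \<in> sets \<mu>" "mbounded A" for A
  proof -
    have "mbounded (insert \<rho> A)" using A(2) assms(2) by (simp add: mbounded_insert)
    then obtain B where B: "\<forall>x\<in>insert \<rho> A. \<forall>y\<in>insert \<rho> A. mdist T x y \<le> B" and AM: "A \<subseteq> mspace T"
      unfolding mbounded_alt by auto
    then have "A \<subseteq> mcball_of T \<rho> B" using assms(2) by auto
    then have "emeasure \<mu> A \<le> emeasure \<mu> (mcball_of T \<rho> B)"
      using mcball_of_borel[OF assms(2)] by (intro emeasure_mono) (simp_all add: st)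
    then show ?thesis using assms(3) by (rule le_less_trans)
  qed
  then show ?thesis using assms by (simp add: M_bf_def)
qed

lemma M_bfD:
  assumes "\<mu> \<in> M_bf T" "\<rho> \<in> mspace T"
  shows "borel_measure_on T \<mu>" "emeasure \<mu> (mcball_of T \<rho> r) < \<infinity>"
proof -
  interpret Metric_space "mspace T" "mdist T" by (rule Metric_space_mspace_mdist)
  show b: "borel_measure_on T \<mu>" using assms by (simp add: M_bf_def)
  have "mcball_of T \<rho> r \<in> sets \<mu>" using b mcball_of_borel[OF assms(2)] by (simp add: borel_measure_on_def)
  moreover have "mbounded (mcball_of T \<rho> r)" unfolding mcball_of_def by (rule mbounded_mcball)
  ultimately show "emeasure \<mu> (mcball_of T \<rho> r) < \<infinity>" using assms by (simp add: M_bf_def)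
qed

lemma finite_of_disjoint_large:
  assumes meas: "\<And>x. x \<in> X \<Longrightarrow> S x \<in> sets \<mu>" and B: "B \<in> sets \<mu>" and Bfin: "emeasure \<mu> B < \<infinity>"
    and sub: "\<And>x. x \<in> X \<Longrightarrow> S x \<subseteq> B"
    and disj: "\<And>x y. x \<in> X \<Longrightarrow> y \<in> X \<Longrightarrow> x \<noteq> y \<Longrightarrow> S x \<inter> S y = {}"
    and c: "c > 0" "\<And>x. x \<in> X \<Longrightarrow> ennreal c \<le> emeasure \<mu> (S x)"
  shows "finite X"
proof (rule ccontr)
  assume inf: "infinite X"
  define m where "m = enn2real (emeasure \<mu> B)"
  have m: "emeasure \<mu> B = ennreal m" "0 \<le> m" using Bfin by (auto simp: m_def less_top)
  obtain n :: nat where n: "m < real n * c" using c(1) reals_Archimedean3 by blast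
  obtain F where F: "F \<subseteq> X" "finite F" "card F = n" using inf by (meson infinite_arbitrarily_large)
  have "ennreal (real n * c) = (\<Sum>x\<in>F. ennreal c)" using F c by (simp add: ennreal_mult' ennreal_of_nat_eq_real_of_nat)
  also have "\<dots> \<le> (\<Sum>x\<in>F. emeasure \<mu> (S x))" using F c by (intro sum_mono) auto
  also have "\<dots> = emeasure \<mu> (\<Union>x\<in>F. S x)"
    using F meas disj by (intro sum_emeasure) (auto simp: disjoint_family_on_def subset_iff)
  also have "\<dots> \<le> emeasure \<mu> B" using F sub B by (intro emeasure_mono) auto
  finally show False using n m by (simp add: ennreal_le_iff)
qed

text \<open>Closedness of the skeleton is assumed because R_h need not be closed otherwise:
  continuity of the measure from above, applied along the ancestors of a point, requires finite
  masses near that point.\<close>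

locale tree_measure = separable_rtree T \<rho> for T :: "'a metric" and \<rho> +
  fixes \<mu> :: "'a measure"
  assumes bf: "\<mu> \<in> M_bf T" and closed_Skel: "closedin (mtopology_of T) (Skel T \<rho> \<mu>)"
begin

lemma space_eq [simp]: "space \<mu> = mspace T" and sets_eq [simp, measurable_cong]: "sets \<mu> = sets (metric_borel T)"
  using bf by (auto simp: M_bf_def borel_measure_on_def)

lemma ball_finite: "emeasure \<mu> (mcball_of T \<rho> r) < \<infinity>"
  using M_bfD[OF bf root_in] by simp

abbreviation "R h \<equiv> Rh T \<rho> \<mu> h"

lemma Rh_iff: "x \<in> R h \<longleftrightarrow> x = \<rho> \<or> x \<in> mspace T \<and> ennreal h \<le> emeasure \<mu> (above T \<rho> x)"
  by (auto simp: Rh_def)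

lemma rsub_Rh: "rsub (R h)"
  unfolding rsub_def
proof (intro conjI ballI allI impI)
  show "R h \<subseteq> mspace T" "\<rho> \<in> R h" by (auto simp: Rh_iff)
  fix x t assume x: "x \<in> R h" and t: "0 \<le> t" "t \<le> ht x"
  have xM: "x \<in> mspace T" using x by (auto simp: Rh_iff)
  show "pt x t \<in> R h"
  proof (cases "x = \<rho>")
    case True then show ?thesis using t by (simp add: Rh_iff pt_0)
  next
    case False
    then have "ennreal h \<le> emeasure \<mu> (above T \<rho> x)" using x by (simp add: Rh_iff)
    also have "\<dots> \<le> emeasure \<mu> (above T \<rho> (pt x t))"
      by (intro emeasure_mono above_mono above_pt xM t) (simp add: above_borel)
    finally show ?thesis using t xM by (simp add: Rh_iff pt_in)
  qed
qed

text \<open>If theta_x has mass below h, then so does theta of some ancestor of x slightly below it,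
  because these sets decrease to theta_x and have finite mass off the closed skeleton. All points
  near x lie above that ancestor.\<close>

lemma closed_Rh: "closedin (mtopology_of T) (R h)"
  unfolding closedin_def
proof (intro conjI)
  show "R h \<subseteq> topspace (mtopology_of T)" by (auto simp: Rh_iff)
  show "openin (mtopology_of T) (topspace (mtopology_of T) - R h)"
    unfolding openin_metric_iff
  proof (intro conjI ballI)
    fix x assume "x \<in> topspace (mtopology_of T) - R h"
    then have x: "x \<in> mspace T" "x \<noteq> \<rho>" and l: "emeasure \<mu> (above T \<rho> x) < ennreal h"
      by (auto simp: Rh_iff not_le)
    have hx: "ht x > 0" using ht_0[OF x(1)] x(2) by (simp add: less_le)
    have "x \<notin> Skel T \<rho> \<mu>" using x l by (auto simp: Skel_def)
    then have "x \<in> mspace T - Skel T \<rho> \<mu>" using x by simp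
    moreover have "openin (mtopology_of T) (mspace T - Skel T \<rho> \<mu>)" using closed_Skel by (simp add: closedin_def)
    ultimately obtain e where e: "e > 0" "\<forall>y\<in>mspace T. mdist T x y < e \<longrightarrow> y \<in> mspace T - Skel T \<rho> \<mu>"
      unfolding openin_metric_iff by blast
    \<comment> \<open>Staying below \<open>ht x\<close> keeps all approximating heights positive;
      the root belongs to \<open>R h\<close> irrespective of its mass.\<close>
    define e' where "e' = min e (ht x) / 2"
    have e': "e' > 0" "e' < e" "e' < ht x" using e hx by (auto simp: e'_def min_def)
    define a where "a n = ht x - e' / real (Suc n)" for n
    have a: "0 < a n" "a n \<le> ht x" "ht x - e' \<le> a n" for n
    proof -
      have "e' / real (Suc n) \<le> e'" "0 \<le> e' / real (Suc n)" using e' by (auto simp: divide_le_eq)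
      then show "0 < a n" "a n \<le> ht x" "ht x - e' \<le> a n" using e' unfolding a_def by linarith+
    qed
    have a_mono: "a n \<le> a m" if "n \<le> m" for n m
      using that e' by (auto simp: a_def intro!: divide_left_mono)
    have pa: "pt x (a n) \<in> mspace T" "ht (pt x (a n)) = a n" for n
      using a[of n] x by (auto intro: pt_in ht_pt)
    have fin: "emeasure \<mu> (above T \<rho> (pt x (a n))) \<noteq> \<infinity>" for n
    proof -
      have "mdist T x (pt x (a n)) = ht x - a n"
        using dist_pt[OF x(1), of "a n" "ht x"] a[of n] pt_ht[OF x(1)] by (subst mdist_commute) simp
      then have "mdist T x (pt x (a n)) < e" using a[of n] e' by simp
      then have "pt x (a n) \<notin> Skel T \<rho> \<mu>" using e pa by blast
      then show ?thesis using pa by (auto simp: Skel_def)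
    qed
    have int: "(\<Inter>n. above T \<rho> (pt x (a n))) = above T \<rho> x"
    proof (intro equalityI subsetI)
      fix y assume y: "y \<in> (\<Inter>n. above T \<rho> (pt x (a n)))"
      then have yM: "y \<in> mspace T" using above_sub by auto
      have le: "a n \<le> gp x y" for n
        using y above_pt_iff[OF x(1) yM, of "a n"] a[of n] by auto
      have "(\<lambda>n. ht x - e' / real (Suc n)) \<longlonglongrightarrow> ht x - 0"
        by (intro tendsto_diff tendsto_const LIMSEQ_Suc[OF lim_const_over_n])
      then have "a \<longlonglongrightarrow> ht x" unfolding a_def by simp
      then have "ht x \<le> gp x y" by (rule LIMSEQ_le_const2) (use le in auto)
      then show "y \<in> above T \<rho> x" using x yM by (simp add: above_iff)
    next
      fix y assume "y \<in> above T \<rho> x"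
      then show "y \<in> (\<Inter>n. above T \<rho> (pt x (a n)))"
        using above_pt[OF x(1)] a(1,2) above_trans by (meson INT_I less_imp_le)
    qed
    have "(INF n. emeasure \<mu> (above T \<rho> (pt x (a n)))) = emeasure \<mu> (\<Inter>n. above T \<rho> (pt x (a n)))"
    proof (rule INF_emeasure_decseq)
      show "range (\<lambda>n. above T \<rho> (pt x (a n))) \<subseteq> sets \<mu>" by (auto simp: above_borel)
      show "decseq (\<lambda>n. above T \<rho> (pt x (a n)))"
      proof (intro decseq_def[THEN iffD2] allI impI)
        fix n m :: nat assume nm: "n \<le> m"
        have "pt x (a m) \<in> above T \<rho> (pt x (a n))"
          using above_comparable[OF above_pt[OF x(1), of "a n"] above_pt[OF x(1), of "a m"]]
            a[of n] a[of m] a_mono[OF nm] pa by simp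
        then show "above T \<rho> (pt x (a m)) \<subseteq> above T \<rho> (pt x (a n))" by (rule above_mono)
      qed
    qed (rule fin)
    then have "(INF n. emeasure \<mu> (above T \<rho> (pt x (a n)))) < ennreal h" using l unfolding int by simp
    then obtain n where n: "emeasure \<mu> (above T \<rho> (pt x (a n))) < ennreal h" unfolding INF_less_iff by blast
    \<comment> \<open>Since \<open>gp x\<close> is 1-Lipschitz and equals \<open>ht x\<close> at x,
      this ball is contained in theta of the ancestor at height \<open>a n\<close>.\<close>
    have "y \<in> topspace (mtopology_of T) - R h" if y: "y \<in> mspace T" "mdist T x y < ht x - a n" for y
    proof -
      have "\<bar>gp x x - gp x y\<bar> \<le> mdist T x y" using gp_lipschitz[of x y x] x y by simp
      then have "a n \<le> gp x y" using y gp_self[OF x(1)] by auto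
      then have ya: "y \<in> above T \<rho> (pt x (a n))" using above_pt_iff[OF x(1) y(1), of "a n"] a[of n] by auto
      then have "emeasure \<mu> (above T \<rho> y) \<le> emeasure \<mu> (above T \<rho> (pt x (a n)))"
        by (intro emeasure_mono above_mono) (auto simp: above_borel)
      then have "emeasure \<mu> (above T \<rho> y) < ennreal h" using n by (rule le_less_trans)
      moreover have "y \<noteq> \<rho>"
      proof
        assume "y = \<rho>"
        then have "a n \<le> 0" using above_ht[OF ya] pa(2)[of n] by simp
        then show False using a(1)[of n] by simp
      qed
      ultimately show ?thesis using y by (auto simp: Rh_iff)
    qed
    moreover have "ht x - a n > 0" using e' by (simp add: a_def)
    ultimately show "\<exists>e>0. \<forall>y\<in>mspace T. mdist T x y < e \<longrightarrow> y \<in> topspace (mtopology_of T) - R h" by blast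
  qed auto
qed

end

section \<open>Projection onto a closed rooted subtree\<close>

context rooted_rtree
begin

text \<open>The part of [rho,x] inside \<open>R\<close> is an initial piece, and closedness of
  \<open>R\<close> makes its supremum p an element. This replaces the definite description by a
  height, the form in which projections are compared.\<close>

lemma tree_proj_ex1:
  assumes R: "rsub R" "closedin (mtopology_of T) R" and x: "x \<in> mspace T"
  shows "\<exists>p. 0 \<le> p \<and> p \<le> ht x \<and> tree_proj T \<rho> R x = pt x p \<and> (\<forall>t. 0 \<le> t \<longrightarrow> t \<le> ht x \<longrightarrow> (pt x t \<in> R \<longleftrightarrow> t \<le> p))"
proof -
  have RM: "R \<subseteq> mspace T" and \<rho>R: "\<rho> \<in> R" and Rpt: "\<And>x t. x \<in> R \<Longrightarrow> 0 \<le> t \<Longrightarrow> t \<le> ht x \<Longrightarrow> pt x t \<in> R"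
    using R by (auto simp: rsub_def)
  define E where "E = {t. 0 \<le> t \<and> t \<le> ht x \<and> pt x t \<in> R}"
  have E0: "0 \<in> E" using \<rho>R pt_0[OF x] by (simp add: E_def)
  have bdd: "bdd_above E" by (auto simp: E_def bdd_above_def)
  define p where "p = Sup E"
  have p: "0 \<le> p" "p \<le> ht x"
  proof -
    show "0 \<le> p" unfolding p_def by (rule cSup_upper[OF E0 bdd])
    show "p \<le> ht x" unfolding p_def
    proof (rule cSup_least)
      show "E \<noteq> {}" using E0 by blast
    qed (simp add: E_def)
  qed
  have down: "s \<in> E" if "t \<in> E" "0 \<le> s" "s \<le> t" for s t
  proof -
    have t: "0 \<le> t" "t \<le> ht x" "pt x t \<in> R" using that by (auto simp: E_def)
    have "pt (pt x t) s \<in> R" using Rpt[OF t(3) that(2)] ht_pt[OF x t(1,2)] that by simp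
    then show ?thesis using pt_pt[OF x that(2,3) t(2)] that t by (simp add: E_def)
  qed
  have pM: "pt x p \<in> mspace T" using p x by (auto intro: pt_in)
  have pR: "pt x p \<in> R"
  proof (rule ccontr)
    assume "pt x p \<notin> R"
    then have "pt x p \<in> mspace T - R" using pM by simp
    moreover have "openin (mtopology_of T) (mspace T - R)" using R by (simp add: closedin_def)
    ultimately obtain e where e: "e > 0" "\<forall>y\<in>mspace T. mdist T (pt x p) y < e \<longrightarrow> y \<in> mspace T - R"
      unfolding openin_metric_iff by blast
    obtain t where t: "t \<in> E" "p - e < t" using less_cSupD[of E "p - e"] E0 e unfolding p_def by force
    have tp: "t \<le> p" using cSup_upper[OF t(1) bdd] by (simp add: p_def)
    have t': "0 \<le> t" "t \<le> ht x" "pt x t \<in> R" using t by (auto simp: E_def)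
    have "mdist T (pt x p) (pt x t) = p - t" using dist_pt[OF x t'(1) tp p(2)] by (subst mdist_commute) simp
    then have "pt x t \<in> mspace T - R" using e t t' RM by auto
    then show False using t' by simp
  qed
  have iff: "pt x t \<in> R \<longleftrightarrow> t \<le> p" if "0 \<le> t" "t \<le> ht x" for t
  proof
    assume "pt x t \<in> R" then have "t \<in> E" using that by (simp add: E_def)
    then show "t \<le> p" unfolding p_def using bdd by (rule cSup_upper)
  next
    assume "t \<le> p"
    moreover have "p \<in> E" using pR p by (simp add: E_def)
    ultimately show "pt x t \<in> R" using down that by (auto simp: E_def)
  qed
  have seg1: "seg T \<rho> x \<inter> R = pt x ` {0..p}"
    unfolding seg_eq[OF x] using iff p by auto
  have seg2: "seg T \<rho> (pt x p) = pt x ` {0..p}"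
    unfolding seg_eq[OF pM] ht_pt[OF x p] using pt_pt[OF x _ _ p(2)] by (intro image_cong) auto
  have "tree_proj T \<rho> R x = pt x p"
    unfolding tree_proj_def
  proof (rule the_equality)
    show "pt x p \<in> mspace T \<and> seg T \<rho> x \<inter> R = seg T \<rho> (pt x p)" using pM seg1 seg2 by simp
  next
    fix q assume q: "q \<in> mspace T \<and> seg T \<rho> x \<inter> R = seg T \<rho> q"
    then have e: "pt q ` {0..ht q} = pt x ` {0..p}" using seg1 seg_eq[of q] by auto
    have "pt q (ht q) \<in> pt q ` {0..ht q}" by auto
    then have "q \<in> pt x ` {0..p}" using e pt_ht[of q] q by simp
    then obtain s where s: "0 \<le> s" "s \<le> p" "q = pt x s" by auto
    have hq: "ht q = s" using s p ht_pt[OF x, of s] by simp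
    have "pt x p \<in> pt q ` {0..ht q}" unfolding e using p by auto
    then obtain u where u: "0 \<le> u" "u \<le> s" "pt x p = pt q u" using hq by auto
    then have "ht (pt q u) = p" using ht_pt[OF x p] by simp
    then have "u = p" using ht_pt[of q u] u q hq by simp
    then show "q = pt x p" using u s by simp
  qed
  then show ?thesis using p iff by blast
qed

lemma
  assumes R: "rsub R" "closedin (mtopology_of T) R" and x: "x \<in> mspace T"
  shows tree_proj_in: "tree_proj T \<rho> R x \<in> R"
    and tree_proj_below: "x \<in> above T \<rho> (tree_proj T \<rho> R x)"
    and pt_in_R_iff: "0 \<le> t \<Longrightarrow> t \<le> ht x \<Longrightarrow> pt x t \<in> R \<longleftrightarrow> t \<le> ht (tree_proj T \<rho> R x)"
proof -
  obtain p where p: "0 \<le> p" "p \<le> ht x" "tree_proj T \<rho> R x = pt x p"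
    "\<forall>t. 0 \<le> t \<longrightarrow> t \<le> ht x \<longrightarrow> (pt x t \<in> R \<longleftrightarrow> t \<le> p)" using tree_proj_ex1[OF assms] by blast
  show "tree_proj T \<rho> R x \<in> R" using p by simp
  show "x \<in> above T \<rho> (tree_proj T \<rho> R x)" using p x above_pt by simp
  show "0 \<le> t \<Longrightarrow> t \<le> ht x \<Longrightarrow> pt x t \<in> R \<longleftrightarrow> t \<le> ht (tree_proj T \<rho> R x)" using p ht_pt[OF x p(1,2)] by simp
qed

text \<open>The preimage of theta_sigma is theta_sigma or empty. Measurability of the projection and
  the mass of every projected set theta_sigma can be read off from this.\<close>

lemma tree_proj_above_iff:
  assumes R: "rsub R" "closedin (mtopology_of T) R" and x: "x \<in> mspace T" and \<sigma>: "\<sigma> \<in> mspace T"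
  shows "tree_proj T \<rho> R x \<in> above T \<rho> \<sigma> \<longleftrightarrow> x \<in> above T \<rho> \<sigma> \<and> \<sigma> \<in> R"
proof
  let ?p = "tree_proj T \<rho> R x"
  note p = tree_proj_in[OF R x] tree_proj_below[OF R x] pt_in_R_iff[OF R x]
  assume a: "?p \<in> above T \<rho> \<sigma>"
  then have xs: "x \<in> above T \<rho> \<sigma>" using p(2) above_trans by blast
  moreover have "\<sigma> \<in> R"
    using p(3)[of "ht \<sigma>"] above_ht[OF a] above_ht[OF xs] xs by (auto simp: above_iff')
  ultimately show "x \<in> above T \<rho> \<sigma> \<and> \<sigma> \<in> R" by simp
next
  let ?p = "tree_proj T \<rho> R x"
  note p = tree_proj_in[OF R x] tree_proj_below[OF R x] pt_in_R_iff[OF R x]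
  assume a: "x \<in> above T \<rho> \<sigma> \<and> \<sigma> \<in> R"
  then have "ht \<sigma> \<le> ht ?p"
    using p(3)[of "ht \<sigma>"] above_ht[of x \<sigma>] by (auto simp: above_iff')
  then show "?p \<in> above T \<rho> \<sigma>" using above_comparable[of x \<sigma> ?p] a p(2) by blast
qed

end

lemma (in separable_rtree) tree_proj_measurable:
  assumes R: "rsub R" "closedin (mtopology_of T) R" and st: "sets N = sets (metric_borel T)"
  shows "tree_proj T \<rho> R \<in> measurable N (metric_borel T)"
proof (rule measurable_above)
  have sp: "space N = mspace T" using sets_eq_imp_space_eq[OF st] by simp
  show "tree_proj T \<rho> R x \<in> mspace T" if "x \<in> space N" for x
    using tree_proj_in[OF R, of x] that R sp by (auto simp: rsub_def)
  show "{x\<in>space N. tree_proj T \<rho> R x \<in> above T \<rho> \<sigma>} \<in> sets N" if s: "\<sigma> \<in> mspace T" for \<sigma>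
  proof -
    have "{x\<in>space N. tree_proj T \<rho> R x \<in> above T \<rho> \<sigma>} = (if \<sigma> \<in> R then above T \<rho> \<sigma> else {})"
      using tree_proj_above_iff[OF R _ s] above_sub[of \<sigma>] by (auto simp: sp)
    then show ?thesis using st above_borel by simp
  qed
qed

section \<open>The erased measure\<close>

lemma mcball_of_0: "x \<in> mspace T \<Longrightarrow> mcball_of T x 0 = {x}"
proof -
  assume x: "x \<in> mspace T"
  have "y \<in> mcball_of T x 0 \<longleftrightarrow> y = x" for y
    using x mdist_zero[of x T y] mdist_nonneg[of T x y] by (metis in_mcball_of order_antisym order_refl)
  then show ?thesis by blast
qed

lemma singleton_borel: "x \<in> mspace T \<Longrightarrow> {x} \<in> sets (metric_borel T)"
  using mcball_of_borel[of x T 0] mcball_of_0[of x T] by simp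

section \<open>Leaves and branch points through branches\<close>

context rooted_rtree
begin

lemma ball_borel [simp]: "mcball_of T \<rho> r \<in> sets (metric_borel T)"
  by (rule mcball_of_borel[OF root_in])

definition leaves :: "'a set \<Rightarrow> 'a set" where
  "leaves R = {\<sigma>\<in>R. \<sigma> \<noteq> \<rho> \<and> branches T \<rho> R \<sigma> = {}}"

text \<open>The component of the root is not among the branches, so the threshold is 2 where
  \<open>Bp\<close> has 3; likewise a leaf has no branch where \<open>Lf\<close> asks for one
  component.\<close>

definition bpoints :: "'a set \<Rightarrow> 'a set" where
  "bpoints R = {\<sigma>\<in>R. \<sigma> \<noteq> \<rho> \<and> 2 \<le> ecard (branches T \<rho> R \<sigma>)}"

lemma Lf_leaves: assumes "rsub R" shows "Lf (submetric T R) \<rho> = leaves R"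
proof -
  have "e + 1 = 1 \<longleftrightarrow> e = 0" for e :: enat by (cases e) (auto simp: one_enat_def zero_enat_def)
  moreover have "ecard X = 0 \<longleftrightarrow> X = {}" for X :: "'a set set"
    by (auto simp: ecard_def zero_enat_def)
  moreover have "R \<subseteq> mspace T" using assms by (simp add: rsub_def)
  ultimately show ?thesis
    unfolding Lf_def leaves_def by (auto simp: ncomp_branches[OF assms])
qed

lemma Bp_bpoints: assumes "rsub R" shows "Bp (submetric T R) \<rho> = bpoints R"
proof -
  have "3 \<le> e + 1 \<longleftrightarrow> 2 \<le> e" for e :: enat
    by (cases e) (auto simp: one_enat_def numeral_eq_enat)
  moreover have "R \<subseteq> mspace T" using assms by (simp add: rsub_def)
  ultimately show ?thesis
    unfolding Bp_def bpoints_def by (auto simp: ncomp_branches[OF assms])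
qed

lemma ncomp_bpoint: assumes "rsub R" "\<sigma> \<in> bpoints R"
  shows "ncomp (submetric T R) \<sigma> - 2 = ecard (branches T \<rho> R \<sigma>) - 1"
proof -
  have "e + 1 - 2 = e - 1" for e :: enat
    by (cases e) (auto simp: one_enat_def numeral_eq_enat)
  then show ?thesis using assms by (simp add: bpoints_def ncomp_branches)
qed

lemma leaves_iff: "\<sigma> \<in> leaves R \<longleftrightarrow> \<sigma> \<in> R \<and> \<sigma> \<noteq> \<rho> \<and> R \<inter> above T \<rho> \<sigma> \<subseteq> {\<sigma>}"
  unfolding leaves_def branches_def by auto

lemma leaves_disjoint:
  assumes "\<sigma> \<in> leaves R" "\<tau> \<in> leaves R" "\<sigma> \<noteq> \<tau>"
  shows "above T \<rho> \<sigma> \<inter> above T \<rho> \<tau> = {}"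
proof -
  have "False" if x: "x \<in> above T \<rho> \<sigma>" "x \<in> above T \<rho> \<tau>" for x
  proof (cases "ht \<sigma> \<le> ht \<tau>")
    case True
    then have "\<tau> \<in> above T \<rho> \<sigma>" using above_comparable x by blast
    then show False using assms unfolding leaves_iff by blast
  next
    case False
    then have "\<sigma> \<in> above T \<rho> \<tau>" using above_comparable[OF x(2,1)] by simp
    then show False using assms unfolding leaves_iff by blast
  qed
  then show ?thesis by blast
qed

lemma leaf_proj_iff:
  assumes R: "rsub R" "closedin (mtopology_of T) R" and \<sigma>: "\<sigma> \<in> leaves R" and x: "x \<in> mspace T"
  shows "tree_proj T \<rho> R x = \<sigma> \<longleftrightarrow> x \<in> above T \<rho> \<sigma>"
proof
  have \<sigma>M: "\<sigma> \<in> mspace T" using \<sigma> R by (auto simp: leaves_def rsub_def)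
  show "x \<in> above T \<rho> \<sigma>" if "tree_proj T \<rho> R x = \<sigma>" using tree_proj_below[OF R x] that by simp
  show "tree_proj T \<rho> R x = \<sigma>" if "x \<in> above T \<rho> \<sigma>"
    using tree_proj_above_iff[OF R x \<sigma>M] that \<sigma> tree_proj_in[OF R x] unfolding leaves_iff by blast
qed

end

context tree_measure
begin

abbreviation "pj h \<equiv> tree_proj T \<rho> (R h)"
abbreviation "kk h \<sigma> \<equiv> ecard (branches T \<rho> (R h) \<sigma>)"

lemma Rh_sub: "R h \<subseteq> mspace T"
  using rsub_Rh by (auto simp: rsub_def)

lemma pj_meas [measurable]: "pj h \<in> measurable \<mu> (metric_borel T)"
  by (rule tree_proj_measurable[OF rsub_Rh closed_Rh sets_eq])

text \<open>The sets theta_sigma over the leaves are disjoint and each has positive mass in some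
  ball of integer radius, while balls have finite mass. Countability makes the set of leaves
  Borel.\<close>

lemma countable_leaves:
  assumes h: "h > 0" shows "countable (leaves (R h))"
proof -
  define X where "X n j = {\<sigma>\<in>leaves (R h). ennreal (1 / real (Suc j)) \<le> emeasure \<mu> (above T \<rho> \<sigma> \<inter> mcball_of T \<rho> (real n))}"
    for n j :: nat
  have "finite (X n j)" for n j
  proof (rule finite_of_disjoint_large[where B="mcball_of T \<rho> (real n)" and \<mu>=\<mu> and c="1 / real (Suc j)"
        and S="\<lambda>\<sigma>. above T \<rho> \<sigma> \<inter> mcball_of T \<rho> (real n)"])
    show "mcball_of T \<rho> (real n) \<in> sets \<mu>" by simp
    show "above T \<rho> x \<inter> mcball_of T \<rho> (real n) \<in> sets \<mu>" for x
      by (simp add: above_borel sets.Int)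
    show "(above T \<rho> x \<inter> mcball_of T \<rho> (real n)) \<inter> (above T \<rho> y \<inter> mcball_of T \<rho> (real n)) = {}"
      if "x \<in> X n j" "y \<in> X n j" "x \<noteq> y" for x y
      using leaves_disjoint[of x "R h" y] that unfolding X_def by blast
  qed (use ball_finite in \<open>auto simp: X_def\<close>)
  moreover have "leaves (R h) \<subseteq> (\<Union>n. \<Union>j. X n j)"
  proof
    fix \<sigma> assume \<sigma>: "\<sigma> \<in> leaves (R h)"
    then have l: "ennreal h \<le> emeasure \<mu> (above T \<rho> \<sigma>)" by (auto simp: leaves_def Rh_iff)
    have "(SUP n. emeasure \<mu> (above T \<rho> \<sigma> \<inter> mcball_of T \<rho> (real n))) = emeasure \<mu> (\<Union>n. above T \<rho> \<sigma> \<inter> mcball_of T \<rho> (real n))"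
      by (rule SUP_emeasure_incseq)
        (auto simp: incseq_def above_borel intro!: sets.Int)
    also have "(\<Union>n. above T \<rho> \<sigma> \<inter> mcball_of T \<rho> (real n)) = above T \<rho> \<sigma>"
    proof (intro equalityI subsetI)
      fix x assume x: "x \<in> above T \<rho> \<sigma>"
      obtain n where "ht x \<le> real n" using real_arch_simple by blast
      moreover have "x \<in> mspace T" using x above_sub by blast
      ultimately have "x \<in> mcball_of T \<rho> (real n)" by simp
      then show "x \<in> (\<Union>n. above T \<rho> \<sigma> \<inter> mcball_of T \<rho> (real n))" using x by blast
    qed blast
    finally have "0 < (SUP n. emeasure \<mu> (above T \<rho> \<sigma> \<inter> mcball_of T \<rho> (real n)))"
      using l h by (simp add: less_le_trans[of 0 "ennreal h"])
    then obtain n where n: "0 < emeasure \<mu> (above T \<rho> \<sigma> \<inter> mcball_of T \<rho> (real n))" by (auto simp: less_SUP_iff)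
    obtain c :: real where c: "0 < c" "ennreal c \<le> emeasure \<mu> (above T \<rho> \<sigma> \<inter> mcball_of T \<rho> (real n))"
    proof (cases "emeasure \<mu> (above T \<rho> \<sigma> \<inter> mcball_of T \<rho> (real n))")
      case (real r) then show ?thesis using n that[of r] by simp
    next
      case top then show ?thesis using that[of 1] by simp
    qed
    obtain j where "inverse (real (Suc j)) < c" using reals_Archimedean[OF c(1)] by blast
    then have "ennreal (1 / real (Suc j)) \<le> ennreal c" by (intro ennreal_leI) (simp add: inverse_eq_divide)
    then have "\<sigma> \<in> X n j" using c(2) \<sigma> unfolding X_def by auto
    then show "\<sigma> \<in> (\<Union>n. \<Union>j. X n j)" by blast
  qed
  ultimately show ?thesis
    by (meson countable_UN countable_finite countable_subset countableI_type)
qed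

lemma leaves_borel: assumes h: "h > 0" shows "leaves (R h) \<in> sets (metric_borel T)"
  by (rule sets.countable[OF _ countable_leaves[OF h]])
    (rule singleton_borel, use Rh_sub in \<open>auto simp: leaves_def\<close>)

text \<open>The formula of \<open>erase\<close> before h is taken off at the root, with component
  counts replaced by branch counts. All of its terms are nonnegative, so additivity can be shown
  term by term.\<close>

definition Psi :: "real \<Rightarrow> 'a set \<Rightarrow> ennreal" where
  "Psi h A = emeasure \<mu> {x\<in>mspace T. pj h x \<in> A \<inter> (R h - leaves (R h))}
     + infsum (\<lambda>\<sigma>. emeasure \<mu> (above T \<rho> \<sigma>) - ennreal h) (leaves (R h) \<inter> A)
     + ennreal h * infsum (\<lambda>\<sigma>. ennreal_of_enat (kk h \<sigma> - 1)) (bpoints (R h) \<inter> A)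
     + ennreal h * ennreal_of_enat (kk h \<rho>) * indicator A \<rho>"

lemma Psi_countably_additive:
  assumes h: "h > 0" shows "countably_additive (sets (metric_borel T)) (Psi h)"
proof -
  let ?N = "distr \<mu> (metric_borel T) (pj h)"
  have Rb: "R h - leaves (R h) \<in> sets (metric_borel T)"
    using closed_in_metric_borel[OF closed_Rh] leaves_borel[OF h] by auto
  have "countably_additive (sets ?N) (emeasure ?N)" by (rule emeasure_countably_additive)
  then have "countably_additive (sets (metric_borel T)) (emeasure ?N)" by simp
  then have "countably_additive (sets (metric_borel T)) (\<lambda>A. emeasure ?N (A \<inter> (R h - leaves (R h))))"
    by (rule countably_additive_Int) (use Rb in auto)
  moreover have "emeasure ?N (A \<inter> (R h - leaves (R h))) = emeasure \<mu> {x\<in>mspace T. pj h x \<in> A \<inter> (R h - leaves (R h))}"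
    if "A \<in> sets (metric_borel T)" for A
    using that Rb by (subst emeasure_distr[OF pj_meas]) (auto intro!: arg_cong[where f="emeasure \<mu>"])
  ultimately have "countably_additive (sets (metric_borel T)) (\<lambda>A. emeasure \<mu> {x\<in>mspace T. pj h x \<in> A \<inter> (R h - leaves (R h))})"
    unfolding countably_additive_def by (auto simp: range_subsetD)
  then show ?thesis
    unfolding Psi_def
    by (intro countably_additive_add countably_additive_cmult countably_additive_infsum countably_additive_cindicator)
qed

lemma branches_root_nonempty: assumes "R h \<noteq> {\<rho>}" shows "kk h \<rho> \<ge> 1"
proof -
  have "\<rho> \<in> R h" by (simp add: Rh_iff)
  then obtain y where y: "y \<in> R h" "y \<noteq> \<rho>" using assms by blast
  then have "branches T \<rho> (R h) \<rho> \<noteq> {}" using Rh_sub by (auto simp: branches_def above_root)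
  then have "kk h \<rho> \<noteq> 0" by (auto simp: ecard_def zero_enat_def)
  then show ?thesis by (metis enat_ile ileI1 linorder_not_less one_eSuc zero_less_iff_neq_zero)
qed

text \<open>Guarantees that the final subtraction at the root is not truncated. Either R is the root
  alone and carries the whole mass, or the root has at least one branch and thus a term of size
  h.\<close>

lemma Psi_root: assumes h: "h > 0" "ennreal h \<le> emeasure \<mu> (mspace T)" shows "ennreal h \<le> Psi h {\<rho>}"
proof (cases "R h = {\<rho>}")
  case True
  have "{x\<in>mspace T. pj h x \<in> {\<rho>} \<inter> (R h - leaves (R h))} = mspace T"
  proof -
    have "pj h x = \<rho>" if "x \<in> mspace T" for x using tree_proj_in[OF rsub_Rh closed_Rh that] True by blast
    moreover have "\<rho> \<in> R h - leaves (R h)" by (simp add: leaves_def Rh_iff)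
    ultimately show ?thesis by auto
  qed
  then show ?thesis using h unfolding Psi_def by (simp add: add_increasing2)
next
  case False
  then have "ennreal_of_enat 1 \<le> ennreal_of_enat (kk h \<rho>)"
    using branches_root_nonempty by (simp only: ennreal_of_enat_le_iff)
  then have "ennreal h * 1 \<le> ennreal h * ennreal_of_enat (kk h \<rho>)"
    by (intro mult_left_mono) simp_all
  then show ?thesis unfolding Psi_def by (simp add: add_increasing)
qed

text \<open>\<open>measure_of\<close> reproduces the given set function only if that function is
  countably additive, which is not evident from a formula containing a subtraction.\<close>

lemma erase_Psi:
  assumes h: "h > 0" "ennreal h \<le> emeasure \<mu> (mspace T)"
  shows "sets (erase T \<rho> h \<mu>) = sets (metric_borel T)"
    and "A \<in> sets (metric_borel T) \<Longrightarrow> emeasure (erase T \<rho> h \<mu>) A = Psi h A - ennreal h * indicator A \<rho>"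
proof -
  let ?S = "sets (metric_borel T)"
  let ?f = "\<lambda>A. emeasure (Pr T \<rho> (R h) \<mu>) (A \<inter> (R h - leaves (R h)))
            + (\<Sum>\<^sub>\<infinity>\<sigma>\<in>leaves (R h) \<inter> A. emeasure \<mu> (above T \<rho> \<sigma>) - ennreal h)
            + ennreal h * (\<Sum>\<^sub>\<infinity>\<sigma>\<in>bpoints (R h) \<inter> A. ennreal_of_enat (ncomp (submetric T (R h)) \<sigma> - 2))
            + ennreal h * ennreal_of_enat (ncomp (submetric T (R h)) \<rho>) * indicator A \<rho>
            - ennreal h * indicator A \<rho>"
  have e: "erase T \<rho> h \<mu> = measure_of (mspace T) {U. openin (mtopology_of T) U} ?f"
  proof -
    have nl: "\<not> emeasure \<mu> (mspace T) < ennreal h" using h by (simp add: not_less)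
    show ?thesis
      unfolding erase_def Let_def if_not_P[OF nl] Lf_leaves[OF rsub_Rh] Bp_bpoints[OF rsub_Rh] by (rule refl)
  qed
  have Pw: "{U. openin (mtopology_of T) U} \<subseteq> Pow (mspace T)" using openin_subset_mspace by blast
  show s: "sets (erase T \<rho> h \<mu>) = ?S"
    unfolding e sets_metric_borel by (rule sets_measure_of[OF Pw])
  have Rb: "R h - leaves (R h) \<in> ?S"
    using closed_in_metric_borel[OF closed_Rh] leaves_borel[OF h(1)] by auto
  have f: "?f A = Psi h A - ennreal h * indicator A \<rho>" if A: "A \<in> ?S" for A
  proof -
    have "emeasure (Pr T \<rho> (R h) \<mu>) (A \<inter> (R h - leaves (R h))) = emeasure \<mu> {x\<in>mspace T. pj h x \<in> A \<inter> (R h - leaves (R h))}"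
      unfolding Pr_def using A Rb
      by (subst emeasure_distr[OF pj_meas]) (auto intro!: arg_cong[where f="emeasure \<mu>"])
    moreover have "(\<Sum>\<^sub>\<infinity>\<sigma>\<in>bpoints (R h) \<inter> A. ennreal_of_enat (ncomp (submetric T (R h)) \<sigma> - 2))
      = (\<Sum>\<^sub>\<infinity>\<sigma>\<in>bpoints (R h) \<inter> A. ennreal_of_enat (kk h \<sigma> - 1))"
      by (rule infsum_cong) (simp add: ncomp_bpoint[OF rsub_Rh])
    moreover have "ncomp (submetric T (R h)) \<rho> = kk h \<rho>"
      using ncomp_branches[OF rsub_Rh, of \<rho> h] by (simp add: Rh_iff)
    ultimately show ?thesis by (simp add: Psi_def)
  qed
  \<comment> \<open>The subtraction rewritten as a sum: the mass off the root plus an atom of fixed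
    size at the root.\<close>
  let ?g = "\<lambda>A. Psi h (A \<inter> (mspace T - {\<rho>})) + (Psi h {\<rho>} - ennreal h) * indicator A \<rho>"
  have \<rho>b: "{\<rho>} \<in> ?S" by (rule singleton_borel[OF root_in])
  have compl: "mspace T - {\<rho>} \<in> ?S" using \<rho>b sets.compl_sets[of "{\<rho>}" "metric_borel T"] by simp
  have g: "Psi h A - ennreal h * indicator A \<rho> = ?g A" if A: "A \<in> ?S" for A
  proof (cases "\<rho> \<in> A")
    case True
    have AM: "A \<subseteq> mspace T" using sets.sets_into_space[OF A] by simp
    have "Psi h ({\<rho>} \<union> (A \<inter> (mspace T - {\<rho>}))) = Psi h {\<rho>} + Psi h (A \<inter> (mspace T - {\<rho>}))"
    proof (rule additiveD)
      show "additive ?S (Psi h)"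
        using sets.countably_additive_additive[OF _ Psi_countably_additive[OF h(1)]]
        by (auto simp: positive_def Psi_def)
    qed (use \<rho>b compl A in auto)
    moreover have "{\<rho>} \<union> (A \<inter> (mspace T - {\<rho>})) = A" using True AM by auto
    ultimately have "Psi h A = Psi h {\<rho>} + Psi h (A \<inter> (mspace T - {\<rho>}))" by simp
    then show ?thesis using True Psi_root[OF h]
      by (simp add: diff_add_assoc2_ennreal add.commute)
  next
    case False
    then have "A \<inter> (mspace T - {\<rho>}) = A" using sets.sets_into_space[OF A] by auto
    then show ?thesis using False by simp
  qed
  have ca: "countably_additive ?S ?g"
    by (intro countably_additive_add countably_additive_cindicator countably_additive_Int Psi_countably_additive h)
      (use compl in auto)
  have fg: "?f A = ?g A" if "A \<in> ?S" for A using f[OF that] g[OF that] by (rule trans)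
  have caf: "countably_additive ?S ?f"
    unfolding countably_additive_def
  proof (intro allI impI)
    fix A :: "nat \<Rightarrow> 'a set" assume A: "range A \<subseteq> ?S" "disjoint_family A" "(\<Union>i. A i) \<in> ?S"
    have "(\<Sum>i. ?f (A i)) = (\<Sum>i. ?g (A i))" by (rule suminf_cong) (use A fg in auto)
    also have "\<dots> = ?g (\<Union>i. A i)" using ca A unfolding countably_additive_def by blast
    finally show "(\<Sum>i. ?f (A i)) = ?f (\<Union>i. A i)" using fg[OF A(3)] by simp
  qed
  show "emeasure (erase T \<rho> h \<mu>) A = Psi h A - ennreal h * indicator A \<rho>" if A: "A \<in> ?S"
  proof -
    have "emeasure (erase T \<rho> h \<mu>) A = ?f A"
    proof (rule emeasure_measure_of[OF e Pw])
      show "positive (sets (erase T \<rho> h \<mu>)) ?f" by (auto simp: positive_def)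
      show "countably_additive (sets (erase T \<rho> h \<mu>)) ?f" unfolding s by (rule caf)
      show "A \<in> sets (erase T \<rho> h \<mu>)" using A s by simp
    qed
    then show ?thesis using f[OF A] by simp
  qed
qed

lemma erase_small:
  assumes "emeasure \<mu> (mspace T) < ennreal h"
  shows "erase T \<rho> h \<mu> = null_measure (metric_borel T)"
  using assms by (simp add: erase_def)

lemma sets_erase: "h > 0 \<Longrightarrow> sets (erase T \<rho> h \<mu>) = sets (metric_borel T)"
  using erase_Psi(1)[of h] erase_small[of h] by (cases "emeasure \<mu> (mspace T) < ennreal h") auto

end

text \<open>The erased measure on \<open>V\<close> only depends on \<open>R\<close> in an upward neighbourhood \<open>V'\<close> of \<open>V\<close>
  and on the mass that is projected into \<open>V\<close>.\<close>

lemma (in separable_rtree) Psi_local: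
  assumes m1: "tree_measure T \<rho> \<mu>" and m2: "tree_measure T \<rho> \<nu>" and h: "h > 0"
    and VV: "V \<subseteq> V'" and RV: "Rh T \<rho> \<mu> h \<inter> V' = Rh T \<rho> \<nu> h \<inter> V'"
    and up: "\<And>y z. y \<in> V \<Longrightarrow> z \<in> above T \<rho> y \<Longrightarrow> z \<noteq> y \<Longrightarrow>
        \<exists>d>0. \<forall>t. ht y \<le> t \<longrightarrow> t < ht y + d \<longrightarrow> t \<le> ht z \<longrightarrow> pt z t \<in> V'"
    and mass: "\<And>B. B \<in> sets (metric_borel T) \<Longrightarrow> (\<And>x. x \<in> B \<Longrightarrow> tree_proj T \<rho> (Rh T \<rho> \<mu> h) x \<in> V) \<Longrightarrow>
        emeasure \<mu> B = emeasure \<nu> B"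
    and A: "A \<in> sets (metric_borel T)" "A \<subseteq> V"
  shows "tree_measure.Psi T \<rho> \<mu> h A = tree_measure.Psi T \<rho> \<nu> h A"
proof -
  interpret m1: tree_measure T \<rho> \<mu> by (rule m1)
  interpret m2: tree_measure T \<rho> \<nu> by (rule m2)
  let ?R = "Rh T \<rho> \<mu> h" and ?S = "Rh T \<rho> \<nu> h"
  \<comment> \<open>If the projection onto \<open>S\<close> went beyond the projection y onto
    \<open>R\<close>, then points of the path slightly above y would lie in \<open>S\<close> and in
    \<open>V'\<close>, hence in \<open>R\<close>, which is impossible.\<close>
  have proj: "tree_proj T \<rho> S x = tree_proj T \<rho> R x"
    if R: "rsub R" "closedin (mtopology_of T) R" and S: "rsub S" "closedin (mtopology_of T) S"
      and RS: "R \<inter> V' = S \<inter> V'" and x: "x \<in> mspace T" and xV: "tree_proj T \<rho> R x \<in> V" for R S x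
  proof -
    let ?y = "tree_proj T \<rho> R x"
    note p = tree_proj_in[OF R x] tree_proj_below[OF R x] pt_in_R_iff[OF R x]
    note q = tree_proj_in[OF S x] tree_proj_below[OF S x] pt_in_R_iff[OF S x]
    have hyx: "ht ?y \<le> ht x" using above_ht[OF p(2)] .
    have y: "pt x (ht ?y) = ?y" using p(2) by (simp add: above_iff')
    have "?y \<in> S" using p(1) xV VV RS by blast
    then have le: "ht ?y \<le> ht (tree_proj T \<rho> S x)" using q(3)[of "ht ?y"] y hyx by simp
    have ge: "ht (tree_proj T \<rho> S x) \<le> ht ?y"
    proof (cases "x = ?y")
      case True
      then show ?thesis using above_ht[OF q(2)] by simp
    next
      case False
      obtain d where d: "d > 0" "\<forall>t. ht ?y \<le> t \<longrightarrow> t < ht ?y + d \<longrightarrow> t \<le> ht x \<longrightarrow> pt x t \<in> V'"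
        using up[OF xV p(2) False] by blast
      show ?thesis
      proof (rule ccontr)
        assume "\<not> ht (tree_proj T \<rho> S x) \<le> ht ?y"
        then have g: "ht ?y < ht (tree_proj T \<rho> S x)" by simp
        define t where "t = min (ht (tree_proj T \<rho> S x)) (ht ?y + d/2)"
        have t: "ht ?y < t" "t < ht ?y + d" "t \<le> ht (tree_proj T \<rho> S x)" using g d by (auto simp: t_def min_def)
        have tx: "t \<le> ht x" using t(3) above_ht[OF q(2)] by simp
        have t0: "0 \<le> t" using t(1) mdist_nonneg[of T \<rho> ?y] by linarith
        have "pt x t \<in> S" using q(3)[OF t0 tx] t by simp
        moreover have "pt x t \<in> V'" using d(2) t tx by simp
        ultimately have "pt x t \<in> R" using RS by blast
        then show False using p(3)[OF t0 tx] t by simp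
      qed
    qed
    have e: "pt x (ht (tree_proj T \<rho> S x)) = tree_proj T \<rho> S x" using q(2) unfolding above_iff' by blast
    have "ht (tree_proj T \<rho> S x) = ht ?y" using le ge by (rule order_antisym[rotated])
    then show ?thesis using e y by metis
  qed
  note pjR = proj[OF m1.rsub_Rh m1.closed_Rh m2.rsub_Rh m2.closed_Rh RV]
  note pjS = proj[OF m2.rsub_Rh m2.closed_Rh m1.rsub_Rh m1.closed_Rh RV[symmetric]]
  \<comment> \<open>A branch at y is represented by points arbitrarily close to y. One of them lies
    in \<open>V'\<close>, where the two subtrees coincide.\<close>
  have br_sub: "branches T \<rho> R y \<subseteq> branches T \<rho> S y"
    if R: "rsub R" and RS: "R \<inter> V' = S \<inter> V'" and y: "y \<in> V" for R S y
  proof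
    fix B assume "B \<in> branches T \<rho> R y"
    then obtain z where z: "z \<in> R" "z \<in> above T \<rho> y" "z \<noteq> y" "B = branch T \<rho> y z" by (auto simp: branches_def)
    have zM: "z \<in> mspace T" "y \<in> mspace T" using z by (auto simp: above_iff)
    have yz: "ht y < ht z" using above_antisym[OF z(2)] z(3) by force
    obtain d where d: "d > 0" "\<forall>t. ht y \<le> t \<longrightarrow> t < ht y + d \<longrightarrow> t \<le> ht z \<longrightarrow> pt z t \<in> V'"
      using up[OF y z(2,3)] by blast
    define t where "t = min (ht z) (ht y + d/2)"
    have t: "ht y < t" "t < ht y + d" "t \<le> ht z" using yz d by (auto simp: t_def min_def)
    have t0: "0 \<le> t" using t(1) mdist_nonneg[of T \<rho> y] by linarith
    let ?w = "pt z t"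
    have w: "?w \<in> R" using R z(1) t0 t by (simp add: rsub_def)
    have wV: "?w \<in> V'" using d(2) t by simp
    have wa: "?w \<in> above T \<rho> y" using above_Int_pt[OF z(2)] t by simp
    have hw: "ht ?w = t" using ht_pt[OF zM(1) t0 t(3)] .
    have wy: "?w \<noteq> y" using hw t(1) by auto
    have "gp ?w z = t" using gp_pt[OF zM(1) zM(1) t0 t(3)] gp_self[OF zM(1)] t(3) by simp
    then have "branch T \<rho> y ?w = branch T \<rho> y z" using branch_eq_iff[OF wa z(2) wy] t by simp
    then have "B = branch T \<rho> y ?w" using z(4) by simp
    moreover have "?w \<in> S" using w wV RS by blast
    ultimately show "B \<in> branches T \<rho> S y" using wa wy by (auto simp: branches_def)
  qed
  have br: "branches T \<rho> ?R y = branches T \<rho> ?S y" if "y \<in> V" for y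
    using br_sub[OF m1.rsub_Rh RV that] br_sub[OF m2.rsub_Rh RV[symmetric] that] by blast
  have RVy: "y \<in> ?R \<longleftrightarrow> y \<in> ?S" if "y \<in> V" for y using RV VV that by blast
  have lv: "y \<in> leaves ?R \<longleftrightarrow> y \<in> leaves ?S" if "y \<in> V" for y
    using br[OF that] RVy[OF that] by (simp add: leaves_def)
  have bp: "y \<in> bpoints ?R \<longleftrightarrow> y \<in> bpoints ?S" if "y \<in> V" for y
    using br[OF that] RVy[OF that] by (simp add: bpoints_def)
  have eq1: "{x\<in>mspace T. tree_proj T \<rho> ?R x \<in> A \<inter> (?R - leaves ?R)} = {x\<in>mspace T. tree_proj T \<rho> ?S x \<in> A \<inter> (?S - leaves ?S)}"
  proof (intro Collect_cong conj_cong refl iffI)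
    fix x assume x: "x \<in> mspace T" "tree_proj T \<rho> ?R x \<in> A \<inter> (?R - leaves ?R)"
    then have "tree_proj T \<rho> ?S x = tree_proj T \<rho> ?R x" using pjR A(2) by blast
    then show "tree_proj T \<rho> ?S x \<in> A \<inter> (?S - leaves ?S)"
      using x RVy[of "tree_proj T \<rho> ?R x"] lv[of "tree_proj T \<rho> ?R x"] A(2) by (simp add: subset_iff)
  next
    fix x assume x: "x \<in> mspace T" "tree_proj T \<rho> ?S x \<in> A \<inter> (?S - leaves ?S)"
    then have "tree_proj T \<rho> ?R x = tree_proj T \<rho> ?S x" using pjS A(2) by blast
    then show "tree_proj T \<rho> ?R x \<in> A \<inter> (?R - leaves ?R)"
      using x RVy[of "tree_proj T \<rho> ?S x"] lv[of "tree_proj T \<rho> ?S x"] A(2) by (simp add: subset_iff)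
  qed
  have m: "{x\<in>mspace T. tree_proj T \<rho> ?R x \<in> A \<inter> (?R - leaves ?R)} \<in> sets (metric_borel T)"
  proof -
    have "A \<inter> (?R - leaves ?R) \<in> sets (metric_borel T)"
      using closed_in_metric_borel[OF m1.closed_Rh] m1.leaves_borel[OF h] A by auto
    from measurable_sets[OF m1.pj_meas this] show ?thesis
      by (simp add: vimage_def Int_def conj_commute)
  qed
  have "emeasure \<mu> {x\<in>mspace T. tree_proj T \<rho> ?R x \<in> A \<inter> (?R - leaves ?R)}
      = emeasure \<nu> {x\<in>mspace T. tree_proj T \<rho> ?S x \<in> A \<inter> (?S - leaves ?S)}"
    unfolding eq1[symmetric] by (rule mass[OF m]) (use A in blast)
  moreover have "leaves ?R \<inter> A = leaves ?S \<inter> A" "bpoints ?R \<inter> A = bpoints ?S \<inter> A" using lv bp A(2) by blast+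
  moreover have "infsum (\<lambda>\<sigma>. emeasure \<mu> (above T \<rho> \<sigma>) - ennreal h) (leaves ?S \<inter> A)
     = infsum (\<lambda>\<sigma>. emeasure \<nu> (above T \<rho> \<sigma>) - ennreal h) (leaves ?S \<inter> A)"
  proof (rule infsum_cong)
    fix \<sigma> assume s: "\<sigma> \<in> leaves ?S \<inter> A"
    then have sV: "\<sigma> \<in> V" "\<sigma> \<in> leaves ?R" using A lv by auto
    \<comment> \<open>Everything above a leaf projects to that leaf, so the mass above it is mass
      projected into \<open>V\<close>.\<close>
    have "emeasure \<mu> (above T \<rho> \<sigma>) = emeasure \<nu> (above T \<rho> \<sigma>)"
    proof (rule mass[OF above_borel])
      fix x assume x: "x \<in> above T \<rho> \<sigma>"
      then have "x \<in> mspace T" using above_sub by auto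
      then have "tree_proj T \<rho> ?R x = \<sigma>"
        using leaf_proj_iff[OF m1.rsub_Rh m1.closed_Rh sV(2)] x by blast
      then show "tree_proj T \<rho> ?R x \<in> V" using sV(1) by metis
    qed
    then show "emeasure \<mu> (above T \<rho> \<sigma>) - ennreal h = emeasure \<nu> (above T \<rho> \<sigma>) - ennreal h" by simp
  qed
  moreover have "infsum (\<lambda>\<sigma>. ennreal_of_enat (ecard (branches T \<rho> ?R \<sigma>) - 1)) (bpoints ?S \<inter> A)
     = infsum (\<lambda>\<sigma>. ennreal_of_enat (ecard (branches T \<rho> ?S \<sigma>) - 1)) (bpoints ?S \<inter> A)"
    by (rule infsum_cong) (use br A(2) in fastforce)
  moreover have "ennreal h * ennreal_of_enat (ecard (branches T \<rho> ?R \<rho>)) * indicator A \<rho>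
      = ennreal h * ennreal_of_enat (ecard (branches T \<rho> ?S \<rho>)) * indicator A \<rho>"
    using br[of \<rho>] A(2) by (cases "\<rho> \<in> A") (auto simp: subset_iff)
  ultimately show ?thesis
    unfolding m1.Psi_def m2.Psi_def by simp
qed

section \<open>Mass erasure as a mixture of projections\<close>

lemma mspace_borel [simp]: "mspace T \<in> sets (metric_borel T)"
  using sets.top[of "metric_borel T"] by simp

section \<open>Counting the leaves of a finite tree\<close>

context rooted_rtree
begin

text \<open>The number of branches at \<tau> in the tree spanned by the finite set \<open>L\<close>
  of leaves; natural numbers keep the induction on leaves elementary.\<close>

definition deg :: "'a set \<Rightarrow> 'a \<Rightarrow> nat" where
  "deg L \<tau> = card (branch T \<rho> \<tau> ` (L \<inter> above T \<rho> \<tau> - {\<tau>}))"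

lemma deg_le_1:
  assumes "L \<inter> above T \<rho> \<tau> - {\<tau>} \<subseteq> {l}" shows "deg L \<tau> \<le> 1"
proof -
  have "branch T \<rho> \<tau> ` (L \<inter> above T \<rho> \<tau> - {\<tau>}) \<subseteq> {branch T \<rho> \<tau> l}" using assms by blast
  then have "card (branch T \<rho> \<tau> ` (L \<inter> above T \<rho> \<tau> - {\<tau>})) \<le> card {branch T \<rho> \<tau> l}"
    by (intro card_mono) auto
  then show ?thesis by (simp add: deg_def)
qed

lemma deg_insert_new:
  assumes fin: "finite L" and l: "l \<in> above T \<rho> \<tau>" "l \<noteq> \<tau>"
    and new: "\<And>l'. l' \<in> L \<Longrightarrow> l' \<in> above T \<rho> \<tau> \<Longrightarrow> gp l l' \<le> ht \<tau>"
  shows "deg (insert l L) \<tau> = Suc (deg L \<tau>)"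
proof -
  have "insert l L \<inter> above T \<rho> \<tau> - {\<tau>} = insert l (L \<inter> above T \<rho> \<tau> - {\<tau>})" using l by blast
  moreover have "branch T \<rho> \<tau> l \<notin> branch T \<rho> \<tau> ` (L \<inter> above T \<rho> \<tau> - {\<tau>})"
  proof
    assume "branch T \<rho> \<tau> l \<in> branch T \<rho> \<tau> ` (L \<inter> above T \<rho> \<tau> - {\<tau>})"
    then obtain l' where l': "l' \<in> L" "l' \<in> above T \<rho> \<tau>" "branch T \<rho> \<tau> l = branch T \<rho> \<tau> l'" by blast
    then have "ht \<tau> < gp l l'" using branch_eq_iff[OF l(1) l'(2) l(2)] by blast
    then show False using new[OF l'(1,2)] by simp
  qed
  ultimately show ?thesis using fin by (simp add: deg_def)
qed

lemma deg_insert_old: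
  assumes "l \<notin> above T \<rho> \<tau> \<or> (\<exists>l'\<in>L. l' \<in> above T \<rho> \<tau> \<and> ht \<tau> < gp l l')"
  shows "deg (insert l L) \<tau> = deg L \<tau>"
proof (cases "l \<in> above T \<rho> \<tau>")
  case False
  then have "insert l L \<inter> above T \<rho> \<tau> - {\<tau>} = L \<inter> above T \<rho> \<tau> - {\<tau>}" by blast
  then show ?thesis by (simp add: deg_def)
next
  case True
  then obtain l' where l': "l' \<in> L" "l' \<in> above T \<rho> \<tau>" "ht \<tau> < gp l l'" using assms by blast
  have M: "l \<in> mspace T" "l' \<in> mspace T" using True l' above_sub by auto
  have "ht \<tau> < ht l" "ht \<tau> < ht l'" using gp_le1[OF M] gp_le2[OF M] l'(3) by auto
  then have ne: "l \<noteq> \<tau>" "l' \<noteq> \<tau>" by auto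
  have "branch T \<rho> \<tau> l = branch T \<rho> \<tau> l'" using branch_eq_iff[OF True l'(2) ne(1)] l' by simp
  then have "branch T \<rho> \<tau> l \<in> branch T \<rho> \<tau> ` (L \<inter> above T \<rho> \<tau> - {\<tau>})" using l' ne by blast
  moreover have "insert l L \<inter> above T \<rho> \<tau> - {\<tau>} = insert l (L \<inter> above T \<rho> \<tau> - {\<tau>})" using True ne by blast
  ultimately show ?thesis by (simp add: deg_def insert_absorb)
qed

text \<open>Induction on the leaves: a new leaf \<open>l\<close> is attached at the point \<open>a\<close> where \<open>[\<rho>, l]\<close> leaves
  the tree spanned by the others, and \<open>a\<close> is the only point above \<open>\<sigma>\<close> whose excess degree changes.\<close>

lemma leaf_count:
  assumes "finite L" "L \<subseteq> mspace T"
    and "\<And>l l'. l \<in> L \<Longrightarrow> l' \<in> L \<Longrightarrow> l \<noteq> l' \<Longrightarrow> l' \<notin> above T \<rho> l"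
    and "L \<inter> above T \<rho> \<sigma> \<noteq> {}"
  shows "\<exists>W. finite W \<and> W \<subseteq> above T \<rho> \<sigma> \<and> (\<forall>\<tau>\<in>above T \<rho> \<sigma> - W. deg L \<tau> \<le> 1) \<and>
    (\<Sum>\<tau>\<in>W. deg L \<tau> - 1) + 1 = card (L \<inter> above T \<rho> \<sigma>)"
  using assms
proof (induction L rule: finite_induct)
  case empty
  then show ?case by simp
next
  case (insert l L)
  have LM: "L \<subseteq> mspace T" "l \<in> mspace T" using insert.prems(1) by auto
  have anti: "l' \<notin> above T \<rho> l''" if "l' \<in> insert l L" "l'' \<in> insert l L" "l'' \<noteq> l'" for l' l''
    using insert.prems(2)[of l'' l'] that by blast
  show ?case
  proof (cases "L \<inter> above T \<rho> \<sigma> = {}")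
    case True
    then have l: "l \<in> above T \<rho> \<sigma>" using insert.prems(3) by auto
    then have "insert l L \<inter> above T \<rho> \<sigma> = {l}" using True by blast
    moreover have "deg (insert l L) \<tau> \<le> 1" if "\<tau> \<in> above T \<rho> \<sigma>" for \<tau>
      using deg_le_1[of "insert l L" \<tau> l] above_mono[OF that] True by blast
    ultimately show ?thesis by (intro exI[of _ "{}"]) auto
  next
    case ne: False
    have "\<And>l l'. l \<in> L \<Longrightarrow> l' \<in> L \<Longrightarrow> l \<noteq> l' \<Longrightarrow> l' \<notin> above T \<rho> l" using anti by blast
    from insert.IH[OF LM(1) this ne] obtain W where W: "finite W" "W \<subseteq> above T \<rho> \<sigma>"
      "\<forall>\<tau>\<in>above T \<rho> \<sigma> - W. deg L \<tau> \<le> 1" "(\<Sum>\<tau>\<in>W. deg L \<tau> - 1) + 1 = card (L \<inter> above T \<rho> \<sigma>)" by blast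
    show ?thesis
    proof (cases "l \<in> above T \<rho> \<sigma>")
      case False
      then have "insert l L \<inter> above T \<rho> \<sigma> = L \<inter> above T \<rho> \<sigma>" by blast
      moreover have "deg (insert l L) \<tau> = deg L \<tau>" if "\<tau> \<in> above T \<rho> \<sigma>" for \<tau>
        by (rule deg_insert_old) (use False above_mono[OF that] in blast)
      moreover have "(\<Sum>\<tau>\<in>W. deg (insert l L) \<tau> - 1) = (\<Sum>\<tau>\<in>W. deg L \<tau> - 1)"
        by (rule sum.cong) (use calculation(2) W(2) in auto)
      ultimately show ?thesis using W by (intro exI[of _ W]) auto
    next
      case True
      let ?P = "gp l ` (L \<inter> above T \<rho> \<sigma>)"
      \<comment> \<open>The older leaf above sigma that shares the longest initial segment with
        \<open>l\<close> determines the attachment height.\<close>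
      define p where "p = Max ?P"
      have finP: "finite ?P" "?P \<noteq> {}" using insert.hyps ne by auto
      have pmax: "gp l l' \<le> p" if "l' \<in> L" "l' \<in> above T \<rho> \<sigma>" for l'
        unfolding p_def using finP that by (intro Max_ge) auto
      have "p \<in> ?P" unfolding p_def by (rule Max_in[OF finP])
      then obtain m where m: "m \<in> L" "m \<in> above T \<rho> \<sigma>" "gp l m = p" by auto
      have mM: "m \<in> mspace T" using m LM by auto
      have \<sigma>M: "\<sigma> \<in> mspace T" using True by (simp add: above_iff)
      have lm: "l \<noteq> m" using m insert.hyps by auto
      have "min (gp l \<sigma>) (gp \<sigma> m) \<le> gp l m" by (rule gp_ultra[OF LM(2) \<sigma>M mM])
      then have \<sigma>p: "ht \<sigma> \<le> p" using above_gp[OF True] above_gp[OF m(2)] gp_sym[of l \<sigma>] m(3) by simp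
      have p: "0 \<le> p" "p \<le> ht l" "p \<le> ht m" using gp_nonneg[OF LM(2) mM] gp_le1[OF LM(2) mM] gp_le2[OF LM(2) mM] m(3) by auto
      define a where "a = pt l p"
      have am: "a = pt m p" using pt_gp[OF LM(2) mM] m(3) by (simp add: a_def)
      have ha: "ht a = p" using ht_pt[OF LM(2) p(1,2)] by (simp add: a_def)
      have la: "l \<in> above T \<rho> a" unfolding a_def by (rule above_pt[OF LM(2) p(1,2)])
      have ma: "m \<in> above T \<rho> a" unfolding am by (rule above_pt[OF mM p(1,3)])
      have a\<sigma>: "a \<in> above T \<rho> \<sigma>" unfolding a_def by (rule above_Int_pt[OF True \<sigma>p p(2)])
      have lna: "l \<noteq> a" using ma anti[of m l] m(1) lm by auto
      have mna: "m \<noteq> a" using la anti[of l m] m(1) lm by auto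
      have dega: "deg (insert l L) a = Suc (deg L a)"
        by (rule deg_insert_new[OF insert.hyps(1) la lna]) (use pmax above_mono[OF a\<sigma>] ha in auto)
      have dega1: "1 \<le> deg L a"
      proof -
        have "branch T \<rho> a m \<in> branch T \<rho> a ` (L \<inter> above T \<rho> a - {a})" using m ma mna by blast
        then show ?thesis using insert.hyps(1) by (auto simp: deg_def Suc_le_eq card_gt_0_iff)
      qed
      \<comment> \<open>On [rho,l] strictly below \<open>a\<close>, the branch towards
        \<open>l\<close> already contains \<open>m\<close>; strictly above \<open>a\<close> there is
        no older leaf, so both degrees are at most 1. Truncated subtraction hides a change from 0 to
        1.\<close>
      have other: "deg (insert l L) \<tau> = deg L \<tau> \<or> (deg (insert l L) \<tau> \<le> 1 \<and> deg L \<tau> \<le> 1)"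
        if \<tau>: "\<tau> \<in> above T \<rho> \<sigma>" "\<tau> \<noteq> a" for \<tau>
      proof (cases "l \<in> above T \<rho> \<tau>")
        case False
        then show ?thesis using deg_insert_old by blast
      next
        case l\<tau>: True
        then have \<tau>': "\<tau> = pt l (ht \<tau>)" "ht \<tau> \<le> ht l" by (auto simp: above_iff')
        show ?thesis
        proof (cases "ht \<tau> \<le> p")
          case True
          then have "a \<in> above T \<rho> \<tau>" using above_comparable[OF l\<tau> la] ha by simp
          then have "m \<in> above T \<rho> \<tau>" using ma above_trans by blast
          moreover have "ht \<tau> \<noteq> p" using \<tau>'(1) \<tau>(2) a_def by metis
          then have "ht \<tau> < gp l m" using True m(3) by simp
          ultimately show ?thesis using deg_insert_old m(1) by blast
        next
          case False
          have "l' \<notin> above T \<rho> \<tau>" if l': "l' \<in> L" for l'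
          proof
            assume b: "l' \<in> above T \<rho> \<tau>"
            have M: "\<tau> \<in> mspace T" "l' \<in> mspace T" using b by (auto simp: above_iff)
            have "min (gp l \<tau>) (gp \<tau> l') \<le> gp l l'" by (rule gp_ultra[OF LM(2) M])
            then have "ht \<tau> \<le> gp l l'" using above_gp[OF b] above_gp[OF l\<tau>] gp_sym[of l \<tau>] by simp
            moreover have "l' \<in> above T \<rho> \<sigma>" using above_mono[OF \<tau>(1)] b by blast
            ultimately show False using pmax[OF l'] False by simp
          qed
          then have "L \<inter> above T \<rho> \<tau> = {}" by blast
          then show ?thesis using deg_le_1[of "insert l L" \<tau> l] deg_le_1[of L \<tau> l] by blast
        qed
      qed
      let ?W = "insert a W"
      have "(\<Sum>\<tau>\<in>?W. deg (insert l L) \<tau> - 1) = deg L a + (\<Sum>\<tau>\<in>W - {a}. deg (insert l L) \<tau> - 1)"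
        using W(1) dega by (simp add: sum.insert_remove)
      also have "(\<Sum>\<tau>\<in>W - {a}. deg (insert l L) \<tau> - 1) = (\<Sum>\<tau>\<in>W - {a}. deg L \<tau> - 1)"
      proof (rule sum.cong[OF refl])
        fix \<tau> assume "\<tau> \<in> W - {a}"
        then have "\<tau> \<in> above T \<rho> \<sigma>" "\<tau> \<noteq> a" using W(2) by blast+
        from other[OF this] show "deg (insert l L) \<tau> - 1 = deg L \<tau> - 1" by auto
      qed
      finally have s1: "(\<Sum>\<tau>\<in>?W. deg (insert l L) \<tau> - 1) = deg L a + (\<Sum>\<tau>\<in>W - {a}. deg L \<tau> - 1)" .
      have s2: "(\<Sum>\<tau>\<in>W. deg L \<tau> - 1) = deg L a - 1 + (\<Sum>\<tau>\<in>W - {a}. deg L \<tau> - 1)"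
      proof (cases "a \<in> W")
        case True
        then show ?thesis using W(1) by (simp add: sum.remove)
      next
        case False
        \<comment> \<open>Outside \<open>W\<close> degrees are at most 1, and the leaf
          \<open>m\<close> makes this one at least 1.\<close>
        then have "deg L a = 1" using W(3) a\<sigma> dega1 by force
        then show ?thesis using False by simp
      qed
      have "insert l L \<inter> above T \<rho> \<sigma> = insert l (L \<inter> above T \<rho> \<sigma>)" using True by blast
      then have "card (insert l L \<inter> above T \<rho> \<sigma>) = Suc (card (L \<inter> above T \<rho> \<sigma>))" using insert.hyps by simp
      then have "(\<Sum>\<tau>\<in>?W. deg (insert l L) \<tau> - 1) + 1 = card (insert l L \<inter> above T \<rho> \<sigma>)"
        using s1 s2 W(4) dega1 by simp
      moreover have "\<forall>\<tau>\<in>above T \<rho> \<sigma> - ?W. deg (insert l L) \<tau> \<le> 1"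
      proof
        fix \<tau> assume t: "\<tau> \<in> above T \<rho> \<sigma> - ?W"
        then have "deg L \<tau> \<le> 1" using W(3) by blast
        then show "deg (insert l L) \<tau> \<le> 1" using other[of \<tau>] t by auto
      qed
      ultimately show ?thesis using W(1,2) a\<sigma> by (intro exI[of _ ?W]) auto
    qed
  qed
qed

end

section \<open>The erased measure of a finite measure\<close>

locale finite_tree_measure = separable_rtree T \<rho> for T :: "'a metric" and \<rho> +
  fixes \<mu> :: "'a measure"
  assumes borel_on: "borel_measure_on T \<mu>" and finite_mass: "emeasure \<mu> (mspace T) < \<infinity>"
begin

lemma Skel_finite: "Skel T \<rho> \<mu> = {\<rho>}"
proof -
  have "emeasure \<mu> (above T \<rho> \<sigma>) \<le> emeasure \<mu> (mspace T)" for \<sigma>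
    using borel_on above_sub by (intro emeasure_mono) (auto simp: borel_measure_on_def)
  then have "emeasure \<mu> (above T \<rho> \<sigma>) \<noteq> \<infinity>" for \<sigma> using finite_mass by (metis infinity_ennreal_def leD top.not_eq_extremum)
  then show ?thesis by (auto simp: Skel_def)
qed

sublocale tree_measure T \<rho> \<mu>
proof
  show "\<mu> \<in> M_bf T"
  proof (rule M_bfI[OF borel_on root_in])
    show "emeasure \<mu> (mcball_of T \<rho> r) < \<infinity>" for r
    proof -
      have "emeasure \<mu> (mcball_of T \<rho> r) \<le> emeasure \<mu> (mspace T)"
        using borel_on by (intro emeasure_mono) (auto simp: borel_measure_on_def)
      then show ?thesis using finite_mass by (rule le_less_trans)
    qed
  qed
  show "closedin (mtopology_of T) (Skel T \<rho> \<mu>)"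
  proof -
    show ?thesis unfolding Skel_finite using closedin_mcball_of[OF root_in, of 0] mcball_of_0[OF root_in] by simp
  qed
qed

sublocale finite_measure \<mu>
  by standard (use finite_mass in simp)

lemma finite_leaves: assumes h: "h > 0" shows "finite (leaves (R h))"
proof (rule finite_of_disjoint_large[where B="mspace T" and \<mu>=\<mu> and c=h and S="above T \<rho>"])
  show "mspace T \<in> sets \<mu>" using sets.top[of \<mu>] by simp
  show "above T \<rho> x \<inter> above T \<rho> y = {}" if "x \<in> leaves (R h)" "y \<in> leaves (R h)" "x \<noteq> y" for x y
    using leaves_disjoint that by blast
  show "ennreal h \<le> emeasure \<mu> (above T \<rho> x)" if "x \<in> leaves (R h)" for x
    using that by (auto simp: leaves_def Rh_iff)
qed (simp_all add: h finite_mass[simplified] above_sub above_borel)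

text \<open>Zorn's lemma in the part of R above y. The upper bound of a chain comes from mass: the
  decreasing sets theta along the chain keep mass at least h > 0, so their intersection contains a
  point, and its projection onto R lies above the whole chain.\<close>

lemma leaf_above_exists:
  assumes h: "h > 0" and y: "y \<in> R h" "y \<noteq> \<rho>"
  shows "\<exists>l\<in>leaves (R h). l \<in> above T \<rho> y"
proof -
  let ?A = "R h \<inter> above T \<rho> y"
  have yM: "y \<in> mspace T" using y Rh_sub by auto
  have yA: "y \<in> ?A" using y above_refl[OF yM] by auto
  have large: "ennreal h \<le> emeasure \<mu> (above T \<rho> z)" if "z \<in> ?A" for z
  proof -
    have "z \<noteq> \<rho>" using that y above_antisym[of \<rho> y] by auto
    then show ?thesis using that by (auto simp: Rh_iff)
  qed
  have "\<exists>m\<in>?A. \<forall>a\<in>?A. a \<in> above T \<rho> m \<longrightarrow> a = m"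
  proof (rule predicate_Zorn)
    show "partial_order_on ?A (relation_of (\<lambda>x z. z \<in> above T \<rho> x) ?A)"
    proof (rule partial_order_on_relation_ofI)
      show "a \<in> above T \<rho> a" if "a \<in> ?A" for a using that Rh_sub by (intro above_refl) auto
      show "c \<in> above T \<rho> a" if "b \<in> above T \<rho> a" "c \<in> above T \<rho> b" for a b c using that by (rule above_trans)
      show "a = b" if "b \<in> above T \<rho> a" "a \<in> above T \<rho> b" for a b
        by (rule above_antisym[OF that(2) above_ht[OF that(1)]])
    qed
    fix C assume C: "C \<in> Chains (relation_of (\<lambda>x z. z \<in> above T \<rho> x) ?A)"
    then have CA: "C \<subseteq> ?A" and ch: "\<And>a b. a \<in> C \<Longrightarrow> b \<in> C \<Longrightarrow> b \<in> above T \<rho> a \<or> a \<in> above T \<rho> b"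
      by (auto simp: Chains_def relation_of_def)
    have ch': "b \<in> above T \<rho> a" if "a \<in> C" "b \<in> C" "ht a \<le> ht b" for a b
    proof (rule ccontr)
      assume n: "b \<notin> above T \<rho> a"
      then have "a \<in> above T \<rho> b" using ch[OF that(1,2)] by blast
      then have "a = b" by (rule above_antisym[OF _ that(3)])
      then show False using n that(1) CA above_refl[of a] Rh_sub by blast
    qed
    show "\<exists>u\<in>?A. \<forall>a\<in>C. u \<in> above T \<rho> a"
    proof (cases "\<exists>u\<in>C. \<forall>a\<in>C. ht a \<le> ht u")
      case True
      then obtain u where u: "u \<in> C" "\<And>a. a \<in> C \<Longrightarrow> ht a \<le> ht u" by metis
      show ?thesis
      proof (intro bexI[of _ u] ballI)
        show "u \<in> ?A" using u(1) CA by (rule subsetD[rotated])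
        show "u \<in> above T \<rho> a" if "a \<in> C" for a by (rule ch'[OF that u(1) u(2)[OF that]])
      qed
    next
      case False
      then have nomax: "\<And>u. u \<in> C \<Longrightarrow> \<exists>a\<in>C. ht u < ht a" by (auto simp: not_le)
      show ?thesis
      proof (cases "C = {}")
        case True then show ?thesis using yA by blast
      next
        case ne: False
        \<comment> \<open>A chain is ordered by height, so a cofinal sequence exists even if the
          chain is uncountable; continuity from above needs a sequence.\<close>
        have "\<exists>g::nat \<Rightarrow> 'a. range g \<subseteq> C \<and> (\<forall>c\<in>C. \<exists>n. ht c \<le> ht (g n))"
        proof (cases "bdd_above (mdist T \<rho> ` C)")
          case True
          define H where "H = Sup (mdist T \<rho> ` C)"
          have "\<exists>c\<in>C. H - 1 / real (Suc n) < ht c" for n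
            using less_cSupD[of "mdist T \<rho> ` C" "H - 1 / real (Suc n)"] ne by (auto simp: H_def)
          then obtain g where g: "\<And>n. g n \<in> C" "\<And>n. H - 1 / real (Suc n) < ht (g n)" by metis
          have "\<exists>n. ht c \<le> ht (g n)" if c: "c \<in> C" for c
          proof -
            obtain c' where c': "c' \<in> C" "ht c < ht c'" using nomax[OF c] by blast
            have "ht c' \<le> H" unfolding H_def using True c' by (intro cSup_upper) auto
            then have "0 < H - ht c" using c' by simp
            then obtain n where "inverse (real (Suc n)) < H - ht c" using reals_Archimedean by blast
            then have "ht c \<le> ht (g n)" using g(2)[of n] by (simp add: inverse_eq_divide)
            then show ?thesis by blast
          qed
          then show ?thesis using g by blast
        next
          case False
          have "\<exists>c\<in>C. real n < ht c" for n
          proof (rule ccontr)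
            assume "\<not> ?thesis"
            then have "bdd_above (mdist T \<rho> ` C)" by (intro bdd_aboveI[of _ "real n"]) (auto simp: not_less)
            then show False using False by simp
          qed
          then obtain g where g: "\<And>n. g n \<in> C" "\<And>n. real n < ht (g n)" by metis
          have "\<exists>n. ht c \<le> ht (g n)" for c
          proof -
            obtain n where "ht c \<le> real n" using real_arch_simple by blast
            then have "ht c \<le> ht (g n)" using g(2)[of n] by linarith
            then show ?thesis by blast
          qed
          then show ?thesis using g by blast
        qed
        then obtain g where g: "\<And>n::nat. g n \<in> C" "\<And>c. c \<in> C \<Longrightarrow> \<exists>n. ht c \<le> ht (g n)" by blast
        \<comment> \<open>Finite intersections make the sets decrease although the sequence itself
          need not increase. Each equals theta of its highest member or contains it, hence has mass
          at least h.\<close>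
        define B where "B n = (\<Inter>i\<le>n. above T \<rho> (g i))" for n :: nat
        have B_ge: "ennreal h \<le> emeasure \<mu> (B n)" for n
        proof -
          have "finite (g ` {..n})" "g ` {..n} \<noteq> {}" by auto
          then obtain m where m: "m \<in> g ` {..n}" "\<And>c. c \<in> g ` {..n} \<Longrightarrow> ht c \<le> ht m"
          proof -
            have "Max (mdist T \<rho> ` g ` {..n}) \<in> mdist T \<rho> ` g ` {..n}" by (rule Max_in) auto
            then obtain m where "m \<in> g ` {..n}" "ht m = Max (mdist T \<rho> ` g ` {..n})" by (metis imageE)
            moreover have "ht c \<le> Max (mdist T \<rho> ` g ` {..n})" if "c \<in> g ` {..n}" for c
              using that by (intro Max_ge) auto
            ultimately show ?thesis using that by metis
          qed
          have mC: "m \<in> C" using m(1) g(1) by auto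
          have "above T \<rho> m \<subseteq> B n"
            unfolding B_def
          proof (rule INT_greatest)
            fix i assume "i \<in> {..n}"
            then have "ht (g i) \<le> ht m" by (intro m(2)) simp
            then show "above T \<rho> m \<subseteq> above T \<rho> (g i)" by (rule above_mono[OF ch'[OF g(1) mC]])
          qed
          moreover have "B n \<in> sets \<mu>" unfolding B_def by (auto intro!: sets.finite_INT above_borel)
          ultimately have "emeasure \<mu> (above T \<rho> m) \<le> emeasure \<mu> (B n)" by (rule emeasure_mono)
          moreover have "m \<in> ?A" using mC CA by blast
          ultimately show ?thesis using order_trans[OF large[of m]] by blast
        qed
        have "(INF n. emeasure \<mu> (B n)) = emeasure \<mu> (\<Inter>n. B n)"
        proof (rule INF_emeasure_decseq)
          show "range B \<subseteq> sets \<mu>" unfolding B_def by (auto intro!: sets.finite_INT above_borel)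
          show "decseq B" unfolding B_def decseq_def by auto
          show "emeasure \<mu> (B i) \<noteq> \<infinity>" for i by simp
        qed
        moreover have "ennreal h \<le> (INF n. emeasure \<mu> (B n))" using B_ge by (intro INF_greatest)
        moreover have "0 < ennreal h" using h by simp
        ultimately have "0 < emeasure \<mu> (\<Inter>n. B n)" by (metis less_le_trans)
        then have "(\<Inter>n. B n) \<noteq> {}" by auto
        then obtain x where x: "\<And>n. x \<in> above T \<rho> (g n)" by (auto simp: B_def)
        have xM: "x \<in> mspace T" using x[of 0] above_sub by auto
        \<comment> \<open>The point x of the intersection need not belong to R; its projection does
          and still lies above every element of the chain.\<close>
        let ?u = "pj h x"
        have u1: "?u \<in> above T \<rho> c" if c: "c \<in> C" for c
        proof -
          obtain n where n: "ht c \<le> ht (g n)" using g(2)[OF c] by blast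
          have "x \<in> above T \<rho> c" using above_trans[OF ch'[OF c g(1) n] x] .
          moreover have "c \<in> R h" "c \<in> mspace T" using c CA Rh_sub by auto
          ultimately show ?thesis using tree_proj_above_iff[OF rsub_Rh closed_Rh xM, of c h] by blast
        qed
        have "?u \<in> above T \<rho> y"
        proof -
          obtain c where c: "c \<in> C" using ne by blast
          then have "c \<in> above T \<rho> y" using CA by blast
          then show ?thesis by (rule above_trans[OF _ u1[OF c]])
        qed
        then have "?u \<in> ?A" using tree_proj_in[OF rsub_Rh closed_Rh xM] by blast
        then show ?thesis using u1 by (intro bexI[of _ ?u] ballI)
      qed
    qed
  qed
  then obtain m where m': "m \<in> ?A" "\<forall>a\<in>?A. a \<in> above T \<rho> m \<longrightarrow> a = m" by (rule bexE)
  then have m: "m \<in> R h" "m \<in> above T \<rho> y" by auto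
  have "m \<noteq> \<rho>" using m(2) y above_antisym[of \<rho> y] by auto
  moreover have "R h \<inter> above T \<rho> m \<subseteq> {m}" using m'(2) above_mono[OF m(2)] by blast
  ultimately have "m \<in> leaves (R h)" using m(1) by (simp add: leaves_iff)
  then show ?thesis using m(2) by (rule bexI[rotated])
qed

text \<open>Every branch of R contains a leaf of R, so the finitely many leaves account for all
  branches and branch counts become degrees.\<close>

lemma branches_leaves:
  assumes h: "h > 0"
  shows "branches T \<rho> (R h) \<tau> = branch T \<rho> \<tau> ` (leaves (R h) \<inter> above T \<rho> \<tau> - {\<tau>})"
proof
  show "branch T \<rho> \<tau> ` (leaves (R h) \<inter> above T \<rho> \<tau> - {\<tau>}) \<subseteq> branches T \<rho> (R h) \<tau>"
    unfolding branches_def by (intro image_mono) (auto simp: leaves_def)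
  show "branches T \<rho> (R h) \<tau> \<subseteq> branch T \<rho> \<tau> ` (leaves (R h) \<inter> above T \<rho> \<tau> - {\<tau>})"
  proof
    fix B assume "B \<in> branches T \<rho> (R h) \<tau>"
    then obtain y where y: "y \<in> R h" "y \<in> above T \<rho> \<tau>" "y \<noteq> \<tau>" "B = branch T \<rho> \<tau> y" by (auto simp: branches_def)
    have "y \<noteq> \<rho>" using y above_antisym[of \<rho> \<tau>] by auto
    then obtain l where l: "l \<in> leaves (R h)" "l \<in> above T \<rho> y" using leaf_above_exists[OF h y(1)] by blast
    have l\<tau>: "l \<in> above T \<rho> \<tau>" using l y above_trans by blast
    have hy: "ht \<tau> < ht y" using y above_antisym[of y \<tau>] by force
    then have "branch T \<rho> \<tau> y = branch T \<rho> \<tau> l"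
      using branch_eq_iff[OF y(2) l\<tau> y(3)] above_gp[OF l(2)] by simp
    moreover have "l \<noteq> \<tau>" using above_ht[OF l(2)] hy by auto
    ultimately show "B \<in> branch T \<rho> \<tau> ` (leaves (R h) \<inter> above T \<rho> \<tau> - {\<tau>})" using y(4) l(1) l\<tau> by blast
  qed
qed

lemma kk_deg: assumes h: "h > 0" shows "kk h \<tau> = enat (deg (leaves (R h)) \<tau>)"
  using finite_leaves[OF h] unfolding branches_leaves[OF h] by (simp add: ecard_def deg_def)

text \<open>The mass above sigma either projects to a point of R that is no leaf or lies above
  exactly one leaf. The last summand collects the amount h that erasure removes at each
  leaf.\<close>

lemma mass_above_split:
  assumes h: "h > 0" and \<sigma>: "\<sigma> \<in> R h"
  shows "emeasure \<mu> {x\<in>mspace T. pj h x \<in> above T \<rho> \<sigma> \<inter> (R h - leaves (R h))}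
     + (\<Sum>l\<in>leaves (R h) \<inter> above T \<rho> \<sigma>. emeasure \<mu> (above T \<rho> l) - ennreal h)
     + ennreal h * of_nat (card (leaves (R h) \<inter> above T \<rho> \<sigma>)) = emeasure \<mu> (above T \<rho> \<sigma>)"
proof -
  let ?L = "leaves (R h) \<inter> above T \<rho> \<sigma>"
  have fin: "finite ?L" using finite_leaves[OF h] by simp
  have \<sigma>M: "\<sigma> \<in> mspace T" using \<sigma> Rh_sub by auto
  have set1: "{x\<in>mspace T. pj h x \<in> above T \<rho> \<sigma> \<inter> (R h - leaves (R h))} = above T \<rho> \<sigma> - (\<Union>l\<in>?L. above T \<rho> l)"
  proof (intro equalityI subsetI)
    fix x assume x: "x \<in> {x\<in>mspace T. pj h x \<in> above T \<rho> \<sigma> \<inter> (R h - leaves (R h))}"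
    then have xM: "x \<in> mspace T" and xs: "x \<in> above T \<rho> \<sigma>" using tree_proj_above_iff[OF rsub_Rh closed_Rh _ \<sigma>M] by auto
    have "x \<notin> above T \<rho> l" if "l \<in> ?L" for l
      using leaf_proj_iff[OF rsub_Rh closed_Rh _ xM, of l] that x by auto
    then show "x \<in> above T \<rho> \<sigma> - (\<Union>l\<in>?L. above T \<rho> l)" using xs by blast
  next
    fix x assume x: "x \<in> above T \<rho> \<sigma> - (\<Union>l\<in>?L. above T \<rho> l)"
    then have xM: "x \<in> mspace T" using above_sub by blast
    have a: "pj h x \<in> above T \<rho> \<sigma>" using tree_proj_above_iff[OF rsub_Rh closed_Rh xM \<sigma>M] x \<sigma> by blast
    moreover have "pj h x \<notin> leaves (R h)"
    proof
      assume "pj h x \<in> leaves (R h)"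
      then have "pj h x \<in> ?L" using a by blast
      then show False using x tree_proj_below[OF rsub_Rh closed_Rh xM] by blast
    qed
    ultimately show "x \<in> {x\<in>mspace T. pj h x \<in> above T \<rho> \<sigma> \<inter> (R h - leaves (R h))}"
      using tree_proj_in[OF rsub_Rh closed_Rh xM] xM by blast
  qed
  have sub: "(\<Union>l\<in>?L. above T \<rho> l) \<subseteq> above T \<rho> \<sigma>" using above_mono by blast
  have um: "(\<Union>l\<in>?L. above T \<rho> l) \<in> sets \<mu>" using fin by (auto intro!: sets.finite_UN above_borel)
  have "(\<Sum>l\<in>?L. emeasure \<mu> (above T \<rho> l)) = emeasure \<mu> (\<Union>l\<in>?L. above T \<rho> l)"
  proof (rule sum_emeasure[OF _ _ fin])
    show "(\<lambda>l. above T \<rho> l) ` ?L \<subseteq> sets \<mu>" by (auto simp: above_borel)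
    show "disjoint_family_on (\<lambda>l. above T \<rho> l) ?L"
      using leaves_disjoint[of _ "R h"] unfolding disjoint_family_on_def by blast
  qed
  moreover have "(\<Sum>l\<in>?L. emeasure \<mu> (above T \<rho> l) - ennreal h) + ennreal h * of_nat (card ?L) = (\<Sum>l\<in>?L. emeasure \<mu> (above T \<rho> l))"
  proof -
    have "(\<Sum>l\<in>?L. emeasure \<mu> (above T \<rho> l)) = (\<Sum>l\<in>?L. (emeasure \<mu> (above T \<rho> l) - ennreal h) + ennreal h)"
    proof (rule sum.cong[OF refl])
      fix l assume "l \<in> ?L"
      then have "ennreal h \<le> emeasure \<mu> (above T \<rho> l)" by (auto simp: leaves_def Rh_iff)
      then show "emeasure \<mu> (above T \<rho> l) = (emeasure \<mu> (above T \<rho> l) - ennreal h) + ennreal h"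
        by (simp add: diff_add_cancel_ennreal)
    qed
    also have "\<dots> = (\<Sum>l\<in>?L. emeasure \<mu> (above T \<rho> l) - ennreal h) + of_nat (card ?L) * ennreal h"
      by (simp add: sum.distrib)
    finally show ?thesis by (simp add: mult.commute)
  qed
  moreover have "emeasure \<mu> (above T \<rho> \<sigma> - (\<Union>l\<in>?L. above T \<rho> l)) + emeasure \<mu> (\<Union>l\<in>?L. above T \<rho> l) = emeasure \<mu> (above T \<rho> \<sigma>)"
    using um sub by (subst plus_emeasure) (auto simp: above_borel Un_absorb2)
  ultimately show ?thesis unfolding set1 by (simp add: add.assoc)
qed

text \<open>Above sigma, the excess degrees add up to the number of leaves minus 1. This is the
  reason for the coefficients n - 2 at branch points in the definition of E_h.\<close>

lemma sum_bpoints: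
  assumes h: "h > 0" and \<sigma>: "\<sigma> \<in> R h" and ne: "leaves (R h) \<inter> above T \<rho> \<sigma> \<noteq> {}"
  shows "infsum (\<lambda>\<tau>. ennreal_of_enat (kk h \<tau> - 1)) (bpoints (R h) \<inter> above T \<rho> \<sigma>)
     + (if \<sigma> = \<rho> then ennreal_of_enat (kk h \<rho>) else 1) = of_nat (card (leaves (R h) \<inter> above T \<rho> \<sigma>))"
proof -
  let ?L = "leaves (R h)"
  have "\<exists>W. finite W \<and> W \<subseteq> above T \<rho> \<sigma> \<and> (\<forall>\<tau>\<in>above T \<rho> \<sigma> - W. deg ?L \<tau> \<le> 1) \<and>
    (\<Sum>\<tau>\<in>W. deg ?L \<tau> - 1) + 1 = card (?L \<inter> above T \<rho> \<sigma>)"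
  proof (rule leaf_count[OF finite_leaves[OF h] _ _ ne])
    show "?L \<subseteq> mspace T" using Rh_sub by (auto simp: leaves_def)
    show "l' \<notin> above T \<rho> l" if "l \<in> ?L" "l' \<in> ?L" "l \<noteq> l'" for l l'
      using leaves_disjoint[OF that] above_refl[of l'] that Rh_sub unfolding leaves_def by blast
  qed
  then obtain W where W: "finite W" "W \<subseteq> above T \<rho> \<sigma>" "\<forall>\<tau>\<in>above T \<rho> \<sigma> - W. deg ?L \<tau> \<le> 1"
    "(\<Sum>\<tau>\<in>W. deg ?L \<tau> - 1) + 1 = card (?L \<inter> above T \<rho> \<sigma>)" by blast
  have bp: "\<tau> \<in> bpoints (R h) \<inter> above T \<rho> \<sigma> \<longleftrightarrow> \<tau> \<in> above T \<rho> \<sigma> \<and> \<tau> \<noteq> \<rho> \<and> 2 \<le> deg ?L \<tau>" for \<tau>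
  proof -
    have "\<tau> \<in> R h" if "2 \<le> deg ?L \<tau>"
    proof -
      have "?L \<inter> above T \<rho> \<tau> \<noteq> {}" using that by (auto simp: deg_def)
      then obtain l where l: "l \<in> ?L" "l \<in> above T \<rho> \<tau>" by blast
      then have "l \<in> R h" "\<tau> = pt l (ht \<tau>)" "ht \<tau> \<le> ht l" by (auto simp: leaves_def above_iff')
      then show ?thesis using rsub_Rh[of h] unfolding rsub_def by (metis mdist_nonneg)
    qed
    then show ?thesis unfolding bpoints_def kk_deg[OF h] by (auto simp: numeral_eq_enat)
  qed
  let ?B = "bpoints (R h) \<inter> above T \<rho> \<sigma>"
  have BW: "?B \<subseteq> W"
  proof
    fix \<tau> assume t: "\<tau> \<in> ?B"
    then have "\<not> deg ?L \<tau> \<le> 1" using bp by auto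
    then show "\<tau> \<in> W" using W(3) t by blast
  qed
  have finB: "finite ?B" using BW W(1) finite_subset by blast
  have e: "ennreal_of_enat (kk h \<tau> - 1) = of_nat (deg ?L \<tau> - 1)" for \<tau>
    unfolding kk_deg[OF h] by (simp add: one_enat_def ennreal_of_enat_enat)
  have i: "infsum (\<lambda>\<tau>. ennreal_of_enat (kk h \<tau> - 1)) ?B = of_nat (\<Sum>\<tau>\<in>?B. deg ?L \<tau> - 1)"
    unfolding e using finB by simp
  have z: "deg ?L \<tau> - 1 = 0" if "\<tau> \<in> W - ?B" "\<tau> \<noteq> \<rho>" for \<tau>
    using bp[of \<tau>] that W(2) by auto
  show ?thesis
  proof (cases "\<sigma> = \<rho>")
    case False
    then have "\<rho> \<notin> above T \<rho> \<sigma>" using above_antisym[of \<rho> \<sigma>] by auto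
    then have "(\<Sum>\<tau>\<in>?B. deg ?L \<tau> - 1) = (\<Sum>\<tau>\<in>W. deg ?L \<tau> - 1)"
      using z W(2) by (intro sum.mono_neutral_left W(1) BW) auto
    then have "(\<Sum>\<tau>\<in>?B. deg ?L \<tau> - 1) + 1 = card (?L \<inter> above T \<rho> \<sigma>)" using W(4) by (simp only:)
    then have "of_nat ((\<Sum>\<tau>\<in>?B. deg ?L \<tau> - 1) + 1) = (of_nat (card (?L \<inter> above T \<rho> \<sigma>)) :: ennreal)" by (rule arg_cong)
    then show ?thesis unfolding i if_not_P[OF False] by (simp only: of_nat_add of_nat_1)
  next
    case True
    obtain l where l: "l \<in> ?L" using ne by blast
    have "l \<in> above T \<rho> \<rho>" "l \<noteq> \<rho>" using l Rh_sub by (auto simp: above_root leaves_def)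
    then have "branch T \<rho> \<rho> l \<in> branch T \<rho> \<rho> ` (?L \<inter> above T \<rho> \<rho> - {\<rho>})" using l by blast
    then have d1: "1 \<le> deg ?L \<rho>" using finite_leaves[OF h] by (auto simp: deg_def Suc_le_eq card_gt_0_iff)
    have \<rho>B: "\<rho> \<notin> ?B" using bp by auto
    \<comment> \<open>The root is never in \<open>bpoints\<close>. Its own excess, degree minus 1,
      and the extra 1 of the leaf count combine to the full degree of the root, the coefficient that
      \<open>Psi\<close> uses there.\<close>
    have "(\<Sum>\<tau>\<in>insert \<rho> ?B. deg ?L \<tau> - 1) = (\<Sum>\<tau>\<in>insert \<rho> W. deg ?L \<tau> - 1)"
      using z W(1) BW by (intro sum.mono_neutral_left) auto
    also have "\<dots> = (\<Sum>\<tau>\<in>W. deg ?L \<tau> - 1)"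
    proof (cases "\<rho> \<in> W")
      case True then show ?thesis by (simp add: insert_absorb)
    next
      case False
      then have "deg ?L \<rho> \<le> 1" using W(3) True by (simp add: above_root)
      then show ?thesis using False W(1) by simp
    qed
    finally have "deg ?L \<rho> - 1 + (\<Sum>\<tau>\<in>?B. deg ?L \<tau> - 1) = (\<Sum>\<tau>\<in>W. deg ?L \<tau> - 1)"
      using finB \<rho>B by simp
    then have c: "(\<Sum>\<tau>\<in>?B. deg ?L \<tau> - 1) + deg ?L \<rho> = card (?L \<inter> above T \<rho> \<sigma>)" using W(4) d1 by linarith
    have k:  "ennreal_of_enat (kk h \<rho>) = of_nat (deg ?L \<rho>)"
      unfolding kk_deg[OF h] by (simp add: ennreal_of_enat_enat)
    show ?thesis unfolding i if_P[OF True] k c[symmetric] by (rule of_nat_add[symmetric])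
  qed
qed

text \<open>Each of the leaves above sigma loses h, and the atoms at branch points give back h for
  all but one of them. A net loss of h remains on theta_sigma; for the root it is the explicit term
  -h.\<close>

lemma erase_above:
  assumes h: "h > 0" and \<sigma>: "\<sigma> \<in> mspace T"
  shows "emeasure (erase T \<rho> h \<mu>) (above T \<rho> \<sigma>) = emeasure \<mu> (above T \<rho> \<sigma>) - ennreal h"
proof (cases "ennreal h \<le> emeasure \<mu> (mspace T)")
  case False
  then have l: "emeasure \<mu> (mspace T) < ennreal h" by simp
  have "emeasure \<mu> (above T \<rho> \<sigma>) \<le> emeasure \<mu> (mspace T)"
    using above_sub sets.top[of \<mu>] by (intro emeasure_mono) auto
  then have "emeasure \<mu> (above T \<rho> \<sigma>) < ennreal h" using l by (rule le_less_trans)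
  then have "emeasure \<mu> (above T \<rho> \<sigma>) - ennreal h = 0"
    using less_trans[OF _ ennreal_less_top] by (simp add: diff_eq_0_iff_ennreal less_imp_le)
  then show ?thesis using erase_small[OF l] by simp
next
  case big: True
  note er = erase_Psi(2)[OF h big above_borel]
  let ?L = "leaves (R h) \<inter> above T \<rho> \<sigma>"
  have finL: "finite ?L" using finite_leaves[OF h] by simp
  show ?thesis
  proof (cases "\<sigma> \<in> R h")
    case False
    then have s: "\<sigma> \<noteq> \<rho>" "emeasure \<mu> (above T \<rho> \<sigma>) < ennreal h" using \<sigma> by (auto simp: Rh_iff)
    have lt: "emeasure \<mu> (above T \<rho> \<sigma>) < top" using less_trans[OF s(2) ennreal_less_top] .
    have "R h \<inter> above T \<rho> \<sigma> = {}"
    proof -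
      have False if x: "x \<in> R h" "x \<in> above T \<rho> \<sigma>" for x
      proof -
        have "\<sigma> = pt x (ht \<sigma>)" "ht \<sigma> \<le> ht x" using x by (auto simp: above_iff')
        then have "\<sigma> \<in> R h" using rsub_Rh[of h] x(1) unfolding rsub_def by (metis mdist_nonneg)
        then show False using False by simp
      qed
      then show ?thesis by blast
    qed
    then have e2: "?L = {}" "bpoints (R h) \<inter> above T \<rho> \<sigma> = {}" "above T \<rho> \<sigma> \<inter> (R h - leaves (R h)) = {}"
      by (auto simp: leaves_def bpoints_def)
    have \<rho>: "\<rho> \<notin> above T \<rho> \<sigma>" using s(1) above_antisym[of \<rho> \<sigma>] by auto
    have "Psi h (above T \<rho> \<sigma>) = 0" unfolding Psi_def e2 using \<rho> by simp
    moreover have "emeasure \<mu> (above T \<rho> \<sigma>) - ennreal h = 0" using s(2) lt by (simp add: diff_eq_0_iff_ennreal less_imp_le)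
    ultimately show ?thesis using er by simp
  next
    case True
    let ?E1 = "emeasure \<mu> {x\<in>mspace T. pj h x \<in> above T \<rho> \<sigma> \<inter> (R h - leaves (R h))}"
    let ?E2 = "\<Sum>l\<in>?L. emeasure \<mu> (above T \<rho> l) - ennreal h"
    let ?I = "infsum (\<lambda>\<tau>. ennreal_of_enat (kk h \<tau> - 1)) (bpoints (R h) \<inter> above T \<rho> \<sigma>)"
    note sp = mass_above_split[OF h True]
    have P: "Psi h (above T \<rho> \<sigma>) = ?E1 + ?E2 + ennreal h * ?I + ennreal h * ennreal_of_enat (kk h \<rho>) * indicator (above T \<rho> \<sigma>) \<rho>"
      unfolding Psi_def using finL by simp
    show ?thesis
    proof (cases "?L = {}")
      \<comment> \<open>A point of R other than the root has a leaf above it, so here R is the root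
        alone and nothing but the term -h is lost.\<close>
      case L0: True
      have \<sigma>\<rho>: "\<sigma> = \<rho>" using leaf_above_exists[OF h True] L0 by blast
      have l0: "leaves (R h) = {}" using L0 \<sigma>\<rho> Rh_sub by (auto simp: above_root leaves_def)
      have k0: "kk h \<tau> = 0" for \<tau> unfolding kk_deg[OF h] l0 by (simp add: deg_def zero_enat_def)
      have "bpoints (R h) = {}" unfolding bpoints_def k0 by auto
      then have "Psi h (above T \<rho> \<sigma>) = emeasure \<mu> (above T \<rho> \<sigma>)" using P sp L0 k0 by simp
      moreover have "indicator (above T \<rho> \<sigma>) \<rho> = (1::ennreal)" using \<sigma>\<rho> by (simp add: above_root)
      ultimately show ?thesis using er by simp
    next
      case ne: False
      note sb = sum_bpoints[OF h True ne]
      show ?thesis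
      proof (cases "\<sigma> = \<rho>")
        case r: True
        have ind: "indicator (above T \<rho> \<sigma>) \<rho> = (1::ennreal)" using r by (simp add: above_root)
        have "ennreal h * ?I + ennreal h * ennreal_of_enat (kk h \<rho>) = ennreal h * of_nat (card ?L)"
          using sb r by (simp add: distrib_left[symmetric])
        then have "Psi h (above T \<rho> \<sigma>) = emeasure \<mu> (above T \<rho> \<sigma>)" using P sp ind by (simp add: add.assoc)
        then show ?thesis using er ind by simp
      next
        case nr: False
        have "\<rho> \<notin> above T \<rho> \<sigma>" using nr above_antisym[of \<rho> \<sigma>] by auto
        then have ind: "indicator (above T \<rho> \<sigma>) \<rho> = (0::ennreal)" by simp
        have "ennreal h * ?I + ennreal h = ennreal h * (?I + 1)" by (simp add: distrib_left)
        also have "\<dots> = ennreal h * of_nat (card ?L)" using sb nr by simp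
        finally have "Psi h (above T \<rho> \<sigma>) + ennreal h = emeasure \<mu> (above T \<rho> \<sigma>)" using P sp ind by (simp add: add.assoc)
        then have "Psi h (above T \<rho> \<sigma>) = emeasure \<mu> (above T \<rho> \<sigma>) - ennreal h" by (metis ennreal_add_diff_cancel_right ennreal_neq_top)
        then show ?thesis using er ind by simp
      qed
    qed
  qed
qed

text \<open>The values of v at which the mass is kept. For them the root satisfies the mass
  criterion too, so membership in R at level h / v is a single inequality without an exception for
  the root.\<close>

abbreviation "levels h \<equiv> {v. 0 < v \<and> v < 1 \<and> h \<le> v * measure \<mu> (mspace T)}"

text \<open>The preimage of theta_sigma under the joint map is a product set, which settles joint
  measurability and makes its mass a product.\<close>

lemma pj_joint_meas:
  assumes h: "h > 0"
  shows "(\<lambda>(v, x). pj (h / v) x) \<in> measurable (restrict_space lborel (levels h) \<Otimes>\<^sub>M \<mu>) (metric_borel T)"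
    and "\<sigma> \<in> mspace T \<Longrightarrow> {\<omega>\<in>space (restrict_space lborel (levels h) \<Otimes>\<^sub>M \<mu>). (\<lambda>(v, x). pj (h / v) x) \<omega> \<in> above T \<rho> \<sigma>}
      = {v\<in>levels h. h \<le> v * measure \<mu> (above T \<rho> \<sigma>)} \<times> above T \<rho> \<sigma>"
proof -
  let ?P = "restrict_space lborel (levels h) \<Otimes>\<^sub>M \<mu>"
  have sp: "space ?P = levels h \<times> mspace T" by (auto simp: space_pair_measure space_restrict_space)
  have R: "\<sigma> \<in> R (h / v) \<longleftrightarrow> h \<le> v * measure \<mu> (above T \<rho> \<sigma>)" if v: "v \<in> levels h" and \<sigma>: "\<sigma> \<in> mspace T" for v \<sigma>
  proof -
    have "ennreal (h / v) \<le> emeasure \<mu> (above T \<rho> \<sigma>) \<longleftrightarrow> h / v \<le> measure \<mu> (above T \<rho> \<sigma>)"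
      by (simp add: emeasure_eq_measure ennreal_le_iff)
    also have "\<dots> \<longleftrightarrow> h \<le> v * measure \<mu> (above T \<rho> \<sigma>)" using v by (simp add: divide_le_eq mult.commute)
    finally show ?thesis using \<sigma> v by (auto simp: Rh_iff above_root)
  qed
  show eq: "{\<omega>\<in>space ?P. (\<lambda>(v, x). pj (h / v) x) \<omega> \<in> above T \<rho> \<sigma>}
      = {v\<in>levels h. h \<le> v * measure \<mu> (above T \<rho> \<sigma>)} \<times> above T \<rho> \<sigma>" if \<sigma>: "\<sigma> \<in> mspace T" for \<sigma>
  proof (intro equalityI subsetI)
    fix \<omega> assume "\<omega> \<in> {\<omega>\<in>space ?P. (\<lambda>(v, x). pj (h / v) x) \<omega> \<in> above T \<rho> \<sigma>}"
    then obtain v x where w: "\<omega> = (v, x)" "v \<in> levels h" "x \<in> mspace T" "pj (h / v) x \<in> above T \<rho> \<sigma>"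
      unfolding sp by auto
    then show "\<omega> \<in> {v\<in>levels h. h \<le> v * measure \<mu> (above T \<rho> \<sigma>)} \<times> above T \<rho> \<sigma>"
      using tree_proj_above_iff[OF rsub_Rh closed_Rh w(3) \<sigma>, of "h/v"] R[OF w(2) \<sigma>] by blast
  next
    fix \<omega> assume "\<omega> \<in> {v\<in>levels h. h \<le> v * measure \<mu> (above T \<rho> \<sigma>)} \<times> above T \<rho> \<sigma>"
    then obtain v x where w: "\<omega> = (v, x)" "v \<in> levels h" "h \<le> v * measure \<mu> (above T \<rho> \<sigma>)" "x \<in> above T \<rho> \<sigma>"
      by blast
    have xM: "x \<in> mspace T" using w above_sub by auto
    then have "pj (h / v) x \<in> above T \<rho> \<sigma>"
      using tree_proj_above_iff[OF rsub_Rh closed_Rh xM \<sigma>, of "h/v"] R[OF w(2) \<sigma>] w by blast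
    then show "\<omega> \<in> {\<omega>\<in>space ?P. (\<lambda>(v, x). pj (h / v) x) \<omega> \<in> above T \<rho> \<sigma>}"
      unfolding sp using w(1,2) xM by simp
  qed
  show "(\<lambda>(v, x). pj (h / v) x) \<in> measurable ?P (metric_borel T)"
  proof (rule measurable_above)
    show "(\<lambda>(v, x). pj (h / v) x) \<omega> \<in> mspace T" if "\<omega> \<in> space ?P" for \<omega>
      using that Rh_sub tree_proj_in[OF rsub_Rh closed_Rh] unfolding sp by (auto split: prod.splits)
    show "{\<omega>\<in>space ?P. (\<lambda>(v, x). pj (h / v) x) \<omega> \<in> above T \<rho> \<sigma>} \<in> sets ?P" if \<sigma>: "\<sigma> \<in> mspace T" for \<sigma>
    proof -
      have "{v\<in>levels h. h \<le> v * measure \<mu> (above T \<rho> \<sigma>)} \<in> sets (restrict_space lborel (levels h))"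
        by (subst sets_restrict_space_iff) auto
      moreover have "above T \<rho> \<sigma> \<in> sets \<mu>" by (simp add: above_borel)
      ultimately show ?thesis unfolding eq[OF \<sigma>] by (rule pair_measureI)
    qed
  qed
qed

text \<open>Both sides are measured on the sets theta_sigma. If g is the mass of theta_sigma, the
  mixture keeps it exactly for v in [h/g, 1), which gives (1 - h/g) g = g - h for h < g and nothing
  otherwise.\<close>

lemma erase_mixture:
  assumes h: "h > 0"
  shows "erase T \<rho> h \<mu> = distr (restrict_space lborel (levels h) \<Otimes>\<^sub>M \<mu>) (metric_borel T) (\<lambda>(v, x). pj (h / v) x)"
    (is "_ = distr ?P _ ?F")
proof (rule measure_eq_above)
  show "sets (erase T \<rho> h \<mu>) = sets (metric_borel T)" by (rule sets_erase[OF h])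
  show "sets (distr ?P (metric_borel T) ?F) = sets (metric_borel T)" by simp
  show "emeasure (erase T \<rho> h \<mu>) (mspace T) \<noteq> \<infinity>"
    using erase_above[OF h root_in] finite_mass
    by (metis above_root diff_le_self_ennreal infinity_ennreal_def leD less_top)
  fix \<sigma> assume \<sigma>: "\<sigma> \<in> mspace T"
  let ?g = "measure \<mu> (above T \<rho> \<sigma>)"
  let ?J = "{v\<in>levels h. h \<le> v * ?g}"
  have g: "0 \<le> ?g" "?g \<le> measure \<mu> (mspace T)"
    using finite_measure_mono[of "above T \<rho> \<sigma>" "mspace T"] above_sub[of \<sigma>] sets.top[of \<mu>] by auto
  have "emeasure (distr ?P (metric_borel T) ?F) (above T \<rho> \<sigma>) = emeasure ?P (?F -` above T \<rho> \<sigma> \<inter> space ?P)"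
    by (rule emeasure_distr[OF pj_joint_meas(1)[OF h] above_borel])
  also have "?F -` above T \<rho> \<sigma> \<inter> space ?P = {\<omega>\<in>space ?P. ?F \<omega> \<in> above T \<rho> \<sigma>}" by auto
  also have "\<dots> = ?J \<times> above T \<rho> \<sigma>" by (rule pj_joint_meas(2)[OF h \<sigma>])
  also have "emeasure ?P (?J \<times> above T \<rho> \<sigma>) = emeasure (restrict_space lborel (levels h)) ?J * emeasure \<mu> (above T \<rho> \<sigma>)"
    by (rule emeasure_pair_measure_Times) (auto simp: sets_restrict_space_iff above_borel)
  also have "emeasure (restrict_space lborel (levels h)) ?J = emeasure lborel ?J"
    by (rule emeasure_restrict_space) auto
  also have "emeasure lborel ?J * emeasure \<mu> (above T \<rho> \<sigma>) = emeasure \<mu> (above T \<rho> \<sigma>) - ennreal h"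
  proof (cases "h < ?g")
    case True
    \<comment> \<open>Since theta_sigma has at most the total mass, its own inequality implies the
      one in \<open>levels\<close>.\<close>
    have "?J = {h / ?g..<1}"
    proof (intro equalityI subsetI)
      fix v assume "v \<in> ?J"
      then show "v \<in> {h / ?g..<1}" using True h by (simp add: divide_le_eq)
    next
      fix v assume v: "v \<in> {h / ?g..<1}"
      have "0 < h / ?g" using h True by simp
      then have v0: "0 < v" using v by auto
      have a: "h \<le> v * ?g" using v True h by (simp add: divide_le_eq)
      also have "v * ?g \<le> v * measure \<mu> (mspace T)" using v0 g by (intro mult_left_mono) auto
      finally have b: "h \<le> v * measure \<mu> (mspace T)" .
      show "v \<in> ?J" using v v0 a b by auto
    qed
    moreover have "h / ?g \<le> 1" using True h by simp
    ultimately have "emeasure lborel ?J = ennreal (1 - h / ?g)" by simp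
    then have "emeasure lborel ?J * emeasure \<mu> (above T \<rho> \<sigma>) = ennreal ((1 - h / ?g) * ?g)"
      using g(1) \<open>h / ?g \<le> 1\<close> by (simp add: emeasure_eq_measure ennreal_mult)
    also have "(1 - h / ?g) * ?g = ?g - h" using True h by (simp add: field_simps)
    finally show ?thesis using h by (simp add: emeasure_eq_measure ennreal_minus)
  next
    case False
    have "?J = {}"
    proof -
      have "v * ?g < h" if "0 < v" "v < 1" for v
      proof -
        have "v * ?g \<le> v * h" using that False by (simp add: mult_left_mono)
        also have "v * h < 1 * h" using that h by (intro mult_strict_right_mono) auto
        finally show ?thesis by simp
      qed
      then show ?thesis by (auto simp: not_le)
    qed
    moreover have "emeasure \<mu> (above T \<rho> \<sigma>) - ennreal h = 0"
      unfolding emeasure_eq_measure using False h by (subst ennreal_minus) (auto intro: ennreal_neg)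
    ultimately show ?thesis by (simp only: emeasure_empty mult_zero_left)
  qed
  finally show "emeasure (erase T \<rho> h \<mu>) (above T \<rho> \<sigma>) = emeasure (distr ?P (metric_borel T) ?F) (above T \<rho> \<sigma>)"
    using erase_above[OF h \<sigma>] by simp
qed

lemma erase_layers:
  assumes h: "h > 0" and A: "A \<in> sets (metric_borel T)"
  shows "emeasure (erase T \<rho> h \<mu>) A =
      (\<integral>\<^sup>+v. emeasure \<mu> {x\<in>mspace T. pj (h / v) x \<in> A} * indicator (levels h) v \<partial>lborel)"
    and "(\<lambda>v. emeasure \<mu> {x\<in>mspace T. pj (h / v) x \<in> A} * indicator (levels h) v) \<in> borel_measurable lborel"
proof -
  let ?P = "restrict_space lborel (levels h) \<Otimes>\<^sub>M \<mu>" and ?F = "\<lambda>(v, x). pj (h / v) x"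
  let ?X = "?F -` A \<inter> space ?P"
  have X: "?X \<in> sets ?P" by (rule measurable_sets[OF pj_joint_meas(1)[OF h] A])
  have sec: "Pair v -` ?X = {x\<in>mspace T. pj (h / v) x \<in> A}" if "v \<in> levels h" for v
    using that by (auto simp: space_pair_measure space_restrict_space)
  have m: "(\<lambda>v. emeasure \<mu> (Pair v -` ?X)) \<in> borel_measurable (restrict_space lborel (levels h))"
    by (rule measurable_emeasure_Pair[OF X])
  have m': "(\<lambda>v. emeasure \<mu> {x\<in>mspace T. pj (h / v) x \<in> A}) \<in> borel_measurable (restrict_space lborel (levels h))"
    by (rule measurable_cong[THEN iffD1, OF _ m]) (use sec in \<open>simp add: space_restrict_space\<close>)
  show meas: "(\<lambda>v. emeasure \<mu> {x\<in>mspace T. pj (h / v) x \<in> A} * indicator (levels h) v) \<in> borel_measurable lborel"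
    using m' by (subst (asm) borel_measurable_restrict_space_iff_ennreal) auto
  have "emeasure (erase T \<rho> h \<mu>) A = emeasure ?P ?X"
    unfolding erase_mixture[OF h] by (rule emeasure_distr[OF pj_joint_meas(1)[OF h] A])
  also have "\<dots> = (\<integral>\<^sup>+v. emeasure \<mu> (Pair v -` ?X) \<partial>restrict_space lborel (levels h))"
    by (rule emeasure_pair_measure_alt[OF X])
  also have "\<dots> = (\<integral>\<^sup>+v. emeasure \<mu> {x\<in>mspace T. pj (h / v) x \<in> A} \<partial>restrict_space lborel (levels h))"
    by (rule nn_integral_cong) (use sec in \<open>simp add: space_restrict_space\<close>)
  also have "\<dots> = (\<integral>\<^sup>+v. emeasure \<mu> {x\<in>mspace T. pj (h / v) x \<in> A} * indicator (levels h) v \<partial>lborel)"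
    by (rule nn_integral_restrict_space) auto
  finally show "emeasure (erase T \<rho> h \<mu>) A =
      (\<integral>\<^sup>+v. emeasure \<mu> {x\<in>mspace T. pj (h / v) x \<in> A} * indicator (levels h) v \<partial>lborel)" .
qed

end

section \<open>Continuity of mass erasure for finite measures\<close>

text \<open>A substitute for closeness in a common ambient space: \<open>C\<close> consists of the pairs of points that would
  be close there. The distortion refers to Gromov products instead of distances because these stay
  under control when points are replaced by their ancestors (\<open>down\<close>).\<close>

definition gclose :: "'a metric \<Rightarrow> 'a \<Rightarrow> 'b metric \<Rightarrow> 'b \<Rightarrow> ('a \<times> 'b) set \<Rightarrow> real \<Rightarrow> bool" where
  "gclose T \<rho> T' \<rho>' C \<epsilon> \<longleftrightarrow> C \<subseteq> mspace T \<times> mspace T' \<and>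
    (\<forall>(x, x')\<in>C. \<forall>(y, y')\<in>C. \<bar>gprod T \<rho> x y - gprod T' \<rho>' x' y'\<bar> \<le> \<epsilon>)"

text \<open>A one-sided Prokhorov inequality. The thickening is replaced by any measurable set that
  contains the image under \<open>C\<close>, because the image itself need not be
  measurable.\<close>

definition mclose :: "'a measure \<Rightarrow> 'b measure \<Rightarrow> ('a \<times> 'b) set \<Rightarrow> real \<Rightarrow> bool" where
  "mclose \<mu> \<nu> C \<epsilon> \<longleftrightarrow> (\<forall>A\<in>sets \<mu>. \<forall>B\<in>sets \<nu>. C `` A \<subseteq> B \<longrightarrow> emeasure \<mu> A \<le> emeasure \<nu> B + ennreal \<epsilon>)"

definition down :: "'a metric \<Rightarrow> 'a \<Rightarrow> 'b metric \<Rightarrow> 'b \<Rightarrow> ('a \<times> 'b) set \<Rightarrow> real \<Rightarrow> ('a \<times> 'b) set" where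
  "down T \<rho> T' \<rho>' C \<eta> = {(rooted_rtree.pt T \<rho> x t, rooted_rtree.pt T' \<rho>' x' t') | x x' t t'.
     (x, x') \<in> C \<and> 0 \<le> t \<and> t \<le> mdist T \<rho> x \<and> 0 \<le> t' \<and> t' \<le> mdist T' \<rho>' x' \<and> \<bar>t - t'\<bar> \<le> \<eta>}"

lemma gcloseD:
  assumes "gclose T \<rho> T' \<rho>' C \<epsilon>" "(x, x') \<in> C" "(y, y') \<in> C"
  shows "\<bar>gprod T \<rho> x y - gprod T' \<rho>' x' y'\<bar> \<le> \<epsilon>"
  using assms unfolding gclose_def by fastforce

lemma gclose_in:
  assumes "gclose T \<rho> T' \<rho>' C \<epsilon>" "(x, x') \<in> C" shows "x \<in> mspace T" "x' \<in> mspace T'"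
  using assms unfolding gclose_def by auto

lemma gclose_ht:
  assumes "gclose T \<rho> T' \<rho>' C \<epsilon>" "(x, x') \<in> C"
  shows "\<bar>mdist T \<rho> x - mdist T' \<rho>' x'\<bar> \<le> \<epsilon>"
proof -
  have "mdist T x x = 0" "mdist T' x' x' = 0" using gclose_in[OF assms] by auto
  then show ?thesis using gcloseD[OF assms(1,2,2)] by (simp add: gprod_def)
qed

lemma gclose_converse: "gclose T \<rho> T' \<rho>' C \<epsilon> \<Longrightarrow> gclose T' \<rho>' T \<rho> (C\<inverse>) \<epsilon>"
  unfolding gclose_def by (fastforce simp: abs_minus_commute)

lemma gclose_mono: "gclose T \<rho> T' \<rho>' C \<epsilon> \<Longrightarrow> \<epsilon> \<le> \<delta> \<Longrightarrow> gclose T \<rho> T' \<rho>' C \<delta>"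
  unfolding gclose_def by fastforce

lemma gclose_subset: "gclose T \<rho> T' \<rho>' C \<epsilon> \<Longrightarrow> C' \<subseteq> C \<Longrightarrow> gclose T \<rho> T' \<rho>' C' \<epsilon>"
  unfolding gclose_def by blast

lemma down_converse: "down T' \<rho>' T \<rho> (C\<inverse>) \<eta> = (down T \<rho> T' \<rho>' C \<eta>)\<inverse>"
proof (intro set_eqI iffI)
  fix p assume "p \<in> down T' \<rho>' T \<rho> (C\<inverse>) \<eta>"
  then obtain x x' t t' where p: "p = (rooted_rtree.pt T' \<rho>' x' t', rooted_rtree.pt T \<rho> x t)" and
    x: "(x', x) \<in> C\<inverse>" "0 \<le> t'" "t' \<le> mdist T' \<rho>' x'" "0 \<le> t" "t \<le> mdist T \<rho> x" "\<bar>t' - t\<bar> \<le> \<eta>"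
    unfolding down_def by blast
  have "(rooted_rtree.pt T \<rho> x t, rooted_rtree.pt T' \<rho>' x' t') \<in> down T \<rho> T' \<rho>' C \<eta>"
    unfolding down_def mem_Collect_eq using x by (intro exI[of _ x] exI[of _ x'] exI[of _ t] exI[of _ t']) auto
  then show "p \<in> (down T \<rho> T' \<rho>' C \<eta>)\<inverse>" unfolding p by simp
next
  fix p assume "p \<in> (down T \<rho> T' \<rho>' C \<eta>)\<inverse>"
  then obtain x x' t t' where p: "p = (rooted_rtree.pt T' \<rho>' x' t', rooted_rtree.pt T \<rho> x t)" and
    x: "(x, x') \<in> C" "0 \<le> t" "t \<le> mdist T \<rho> x" "0 \<le> t'" "t' \<le> mdist T' \<rho>' x'" "\<bar>t - t'\<bar> \<le> \<eta>"
    unfolding down_def by blast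
  then show "p \<in> down T' \<rho>' T \<rho> (C\<inverse>) \<eta>"
    unfolding p unfolding down_def mem_Collect_eq by (intro exI[of _ x'] exI[of _ x] exI[of _ t'] exI[of _ t]) auto
qed

lemma mclose_mono: "mclose \<mu> \<nu> C \<epsilon> \<Longrightarrow> \<epsilon> \<le> \<delta> \<Longrightarrow> mclose \<mu> \<nu> C \<delta>"
  unfolding mclose_def by (meson add_left_mono ennreal_leI order_trans)

lemma mcloseD: "mclose \<mu> \<nu> C \<epsilon> \<Longrightarrow> A \<in> sets \<mu> \<Longrightarrow> B \<in> sets \<nu> \<Longrightarrow> C `` A \<subseteq> B \<Longrightarrow> emeasure \<mu> A \<le> emeasure \<nu> B + ennreal \<epsilon>"
  unfolding mclose_def by blast

text \<open>The Gromov product of two ancestors is a minimum of their heights and the original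
  product. The two errors therefore combine to a maximum and not to a sum.\<close>

lemma gclose_down:
  assumes T: "rtree T \<rho>" and T': "rtree T' \<rho>'" and C: "gclose T \<rho> T' \<rho>' C \<epsilon>"
  shows "gclose T \<rho> T' \<rho>' (down T \<rho> T' \<rho>' C \<eta>) (max \<epsilon> \<eta>)"
proof -
  interpret T: rooted_rtree T \<rho> by standard (rule T)
  interpret T': rooted_rtree T' \<rho>' by standard (rule T')
  have in1: "T.pt x t \<in> mspace T" "T'.pt x' t' \<in> mspace T'"
    if "(x, x') \<in> C" "0 \<le> t" "t \<le> T.ht x" "0 \<le> t'" "t' \<le> T'.ht x'" for x x' t t'
    using T.pt_in[OF gclose_in(1)[OF C that(1)] that(2,3)] T'.pt_in[OF gclose_in(2)[OF C that(1)] that(4,5)] by auto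
  have gp: "\<bar>T.gp (T.pt x t) (T.pt y s) - T'.gp (T'.pt x' t') (T'.pt y' s')\<bar> \<le> max \<epsilon> \<eta>"
    if x: "(x, x') \<in> C" "0 \<le> t" "t \<le> T.ht x" "0 \<le> t'" "t' \<le> T'.ht x'" "\<bar>t - t'\<bar> \<le> \<eta>"
      and y: "(y, y') \<in> C" "0 \<le> s" "s \<le> T.ht y" "0 \<le> s'" "s' \<le> T'.ht y'" "\<bar>s - s'\<bar> \<le> \<eta>" for x x' t t' y y' s s'
  proof -
    have "\<bar>T.gp x y - T'.gp x' y'\<bar> \<le> \<epsilon>" by (rule gcloseD[OF C x(1) y(1)])
    moreover have "T.gp (T.pt x t) (T.pt y s) = min (min t s) (T.gp x y)"
      by (rule T.gp_pt2[OF gclose_in(1)[OF C x(1)] gclose_in(1)[OF C y(1)] x(2,3) y(2,3)])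
    moreover have "T'.gp (T'.pt x' t') (T'.pt y' s') = min (min t' s') (T'.gp x' y')"
      by (rule T'.gp_pt2[OF gclose_in(2)[OF C x(1)] gclose_in(2)[OF C y(1)] x(4,5) y(4,5)])
    ultimately show ?thesis using x(6) y(6) by linarith
  qed
  show ?thesis
    unfolding gclose_def
  proof (intro conjI subsetI ballI)
    fix p assume "p \<in> down T \<rho> T' \<rho>' C \<eta>"
    then obtain x x' t t' where "p = (T.pt x t, T'.pt x' t')" "(x, x') \<in> C" "0 \<le> t" "t \<le> T.ht x" "0 \<le> t'" "t' \<le> T'.ht x'"
      unfolding down_def by blast
    then show "p \<in> mspace T \<times> mspace T'" using in1 by simp
  next
    fix p assume "p \<in> down T \<rho> T' \<rho>' C \<eta>"
    then obtain x x' t t' where p: "p = (T.pt x t, T'.pt x' t')" and x: "(x, x') \<in> C" "0 \<le> t" "t \<le> T.ht x" "0 \<le> t'" "t' \<le> T'.ht x'" "\<bar>t - t'\<bar> \<le> \<eta>"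
      unfolding down_def by blast
    have "\<bar>T.gp (T.pt x t) z - T'.gp (T'.pt x' t') z'\<bar> \<le> max \<epsilon> \<eta>" if z: "(z, z') \<in> down T \<rho> T' \<rho>' C \<eta>" for z z'
    proof -
      obtain y y' s s' where "z = T.pt y s" "z' = T'.pt y' s'" "(y, y') \<in> C" "0 \<le> s" "s \<le> T.ht y" "0 \<le> s'" "s' \<le> T'.ht y'" "\<bar>s - s'\<bar> \<le> \<eta>"
        using z unfolding down_def by blast
      then show ?thesis using gp[OF x] by simp
    qed
    then show "case p of (x, x') \<Rightarrow> \<forall>(y, y')\<in>down T \<rho> T' \<rho>' C \<eta>. \<bar>T.gp x y - T'.gp x' y'\<bar> \<le> max \<epsilon> \<eta>"
      unfolding p by auto
  qed
qed

text \<open>Shifting the variable cancels the two integrals on their common range. What is left lies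
  over an interval of length k, where f is at most K.\<close>

lemma mono_shift_integral:
  fixes f :: "real \<Rightarrow> real"
  assumes f: "mono f" and nn: "\<And>v. 0 \<le> f v" and K: "\<And>v. f v \<le> K" and k: "0 \<le> k"
  shows "(\<integral>\<^sup>+v. ennreal (f (v + k) - f v) * indicator {0<..<1} v \<partial>lborel) \<le> ennreal (k * K)"
proof -
  have [measurable]: "f \<in> borel_measurable borel" by (rule borel_measurable_mono[OF f])
  have K0: "0 \<le> K" using nn[of 0] K[of 0] by simp
  let ?a = "\<integral>\<^sup>+v. ennreal (f v) * indicator {0<..<1} v \<partial>lborel"
  let ?I = "\<integral>\<^sup>+v. ennreal (f (v + k) - f v) * indicator {0<..<1} v \<partial>lborel"
  have "?a \<le> (\<integral>\<^sup>+v. ennreal K * indicator {0<..<1::real} v \<partial>lborel)"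
    by (intro nn_integral_mono mult_right_mono ennreal_leI K) auto
  also have "\<dots> = ennreal K" by (subst nn_integral_cmult_indicator) auto
  finally have afin: "?a < top" using ennreal_less_top le_less_trans by blast
  have "?I + ?a = (\<integral>\<^sup>+v. ennreal (f (v + k) - f v) * indicator {0<..<1} v + ennreal (f v) * indicator {0<..<1} v \<partial>lborel)"
    by (rule nn_integral_add[symmetric]) measurable
  also have "\<dots> = (\<integral>\<^sup>+v. ennreal (f (k + 1 * v)) * indicator {k<..<1+k} (k + 1 * v) \<partial>lborel)"
  proof (rule nn_integral_cong)
    fix v :: real
    have "f v \<le> f (v + k)" using f k by (simp add: mono_def)
    then have "ennreal (f (v + k) - f v) + ennreal (f v) = ennreal (f (v + k))" using nn by (simp flip: ennreal_plus)
    then show "ennreal (f (v + k) - f v) * indicator {0<..<1} v + ennreal (f v) * indicator {0<..<1} v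
      = ennreal (f (k + 1 * v)) * indicator {k<..<1+k} (k + 1 * v)"
      by (auto split: split_indicator simp: add.commute)
  qed
  also have "\<dots> = (\<integral>\<^sup>+v. ennreal (f v) * indicator {k<..<1+k} v \<partial>lborel)"
    by (subst nn_integral_real_affine[where c=1 and t=k]) simp_all
  also have "\<dots> \<le> (\<integral>\<^sup>+v. ennreal (f v) * indicator {0<..<1} v + ennreal K * indicator {1..1+k} v \<partial>lborel)"
    using k K nn by (intro nn_integral_mono) (auto split: split_indicator intro: ennreal_leI)
  also have "\<dots> = ?a + (\<integral>\<^sup>+v. ennreal K * indicator {1..1+k} v \<partial>lborel)"
    by (rule nn_integral_add) measurable
  also have "(\<integral>\<^sup>+v. ennreal K * indicator {1..1+k} v \<partial>lborel) = ennreal (k * K)"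
    using k K0 by (subst nn_integral_cmult_indicator) (auto simp: ennreal_mult' mult.commute)
  finally have "?a + ?I \<le> ?a + ennreal (k * K)" by (simp add: add.commute)
  then show ?thesis using afin by (auto simp: ennreal_add_left_cancel_le)
qed

section \<open>Comparing projections in two close trees\<close>

context tree_measure
begin

lemma ht_pj_antimono:
  assumes x: "x \<in> mspace T" and s: "s \<le> s'"
  shows "ht (pj s' x) \<le> ht (pj s x)"
proof -
  let ?t = "ht (pj s' x)"
  have t: "?t \<le> ht x" "pt x ?t = pj s' x"
    using tree_proj_below[OF rsub_Rh closed_Rh x, of s'] by (auto simp: above_iff')
  have "pj s' x \<in> R s'" by (rule tree_proj_in[OF rsub_Rh closed_Rh x])
  then have "pj s' x \<in> R s" using ennreal_leI[OF s] order_trans[of "ennreal s" "ennreal s'"] unfolding Rh_iff by blast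
  then show ?thesis using pt_in_R_iff[OF rsub_Rh closed_Rh x _ t(1)] t(2) by simp
qed

lemma ht_pj_le: "x \<in> mspace T \<Longrightarrow> ht (pj s x) \<le> ht x"
  by (rule above_ht[OF tree_proj_below[OF rsub_Rh closed_Rh]])

lemma pj_pt: "x \<in> mspace T \<Longrightarrow> pj s x = pt x (ht (pj s x))"
  using tree_proj_below[OF rsub_Rh closed_Rh, of x s] unfolding above_iff' by metis

lemma ht_meas [measurable]: "(\<lambda>x. ht x) \<in> borel_measurable (metric_borel T)"
proof (subst borel_measurable_iff_le, intro allI)
  fix a
  have "{x\<in>space (metric_borel T). ht x \<le> a} = mcball_of T \<rho> a" by auto
  then show "{x\<in>space (metric_borel T). ht x \<le> a} \<in> sets (metric_borel T)" by simp
qed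

end

text \<open>Let t be the height of the projection of \<open>x\<close> at level \<open>s\<close>.
  Points related to those above the projection separate from \<open>x'\<close> not below t -
  \<epsilon>, so theta of the ancestor of \<open>x'\<close> at height t - \<epsilon> has mass at
  least s - \<epsilon> and that ancestor is in the other subtree.\<close>

lemma pj_height_compare:
  assumes "finite_tree_measure T \<rho> \<mu>" "finite_tree_measure T' \<rho>' \<nu>"
    and C: "gclose T \<rho> T' \<rho>' C \<epsilon>" and m: "mclose \<mu> \<nu> C \<epsilon>" and \<epsilon>: "0 \<le> \<epsilon>"
    and x: "(x, x') \<in> C" and s: "s' \<le> s - \<epsilon>"
  shows "mdist T \<rho> (tree_proj T \<rho> (Rh T \<rho> \<mu> s) x) - \<epsilon> \<le> mdist T' \<rho>' (tree_proj T' \<rho>' (Rh T' \<rho>' \<nu> s') x')"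
proof -
  interpret T: finite_tree_measure T \<rho> \<mu> by fact
  interpret T': finite_tree_measure T' \<rho>' \<nu> by fact
  have xM: "x \<in> mspace T" "x' \<in> mspace T'" using gclose_in[OF C x] by auto
  let ?p = "T.pj s x" and ?p' = "T'.pj s' x'"
  let ?t = "T.ht ?p"
  show ?thesis
  proof (cases "?t - \<epsilon> \<le> 0")
    case True
    then show ?thesis using mdist_nonneg[of T' \<rho>' ?p'] by linarith
  next
    case False
    have "?p \<noteq> \<rho>" using False \<epsilon> by auto
    then have large: "ennreal s \<le> emeasure \<mu> (above T \<rho> ?p)"
      using T.tree_proj_in[OF T.rsub_Rh T.closed_Rh xM(1), of s] unfolding T.Rh_iff by blast
    have t: "?t \<le> T.ht x" "?p = T.pt x ?t" using T.ht_pj_le[OF xM(1)] T.pj_pt[OF xM(1)] by auto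
    have "\<bar>T.ht x - T'.ht x'\<bar> \<le> \<epsilon>" by (rule gclose_ht[OF C x])
    then have t': "0 \<le> ?t - \<epsilon>" "?t - \<epsilon> \<le> T'.ht x'" using t False by auto
    let ?q = "T'.pt x' (?t - \<epsilon>)"
    have qM: "?q \<in> mspace T'" by (rule T'.pt_in[OF xM(2) t'])
    \<comment> \<open>The one place where distortion of Gromov products turns into inclusion of sets
      theta.\<close>
    have "C `` above T \<rho> ?p \<subseteq> above T' \<rho>' ?q"
    proof
      fix y' assume "y' \<in> C `` above T \<rho> ?p"
      then obtain y where y: "(y, y') \<in> C" "y \<in> above T \<rho> ?p" by blast
      have yM: "y \<in> mspace T" "y' \<in> mspace T'" using gclose_in[OF C y(1)] by auto
      have "y \<in> above T \<rho> (T.pt x ?t)" using y(2) t(2) by simp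
      then have "?t \<le> T.gp x y" using T.above_pt_iff[OF xM(1) yM(1) mdist_nonneg t(1)] by blast
      moreover have "\<bar>T.gp x y - T'.gp x' y'\<bar> \<le> \<epsilon>" by (rule gcloseD[OF C x y(1)])
      ultimately have "?t - \<epsilon> \<le> T'.gp x' y'" by linarith
      then show "y' \<in> above T' \<rho>' ?q" using T'.above_pt_iff[OF xM(2) yM(2) t'] by blast
    qed
    then have "emeasure \<mu> (above T \<rho> ?p) \<le> emeasure \<nu> (above T' \<rho>' ?q) + ennreal \<epsilon>"
      by (intro mcloseD[OF m]) (auto simp: T.above_borel T'.above_borel)
    then have "ennreal s \<le> ennreal (measure \<nu> (above T' \<rho>' ?q) + \<epsilon>)"
      using large \<epsilon> by (simp add: T'.emeasure_eq_measure)
    then have "s \<le> measure \<nu> (above T' \<rho>' ?q) + \<epsilon>"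
      using \<epsilon> by (subst (asm) ennreal_le_iff) auto
    then have "ennreal s' \<le> emeasure \<nu> (above T' \<rho>' ?q)"
      using s unfolding T'.emeasure_eq_measure by (intro ennreal_leI) linarith
    then have "?q \<in> T'.R s'" using qM by (simp add: T'.Rh_iff)
    then show ?thesis using T'.pt_in_R_iff[OF T'.rsub_Rh T'.closed_Rh xM(2) t'] by blast
  qed
qed

text \<open>Layer v of the first mixture is compared with layer v + k of the second. By
  \<open>pj_height_compare\<close> the height in the second lies, up to \<epsilon>, between the
  heights of the first at v and v + 2 k; where these two differ by at most \<eta>, the projections
  are related by \<open>down\<close>. The remaining points have small mass after averaging over v.
  The error terms stand for those points, heights above \<open>L\<close>, the distortion, and the
  layers v >= 1 - k without counterpart.\<close>

lemma erase_close_one_sided: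
  assumes fT: "finite_tree_measure T \<rho> \<mu>" and fT': "finite_tree_measure T' \<rho>' \<nu>"
    and C: "gclose T \<rho> T' \<rho>' C \<epsilon>" and m1: "mclose \<mu> \<nu> C \<epsilon>" and m2: "mclose \<nu> \<mu> (C\<inverse>) \<epsilon>" and \<epsilon>: "0 \<le> \<epsilon>"
    and h: "h > 0" "h' > 0" and k: "0 < k" "k \<le> 1" "2 * \<bar>h - h'\<bar> + 6 * \<epsilon> \<le> h * k" "2 * \<bar>h - h'\<bar> + 6 * \<epsilon> \<le> h' * k"
    and \<eta>: "\<eta> > 0" and L: "0 \<le> L"
    and A: "A \<in> sets (metric_borel T)" and B: "B \<in> sets (metric_borel T')"
    and AB: "down T \<rho> T' \<rho>' C (\<eta> + \<epsilon>) `` A \<subseteq> B"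
  shows "emeasure (erase T \<rho> h \<mu>) A \<le> emeasure (erase T' \<rho>' h' \<nu>) B +
     (ennreal (2 * k * L * measure \<mu> (mspace T) / \<eta>) + emeasure \<mu> {x\<in>mspace T. L < mdist T \<rho> x} + ennreal \<epsilon>
       + ennreal (k * measure \<mu> (mspace T)))"
proof -
  interpret T: finite_tree_measure T \<rho> \<mu> by (rule fT)
  interpret T': finite_tree_measure T' \<rho>' \<nu> by (rule fT')
  define m where "m = measure \<mu> (mspace T)"
  have m0: "0 \<le> m" by (simp add: m_def)
  have mM: "emeasure \<mu> (mspace T) = ennreal m" by (simp add: m_def T.emeasure_eq_measure)
  define H where "H v x = T.ht (T.pj (h / v) x)" for v x
  \<comment> \<open>Heights need not be integrable, so their mean is taken over the points up to
    height \<open>L\<close>; the others are charged to the tail.\<close>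
  define D where "D = {x\<in>mspace T. T.ht x \<le> L}"
  define I where "I v = (\<integral>\<^sup>+x. ennreal (H v x) * indicator D x \<partial>\<mu>)" for v
  \<comment> \<open>Extended by 0 to v <= 0, where the level h / v makes no sense, so that it is
    monotone on the whole line as \<open>mono_shift_integral\<close> requires.\<close>
  define F where "F v = (if v \<le> 0 then 0 else enn2real (I v))" for v
  have D: "D \<in> sets \<mu>"
  proof -
    have "D = mcball_of T \<rho> L" by (auto simp: D_def)
    then show ?thesis by simp
  qed
  have Hm: "(\<lambda>x. H v x) \<in> borel_measurable \<mu>" for v
    unfolding H_def by (rule measurable_compose[OF T.pj_meas T.ht_meas])
  have Hmono: "H v x \<le> H w x" if "0 < v" "v \<le> w" "x \<in> mspace T" for v w x
    unfolding H_def by (rule T.ht_pj_antimono[OF that(3)]) (use that h in \<open>simp add: frac_le\<close>)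
  have Hle: "H v x \<le> T.ht x" if "x \<in> mspace T" for v x
    unfolding H_def by (rule T.ht_pj_le[OF that])
  have I_le: "I v \<le> ennreal (L * m)" for v
  proof -
    have "I v \<le> (\<integral>\<^sup>+x. ennreal L * indicator D x \<partial>\<mu>)"
      unfolding I_def
    proof (rule nn_integral_mono)
      fix x assume "x \<in> space \<mu>"
      then have xM: "x \<in> mspace T" by simp
      have "H v x \<le> L" if "x \<in> D" using Hle[OF xM, of v] that by (simp add: D_def)
      then show "ennreal (H v x) * indicator D x \<le> ennreal L * indicator D x"
        by (auto split: split_indicator intro: ennreal_leI)
    qed
    also have "\<dots> = ennreal L * emeasure \<mu> D" by (rule nn_integral_cmult_indicator[OF D])
    also have "\<dots> \<le> ennreal L * ennreal m"
      unfolding mM[symmetric] using D by (intro mult_left_mono emeasure_mono) (auto simp: D_def)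
    finally show ?thesis using L m0 by (simp add: ennreal_mult)
  qed
  have I_fin: "I v = ennreal (enn2real (I v))" for v
    using I_le[of v] by (metis ennreal_enn2real ennreal_less_top le_less_trans)
  have I_mono: "I v \<le> I w" if "0 < v" "v \<le> w" for v w
    unfolding I_def using Hmono[OF that] by (intro nn_integral_mono mult_right_mono ennreal_leI) auto
  have F0: "0 \<le> F v" for v by (simp add: F_def)
  have F_le: "F v \<le> L * m" for v
    using I_le[of v] L m0 by (auto simp: F_def intro: enn2real_leI)
  have F_mono: "mono F"
  proof (rule monoI)
    fix v w :: real assume "v \<le> w"
    show "F v \<le> F w"
    proof (cases "v \<le> 0")
      case True then show ?thesis using F0[of w] by (simp add: F_def)
    next
      case False
      then have "I v \<le> I w" using I_mono \<open>v \<le> w\<close> by simp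
      then have "enn2real (I v) \<le> enn2real (I w)"
        using le_less_trans[OF I_le ennreal_less_top] by (intro enn2real_mono)
      then show ?thesis using False \<open>v \<le> w\<close> by (simp add: F_def)
    qed
  qed
  have [measurable]: "F \<in> borel_measurable borel" by (rule borel_measurable_mono[OF F_mono])
  define bad where "bad v = {x\<in>D. H v x + \<eta> < H (v + 2 * k) x}" for v
  have bad_meas: "bad v \<in> sets \<mu>" for v
  proof -
    have "{x\<in>space \<mu>. H v x + \<eta> < H (v + 2 * k) x} \<in> sets \<mu>"
      using Hm[of v] Hm[of "v + 2 * k"] by measurable
    moreover have "bad v = D \<inter> {x\<in>space \<mu>. H v x + \<eta> < H (v + 2 * k) x}"
      using sets.sets_into_space[OF D] by (auto simp: bad_def)
    ultimately show ?thesis using D by auto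
  qed
  \<comment> \<open>Markov's inequality: the height gains more than \<eta> on \<open>bad v\<close>
    and never decreases, so \<eta> times the mass of \<open>bad v\<close> is at most the gain of the
    mean height.\<close>
  have bad_le: "emeasure \<mu> (bad v) \<le> ennreal (1 / \<eta>) * ennreal (F (v + 2 * k) - F v)" if v: "0 < v" for v
  proof -
    have "ennreal \<eta> * emeasure \<mu> (bad v) + I v = (\<integral>\<^sup>+x. ennreal \<eta> * indicator (bad v) x \<partial>\<mu>) + I v"
      by (simp add: nn_integral_cmult_indicator[OF bad_meas])
    also have "\<dots> = (\<integral>\<^sup>+x. ennreal \<eta> * indicator (bad v) x + ennreal (H v x) * indicator D x \<partial>\<mu>)"
      unfolding I_def using bad_meas D Hm[of v]
      by (intro nn_integral_add[symmetric]) (auto intro!: borel_measurable_times_ennreal measurable_compose[OF _ measurable_ennreal])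
    also have "\<dots> \<le> I (v + 2 * k)"
      unfolding I_def
    proof (rule nn_integral_mono)
      fix x assume "x \<in> space \<mu>"
      then have xM: "x \<in> mspace T" by simp
      have a: "H v x \<le> H (v + 2 * k) x" using Hmono[of v "v + 2 * k" x] v k xM by simp
      have H0: "0 \<le> H v x" by (simp add: H_def)
      show "ennreal \<eta> * indicator (bad v) x + ennreal (H v x) * indicator D x \<le> ennreal (H (v + 2 * k) x) * indicator D x"
      proof (cases "x \<in> D")
        case False
        then show ?thesis by (simp add: bad_def)
      next
        case True
        show ?thesis
        proof (cases "x \<in> bad v")
          case b: True
          have "ennreal \<eta> + ennreal (H v x) = ennreal (\<eta> + H v x)" using \<eta> H0 by simp
          also have "\<dots> \<le> ennreal (H (v + 2 * k) x)" using b by (intro ennreal_leI) (auto simp: bad_def)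
          finally show ?thesis using True b by simp
        next
          case False
          then show ?thesis using True a by (simp add: ennreal_leI)
        qed
      qed
    qed
    finally have 1: "ennreal \<eta> * emeasure \<mu> (bad v) + I v \<le> I (v + 2 * k)" .
    have Fv: "I v = ennreal (F v)" "I (v + 2 * k) = ennreal (F (v + 2 * k))"
      using v k I_fin by (auto simp: F_def)
    have "ennreal (\<eta> * measure \<mu> (bad v) + F v) \<le> ennreal (F (v + 2 * k))"
      using 1 \<eta> F0 unfolding Fv by (simp add: T.emeasure_eq_measure ennreal_mult)
    then have "\<eta> * measure \<mu> (bad v) + F v \<le> F (v + 2 * k)" using F0 by (simp add: ennreal_le_iff)
    then have "measure \<mu> (bad v) \<le> 1 / \<eta> * (F (v + 2 * k) - F v)" using \<eta> by (simp add: field_simps)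
    then have "emeasure \<mu> (bad v) \<le> ennreal (1 / \<eta> * (F (v + 2 * k) - F v))"
      unfolding T.emeasure_eq_measure by (rule ennreal_leI)
    also have "\<dots> = ennreal (1 / \<eta>) * ennreal (F (v + 2 * k) - F v)"
      using \<eta> by (intro ennreal_mult') simp
    finally show ?thesis .
  qed
  define tail where "tail = {x\<in>mspace T. L < T.ht x}"
  have tail: "tail \<in> sets \<mu>"
  proof -
    have "tail = mspace T - D" by (auto simp: tail_def D_def)
    then show ?thesis using sets.compl_sets[OF D] by simp
  qed
  define a where "a v = emeasure \<mu> {x\<in>mspace T. T.pj (h / v) x \<in> A} * indicator (T.levels h) v" for v
  define b where "b v = emeasure \<nu> {x\<in>mspace T'. T'.pj (h' / v) x \<in> B} * indicator (T'.levels h') v" for v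
  have bm: "b \<in> borel_measurable lborel" unfolding b_def by (rule T'.erase_layers(2)[OF h(2) B])
  \<comment> \<open>Integrated over v this is the claim. The last summand pays for the layers close
    to 1, where v + k may leave (0,1).\<close>
  have pw: "a v \<le> b (k + 1 * v) + (ennreal (1 / \<eta>) * (ennreal (F (v + 2 * k) - F v) * indicator {0<..<1} v)
      + (emeasure \<mu> tail + ennreal \<epsilon>) * indicator {0<..<1} v + ennreal m * indicator {1 - k..1} v)" for v
  proof (cases "v \<in> T.levels h")
    case False
    then show ?thesis by (simp add: a_def)
  next
    case True
    then have v: "0 < v" "v < 1" "h \<le> v * m" by (auto simp: m_def)
    let ?A = "{x\<in>mspace T. T.pj (h / v) x \<in> A}"
    have Am: "?A \<in> sets \<mu>"
      using measurable_sets[OF T.pj_meas A, of "h / v"] by (simp add: vimage_def Int_def conj_commute)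
    have av: "a v = emeasure \<mu> ?A" using True by (simp add: a_def)
    show ?thesis
    proof (cases "1 - k \<le> v")
      case True
      have "a v \<le> ennreal m" unfolding av mM[symmetric] by (intro emeasure_mono) auto
      then have "a v \<le> ennreal m * indicator {1 - k..1} v" using True v by simp
      then show ?thesis by (simp add: add_increasing)
    next
      case vk: False
      \<comment> \<open>The arithmetic common to the next two inequalities, stated with variables
        for the products.\<close>
      have aux: "S + P \<le> W" if "P \<le> Q * a" "R \<le> D * b" "R = S - U" "W = U + V" "2 * D + 6 * Q \<le> V" "0 \<le> Q" "0 \<le> D" "a \<le> 6" "b \<le> 2"
        for P Q a R D b S U V W :: real
      proof -
        have "Q * a \<le> Q * 6" "D * b \<le> D * 2" using that by (auto intro: mult_left_mono)
        then show ?thesis using that by linarith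
      qed
      \<comment> \<open>After clearing denominators the error is at most |h - h'| + 2 \<epsilon>, as
        v (v + k) <= 2.\<close>
      have gap1: "h' / (v + k) \<le> h / v - \<epsilon>"
      proof -
        have "\<epsilon> * (v * (v + k)) \<le> \<epsilon> * 2"
        proof (rule mult_left_mono[OF _ \<epsilon>])
          have "v * (v + k) \<le> 1 * 2" using v k by (intro mult_mono) auto
          then show "v * (v + k) \<le> 2" by simp
        qed
        moreover have "(h' - h) * v \<le> \<bar>h - h'\<bar> * 1" using v by (intro mult_mono) auto
        moreover have "(h' - h) * v = h' * v - h * v" "h * (v + k) = h * v + h * k" by (simp_all add: algebra_simps)
        ultimately have "h' * v + \<epsilon> * (v * (v + k)) \<le> h * (v + k)"
          using aux[of "\<epsilon> * (v * (v + k))" \<epsilon> 2 "(h' - h) * v" "\<bar>h - h'\<bar>" 1] k(3) \<epsilon> by simp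
        then show ?thesis using v k by (simp add: field_simps)
      qed
      \<comment> \<open>Here v + k <= 2 and (v + k)(v + 2 k) <= 6; the constants 2 and 6 of the
        hypotheses on \<open>k\<close> come from this step.\<close>
      have gap2: "h / (v + 2 * k) \<le> h' / (v + k) - \<epsilon>"
      proof -
        have "\<epsilon> * ((v + k) * (v + 2 * k)) \<le> \<epsilon> * 6"
        proof (rule mult_left_mono[OF _ \<epsilon>])
          have "(v + k) * (v + 2 * k) \<le> 2 * 3" using v k by (intro mult_mono) auto
          then show "(v + k) * (v + 2 * k) \<le> 6" by simp
        qed
        moreover have "(h - h') * (v + k) \<le> \<bar>h - h'\<bar> * 2" using v k by (intro mult_mono) auto
        moreover have "(h - h') * (v + k) = h * (v + k) - h' * (v + k)" "h' * (v + 2 * k) = h' * (v + k) + h' * k"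
          by (simp_all add: algebra_simps)
        ultimately have "h * (v + k) + \<epsilon> * ((v + k) * (v + 2 * k)) \<le> h' * (v + 2 * k)"
          using aux[of "\<epsilon> * ((v + k) * (v + 2 * k))" \<epsilon> 6 "(h - h') * (v + k)" "\<bar>h - h'\<bar>" 2] k(4) \<epsilon> by simp
        then show ?thesis using v k by (simp add: field_simps)
      qed
      \<comment> \<open>The shifted layer is not discarded on the other side: its level lies
        \<epsilon> below h / v, and the total masses differ by at most \<epsilon>.\<close>
      have inI: "k + 1 * v \<in> T'.levels h'"
      proof -
        have "emeasure \<mu> (mspace T) \<le> emeasure \<nu> (mspace T') + ennreal \<epsilon>"
          by (rule mcloseD[OF m1]) (use C in \<open>auto simp: gclose_def\<close>)
        then have "ennreal m \<le> ennreal (measure \<nu> (mspace T') + \<epsilon>)"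
          unfolding mM using \<epsilon> by (simp add: T'.emeasure_eq_measure)
        then have "m \<le> measure \<nu> (mspace T') + \<epsilon>" using \<epsilon> by (subst (asm) ennreal_le_iff) auto
        moreover have "h / v \<le> m" using v by (simp add: field_simps)
        ultimately have "h' / (v + k) \<le> measure \<nu> (mspace T')" using gap1 by linarith
        then have "h' \<le> (k + v) * measure \<nu> (mspace T')" using v k by (simp add: field_simps)
        then show ?thesis using v k vk by simp
      qed
      let ?B = "{x\<in>mspace T'. T'.pj (h' / (v + k)) x \<in> B}"
      have Bm: "?B \<in> sets \<nu>"
        using measurable_sets[OF T'.pj_meas B, of "h' / (v + k)"] by (simp add: vimage_def Int_def conj_commute)
      have bv: "b (k + 1 * v) = emeasure \<nu> ?B" using inI by (simp add: b_def add.commute)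
      let ?X = "?A - (bad v \<union> tail)"
      have Xm: "?X \<in> sets \<mu>" using Am bad_meas tail by auto
      have "C `` ?X \<subseteq> ?B"
      proof
        fix x' assume "x' \<in> C `` ?X"
        then obtain x where x: "(x, x') \<in> C" "x \<in> ?A" "x \<notin> bad v" "x \<notin> tail" by blast
        have xM: "x \<in> mspace T" "x' \<in> mspace T'" using gclose_in[OF C x(1)] by auto
        let ?H' = "T'.ht (T'.pj (h' / (v + k)) x')"
        have 1: "H v x - \<epsilon> \<le> ?H'"
          unfolding H_def by (rule pj_height_compare[OF fT fT' C m1 \<epsilon> x(1) gap1])
        have "(x', x) \<in> C\<inverse>" using x by simp
        then have 2: "?H' - \<epsilon> \<le> H (v + 2 * k) x"
          unfolding H_def by (rule pj_height_compare[OF fT' fT gclose_converse[OF C] m2 \<epsilon> _ gap2])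
        have "x \<in> D" using x(4) xM by (simp add: tail_def D_def)
        then have "H (v + 2 * k) x \<le> H v x + \<eta>" using x(3) by (simp add: bad_def)
        then have d: "\<bar>H v x - ?H'\<bar> \<le> \<eta> + \<epsilon>" using 1 2 \<eta> \<epsilon> by linarith
        have "(T.pt x (H v x), T'.pt x' ?H') \<in> down T \<rho> T' \<rho>' C (\<eta> + \<epsilon>)"
          unfolding down_def mem_Collect_eq
          by (intro exI[of _ x] exI[of _ x'] exI[of _ "H v x"] exI[of _ ?H'] conjI refl x(1) d Hle[OF xM(1)] T'.ht_pj_le[OF xM(2)])
            (simp_all add: H_def)
        moreover have "T.pt x (H v x) = T.pj (h / v) x" unfolding H_def by (rule T.pj_pt[OF xM(1), symmetric])
        moreover have "T'.pt x' ?H' = T'.pj (h' / (v + k)) x'" by (rule T'.pj_pt[OF xM(2), symmetric])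
        ultimately have "T'.pj (h' / (v + k)) x' \<in> B" using AB x(2) by auto
        then show "x' \<in> ?B" using xM by simp
      qed
      then have X: "emeasure \<mu> ?X \<le> emeasure \<nu> ?B + ennreal \<epsilon>" by (rule mcloseD[OF m1 Xm Bm])
      have "emeasure \<mu> ?A \<le> emeasure \<mu> (?X \<union> (bad v \<union> tail))"
        using Xm bad_meas[of v] tail by (intro emeasure_mono sets.Un) auto
      also have "\<dots> \<le> emeasure \<mu> ?X + emeasure \<mu> (bad v \<union> tail)"
        using Xm bad_meas[of v] tail by (intro emeasure_subadditive sets.Un) auto
      also have "\<dots> \<le> emeasure \<mu> ?X + (emeasure \<mu> (bad v) + emeasure \<mu> tail)"
        using bad_meas tail by (intro add_left_mono emeasure_subadditive) auto
      also have "\<dots> \<le> (emeasure \<nu> ?B + ennreal \<epsilon>) + (ennreal (1 / \<eta>) * ennreal (F (v + 2 * k) - F v) + emeasure \<mu> tail)"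
        by (intro add_mono X bad_le v(1)) auto
      finally have "a v \<le> b (k + 1 * v) + (ennreal (1 / \<eta>) * ennreal (F (v + 2 * k) - F v) + (emeasure \<mu> tail + ennreal \<epsilon>))"
        unfolding av bv by (simp add: ac_simps)
      then show ?thesis using v vk by simp
    qed
  qed
  have "emeasure (erase T \<rho> h \<mu>) A = (\<integral>\<^sup>+v. a v \<partial>lborel)"
    unfolding a_def by (rule T.erase_layers(1)[OF h(1) A])
  also have "\<dots> \<le> (\<integral>\<^sup>+v. b (k + 1 * v) + (ennreal (1 / \<eta>) * (ennreal (F (v + 2 * k) - F v) * indicator {0<..<1} v)
      + (emeasure \<mu> tail + ennreal \<epsilon>) * indicator {0<..<1} v + ennreal m * indicator {1 - k..1} v) \<partial>lborel)"
    by (rule nn_integral_mono) (rule pw)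
  also have "\<dots> = (\<integral>\<^sup>+v. b (k + 1 * v) \<partial>lborel) + (ennreal (1 / \<eta>) * (\<integral>\<^sup>+v. ennreal (F (v + 2 * k) - F v) * indicator {0<..<1} v \<partial>lborel)
      + (emeasure \<mu> tail + ennreal \<epsilon>) + ennreal m * ennreal k)"
  proof -
    have bm': "b \<in> borel_measurable borel" using bm by simp
    have b2: "(\<lambda>v. b (k + 1 * v)) \<in> borel_measurable lborel"
      by (rule measurable_compose[OF _ bm']) simp
    have 1: "(\<integral>\<^sup>+v. (emeasure \<mu> tail + ennreal \<epsilon>) * indicator {0<..<1::real} v \<partial>lborel) = emeasure \<mu> tail + ennreal \<epsilon>"
      by (subst nn_integral_cmult_indicator) auto
    have 2: "(\<integral>\<^sup>+v. ennreal m * indicator {1 - k..1} v \<partial>lborel) = ennreal m * ennreal k"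
      using k by (subst nn_integral_cmult_indicator) auto
    show ?thesis
      using b2 by (simp add: nn_integral_add nn_integral_cmult 1 2)
  qed
  \<comment> \<open>Translation invariance of Lebesgue measure undoes the shift, so comparing
    different layers costs nothing here.\<close>
  also have "(\<integral>\<^sup>+v. b (k + 1 * v) \<partial>lborel) = (\<integral>\<^sup>+v. b v \<partial>lborel)"
    by (subst nn_integral_real_affine[where c=1 and t=k and f=b]) (use bm in simp_all)
  also have "\<dots> = emeasure (erase T' \<rho>' h' \<nu>) B"
    unfolding b_def by (rule T'.erase_layers(1)[OF h(2) B, symmetric])
  finally have 1: "emeasure (erase T \<rho> h \<mu>) A \<le> emeasure (erase T' \<rho>' h' \<nu>) B +
     (ennreal (1 / \<eta>) * (\<integral>\<^sup>+v. ennreal (F (v + 2 * k) - F v) * indicator {0<..<1} v \<partial>lborel)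
      + (emeasure \<mu> tail + ennreal \<epsilon>) + ennreal m * ennreal k)" .
  have "ennreal (1 / \<eta>) * (\<integral>\<^sup>+v. ennreal (F (v + 2 * k) - F v) * indicator {0<..<1} v \<partial>lborel)
      \<le> ennreal (1 / \<eta>) * ennreal (2 * k * (L * m))"
    by (intro mult_left_mono mono_shift_integral[OF F_mono F0 F_le]) (use k in simp_all)
  also have "\<dots> = ennreal (2 * k * L * m / \<eta>)"
    using \<eta> k L m0 by (subst ennreal_mult[symmetric]) (auto simp: ac_simps)
  finally have 2: "ennreal (1 / \<eta>) * (\<integral>\<^sup>+v. ennreal (F (v + 2 * k) - F v) * indicator {0<..<1} v \<partial>lborel)
      \<le> ennreal (2 * k * L * m / \<eta>)" .
  have 3: "ennreal m * ennreal k = ennreal (k * m)" using m0 k by (simp add: ennreal_mult mult.commute)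
  show ?thesis
    unfolding tail_def[symmetric] m_def[symmetric]
    by (rule order_trans[OF 1]) (unfold 3, intro add_left_mono add_right_mono order_trans[OF add_right_mono[OF 2]], simp add: ac_simps)
qed

lemma mdist_self [simp]: "x \<in> mspace T \<Longrightarrow> mdist T x x = 0"
  by simp

lemma (in finite_measure) tail_small:
  fixes f :: "'a \<Rightarrow> real"
  assumes f: "f \<in> borel_measurable M" and e: "e > 0"
  shows "\<exists>L\<ge>0. emeasure M {x\<in>space M. L < f x} \<le> ennreal e"
proof -
  have "(\<lambda>n. emeasure M {x\<in>space M. real n < f x}) \<longlonglongrightarrow> emeasure M (\<Inter>n. {x\<in>space M. real n < f x})"
    by (rule Lim_emeasure_decseq) (use f in \<open>auto simp: decseq_def\<close>)
  moreover have "(\<Inter>n. {x\<in>space M. real n < f x}) = {}"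
  proof -
    have "\<exists>n. \<not> real n < f x" for x using real_arch_simple[of "f x"] by (auto simp: not_less)
    then show ?thesis by blast
  qed
  ultimately have "(\<lambda>n. emeasure M {x\<in>space M. real n < f x}) \<longlonglongrightarrow> 0" by simp
  moreover have "0 < ennreal e" using e by simp
  ultimately have "\<forall>\<^sub>F n in sequentially. emeasure M {x\<in>space M. real n < f x} < ennreal e"
    by (rule order_tendstoD)
  then obtain n where "emeasure M {x\<in>space M. real n < f x} < ennreal e"
    by (auto simp: eventually_sequentially)
  then show ?thesis by (intro exI[of _ "real n"]) auto
qed

text \<open>The order of quantifiers matters: \<epsilon> depends on the fixed tree, on
  \<open>h\<close> and on \<delta>, so a single choice serves all late members of a converging
  sequence.\<close>

lemma erase_continuous:
  assumes fT: "finite_tree_measure T \<rho> \<mu>" and h: "h > 0" and \<delta>: "\<delta> > 0"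
  shows "\<exists>\<epsilon>>0. \<forall>T' \<rho>' \<nu> h' C. finite_tree_measure T' (\<rho>' :: 'b) \<nu> \<longrightarrow> gclose T \<rho> T' \<rho>' C \<epsilon> \<longrightarrow>
     mclose \<mu> \<nu> C \<epsilon> \<longrightarrow> mclose \<nu> \<mu> (C\<inverse>) \<epsilon> \<longrightarrow> \<bar>h - h'\<bar> \<le> \<epsilon> \<longrightarrow>
     (\<exists>C'. gclose T \<rho> T' \<rho>' C' \<delta> \<and> mclose (erase T \<rho> h \<mu>) (erase T' \<rho>' h' \<nu>) C' \<delta> \<and>
       mclose (erase T' \<rho>' h' \<nu>) (erase T \<rho> h \<mu>) (C'\<inverse>) \<delta>)"
proof -
  interpret T: finite_tree_measure T \<rho> \<mu> by (rule fT)
  \<comment> \<open>Bounds both total masses, as the other one is larger by at most \<epsilon> <= 1.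
    For the same reason \<open>L + 1\<close> serves below as truncation height in the other
    tree.\<close>
  define M where "M = measure \<mu> (mspace T) + 1"
  have M1: "1 \<le> M" by (simp add: M_def)
  have "(\<lambda>x. T.ht x) \<in> borel_measurable \<mu>" using T.ht_meas by simp
  from T.tail_small[OF this, of "\<delta> / 16"] \<delta> obtain L where L: "0 \<le> L" "emeasure \<mu> {x\<in>mspace T. L < T.ht x} \<le> ennreal (\<delta> / 16)"
    by auto
  define \<eta> where "\<eta> = min (\<delta> / 4) 1"
  have \<eta>: "\<eta> > 0" "\<eta> \<le> \<delta> / 4" "\<eta> \<le> 1" using \<delta> by (auto simp: \<eta>_def)
  \<comment> \<open>Chosen so that the averaged term 2 k (L + 1) M / \<eta> is at most \<delta> /
    8.\<close>
  define k where "k = min 1 (\<delta> * \<eta> / (16 * ((L + 1) * M)))"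
  have LM: "0 < (L + 1) * M" using L M1 by auto
  have "0 < \<delta> * \<eta> / (16 * ((L + 1) * M))"
    using mult_pos_pos[OF \<delta> \<eta>(1)] LM by (metis divide_pos_pos mult_pos_pos zero_less_numeral)
  then have k: "0 < k" "k \<le> 1" by (simp_all add: k_def)
  have kLM: "k * ((L + 1) * M) \<le> \<delta> * \<eta> / 16"
  proof -
    have "k \<le> \<delta> * \<eta> / (16 * ((L + 1) * M))" by (simp add: k_def)
    then have "k * ((L + 1) * M) \<le> \<delta> * \<eta> / (16 * ((L + 1) * M)) * ((L + 1) * M)"
      by (rule mult_right_mono[OF _ less_imp_le[OF LM]])
    also have "\<dots> = \<delta> * \<eta> / 16"
    proof -
      have "a / (16 * b) * b = a / 16" if "b \<noteq> 0" for a b :: real using that by simp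
      then show ?thesis using LM by (metis less_irrefl)
    qed
    finally show ?thesis .
  qed
  \<comment> \<open>With |h - h'| <= \<epsilon> the conditions of the one-sided estimate ask for 8
    \<epsilon> <= h k and 8 \<epsilon> <= h' k; the second follows because h' >= h / 2.\<close>
  define \<epsilon> where "\<epsilon> = min (min (\<delta> / 16) 1) (h * k / 16)"
  have \<epsilon>: "\<epsilon> > 0" "\<epsilon> \<le> \<delta> / 16" "\<epsilon> \<le> 1" "\<epsilon> \<le> h * k / 16" using \<delta> h k by (auto simp: \<epsilon>_def)
  have "\<exists>C'. gclose T \<rho> T' \<rho>' C' \<delta> \<and> mclose (erase T \<rho> h \<mu>) (erase T' \<rho>' h' \<nu>) C' \<delta> \<and>
       mclose (erase T' \<rho>' h' \<nu>) (erase T \<rho> h \<mu>) (C'\<inverse>) \<delta>"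
    if fT': "finite_tree_measure T' (\<rho>' :: 'b) \<nu>" and C: "gclose T \<rho> T' \<rho>' C \<epsilon>" and
      m1: "mclose \<mu> \<nu> C \<epsilon>" and m2: "mclose \<nu> \<mu> (C\<inverse>) \<epsilon>" and hh: "\<bar>h - h'\<bar> \<le> \<epsilon>" for T' \<rho>' \<nu> h' C
  proof -
    interpret T': finite_tree_measure T' \<rho>' \<nu> by (rule fT')
    have "h * k \<le> h * 1" using h k by (intro mult_left_mono) auto
    then have h'h: "h / 2 \<le> h'" using hh \<epsilon>(4) h by linarith
    then have h': "h' > 0" using h by linarith
    have "h / 2 * k \<le> h' * k" using h'h k by (intro mult_right_mono) auto
    then have c1: "2 * \<bar>h - h'\<bar> + 6 * \<epsilon> \<le> h' * k" using hh \<epsilon>(4) by simp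
    have c2: "2 * \<bar>h - h'\<bar> + 6 * \<epsilon> \<le> h * k" using hh \<epsilon>(4) \<epsilon>(1) by simp
    have total: "measure \<nu> (mspace T') \<le> M"
    proof -
      have "emeasure \<nu> (mspace T') \<le> emeasure \<mu> (mspace T) + ennreal \<epsilon>"
        by (rule mcloseD[OF m2]) (use C in \<open>auto simp: gclose_def\<close>)
      then have "ennreal (measure \<nu> (mspace T')) \<le> ennreal (measure \<mu> (mspace T) + \<epsilon>)"
        using \<epsilon>(1) by (simp add: T'.emeasure_eq_measure T.emeasure_eq_measure)
      then show ?thesis using \<epsilon> by (subst (asm) ennreal_le_iff) (auto simp: M_def)
    qed
    have tail': "emeasure \<nu> {x\<in>mspace T'. L + 1 < T'.ht x} \<le> ennreal (\<delta> / 16) + ennreal (\<delta> / 16)"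
    proof -
      have "{x\<in>space (metric_borel T). L < T.ht x} \<in> sets (metric_borel T)"
        "{x\<in>space (metric_borel T'). L + 1 < T'.ht x} \<in> sets (metric_borel T')"
        using T.ht_meas T'.ht_meas by measurable
      then have s: "{x\<in>mspace T. L < T.ht x} \<in> sets \<mu>" "{x\<in>mspace T'. L + 1 < T'.ht x} \<in> sets \<nu>" by simp_all
      have "emeasure \<nu> {x\<in>mspace T'. L + 1 < T'.ht x} \<le> emeasure \<mu> {x\<in>mspace T. L < T.ht x} + ennreal \<epsilon>"
      proof (rule mcloseD[OF m2 s(2,1)])
        show "C\<inverse> `` {x\<in>mspace T'. L + 1 < T'.ht x} \<subseteq> {x\<in>mspace T. L < T.ht x}"
        proof
          fix x assume "x \<in> C\<inverse> `` {x\<in>mspace T'. L + 1 < T'.ht x}"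
          then obtain x' where x: "(x, x') \<in> C" "L + 1 < T'.ht x'" by blast
          then show "x \<in> {x\<in>mspace T. L < T.ht x}" using gclose_ht[OF C x(1)] gclose_in[OF C x(1)] \<epsilon>(3) by simp
        qed
      qed
      also have "\<dots> \<le> ennreal (\<delta> / 16) + ennreal (\<delta> / 16)" using L(2) \<epsilon> by (intro add_mono ennreal_leI)
      finally show ?thesis .
    qed
    \<comment> \<open>The budget \<delta>/8 + \<delta>/8 + \<delta>/16 + \<delta>/16, stated for
      general arguments so that both directions can use it.\<close>
    have bound: "ennreal (2 * k * l * x / \<eta>) + t + ennreal \<epsilon> + ennreal (k * x) \<le> ennreal \<delta>"
      if x: "0 \<le> x" "x \<le> M" and l: "0 \<le> l" "l \<le> L + 1" and t: "t \<le> ennreal (\<delta> / 8)" for x l t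
    proof -
      have "l * x \<le> (L + 1) * M" using x l by (intro mult_mono) auto
      then have "k * (l * x) \<le> k * ((L + 1) * M)" using k by (intro mult_left_mono) auto
      then have "k * (l * x) \<le> \<delta> * \<eta> / 16" using kLM by linarith
      then have 1: "2 * k * l * x / \<eta> \<le> \<delta> / 8" using \<eta>(1) by (simp add: field_simps)
      have "x \<le> (L + 1) * M" using mult_mono[of 1 "L + 1" x M] x L by simp
      then have "k * x \<le> k * ((L + 1) * M)" using k by (intro mult_left_mono) auto
      also note kLM
      also have "\<delta> * \<eta> / 16 \<le> \<delta> * 1 / 16" using \<eta> \<delta> by (intro divide_right_mono mult_left_mono) auto
      finally have 2: "k * x \<le> \<delta> / 16" by simp
      have "ennreal (2 * k * l * x / \<eta>) + t + ennreal \<epsilon> + ennreal (k * x) \<le>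
        ennreal (\<delta> / 8) + ennreal (\<delta> / 8) + ennreal (\<delta> / 16) + ennreal (\<delta> / 16)"
        using 1 2 t \<epsilon>(2) by (intro add_mono ennreal_leI)
      also have "\<dots> \<le> ennreal \<delta>" using \<delta> by (simp flip: ennreal_plus)
      finally show ?thesis .
    qed
    let ?C = "down T \<rho> T' \<rho>' C (\<eta> + \<epsilon>)"
    have g: "gclose T \<rho> T' \<rho>' ?C \<delta>"
      by (rule gclose_mono[OF gclose_down[OF T.rtree T'.rtree C]]) (use \<eta> \<epsilon> \<delta> in auto)
    have a1: "mclose (erase T \<rho> h \<mu>) (erase T' \<rho>' h' \<nu>) ?C \<delta>"
      unfolding mclose_def T.sets_erase[OF h] T'.sets_erase[OF h']
    proof (intro ballI impI)
      fix A B assume AB: "A \<in> sets (metric_borel T)" "B \<in> sets (metric_borel T')" "?C `` A \<subseteq> B"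
      have "emeasure (erase T \<rho> h \<mu>) A \<le> emeasure (erase T' \<rho>' h' \<nu>) B +
        (ennreal (2 * k * L * measure \<mu> (mspace T) / \<eta>) + emeasure \<mu> {x\<in>mspace T. L < mdist T \<rho> x} + ennreal \<epsilon>
          + ennreal (k * measure \<mu> (mspace T)))"
        by (rule erase_close_one_sided[OF fT fT' C m1 m2 _ h h' k c2 c1 \<eta>(1) L(1) AB]) (use \<epsilon> in simp)
      also have "\<dots> \<le> emeasure (erase T' \<rho>' h' \<nu>) B + ennreal \<delta>"
        using L \<delta> by (intro add_left_mono bound order_trans[OF L(2)] ennreal_leI) (auto simp: M_def)
      finally show "emeasure (erase T \<rho> h \<mu>) A \<le> emeasure (erase T' \<rho>' h' \<nu>) B + ennreal \<delta>" .
    qed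
    have m1': "mclose \<mu> \<nu> ((C\<inverse>)\<inverse>) \<epsilon>" using m1 by simp
    have a2: "mclose (erase T' \<rho>' h' \<nu>) (erase T \<rho> h \<mu>) (?C\<inverse>) \<delta>"
      unfolding mclose_def T.sets_erase[OF h] T'.sets_erase[OF h']
    proof (intro ballI impI)
      fix A B assume AB: "A \<in> sets (metric_borel T')" "B \<in> sets (metric_borel T)" "?C\<inverse> `` A \<subseteq> B"
      have AB': "down T' \<rho>' T \<rho> (C\<inverse>) (\<eta> + \<epsilon>) `` A \<subseteq> B" using AB(3) unfolding down_converse .
      have c1': "2 * \<bar>h' - h\<bar> + 6 * \<epsilon> \<le> h' * k" "2 * \<bar>h' - h\<bar> + 6 * \<epsilon> \<le> h * k"
        using c1 c2 by (simp_all add: abs_minus_commute)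
      have "emeasure (erase T' \<rho>' h' \<nu>) A \<le> emeasure (erase T \<rho> h \<mu>) B +
        (ennreal (2 * k * (L + 1) * measure \<nu> (mspace T') / \<eta>) + emeasure \<nu> {x\<in>mspace T'. L + 1 < mdist T' \<rho>' x} + ennreal \<epsilon>
          + ennreal (k * measure \<nu> (mspace T')))"
        by (rule erase_close_one_sided[OF fT' fT gclose_converse[OF C] m2 m1' _ h' h k c1' \<eta>(1) _ AB(1,2) AB'])
          (use \<epsilon> L in simp_all)
      also have "\<dots> \<le> emeasure (erase T \<rho> h \<mu>) B + ennreal \<delta>"
        using L \<delta> total by (intro add_left_mono bound order_trans[OF tail']) (auto simp flip: ennreal_plus)
      finally show "emeasure (erase T' \<rho>' h' \<nu>) A \<le> emeasure (erase T \<rho> h \<mu>) B + ennreal \<delta>" .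
    qed
    show ?thesis using g a1 a2 by blast
  qed
  then show ?thesis using \<epsilon>(1) by blast
qed

section \<open>The Gromov-Prokhorov distance of truncated trees\<close>

lemma separable_submetric:
  assumes "separable_space (mtopology_of T)"
  shows "separable_space (mtopology_of (submetric T S))"
proof -
  obtain Q where Q: "countable Q" "Q \<subseteq> mspace T"
    "\<And>x e. x \<in> mspace T \<Longrightarrow> e > 0 \<Longrightarrow> \<exists>q\<in>Q. mdist T x q < e"
    using separable_metric_dense[OF assms] by blast
  define P where "P q e y \<longleftrightarrow> y \<in> S \<inter> mspace T \<and> mdist T q y < e" for q and e :: real and y
  define I where "I = {(q, e). q \<in> Q \<and> e \<in> \<rat> \<and> (\<exists>y. P q e y)}"
  have "I \<subseteq> Q \<times> \<rat>" by (auto simp: I_def)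
  then have cI: "countable I" by (rule countable_subset) (intro countable_SIGMA Q(1) countable_rat)
  define f where "f = (\<lambda>(q, e). SOME y. P q e y)"
  have f: "P q e (f (q, e))" if "(q, e) \<in> I" for q e
    using that someI_ex[of "P q e"] by (simp add: I_def f_def)
  have sub: "f ` I \<subseteq> S \<inter> mspace T" using f by (fastforce simp: P_def)
  have "mtopology_of (submetric T S) closure_of (f ` I) = S \<inter> mspace T"
  proof (intro equalityI subsetI)
    fix x assume "x \<in> mtopology_of (submetric T S) closure_of (f ` I)"
    then show "x \<in> S \<inter> mspace T" using closure_of_subset_topspace by fastforce
  next
    fix x assume x: "x \<in> S \<inter> mspace T"
    have "\<exists>y\<in>f ` I. y \<in> Metric_space.mball (S \<inter> mspace T) (mdist T) x r" if r: "r > 0" for r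
    proof -
      obtain q where q: "q \<in> Q" "mdist T x q < r / 4" using Q(3)[of x "r/4"] x r by auto
      obtain e where e: "e \<in> \<rat>" "r / 4 < e" "e < r / 2" using Rats_dense_in_real[of "r/4" "r/2"] r by auto
      have "P q e x" using x q e by (simp add: P_def mdist_commute)
      then have qI: "(q, e) \<in> I" using q e by (auto simp: I_def)
      have y: "P q e (f (q, e))" by (rule f[OF qI])
      have "mdist T x (f (q, e)) \<le> mdist T x q + mdist T q (f (q, e))"
        using x y q Q(2) by (intro mdist_triangle) (auto simp: P_def)
      also have "\<dots> < r" using q y e by (simp add: P_def)
      finally have "mdist T x (f (q, e)) < r" .
      moreover have "Metric_space (S \<inter> mspace T) (mdist T)"
        using Metric_space_mspace_mdist[of "submetric T S"] by simp
      ultimately have "f (q, e) \<in> Metric_space.mball (S \<inter> mspace T) (mdist T) x r"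
        using x y by (auto simp: P_def Metric_space.in_mball)
      then show ?thesis using qI by blast
    qed
    then show "x \<in> mtopology_of (submetric T S) closure_of (f ` I)"
      unfolding mtopology_of_def Metric_space.metric_closure_of[OF Metric_space_mspace_mdist]
      using x by simp
  qed
  then show ?thesis unfolding separable_space_def using cI sub by (intro exI[of _ "f ` I"]) auto
qed

text \<open>What the analysis of \<open>dGV\<close> requires of a tree. It is weaker than being a
  real tree, so it can be checked for the erased trees on their closed rooted subtrees without
  verifying the tree axioms there.\<close>

definition good_tree :: "'a metric \<Rightarrow> 'a \<Rightarrow> 'a measure \<Rightarrow> bool" where
  "good_tree T \<rho> \<mu> \<longleftrightarrow> \<rho> \<in> mspace T \<and> separable_space (mtopology_of T) \<and> \<mu> \<in> M_bf T \<and>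
     (\<forall>x\<in>mspace T. x \<in> seg T \<rho> x \<and> seg T \<rho> x \<subseteq> mspace T)"

definition trunc_set :: "'a metric \<Rightarrow> 'a \<Rightarrow> 'a measure \<Rightarrow> real \<Rightarrow> 'a set" where
  "trunc_set T \<rho> \<mu> r = mtopology_of T closure_of Span T \<rho> (supp T (mrestrict \<mu> (mcball_of T \<rho> r)))"

locale good = fixes T :: "'a metric" and \<rho> \<mu> assumes good: "good_tree T \<rho> \<mu>"
begin

lemma root: "\<rho> \<in> mspace T" and sep: "separable_space (mtopology_of T)" and bfm: "\<mu> \<in> M_bf T"
  and seg: "x \<in> mspace T \<Longrightarrow> x \<in> seg T \<rho> x" "x \<in> mspace T \<Longrightarrow> seg T \<rho> x \<subseteq> mspace T"
  using good by (auto simp: good_tree_def)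

lemma sets_mu [simp]: "sets \<mu> = sets (metric_borel T)" and space_mu [simp]: "space \<mu> = mspace T"
  using bfm by (auto simp: M_bf_def borel_measure_on_def)

lemma ball_in [simp]: "mcball_of T \<rho> r \<in> sets (metric_borel T)"
  by (rule mcball_of_borel[OF root])

lemma ball_fin: "emeasure \<mu> (mcball_of T \<rho> r) < \<infinity>"
  by (rule M_bfD(2)[OF bfm root])

abbreviation "tm r \<equiv> mrestrict \<mu> (mcball_of T \<rho> r)"
abbreviation "ts r \<equiv> trunc_set T \<rho> \<mu> r"

lemma sets_tm [simp]: "sets (tm r) = sets (metric_borel T)" and space_tm [simp]: "space (tm r) = mspace T"
  by (simp_all add: mrestrict_def)

lemma tm_eq: "A \<in> sets (metric_borel T) \<Longrightarrow> emeasure (tm r) A = emeasure \<mu> (A \<inter> mcball_of T \<rho> r)"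
  unfolding mrestrict_def by (subst emeasure_restricted) (simp_all add: Int_commute)

lemma supp_sub: "supp T \<nu> \<subseteq> mspace T"
  by (auto simp: supp_def)

lemma Span_sub: "A \<subseteq> mspace T \<Longrightarrow> Span T \<rho> A \<subseteq> mspace T"
  using seg(2) root by (auto simp: Span_def)

lemma ts_closed: "closedin (mtopology_of T) (ts r)"
  unfolding trunc_set_def by (rule closedin_closure_of)

lemma ts_sub: "ts r \<subseteq> mspace T"
  using closedin_subset[OF ts_closed] by simp

lemma ts_borel [simp]: "ts r \<in> sets (metric_borel T)"
  by (rule closed_in_metric_borel[OF ts_closed])

lemma Span_ts: "Span T \<rho> (supp T (tm r)) \<subseteq> ts r"
  unfolding trunc_set_def using Span_sub[OF supp_sub] by (intro closure_of_subset) simp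

lemma root_ts: "\<rho> \<in> ts r"
  using Span_ts by (auto simp: Span_def)

lemma supp_ts: "supp T (tm r) \<subseteq> ts r"
proof
  fix x assume x: "x \<in> supp T (tm r)"
  then have "x \<in> seg T \<rho> x" using seg(1) supp_sub by blast
  then show "x \<in> ts r" using x Span_ts by (auto simp: Span_def)
qed

lemma ts_mono: assumes "r \<le> s" shows "ts r \<subseteq> ts s"
proof -
  have "supp T (tm r) \<subseteq> supp T (tm s)"
  proof
    fix x assume x: "x \<in> supp T (tm r)"
    have "emeasure (tm r) U \<le> emeasure (tm s) U" if "openin (mtopology_of T) U" for U
      unfolding tm_eq[OF open_in_metric_borel[OF that]] using assms open_in_metric_borel[OF that]
      by (intro emeasure_mono) auto
    then have "0 < emeasure (tm s) U" if "openin (mtopology_of T) U" "x \<in> U" for U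
      using x that less_le_trans[of 0 "emeasure (tm r) U"] by (simp add: supp_def)
    moreover have "x \<in> mspace T" using x supp_sub by (rule subsetD[rotated])
    ultimately show "x \<in> supp T (tm s)" by (simp add: supp_def)
  qed
  then have "Span T \<rho> (supp T (tm r)) \<subseteq> Span T \<rho> (supp T (tm s))" by (auto simp: Span_def)
  then show ?thesis unfolding trunc_set_def by (rule closure_of_mono)
qed

text \<open>A measure may charge the complement of its support in general; separability covers the
  complement of this closed set by countably many null balls.\<close>

lemma tm_null: "emeasure (tm r) (mspace T - ts r) = 0"
proof -
  obtain Q where Q: "countable Q" "Q \<subseteq> mspace T"
    "\<And>x e. x \<in> mspace T \<Longrightarrow> e > 0 \<Longrightarrow> \<exists>q\<in>Q. mdist T x q < e"
    using separable_metric_dense[OF sep] by blast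
  define I where "I = {(q, e). q \<in> Q \<and> e \<in> \<rat> \<and> emeasure (tm r) {y\<in>mspace T. mdist T q y < e} = 0}"
  have "I \<subseteq> Q \<times> \<rat>" by (auto simp: I_def)
  then have cI: "countable I" by (rule countable_subset) (intro countable_SIGMA Q(1) countable_rat)
  have bo: "{y\<in>mspace T. mdist T q y < e} \<in> sets (metric_borel T)" if "q \<in> mspace T" for q e
    by (rule open_in_metric_borel[OF openin_less_lipschitz]) (rule mdist_lipschitz[OF that])
  let ?N = "\<Union>(q, e)\<in>I. {y\<in>mspace T. mdist T q y < e}"
  have bN: "(case p of (q, e) \<Rightarrow> {y\<in>mspace T. mdist T q y < e}) \<in> null_sets (tm r)" if pI: "p \<in> I" for p
  proof -
    obtain q e where p: "p = (q, e)" "q \<in> Q" "emeasure (tm r) {y\<in>mspace T. mdist T q y < e} = 0"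
      using pI by (auto simp: I_def)
    have "q \<in> mspace T" using p(2) Q(2) by (rule subsetD[rotated])
    from bo[OF this, of e] p(3) show ?thesis unfolding p(1) by (simp add: null_sets_def)
  qed
  have N: "?N \<in> null_sets (tm r)"
    by (rule null_sets_UN'[OF cI]) (rule bN)
  have "mspace T - ts r \<subseteq> ?N"
  proof
    fix x assume x: "x \<in> mspace T - ts r"
    then have xM: "x \<in> mspace T" and "x \<notin> supp T (tm r)" using supp_ts[of r] by auto
    then obtain U where U: "openin (mtopology_of T) U" "x \<in> U" "emeasure (tm r) U = 0"
      by (auto simp: supp_def not_less)
    obtain d where d: "d > 0" "\<forall>y\<in>mspace T. mdist T x y < d \<longrightarrow> y \<in> U"
      using U(1,2) unfolding openin_metric_iff by blast
    obtain q where q: "q \<in> Q" "mdist T x q < d/2" using Q(3)[OF xM, of "d/2"] d by auto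
    obtain e where e: "e \<in> \<rat>" "mdist T x q < e" "e < d/2" using q Rats_dense_in_real by blast
    have qM: "q \<in> mspace T" using q Q by auto
    have "y \<in> U" if "y \<in> mspace T" "mdist T q y < e" for y
    proof -
      have "mdist T x y < d" using mdist_triangle[OF xM qM that(1)] that q e by linarith
      then show ?thesis using d(2) that by blast
    qed
    then have "emeasure (tm r) {y\<in>mspace T. mdist T q y < e} \<le> emeasure (tm r) U"
      using open_in_metric_borel[OF U(1)] by (intro emeasure_mono) auto
    then have "(q, e) \<in> I" using U(3) q e by (auto simp: I_def)
    moreover have "mdist T q x < e" using e by (simp add: mdist_commute)
    ultimately show "x \<in> ?N" using xM by (intro UN_I[of "(q, e)"]) simp_all
  qed
  moreover have "mspace T - ts r \<in> sets (tm r)" using sets.compl_sets[of "ts r" "metric_borel T"] by simp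
  ultimately have "mspace T - ts r \<in> null_sets (tm r)" by (intro null_sets_subset[OF N])
  then show ?thesis by auto
qed

lemma tm_ts: assumes "A \<in> sets (metric_borel T)" shows "emeasure (tm r) (A \<inter> ts r) = emeasure (tm r) A"
proof -
  have m: "mspace T - ts r \<in> sets (metric_borel T)" using sets.compl_sets[of "ts r" "metric_borel T"] by simp
  have "emeasure (tm r) A \<le> emeasure (tm r) ((A \<inter> ts r) \<union> (mspace T - ts r))"
    using assms m sets.sets_into_space[OF assms] by (intro emeasure_mono) (auto intro!: sets.Un sets.Int)
  also have "\<dots> \<le> emeasure (tm r) (A \<inter> ts r) + emeasure (tm r) (mspace T - ts r)"
    using assms m by (intro emeasure_subadditive) auto
  finally have "emeasure (tm r) A \<le> emeasure (tm r) (A \<inter> ts r)" by (simp add: tm_null)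
  moreover have "emeasure (tm r) (A \<inter> ts r) \<le> emeasure (tm r) A" using assms by (intro emeasure_mono) auto
  ultimately show ?thesis by (rule antisym[rotated])
qed

lemma trunc_tree_eq: "trunc_tree r (T, \<rho>, \<mu>) = (submetric T (ts r), \<rho>, restrict_space (tm r) (ts r))"
  by (simp add: trunc_tree_def trunc_set_def Let_def)

lemma embedding_measurable:
  assumes "rooted_embedding (submetric T (ts r)) \<rho> Z z \<phi>"
  shows "\<phi> \<in> measurable (restrict_space (tm r) (ts r)) (metric_borel Z)"
proof (rule measurable_sigma_sets[OF sets_metric_borel])
  have \<phi>: "\<phi> \<in> ts r \<inter> mspace T \<rightarrow> mspace Z" "\<And>x y. x \<in> ts r \<Longrightarrow> y \<in> ts r \<Longrightarrow> mdist Z (\<phi> x) (\<phi> y) = mdist T x y"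
    using assms ts_sub[of r] unfolding rooted_embedding_def by auto
  show "{U. openin (mtopology_of Z) U} \<subseteq> Pow (mspace Z)" using openin_subset_mspace by blast
  have sp: "space (restrict_space (tm r) (ts r)) = ts r" using ts_sub by (auto simp: space_restrict_space)
  show "\<phi> \<in> space (restrict_space (tm r) (ts r)) \<rightarrow> mspace Z" using \<phi>(1) ts_sub sp by auto
  fix U assume "U \<in> {U. openin (mtopology_of Z) U}"
  then have U: "openin (mtopology_of Z) U" by simp
  \<comment> \<open>An open set of the whole tree that traces out the preimage of \<open>U\<close>;
    the map is controlled on the truncated part only.\<close>
  define V where "V = \<Union>{W. openin (mtopology_of T) W \<and> W \<inter> ts r \<subseteq> \<phi> -` U}"
  have V: "openin (mtopology_of T) V" unfolding V_def by (rule openin_Union) auto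
  have "\<phi> -` U \<inter> ts r = V \<inter> ts r"
  proof (intro equalityI subsetI)
    fix x assume x: "x \<in> \<phi> -` U \<inter> ts r"
    then obtain e where e: "e > 0" "\<forall>y\<in>mspace Z. mdist Z (\<phi> x) y < e \<longrightarrow> y \<in> U"
      using U unfolding openin_metric_iff by blast
    have xM: "x \<in> mspace T" using x ts_sub by auto
    let ?W = "{y\<in>mspace T. mdist T x y < e}"
    have "openin (mtopology_of T) ?W" by (rule openin_less_lipschitz) (rule mdist_lipschitz[OF xM])
    moreover have "?W \<inter> ts r \<subseteq> \<phi> -` U"
    proof
      fix y assume y: "y \<in> ?W \<inter> ts r"
      then have "\<phi> y \<in> mspace Z" using \<phi>(1) by auto
      moreover have "mdist Z (\<phi> x) (\<phi> y) < e" using \<phi>(2)[of x y] x y by simp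
      ultimately show "y \<in> \<phi> -` U" using e(2) by simp
    qed
    ultimately have "?W \<subseteq> V" unfolding V_def by blast
    moreover have "x \<in> ?W" using xM e by simp
    ultimately show "x \<in> V \<inter> ts r" using x by blast
  next
    fix x assume "x \<in> V \<inter> ts r"
    then show "x \<in> \<phi> -` U \<inter> ts r" unfolding V_def by blast
  qed
  moreover have "V \<inter> ts r \<in> sets (restrict_space (tm r) (ts r))"
    using open_in_metric_borel[OF V] by (auto simp: sets_restrict_space)
  ultimately show "\<phi> -` U \<inter> space (restrict_space (tm r) (ts r)) \<in> sets (restrict_space (tm r) (ts r))"
    unfolding sp by simp
qed

lemma restrict_tm_eq: "A \<in> sets (metric_borel T) \<Longrightarrow> A \<subseteq> ts r \<Longrightarrow> emeasure (restrict_space (tm r) (ts r)) A = emeasure (tm r) A"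
  by (rule emeasure_restrict_space) (use ts_sub in auto)

lemma distr_trunc:
  assumes \<phi>: "rooted_embedding (submetric T (ts r)) \<rho> Z z \<phi>" and A: "A \<in> sets (metric_borel Z)"
  shows "{x\<in>ts r. \<phi> x \<in> A} \<in> sets (metric_borel T)"
    and "emeasure (distr (restrict_space (tm r) (ts r)) (metric_borel Z) \<phi>) A = emeasure (tm r) {x\<in>ts r. \<phi> x \<in> A}"
proof -
  have sp: "space (restrict_space (tm r) (ts r)) = ts r" using ts_sub by (auto simp: space_restrict_space)
  have e: "\<phi> -` A \<inter> space (restrict_space (tm r) (ts r)) = {x\<in>ts r. \<phi> x \<in> A}" unfolding sp by auto
  have "{x\<in>ts r. \<phi> x \<in> A} \<in> sets (restrict_space (tm r) (ts r))"
    using measurable_sets[OF embedding_measurable[OF \<phi>] A] unfolding e .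
  then show m: "{x\<in>ts r. \<phi> x \<in> A} \<in> sets (metric_borel T)"
    by (subst (asm) sets_restrict_space_iff) (use ts_sub in auto)
  have "emeasure (distr (restrict_space (tm r) (ts r)) (metric_borel Z) \<phi>) A = emeasure (restrict_space (tm r) (ts r)) {x\<in>ts r. \<phi> x \<in> A}"
    unfolding e[symmetric] by (rule emeasure_distr[OF embedding_measurable[OF \<phi>] A])
  also have "\<dots> = emeasure (tm r) {x\<in>ts r. \<phi> x \<in> A}" by (rule restrict_tm_eq[OF m]) auto
  finally show "emeasure (distr (restrict_space (tm r) (ts r)) (metric_borel Z) \<phi>) A = emeasure (tm r) {x\<in>ts r. \<phi> x \<in> A}" .
qed

lemma tm_total: "emeasure (tm r) A \<le> emeasure \<mu> (mcball_of T \<rho> r)"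
proof (cases "A \<in> sets (metric_borel T)")
  case True
  then show ?thesis unfolding tm_eq[OF True] by (intro emeasure_mono) auto
next
  case False
  then show ?thesis by (simp add: emeasure_notin_sets)
qed

end

section \<open>Thickenings and the Prokhorov distance\<close>

lemma bdd_below_dist: "bdd_below (mdist Z x ` A)"
  by (rule bdd_belowI2[where m=0]) simp

lemma INF_dist_le:
  assumes "A \<subseteq> mspace Z" "A \<noteq> {}" "x \<in> mspace Z" "y \<in> mspace Z"
  shows "(INF a\<in>A. mdist Z x a) \<le> mdist Z x y + (INF a\<in>A. mdist Z y a)"
proof -
  have "(INF a\<in>A. mdist Z x a) - mdist Z x y \<le> (INF a\<in>A. mdist Z y a)"
  proof (rule cINF_greatest[OF assms(2)])
    fix a assume a: "a \<in> A"
    have "(INF a\<in>A. mdist Z x a) \<le> mdist Z x a" by (rule cINF_lower[OF bdd_below_dist a])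
    also have "\<dots> \<le> mdist Z x y + mdist Z y a" by (rule mdist_triangle) (use assms a in auto)
    finally show "(INF a\<in>A. mdist Z x a) - mdist Z x y \<le> mdist Z y a" by simp
  qed
  then show ?thesis by simp
qed

lemma thicken_borel:
  assumes "A \<subseteq> mspace Z" shows "thicken Z A e \<in> sets (metric_borel Z)"
proof (cases "A = {}")
  case True then show ?thesis by (simp add: thicken_def)
next
  case False
  have "closedin (mtopology_of Z) {x\<in>mspace Z. (INF a\<in>A. mdist Z x a) \<le> e}"
  proof (rule closedin_le_lipschitz)
    fix x y assume "x \<in> mspace Z" "y \<in> mspace Z"
    then show "\<bar>(INF a\<in>A. mdist Z x a) - (INF a\<in>A. mdist Z y a)\<bar> \<le> mdist Z x y"
      using INF_dist_le[OF assms False, of x y] INF_dist_le[OF assms False, of y x] by (simp add: mdist_commute[of Z y x])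
  qed
  then show ?thesis using False closed_in_metric_borel by (simp add: thicken_def)
qed

lemma in_thickenI:
  assumes "a \<in> A" "x \<in> mspace Z" "mdist Z x a \<le> e" shows "x \<in> thicken Z A e"
proof -
  have "(INF a\<in>A. mdist Z x a) \<le> mdist Z x a" by (rule cINF_lower[OF bdd_below_dist assms(1)])
  then show ?thesis using assms by (auto simp: thicken_def)
qed

lemma in_thickenD:
  assumes "x \<in> thicken Z A e" "e < e'" shows "\<exists>a\<in>A. mdist Z x a < e'"
proof (rule ccontr)
  assume "\<not> ?thesis"
  then have "e' \<le> (INF a\<in>A. mdist Z x a)"
    using assms(1) by (intro cINF_greatest) (auto simp: thicken_def not_less)
  then show False using assms by (auto simp: thicken_def)
qed

lemma thicken_mono: "e \<le> e' \<Longrightarrow> thicken Z A e \<subseteq> thicken Z A e'"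
  by (auto simp: thicken_def)

definition prok :: "'z metric \<Rightarrow> 'z measure \<Rightarrow> 'z measure \<Rightarrow> real \<Rightarrow> bool" where
  "prok Z \<mu> \<nu> \<epsilon> \<longleftrightarrow> \<epsilon> > 0 \<and> (\<forall>A. closedin (mtopology_of Z) A \<longrightarrow>
     emeasure \<mu> A \<le> emeasure \<nu> (thicken Z A \<epsilon>) + ennreal \<epsilon> \<and>
     emeasure \<nu> A \<le> emeasure \<mu> (thicken Z A \<epsilon>) + ennreal \<epsilon>)"

lemma dP_prok: "dP Z \<mu> \<nu> = Inf {\<epsilon>. prok Z \<mu> \<nu> \<epsilon>}"
  by (simp add: dP_def prok_def)

lemma prok_bdd: "bdd_below {\<epsilon>. prok Z \<mu> \<nu> \<epsilon>}"
  by (rule bdd_belowI[of _ 0]) (auto simp: prok_def)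

lemma dP_le: "prok Z \<mu> \<nu> \<epsilon> \<Longrightarrow> dP Z \<mu> \<nu> \<le> \<epsilon>"
  unfolding dP_prok by (rule cInf_lower[OF _ prok_bdd]) simp

text \<open>Shows that the infimum in \<open>dP\<close> runs over a nonempty set; the infimum of the
  empty set of reals would carry no information.\<close>

lemma prok_total:
  assumes "\<And>A. emeasure \<mu> A \<le> ennreal K" "\<And>A. emeasure \<nu> A \<le> ennreal K" "0 \<le> K"
  shows "prok Z \<mu> \<nu> (K + 1)"
proof -
  have "ennreal K \<le> ennreal (K + 1)" by (rule ennreal_leI) simp
  then have "emeasure \<mu> A \<le> ennreal (K + 1)" "emeasure \<nu> A \<le> ennreal (K + 1)" for A
    using assms(1,2) order_trans by blast+
  then have "emeasure \<mu> A \<le> c + ennreal (K + 1)" "emeasure \<nu> A \<le> c + ennreal (K + 1)" for A c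
    by (simp_all add: add_increasing)
  then show ?thesis using assms(3) by (auto simp: prok_def)
qed

lemma dP_lessD:
  assumes "dP Z \<mu> \<nu> < e" "prok Z \<mu> \<nu> K"
  shows "\<exists>\<epsilon><e. prok Z \<mu> \<nu> \<epsilon>"
  using cInf_lessD[of "{\<epsilon>. prok Z \<mu> \<nu> \<epsilon>}" e] assms unfolding dP_prok by auto

lemma dP_nonneg: "prok Z \<mu> \<nu> K \<Longrightarrow> 0 \<le> dP Z \<mu> \<nu>"
  unfolding dP_prok by (rule cInf_greatest) (auto simp: prok_def)

section \<open>Gluing two trees along a relation\<close>

lemma gclose_dist:
  assumes "gclose T \<rho> T' \<rho>' C \<delta>" "(x, x') \<in> C" "(y, y') \<in> C"
  shows "\<bar>mdist T x y - mdist T' x' y'\<bar> \<le> 4 * \<delta>"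
  using gcloseD[OF assms(1,2,3)] gclose_ht[OF assms(1,2)] gclose_ht[OF assms(1,3)]
  unfolding gprod_def by argo

text \<open>Related points are joined by bridges of length 2 \<delta>, and the roots by one of
  length 0. Distances between the trees are infima over single bridges. Both trees stay
  isometrically embedded because distances of related pairs differ by at most 4 \<delta>, the length
  of two bridges.\<close>

lemma glue:
  fixes T :: "'a metric" and T' :: "'b metric"
  assumes \<rho>: "\<rho> \<in> mspace T" "\<rho>' \<in> mspace T'" and C: "gclose T \<rho> T' \<rho>' C \<delta>" and \<delta>: "\<delta> > 0"
  shows "\<exists>(Z :: ('a + 'b) metric) \<phi>\<^sub>1 \<phi>\<^sub>2. \<phi>\<^sub>1 \<rho> \<in> mspace Z \<and> rooted_embedding T \<rho> Z (\<phi>\<^sub>1 \<rho>) \<phi>\<^sub>1 \<and>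
     rooted_embedding T' \<rho>' Z (\<phi>\<^sub>1 \<rho>) \<phi>\<^sub>2 \<and> (\<forall>(x, y)\<in>C. mdist Z (\<phi>\<^sub>1 x) (\<phi>\<^sub>2 y) \<le> 2 * \<delta>)"
proof -
  define W where "W = insert (\<rho>, \<rho>', 0) ((\<lambda>(a, a'). (a, a', 2 * \<delta>)) ` C)"
  have W0: "(\<rho>, \<rho>', 0) \<in> W" by (simp add: W_def)
  have Wcases: "(a, a', w) \<in> W \<longleftrightarrow> (a = \<rho> \<and> a' = \<rho>' \<and> w = 0) \<or> ((a, a') \<in> C \<and> w = 2 * \<delta>)" for a a' w
    by (auto simp: W_def)
  have W1: "a \<in> mspace T" "a' \<in> mspace T'" "0 \<le> w" if "(a, a', w) \<in> W" for a a' w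
    using that gclose_in[OF C, of a a'] \<rho> \<delta> unfolding Wcases by auto
  \<comment> \<open>No detour across two bridges is a shortcut. For a bridge together with the root
    pair only heights are compared, so one length suffices.\<close>
  have W2: "\<bar>mdist T a b - mdist T' a' b'\<bar> \<le> w + w'" if ww: "(a, a', w) \<in> W" "(b, b', w') \<in> W" for a a' w b b' w'
  proof -
    consider "a = \<rho>" "a' = \<rho>'" "w = 0" "b = \<rho>" "b' = \<rho>'" "w' = 0"
      | "a = \<rho>" "a' = \<rho>'" "w = 0" "(b, b') \<in> C" "w' = 2 * \<delta>"
      | "b = \<rho>" "b' = \<rho>'" "w' = 0" "(a, a') \<in> C" "w = 2 * \<delta>"
      | "(a, a') \<in> C" "w = 2 * \<delta>" "(b, b') \<in> C" "w' = 2 * \<delta>"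
      using ww unfolding Wcases by blast
    then show ?thesis
    proof cases
      case 1 then show ?thesis using \<rho> by simp
    next
      case 2 then show ?thesis using gclose_ht[OF C 2(4)] \<delta> by simp
    next
      case 3 then show ?thesis
        using gclose_ht[OF C 3(4)] \<delta> mdist_commute[of T a \<rho>] mdist_commute[of T' a' \<rho>'] by simp
    next
      case 4 then show ?thesis using gclose_dist[OF C 4(1,3)] by simp
    qed
  qed
  define g where "g x y = (\<lambda>(a, a', w). mdist T x a + w + mdist T' a' y)" for x y
  define D where "D x y = (INF p\<in>W. g x y p)" for x y
  have g0: "0 \<le> g x y p" if "p \<in> W" for x y p
  proof -
    obtain a a' w where p: "p = (a, a', w)" by (cases p)
    then show ?thesis using W1(3)[of a a' w] that by (simp add: g_def)
  qed
  have D_le: "D x y \<le> mdist T x a + w + mdist T' a' y" if "(a, a', w) \<in> W" for x y a a' w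
  proof -
    have "D x y \<le> g x y (a, a', w)" unfolding D_def by (rule cINF_lower[OF _ that]) (use g0 in \<open>auto intro!: bdd_belowI2\<close>)
    then show ?thesis by (simp add: g_def)
  qed
  have D_ge: "c \<le> D x y" if "\<And>a a' w. (a, a', w) \<in> W \<Longrightarrow> c \<le> mdist T x a + w + mdist T' a' y" for c x y
    unfolding D_def
  proof (rule cINF_greatest)
    show "W \<noteq> {}" using W0 by auto
    fix p assume "p \<in> W" then show "c \<le> g x y p" using that by (cases p) (auto simp: g_def)
  qed
  have D0: "0 \<le> D x y" for x y by (rule D_ge) (use W1(3) in auto)
  have T1: "D x y \<le> mdist T x x1 + D x1 y" if "x \<in> mspace T" "x1 \<in> mspace T" for x x1 y
  proof -
    have "D x y - mdist T x x1 \<le> D x1 y"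
    proof (rule D_ge)
      fix a a' w assume w: "(a, a', w) \<in> W"
      show "D x y - mdist T x x1 \<le> mdist T x1 a + w + mdist T' a' y"
        using D_le[OF w, of x y] mdist_triangle[OF that W1(1)[OF w]] by linarith
    qed
    then show ?thesis by linarith
  qed
  have T2: "D x y \<le> D x y1 + mdist T' y1 y" if "y \<in> mspace T'" "y1 \<in> mspace T'" for x y y1
  proof -
    have "D x y - mdist T' y1 y \<le> D x y1"
    proof (rule D_ge)
      fix a a' w assume w: "(a, a', w) \<in> W"
      show "D x y - mdist T' y1 y \<le> mdist T x a + w + mdist T' a' y1"
        using D_le[OF w, of x y] mdist_triangle[OF W1(2)[OF w] that(2,1)] by linarith
    qed
    then show ?thesis by linarith
  qed
  have T3: "mdist T x x2 \<le> D x y + D x2 y" if "x \<in> mspace T" "x2 \<in> mspace T" "y \<in> mspace T'" for x x2 y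
  proof -
    have "mdist T x x2 - D x2 y \<le> D x y"
    proof (rule D_ge)
      fix a a' w assume w: "(a, a', w) \<in> W"
      have "mdist T x x2 - (mdist T x a + w + mdist T' a' y) \<le> D x2 y"
      proof (rule D_ge)
        fix b b' w' assume w': "(b, b', w') \<in> W"
        have "mdist T x x2 \<le> mdist T x a + mdist T a x2" "mdist T a x2 \<le> mdist T a b + mdist T b x2"
          "mdist T' a' b' \<le> mdist T' a' y + mdist T' y b'"
          using that W1[OF w] W1[OF w'] by (auto intro!: mdist_triangle)
        then show "mdist T x x2 - (mdist T x a + w + mdist T' a' y) \<le> mdist T x2 b + w' + mdist T' b' y"
          using W2[OF w w'] mdist_commute[of T b x2] mdist_commute[of T' y b'] by linarith
      qed
      then show "mdist T x x2 - D x2 y \<le> mdist T x a + w + mdist T' a' y" by linarith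
    qed
    then show ?thesis by linarith
  qed
  have T4: "mdist T' y y2 \<le> D x y + D x y2" if "x \<in> mspace T" "y \<in> mspace T'" "y2 \<in> mspace T'" for x y y2
  proof -
    have "mdist T' y y2 - D x y2 \<le> D x y"
    proof (rule D_ge)
      fix a a' w assume w: "(a, a', w) \<in> W"
      have "mdist T' y y2 - (mdist T x a + w + mdist T' a' y) \<le> D x y2"
      proof (rule D_ge)
        fix b b' w' assume w': "(b, b', w') \<in> W"
        have "mdist T' y y2 \<le> mdist T' y a' + mdist T' a' y2" "mdist T' a' y2 \<le> mdist T' a' b' + mdist T' b' y2"
          "mdist T a b \<le> mdist T a x + mdist T x b"
          using that W1[OF w] W1[OF w'] by (auto intro!: mdist_triangle)
        then show "mdist T' y y2 - (mdist T x a + w + mdist T' a' y) \<le> mdist T x b + w' + mdist T' b' y2"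
          using W2[OF w w'] mdist_commute[of T a x] mdist_commute[of T' y a'] by linarith
      qed
      then show "mdist T' y y2 - D x y2 \<le> mdist T x a + w + mdist T' a' y" by linarith
    qed
    then show ?thesis by linarith
  qed
  \<comment> \<open>Away from the root the construction is a metric and not just a pseudometric:
    every bridge either has positive length or starts at the root of the second tree.\<close>
  have Dpos: "0 < D x y" if "x \<in> mspace T" "y \<in> mspace T'" "y \<noteq> \<rho>'" for x y
  proof -
    have y0: "0 < mdist T' \<rho>' y" using that \<rho> by (metis mdist_nonneg mdist_zero order_le_less)
    have "min (2 * \<delta>) (mdist T' \<rho>' y) \<le> D x y"
    proof (rule D_ge)
      fix a a' w assume "(a, a', w) \<in> W"
      then show "min (2 * \<delta>) (mdist T' \<rho>' y) \<le> mdist T x a + w + mdist T' a' y"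
        unfolding Wcases using mdist_nonneg[of T x a] mdist_nonneg[of T' a' y]
        by (elim disjE conjE) (simp_all add: min_le_iff_disj)
    qed
    then show ?thesis using y0 \<delta> by simp
  qed
  \<comment> \<open>Identifying the two roots changes no distance within the second tree.\<close>
  have Droot: "D \<rho> y = mdist T' \<rho>' y" if "y \<in> mspace T'" for y
  proof (rule antisym)
    show "D \<rho> y \<le> mdist T' \<rho>' y" using D_le[OF W0, of \<rho> y] \<rho> by simp
    show "mdist T' \<rho>' y \<le> D \<rho> y"
    proof (rule D_ge)
      fix a a' w assume w: "(a, a', w) \<in> W"
      show "mdist T' \<rho>' y \<le> mdist T \<rho> a + w + mdist T' a' y"
        using W2[OF W0 w] mdist_triangle[OF \<rho>(2) W1(2)[OF w] that] by linarith
    qed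
  qed
  define dz where "dz p q = (case p of Inl x \<Rightarrow> (case q of Inl y \<Rightarrow> mdist T x y | Inr y \<Rightarrow> D x y)
     | Inr x \<Rightarrow> (case q of Inl y \<Rightarrow> D y x | Inr y \<Rightarrow> mdist T' x y))" for p q
  \<comment> \<open>The second root is represented by the first, since rooted embeddings have to
    send both to the same point.\<close>
  define MZ where "MZ = Inl ` mspace T \<union> Inr ` (mspace T' - {\<rho>'})"
  have ms: "Metric_space MZ dz"
  proof
    show "0 \<le> dz p q" for p q using D0 by (simp add: dz_def split: sum.split)
    show "dz p q = dz q p" for p q by (simp add: dz_def mdist_commute split: sum.split)
    show "dz p q = 0 \<longleftrightarrow> p = q" if "p \<in> MZ" "q \<in> MZ" for p q
      using that Dpos unfolding MZ_def dz_def by (fastforce split: sum.split)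
    show "dz p s \<le> dz p q + dz q s" if "p \<in> MZ" "q \<in> MZ" "s \<in> MZ" for p q s
    proof -
      have "(\<exists>x\<in>mspace T. u = Inl x) \<or> (\<exists>y\<in>mspace T'. u = Inr y)" if "u \<in> MZ" for u using that by (auto simp: MZ_def)
      note c = this[OF that(1)] this[OF that(2)] this[OF that(3)]
      show ?thesis
        using c
      proof (elim disjE bexE)
        fix x x1 x2 assume "x \<in> mspace T" "p = Inl x" "x1 \<in> mspace T" "q = Inl x1" "x2 \<in> mspace T" "s = Inl x2"
        then show ?thesis by (simp add: dz_def mdist_triangle)
      next
        fix x x1 y assume "x \<in> mspace T" "p = Inl x" "x1 \<in> mspace T" "q = Inl x1" "y \<in> mspace T'" "s = Inr y"
        then show ?thesis using T1[of x x1 y] by (simp add: dz_def)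
      next
        fix x y x2 assume "x \<in> mspace T" "p = Inl x" "y \<in> mspace T'" "q = Inr y" "x2 \<in> mspace T" "s = Inl x2"
        then show ?thesis using T3[of x x2 y] by (simp add: dz_def)
      next
        fix x y y2 assume "x \<in> mspace T" "p = Inl x" "y \<in> mspace T'" "q = Inr y" "y2 \<in> mspace T'" "s = Inr y2"
        then show ?thesis using T2[of y2 y x] by (simp add: dz_def)
      next
        fix y x x2 assume "y \<in> mspace T'" "p = Inr y" "x \<in> mspace T" "q = Inl x" "x2 \<in> mspace T" "s = Inl x2"
        then show ?thesis using T1[of x2 x y] by (simp add: dz_def mdist_commute[of T x2])
      next
        fix y x y2 assume "y \<in> mspace T'" "p = Inr y" "x \<in> mspace T" "q = Inl x" "y2 \<in> mspace T'" "s = Inr y2"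
        then show ?thesis using T4[of x y y2] by (simp add: dz_def)
      next
        fix y y1 x assume "y \<in> mspace T'" "p = Inr y" "y1 \<in> mspace T'" "q = Inr y1" "x \<in> mspace T" "s = Inl x"
        then show ?thesis using T2[of y y1 x] by (simp add: dz_def mdist_commute[of T' y1])
      next
        fix y y1 y2 assume "y \<in> mspace T'" "p = Inr y" "y1 \<in> mspace T'" "q = Inr y1" "y2 \<in> mspace T'" "s = Inr y2"
        then show ?thesis by (simp add: dz_def mdist_triangle)
      qed
    qed
  qed
  define Z where "Z = metric (MZ, dz)"
  have Zm: "mspace Z = MZ" "mdist Z = dz"
    unfolding Z_def using Metric_space.mspace_metric[OF ms] Metric_space.mdist_metric[OF ms] by auto
  define \<phi> where "\<phi> y = (if y = \<rho>' then Inl \<rho> else Inr y)" for y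
  have e1: "rooted_embedding T \<rho> Z (Inl \<rho>) Inl"
    unfolding rooted_embedding_def Zm by (auto simp: MZ_def dz_def)
  have e2: "rooted_embedding T' \<rho>' Z (Inl \<rho>) \<phi>"
    unfolding rooted_embedding_def Zm
  proof (intro conjI ballI)
    show "\<phi> \<in> mspace T' \<rightarrow> MZ" using \<rho> by (auto simp: \<phi>_def MZ_def)
    show "dz (\<phi> x) (\<phi> y) = mdist T' x y" if "x \<in> mspace T'" "y \<in> mspace T'" for x y
      using Droot[OF that(1)] Droot[OF that(2)] that \<rho> by (simp add: \<phi>_def dz_def mdist_commute[of T' x \<rho>'])
  qed (simp add: \<phi>_def)
  have cl: "mdist Z (Inl x) (\<phi> y) \<le> 2 * \<delta>" if xy: "(x, y) \<in> C" for x y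
  proof (cases "y = \<rho>'")
    case True
    then show ?thesis using gclose_ht[OF C xy] \<rho> \<delta> by (simp add: Zm \<phi>_def dz_def mdist_commute[of T x])
  next
    case False
    have "(x, y, 2 * \<delta>) \<in> W" using xy unfolding Wcases by simp
    then show ?thesis using D_le[of x y "2 * \<delta>" x y] gclose_in[OF C xy] False by (simp add: Zm \<phi>_def dz_def)
  qed
  show ?thesis
    by (intro exI[of _ Z] exI[of _ Inl] exI[of _ \<phi>] conjI e1 e2) (use cl \<rho> in \<open>auto simp: Zm MZ_def\<close>)
qed

lemma rooted_embedding_submetric:
  "rooted_embedding (submetric T S) \<rho> Z z \<phi> \<Longrightarrow> S' \<subseteq> S \<Longrightarrow> rooted_embedding (submetric T S') \<rho> Z z \<phi>"
  unfolding rooted_embedding_def by auto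

section \<open>The Gromov-Prokhorov distance in terms of relations\<close>

locale good_pair = X: good T \<rho> \<mu> + Y: good T' \<rho>' \<nu>
  for T :: "'a metric" and \<rho> \<mu> and T' :: "'b metric" and \<rho>' \<nu>
begin

definition emb :: "real \<Rightarrow> ('a + 'b) metric \<Rightarrow> ('a \<Rightarrow> 'a + 'b) \<Rightarrow> ('b \<Rightarrow> 'a + 'b) \<Rightarrow> bool" where
  "emb r Z \<phi>\<^sub>1 \<phi>\<^sub>2 \<longleftrightarrow> (\<exists>z. z \<in> mspace Z \<and> rooted_embedding (submetric T (X.ts r)) \<rho> Z z \<phi>\<^sub>1 \<and>
     rooted_embedding (submetric T' (Y.ts r)) \<rho>' Z z \<phi>\<^sub>2)"

abbreviation "m1 r Z \<phi> \<equiv> distr (restrict_space (X.tm r) (X.ts r)) (metric_borel Z) \<phi>"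
abbreviation "m2 r Z \<phi> \<equiv> distr (restrict_space (Y.tm r) (Y.ts r)) (metric_borel Z) \<phi>"
abbreviation "gpd r \<equiv> dGP (trunc_tree r (T, \<rho>, \<mu>)) (trunc_tree r (T', \<rho>', \<nu>))"

lemma gpd_eq: "gpd r = Inf {dP Z (m1 r Z \<phi>\<^sub>1) (m2 r Z \<phi>\<^sub>2) | Z \<phi>\<^sub>1 \<phi>\<^sub>2. emb r Z \<phi>\<^sub>1 \<phi>\<^sub>2}"
  unfolding dGP_def X.trunc_tree_eq Y.trunc_tree_eq emb_def prod.case
  by (rule arg_cong[where f=Inf], rule Collect_cong, rule iffI; elim exE conjE; intro exI conjI; assumption)

lemma emb_D:
  assumes "emb r Z \<phi>\<^sub>1 \<phi>\<^sub>2"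
  shows "x \<in> X.ts r \<Longrightarrow> \<phi>\<^sub>1 x \<in> mspace Z" "y \<in> Y.ts r \<Longrightarrow> \<phi>\<^sub>2 y \<in> mspace Z"
    "x \<in> X.ts r \<Longrightarrow> x' \<in> X.ts r \<Longrightarrow> mdist Z (\<phi>\<^sub>1 x) (\<phi>\<^sub>1 x') = mdist T x x'"
    "y \<in> Y.ts r \<Longrightarrow> y' \<in> Y.ts r \<Longrightarrow> mdist Z (\<phi>\<^sub>2 y) (\<phi>\<^sub>2 y') = mdist T' y y'"
    "\<phi>\<^sub>1 \<rho> = \<phi>\<^sub>2 \<rho>'"
proof -
  obtain z where z: "rooted_embedding (submetric T (X.ts r)) \<rho> Z z \<phi>\<^sub>1" "rooted_embedding (submetric T' (Y.ts r)) \<rho>' Z z \<phi>\<^sub>2"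
    using assms by (auto simp: emb_def)
  have s: "X.ts r \<inter> mspace T = X.ts r" "Y.ts r \<inter> mspace T' = Y.ts r" using X.ts_sub[of r] Y.ts_sub[of r] by auto
  note e = z[unfolded rooted_embedding_def mspace_submetric mdist_submetric s]
  show "x \<in> X.ts r \<Longrightarrow> \<phi>\<^sub>1 x \<in> mspace Z" "y \<in> Y.ts r \<Longrightarrow> \<phi>\<^sub>2 y \<in> mspace Z"
    "x \<in> X.ts r \<Longrightarrow> x' \<in> X.ts r \<Longrightarrow> mdist Z (\<phi>\<^sub>1 x) (\<phi>\<^sub>1 x') = mdist T x x'"
    "y \<in> Y.ts r \<Longrightarrow> y' \<in> Y.ts r \<Longrightarrow> mdist Z (\<phi>\<^sub>2 y) (\<phi>\<^sub>2 y') = mdist T' y y'"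
    "\<phi>\<^sub>1 \<rho> = \<phi>\<^sub>2 \<rho>'" using e by auto
qed

lemma emb_meas:
  assumes "emb r Z \<phi>\<^sub>1 \<phi>\<^sub>2" "A \<in> sets (metric_borel Z)"
  shows "{x\<in>X.ts r. \<phi>\<^sub>1 x \<in> A} \<in> sets (metric_borel T)" "{x\<in>Y.ts r. \<phi>\<^sub>2 x \<in> A} \<in> sets (metric_borel T')"
    "emeasure (m1 r Z \<phi>\<^sub>1) A = emeasure (X.tm r) {x\<in>X.ts r. \<phi>\<^sub>1 x \<in> A}"
    "emeasure (m2 r Z \<phi>\<^sub>2) A = emeasure (Y.tm r) {x\<in>Y.ts r. \<phi>\<^sub>2 x \<in> A}"
proof -
  obtain z where z: "rooted_embedding (submetric T (X.ts r)) \<rho> Z z \<phi>\<^sub>1" "rooted_embedding (submetric T' (Y.ts r)) \<rho>' Z z \<phi>\<^sub>2"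
    using assms(1) by (auto simp: emb_def)
  note d = X.distr_trunc[OF z(1) assms(2)] Y.distr_trunc[OF z(2) assms(2)]
  show "{x\<in>X.ts r. \<phi>\<^sub>1 x \<in> A} \<in> sets (metric_borel T)" "{x\<in>Y.ts r. \<phi>\<^sub>2 x \<in> A} \<in> sets (metric_borel T')"
    "emeasure (m1 r Z \<phi>\<^sub>1) A = emeasure (X.tm r) {x\<in>X.ts r. \<phi>\<^sub>1 x \<in> A}"
    "emeasure (m2 r Z \<phi>\<^sub>2) A = emeasure (Y.tm r) {x\<in>Y.ts r. \<phi>\<^sub>2 x \<in> A}"
    by (rule d)+
qed

lemma emb_mono: "emb s Z \<phi>\<^sub>1 \<phi>\<^sub>2 \<Longrightarrow> r \<le> s \<Longrightarrow> emb r Z \<phi>\<^sub>1 \<phi>\<^sub>2"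
  unfolding emb_def
  by (elim exE conjE, intro exI conjI, assumption)
    (rule rooted_embedding_submetric, assumption, rule X.ts_mono Y.ts_mono, assumption)+

lemma emb_prok:
  assumes "emb r Z \<phi>\<^sub>1 \<phi>\<^sub>2" shows "\<exists>K. prok Z (m1 r Z \<phi>\<^sub>1) (m2 r Z \<phi>\<^sub>2) K"
proof -
  let ?a = "emeasure \<mu> (mcball_of T \<rho> r)" and ?b = "emeasure \<nu> (mcball_of T' \<rho>' r)"
  define K where "K = enn2real (?a + ?b)"
  have K: "?a + ?b = ennreal K" "0 \<le> K" using X.ball_fin[of r] Y.ball_fin[of r] by (auto simp: K_def)
  have "prok Z (m1 r Z \<phi>\<^sub>1) (m2 r Z \<phi>\<^sub>2) (K + 1)"
  proof (rule prok_total)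
    show "emeasure (m1 r Z \<phi>\<^sub>1) A \<le> ennreal K" for A
    proof (cases "A \<in> sets (metric_borel Z)")
      case True
      show ?thesis unfolding emb_meas(3)[OF assms True] K(1)[symmetric] by (rule order_trans[OF X.tm_total]) simp
    qed (simp add: emeasure_notin_sets)
    show "emeasure (m2 r Z \<phi>\<^sub>2) A \<le> ennreal K" for A
    proof (cases "A \<in> sets (metric_borel Z)")
      case True
      show ?thesis unfolding emb_meas(4)[OF assms True] K(1)[symmetric] by (rule order_trans[OF Y.tm_total]) simp
    qed (simp add: emeasure_notin_sets)
  qed (rule K(2))
  then show ?thesis by blast
qed

lemma emb_bdd: "bdd_below {dP Z (m1 r Z \<phi>\<^sub>1) (m2 r Z \<phi>\<^sub>2) | Z \<phi>\<^sub>1 \<phi>\<^sub>2. emb r Z \<phi>\<^sub>1 \<phi>\<^sub>2}"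
proof (rule bdd_belowI[of _ 0])
  fix d assume "d \<in> {dP Z (m1 r Z \<phi>\<^sub>1) (m2 r Z \<phi>\<^sub>2) | Z \<phi>\<^sub>1 \<phi>\<^sub>2. emb r Z \<phi>\<^sub>1 \<phi>\<^sub>2}"
  then obtain Z \<phi>\<^sub>1 \<phi>\<^sub>2 where Z: "emb r Z \<phi>\<^sub>1 \<phi>\<^sub>2" "d = dP Z (m1 r Z \<phi>\<^sub>1) (m2 r Z \<phi>\<^sub>2)" by blast
  obtain K where "prok Z (m1 r Z \<phi>\<^sub>1) (m2 r Z \<phi>\<^sub>2) K" using emb_prok[OF Z(1)] by blast
  then show "0 \<le> d" unfolding Z(2) by (rule dP_nonneg)
qed

lemma gpd_le: "emb r Z \<phi>\<^sub>1 \<phi>\<^sub>2 \<Longrightarrow> gpd r \<le> dP Z (m1 r Z \<phi>\<^sub>1) (m2 r Z \<phi>\<^sub>2)"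
  unfolding gpd_eq by (rule cInf_lower[OF _ emb_bdd]) blast

lemma emb_glue:
  assumes "gclose T \<rho> T' \<rho>' C \<delta>" "\<delta> > 0"
  shows "\<exists>Z \<phi>\<^sub>1 \<phi>\<^sub>2. emb r Z \<phi>\<^sub>1 \<phi>\<^sub>2 \<and> (\<forall>(x, y)\<in>C. mdist Z (\<phi>\<^sub>1 x) (\<phi>\<^sub>2 y) \<le> 2 * \<delta>)"
proof -
  obtain Z :: "('a + 'b) metric" and \<phi>\<^sub>1 \<phi>\<^sub>2 where Z: "\<phi>\<^sub>1 \<rho> \<in> mspace Z" "rooted_embedding T \<rho> Z (\<phi>\<^sub>1 \<rho>) \<phi>\<^sub>1"
     "rooted_embedding T' \<rho>' Z (\<phi>\<^sub>1 \<rho>) \<phi>\<^sub>2" "\<forall>(x, y)\<in>C. mdist Z (\<phi>\<^sub>1 x) (\<phi>\<^sub>2 y) \<le> 2 * \<delta>"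
    using glue[OF X.root Y.root assms] by blast
  have "emb r Z \<phi>\<^sub>1 \<phi>\<^sub>2"
    unfolding emb_def using Z(1) rooted_embedding_submetric[of T "mspace T" \<rho> Z "\<phi>\<^sub>1 \<rho>" \<phi>\<^sub>1 "X.ts r"]
      rooted_embedding_submetric[of T' "mspace T'" \<rho>' Z "\<phi>\<^sub>1 \<rho>" \<phi>\<^sub>2 "Y.ts r"] Z(2,3) X.ts_sub[of r] Y.ts_sub[of r]
    by (intro exI[of _ "\<phi>\<^sub>1 \<rho>"]) simp
  then show ?thesis using Z(4) by blast
qed

text \<open>Gluing along the empty relation joins the trees at their roots only, so the infimum in
  \<open>dGP\<close> is over a nonempty set.\<close>

lemma emb_ne: "\<exists>Z \<phi>\<^sub>1 \<phi>\<^sub>2. emb r Z \<phi>\<^sub>1 \<phi>\<^sub>2"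
proof -
  have "gclose T \<rho> T' \<rho>' {} 1" by (simp add: gclose_def)
  from emb_glue[OF this, of r] show ?thesis by auto
qed

lemma gpd_nonneg: "0 \<le> gpd r"
  unfolding gpd_eq
proof (rule cInf_greatest)
  show "{dP Z (m1 r Z \<phi>\<^sub>1) (m2 r Z \<phi>\<^sub>2) | Z \<phi>\<^sub>1 \<phi>\<^sub>2. emb r Z \<phi>\<^sub>1 \<phi>\<^sub>2} \<noteq> {}" using emb_ne[of r] by blast
  fix d assume "d \<in> {dP Z (m1 r Z \<phi>\<^sub>1) (m2 r Z \<phi>\<^sub>2) | Z \<phi>\<^sub>1 \<phi>\<^sub>2. emb r Z \<phi>\<^sub>1 \<phi>\<^sub>2}"
  then obtain Z \<phi>\<^sub>1 \<phi>\<^sub>2 where Z: "emb r Z \<phi>\<^sub>1 \<phi>\<^sub>2" "d = dP Z (m1 r Z \<phi>\<^sub>1) (m2 r Z \<phi>\<^sub>2)" by blast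
  obtain K where "prok Z (m1 r Z \<phi>\<^sub>1) (m2 r Z \<phi>\<^sub>2) K" using emb_prok[OF Z(1)] by blast
  then show "0 \<le> d" unfolding Z(2) by (rule dP_nonneg)
qed

lemma gpd_lessD: assumes "gpd r < e"
  shows "\<exists>Z \<phi>\<^sub>1 \<phi>\<^sub>2 \<epsilon>. emb r Z \<phi>\<^sub>1 \<phi>\<^sub>2 \<and> \<epsilon> < e \<and> prok Z (m1 r Z \<phi>\<^sub>1) (m2 r Z \<phi>\<^sub>2) \<epsilon>"
proof -
  let ?S = "{dP Z (m1 r Z \<phi>\<^sub>1) (m2 r Z \<phi>\<^sub>2) | Z \<phi>\<^sub>1 \<phi>\<^sub>2. emb r Z \<phi>\<^sub>1 \<phi>\<^sub>2}"
  have "?S \<noteq> {}" using emb_ne[of r] by blast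
  then obtain d where "d \<in> ?S" "d < e" using cInf_lessD[of ?S e] assms unfolding gpd_eq by blast
  then obtain Z \<phi>\<^sub>1 \<phi>\<^sub>2 where Z: "emb r Z \<phi>\<^sub>1 \<phi>\<^sub>2" "dP Z (m1 r Z \<phi>\<^sub>1) (m2 r Z \<phi>\<^sub>2) < e" by blast
  obtain K where "prok Z (m1 r Z \<phi>\<^sub>1) (m2 r Z \<phi>\<^sub>2) K" using emb_prok[OF Z(1)] by blast
  then show ?thesis using dP_lessD[OF Z(2)] Z(1) by blast
qed

text \<open>Related points are within 2 \<delta> in the glued space, so thickening by 2 \<delta>
  captures images under \<open>C\<close>. The relation may leave the truncated trees, but their
  complements carry no truncated mass.\<close>

lemma close_gpd:
  assumes C: "gclose T \<rho> T' \<rho>' C \<delta>" and \<delta>: "\<delta> > 0"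
    and a: "mclose (X.tm r) (Y.tm r) C \<delta>" and b: "mclose (Y.tm r) (X.tm r) (C\<inverse>) \<delta>"
  shows "gpd r \<le> 2 * \<delta>"
proof -
  obtain Z \<phi>\<^sub>1 \<phi>\<^sub>2 where e: "emb r Z \<phi>\<^sub>1 \<phi>\<^sub>2" and cl: "\<forall>(x, y)\<in>C. mdist Z (\<phi>\<^sub>1 x) (\<phi>\<^sub>2 y) \<le> 2 * \<delta>"
    using emb_glue[OF C \<delta>, of r] by (elim exE conjE)
  have "prok Z (m1 r Z \<phi>\<^sub>1) (m2 r Z \<phi>\<^sub>2) (2 * \<delta>)"
    unfolding prok_def
  proof (intro conjI allI impI)
    fix A assume A: "closedin (mtopology_of Z) A"
    have Ab: "A \<in> sets (metric_borel Z)" by (rule closed_in_metric_borel[OF A])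
    have Tb: "thicken Z A (2 * \<delta>) \<in> sets (metric_borel Z)" using closedin_subset[OF A] by (intro thicken_borel) simp
    let ?A1 = "{x\<in>X.ts r. \<phi>\<^sub>1 x \<in> A}" and ?A2 = "{x\<in>Y.ts r. \<phi>\<^sub>2 x \<in> A}"
    let ?B1 = "{x\<in>X.ts r. \<phi>\<^sub>1 x \<in> thicken Z A (2 * \<delta>)}" and ?B2 = "{x\<in>Y.ts r. \<phi>\<^sub>2 x \<in> thicken Z A (2 * \<delta>)}"
    note mA = emb_meas[OF e Ab] and mB = emb_meas[OF e Tb]
    have c1: "mspace T - X.ts r \<in> sets (metric_borel T)" using sets.compl_sets[of "X.ts r" "metric_borel T"] by simp
    have c2: "mspace T' - Y.ts r \<in> sets (metric_borel T')" using sets.compl_sets[of "Y.ts r" "metric_borel T'"] by simp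
    have le: "ennreal \<delta> \<le> ennreal (2 * \<delta>)" using \<delta> by (intro ennreal_leI) simp
    have "emeasure (X.tm r) ?A1 \<le> emeasure (Y.tm r) (?B2 \<union> (mspace T' - Y.ts r)) + ennreal \<delta>"
    proof (rule mcloseD[OF a])
      show "C `` ?A1 \<subseteq> ?B2 \<union> (mspace T' - Y.ts r)"
      proof
        fix y assume "y \<in> C `` ?A1"
        then obtain x where x: "(x, y) \<in> C" "x \<in> X.ts r" "\<phi>\<^sub>1 x \<in> A" by blast
        have yM: "y \<in> mspace T'" using gclose_in[OF C x(1)] by simp
        show "y \<in> ?B2 \<union> (mspace T' - Y.ts r)"
        proof (cases "y \<in> Y.ts r")
          case True
          have "mdist Z (\<phi>\<^sub>2 y) (\<phi>\<^sub>1 x) \<le> 2 * \<delta>" using cl x(1) mdist_commute[of Z "\<phi>\<^sub>2 y"] by auto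
          then have "\<phi>\<^sub>2 y \<in> thicken Z A (2 * \<delta>)" by (rule in_thickenI[OF x(3) emb_D(2)[OF e True]])
          then show ?thesis using True by simp
        qed (use yM in simp)
      qed
    qed (use mA mB c2 in auto)
    also have "emeasure (Y.tm r) (?B2 \<union> (mspace T' - Y.ts r)) \<le> emeasure (Y.tm r) ?B2 + emeasure (Y.tm r) (mspace T' - Y.ts r)"
      by (rule emeasure_subadditive) (use mB c2 in auto)
    finally show "emeasure (m1 r Z \<phi>\<^sub>1) A \<le> emeasure (m2 r Z \<phi>\<^sub>2) (thicken Z A (2 * \<delta>)) + ennreal (2 * \<delta>)"
      unfolding mA(3) mB(4) using le by (simp add: Y.tm_null) (meson add_left_mono order_trans)
    have "emeasure (Y.tm r) ?A2 \<le> emeasure (X.tm r) (?B1 \<union> (mspace T - X.ts r)) + ennreal \<delta>"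
    proof (rule mcloseD[OF b])
      show "C\<inverse> `` ?A2 \<subseteq> ?B1 \<union> (mspace T - X.ts r)"
      proof
        fix x assume "x \<in> C\<inverse> `` ?A2"
        then obtain y where y: "(x, y) \<in> C" "y \<in> Y.ts r" "\<phi>\<^sub>2 y \<in> A" by blast
        have xM: "x \<in> mspace T" using gclose_in[OF C y(1)] by simp
        show "x \<in> ?B1 \<union> (mspace T - X.ts r)"
        proof (cases "x \<in> X.ts r")
          case True
          have "mdist Z (\<phi>\<^sub>1 x) (\<phi>\<^sub>2 y) \<le> 2 * \<delta>" using cl y(1) by auto
          then have "\<phi>\<^sub>1 x \<in> thicken Z A (2 * \<delta>)" by (rule in_thickenI[OF y(3) emb_D(1)[OF e True]])
          then show ?thesis using True by simp
        qed (use xM in simp)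
      qed
    qed (use mA mB c1 in auto)
    also have "emeasure (X.tm r) (?B1 \<union> (mspace T - X.ts r)) \<le> emeasure (X.tm r) ?B1 + emeasure (X.tm r) (mspace T - X.ts r)"
      by (rule emeasure_subadditive) (use mB c1 in auto)
    finally show "emeasure (m2 r Z \<phi>\<^sub>2) A \<le> emeasure (m1 r Z \<phi>\<^sub>1) (thicken Z A (2 * \<delta>)) + ennreal (2 * \<delta>)"
      unfolding mA(4) mB(3) using le by (simp add: X.tm_null) (meson add_left_mono order_trans)
  qed (use \<delta> in simp)
  from order_trans[OF gpd_le[OF e] dP_le[OF this]] show ?thesis .
qed

text \<open>The relation consists of the pairs at distance less than e in a nearly optimal common
  space. Heights then differ by at most e and distances by at most 2 e, which gives (e + e + 2 e) /
  2 = 2 e for Gromov products.\<close>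

lemma gpd_close:
  assumes "gpd r < e"
  shows "\<exists>C. gclose T \<rho> T' \<rho>' C (2 * e) \<and> mclose (X.tm r) (Y.tm r) C e \<and> mclose (Y.tm r) (X.tm r) (C\<inverse>) e"
proof -
  obtain Z \<phi>\<^sub>1 \<phi>\<^sub>2 \<epsilon> where emb: "emb r Z \<phi>\<^sub>1 \<phi>\<^sub>2" and \<epsilon>: "\<epsilon> < e" and pr: "prok Z (m1 r Z \<phi>\<^sub>1) (m2 r Z \<phi>\<^sub>2) \<epsilon>"
    using gpd_lessD[OF assms] by (elim exE conjE)
  have \<epsilon>0: "0 < \<epsilon>" using pr by (simp add: prok_def)
  define C where "C = {(x, y). x \<in> X.ts r \<and> y \<in> Y.ts r \<and> mdist Z (\<phi>\<^sub>1 x) (\<phi>\<^sub>2 y) < e}"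
  note ed = emb_D[OF emb]
  have htd: "\<bar>mdist T \<rho> x - mdist T' \<rho>' y\<bar> \<le> e" if "(x, y) \<in> C" for x y
  proof -
    have xy: "x \<in> X.ts r" "y \<in> Y.ts r" "mdist Z (\<phi>\<^sub>1 x) (\<phi>\<^sub>2 y) < e" using that by (auto simp: C_def)
    have "mdist T \<rho> x = mdist Z (\<phi>\<^sub>1 \<rho>) (\<phi>\<^sub>1 x)" "mdist T' \<rho>' y = mdist Z (\<phi>\<^sub>1 \<rho>) (\<phi>\<^sub>2 y)"
      using ed(3)[OF X.root_ts xy(1)] ed(4)[OF Y.root_ts xy(2)] ed(5) by simp_all
    moreover have "\<bar>mdist Z (\<phi>\<^sub>1 \<rho>) (\<phi>\<^sub>1 x) - mdist Z (\<phi>\<^sub>1 \<rho>) (\<phi>\<^sub>2 y)\<bar> \<le> mdist Z (\<phi>\<^sub>1 x) (\<phi>\<^sub>2 y)"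
      by (rule mdist_lipschitz) (use ed(1,2) xy X.root_ts in auto)
    ultimately show ?thesis using xy(3) by linarith
  qed
  have gp: "\<bar>gprod T \<rho> x x' - gprod T' \<rho>' y y'\<bar> \<le> 2 * e" if "(x, y) \<in> C" "(x', y') \<in> C" for x y x' y'
  proof -
    have xy: "x \<in> X.ts r" "y \<in> Y.ts r" "mdist Z (\<phi>\<^sub>1 x) (\<phi>\<^sub>2 y) < e"
      "x' \<in> X.ts r" "y' \<in> Y.ts r" "mdist Z (\<phi>\<^sub>1 x') (\<phi>\<^sub>2 y') < e" using that by (auto simp: C_def)
    note M = ed(1)[OF xy(1)] ed(2)[OF xy(2)] ed(1)[OF xy(4)] ed(2)[OF xy(5)]
    have "\<bar>mdist Z (\<phi>\<^sub>1 x) (\<phi>\<^sub>1 x') - mdist Z (\<phi>\<^sub>1 x) (\<phi>\<^sub>2 y')\<bar> \<le> mdist Z (\<phi>\<^sub>1 x') (\<phi>\<^sub>2 y')"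
      by (rule mdist_lipschitz[OF M(1,3,4)])
    moreover have "\<bar>mdist Z (\<phi>\<^sub>2 y') (\<phi>\<^sub>1 x) - mdist Z (\<phi>\<^sub>2 y') (\<phi>\<^sub>2 y)\<bar> \<le> mdist Z (\<phi>\<^sub>1 x) (\<phi>\<^sub>2 y)"
      by (rule mdist_lipschitz[OF M(4,1,2)])
    ultimately have "\<bar>mdist T x x' - mdist T' y y'\<bar> \<le> 2 * e"
      using ed(3)[OF xy(1,4)] ed(4)[OF xy(2,5)] xy(3,6) mdist_commute[of Z "\<phi>\<^sub>2 y'" "\<phi>\<^sub>1 x"] mdist_commute[of Z "\<phi>\<^sub>2 y'" "\<phi>\<^sub>2 y"] by linarith
    then show ?thesis using htd[OF that(1)] htd[OF that(2)] unfolding gprod_def by argo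
  qed
  have g: "gclose T \<rho> T' \<rho>' C (2 * e)"
    unfolding gclose_def using gp X.ts_sub[of r] Y.ts_sub[of r] by (auto simp: C_def)
  have le: "ennreal \<epsilon> \<le> ennreal e" using \<epsilon> by (intro ennreal_leI) simp
  have a: "mclose (X.tm r) (Y.tm r) C e"
    unfolding mclose_def X.sets_tm Y.sets_tm
  proof (intro ballI impI)
    fix A B assume A: "A \<in> sets (metric_borel T)" and B: "B \<in> sets (metric_borel T')" and AB: "C `` A \<subseteq> B"
    \<comment> \<open>The Prokhorov inequality speaks of closed sets only. Half of the gap e -
      \<epsilon> absorbs the infimum in the thickening, the other half the passage to the
      closure.\<close>
    let ?K = "mtopology_of Z closure_of (\<phi>\<^sub>1 ` (A \<inter> X.ts r))"
    have sub: "\<phi>\<^sub>1 ` (A \<inter> X.ts r) \<subseteq> mspace Z" using ed(1) by auto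
    have K: "closedin (mtopology_of Z) ?K" by (rule closedin_closure_of)
    have Kb: "?K \<in> sets (metric_borel Z)" by (rule closed_in_metric_borel[OF K])
    have KM: "?K \<subseteq> mspace Z" using closedin_subset[OF K] by simp
    have Tb: "thicken Z ?K \<epsilon> \<in> sets (metric_borel Z)" by (rule thicken_borel[OF KM])
    note mA = emb_meas[OF emb Kb] and mB = emb_meas[OF emb Tb]
    have KK: "\<phi>\<^sub>1 ` (A \<inter> X.ts r) \<subseteq> ?K" using sub by (intro closure_of_subset) simp
    have "emeasure (X.tm r) A = emeasure (X.tm r) (A \<inter> X.ts r)" using X.tm_ts[OF A] by simp
    also have "\<dots> \<le> emeasure (X.tm r) {x\<in>X.ts r. \<phi>\<^sub>1 x \<in> ?K}"
      using KK mA(1) by (intro emeasure_mono) auto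
    also have "\<dots> = emeasure (m1 r Z \<phi>\<^sub>1) ?K" by (rule mA(3)[symmetric])
    also have "\<dots> \<le> emeasure (m2 r Z \<phi>\<^sub>2) (thicken Z ?K \<epsilon>) + ennreal \<epsilon>" using pr K by (simp add: prok_def)
    also have "emeasure (m2 r Z \<phi>\<^sub>2) (thicken Z ?K \<epsilon>) = emeasure (Y.tm r) {y\<in>Y.ts r. \<phi>\<^sub>2 y \<in> thicken Z ?K \<epsilon>}"
      by (rule mB(4))
    also have "\<dots> \<le> emeasure (Y.tm r) B"
    proof (rule emeasure_mono)
      show "{y\<in>Y.ts r. \<phi>\<^sub>2 y \<in> thicken Z ?K \<epsilon>} \<subseteq> B"
      proof
        fix y assume y: "y \<in> {y\<in>Y.ts r. \<phi>\<^sub>2 y \<in> thicken Z ?K \<epsilon>}"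
        then obtain k where k: "k \<in> ?K" "mdist Z (\<phi>\<^sub>2 y) k < (\<epsilon> + e) / 2" using in_thickenD[of "\<phi>\<^sub>2 y" Z ?K \<epsilon> "(\<epsilon> + e)/2"] \<epsilon> by auto
        have "\<exists>u\<in>\<phi>\<^sub>1 ` (A \<inter> X.ts r). u \<in> Metric_space.mball (mspace Z) (mdist Z) k ((e - \<epsilon>) / 2)"
          using k(1) \<epsilon> unfolding mtopology_of_def Metric_space.metric_closure_of[OF Metric_space_mspace_mdist] by simp
        then obtain x where x: "x \<in> A" "x \<in> X.ts r" "mdist Z k (\<phi>\<^sub>1 x) < (e - \<epsilon>) / 2"
          by (auto simp: Metric_space.in_mball[OF Metric_space_mspace_mdist])
        have "mdist Z (\<phi>\<^sub>2 y) (\<phi>\<^sub>1 x) \<le> mdist Z (\<phi>\<^sub>2 y) k + mdist Z k (\<phi>\<^sub>1 x)"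
          by (rule mdist_triangle) (use ed(1,2) x y k(1) KM in auto)
        then have "mdist Z (\<phi>\<^sub>1 x) (\<phi>\<^sub>2 y) < e" using k(2) x(3) mdist_commute[of Z "\<phi>\<^sub>1 x"] by (simp add: field_simps)
        then have "(x, y) \<in> C" using x y by (simp add: C_def)
        then show "y \<in> B" using AB x(1) by blast
      qed
    qed (use B in simp)
    finally have "emeasure (X.tm r) A \<le> emeasure (Y.tm r) B + ennreal \<epsilon>" by (simp add: add_right_mono)
    then show "emeasure (X.tm r) A \<le> emeasure (Y.tm r) B + ennreal e"
      by (rule order_trans[OF _ add_left_mono[OF le]])
  qed
  have b: "mclose (Y.tm r) (X.tm r) (C\<inverse>) e"
    unfolding mclose_def X.sets_tm Y.sets_tm
  proof (intro ballI impI)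
    fix A B assume A: "A \<in> sets (metric_borel T')" and B: "B \<in> sets (metric_borel T)" and AB: "C\<inverse> `` A \<subseteq> B"
    let ?K = "mtopology_of Z closure_of (\<phi>\<^sub>2 ` (A \<inter> Y.ts r))"
    have sub: "\<phi>\<^sub>2 ` (A \<inter> Y.ts r) \<subseteq> mspace Z" using ed(2) by auto
    have K: "closedin (mtopology_of Z) ?K" by (rule closedin_closure_of)
    have Kb: "?K \<in> sets (metric_borel Z)" by (rule closed_in_metric_borel[OF K])
    have KM: "?K \<subseteq> mspace Z" using closedin_subset[OF K] by simp
    have Tb: "thicken Z ?K \<epsilon> \<in> sets (metric_borel Z)" by (rule thicken_borel[OF KM])
    note mA = emb_meas[OF emb Kb] and mB = emb_meas[OF emb Tb]
    have KK: "\<phi>\<^sub>2 ` (A \<inter> Y.ts r) \<subseteq> ?K" using sub by (intro closure_of_subset) simp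
    have "emeasure (Y.tm r) A = emeasure (Y.tm r) (A \<inter> Y.ts r)" using Y.tm_ts[OF A] by simp
    also have "\<dots> \<le> emeasure (Y.tm r) {x\<in>Y.ts r. \<phi>\<^sub>2 x \<in> ?K}"
      using KK mA(2) by (intro emeasure_mono) auto
    also have "\<dots> = emeasure (m2 r Z \<phi>\<^sub>2) ?K" by (rule mA(4)[symmetric])
    also have "\<dots> \<le> emeasure (m1 r Z \<phi>\<^sub>1) (thicken Z ?K \<epsilon>) + ennreal \<epsilon>" using pr K by (simp add: prok_def)
    also have "emeasure (m1 r Z \<phi>\<^sub>1) (thicken Z ?K \<epsilon>) = emeasure (X.tm r) {y\<in>X.ts r. \<phi>\<^sub>1 y \<in> thicken Z ?K \<epsilon>}"
      by (rule mB(3))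
    also have "\<dots> \<le> emeasure (X.tm r) B"
    proof (rule emeasure_mono)
      show "{x\<in>X.ts r. \<phi>\<^sub>1 x \<in> thicken Z ?K \<epsilon>} \<subseteq> B"
      proof
        fix x assume x: "x \<in> {x\<in>X.ts r. \<phi>\<^sub>1 x \<in> thicken Z ?K \<epsilon>}"
        then obtain k where k: "k \<in> ?K" "mdist Z (\<phi>\<^sub>1 x) k < (\<epsilon> + e) / 2" using in_thickenD[of "\<phi>\<^sub>1 x" Z ?K \<epsilon> "(\<epsilon> + e)/2"] \<epsilon> by auto
        have "\<exists>u\<in>\<phi>\<^sub>2 ` (A \<inter> Y.ts r). u \<in> Metric_space.mball (mspace Z) (mdist Z) k ((e - \<epsilon>) / 2)"
          using k(1) \<epsilon> unfolding mtopology_of_def Metric_space.metric_closure_of[OF Metric_space_mspace_mdist] by simp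
        then obtain y where y: "y \<in> A" "y \<in> Y.ts r" "mdist Z k (\<phi>\<^sub>2 y) < (e - \<epsilon>) / 2"
          by (auto simp: Metric_space.in_mball[OF Metric_space_mspace_mdist])
        have "mdist Z (\<phi>\<^sub>1 x) (\<phi>\<^sub>2 y) \<le> mdist Z (\<phi>\<^sub>1 x) k + mdist Z k (\<phi>\<^sub>2 y)"
          by (rule mdist_triangle) (use ed(1,2) x y k(1) KM in auto)
        then have "mdist Z (\<phi>\<^sub>1 x) (\<phi>\<^sub>2 y) < e" using k(2) y(3) by (simp add: field_simps)
        then have "(x, y) \<in> C" using x y by (simp add: C_def)
        then show "x \<in> B" using AB y(1) by blast
      qed
    qed (use B in simp)
    finally have "emeasure (Y.tm r) A \<le> emeasure (X.tm r) B + ennreal \<epsilon>" by (simp add: add_right_mono)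
    then show "emeasure (Y.tm r) A \<le> emeasure (X.tm r) B + ennreal e"
      by (rule order_trans[OF _ add_left_mono[OF le]])
  qed
  show ?thesis using g a b by blast
qed

end

section \<open>Gromov-vague convergence as local closeness\<close>

text \<open>Only \<open>A\<close> is confined to the ball. Leaving \<open>B\<close> unconfined
  avoids boundary effects at the radius, so the notion restricts to smaller balls without any
  condition on spheres.\<close>

definition lclose :: "'a metric \<Rightarrow> 'a \<Rightarrow> 'a measure \<Rightarrow> 'b measure \<Rightarrow> ('a \<times> 'b) set \<Rightarrow> real \<Rightarrow> real \<Rightarrow> bool" where
  "lclose T \<rho> \<mu> \<nu> C R \<epsilon> \<longleftrightarrow> (\<forall>A\<in>sets \<mu>. \<forall>B\<in>sets \<nu>. A \<subseteq> mcball_of T \<rho> R \<longrightarrow> C `` A \<subseteq> B \<longrightarrow>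
     emeasure \<mu> A \<le> emeasure \<nu> B + ennreal \<epsilon>)"

lemma lcloseD:
  "lclose T \<rho> \<mu> \<nu> C R \<epsilon> \<Longrightarrow> A \<in> sets \<mu> \<Longrightarrow> B \<in> sets \<nu> \<Longrightarrow> A \<subseteq> mcball_of T \<rho> R \<Longrightarrow> C `` A \<subseteq> B \<Longrightarrow>
     emeasure \<mu> A \<le> emeasure \<nu> B + ennreal \<epsilon>"
  unfolding lclose_def by simp

lemma lclose_mono:
  assumes "lclose T \<rho> \<mu> \<nu> C R \<epsilon>" "\<epsilon> \<le> \<delta>" shows "lclose T \<rho> \<mu> \<nu> C R \<delta>"
  unfolding lclose_def
proof (intro ballI impI)
  fix A B assume "A \<in> sets \<mu>" "B \<in> sets \<nu>" "A \<subseteq> mcball_of T \<rho> R" "C `` A \<subseteq> B"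
  from order_trans[OF lcloseD[OF assms(1) this] add_left_mono[OF ennreal_leI[OF assms(2)]]]
  show "emeasure \<mu> A \<le> emeasure \<nu> B + ennreal \<delta>" .
qed

section \<open>Dependence on the truncation radius\<close>

context good
begin

definition bm :: "real \<Rightarrow> real" where "bm r = measure \<mu> (mcball_of T \<rho> r)"

lemma bm_eq: "emeasure \<mu> (mcball_of T \<rho> r) = ennreal (bm r)"
  unfolding bm_def using ball_fin[of r] by (intro emeasure_eq_ennreal_measure) simp

lemma bm_nonneg: "0 \<le> bm r"
  by (simp add: bm_def)

lemma ball_mono: "r \<le> s \<Longrightarrow> mcball_of T \<rho> r \<subseteq> mcball_of T \<rho> s"
  by auto

lemma bm_mono: "mono bm"
proof (rule monoI)
  fix r s :: real assume "r \<le> s"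
  then have "ennreal (bm r) \<le> ennreal (bm s)"
    unfolding bm_eq[symmetric] by (intro emeasure_mono ball_mono) simp_all
  then show "bm r \<le> bm s" by (simp add: ennreal_le_iff bm_nonneg)
qed

lemma tm_le_tm:
  assumes W: "W \<in> sets (metric_borel T)" and rs: "r \<le> s"
  shows "emeasure (tm s) W \<le> emeasure (tm r) W + ennreal (bm s - bm r)"
proof -
  let ?B = "\<lambda>r. mcball_of T \<rho> r"
  have d: "emeasure \<mu> (?B s - ?B r) = ennreal (bm s - bm r)"
    using ball_fin[of r] ball_mono[OF rs] by (subst emeasure_Diff) (simp_all add: bm_eq ennreal_minus bm_nonneg)
  have "emeasure (tm s) W = emeasure \<mu> (W \<inter> ?B s)" by (rule tm_eq[OF W])
  also have "\<dots> \<le> emeasure \<mu> ((W \<inter> ?B r) \<union> (?B s - ?B r))"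
    using W by (intro emeasure_mono sets.Un) auto
  also have "\<dots> \<le> emeasure \<mu> (W \<inter> ?B r) + emeasure \<mu> (?B s - ?B r)"
    using W by (intro emeasure_subadditive) auto
  finally show ?thesis unfolding d tm_eq[OF W] .
qed

lemma tm_mono:
  assumes W: "W \<in> sets (metric_borel T)" and rs: "r \<le> s"
  shows "emeasure (tm r) W \<le> emeasure (tm s) W"
  unfolding tm_eq[OF W] using W ball_mono[OF rs] by (intro emeasure_mono) auto

end

context good_pair
begin

text \<open>An embedding that serves the radius \<open>s\<close> also serves \<open>r\<close>;
  shrinking the balls removes at most the masses of the two shells.\<close>

lemma gpd_mono:
  assumes rs: "r \<le> s"
  shows "gpd r \<le> gpd s + (X.bm s - X.bm r) + (Y.bm s - Y.bm r)"
proof (rule field_le_epsilon)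
  fix e :: real assume e: "e > 0"
  obtain Z \<phi>\<^sub>1 \<phi>\<^sub>2 \<epsilon> where es: "emb s Z \<phi>\<^sub>1 \<phi>\<^sub>2" and \<epsilon>: "\<epsilon> < gpd s + e" and pr: "prok Z (m1 s Z \<phi>\<^sub>1) (m2 s Z \<phi>\<^sub>2) \<epsilon>"
    using gpd_lessD[of s "gpd s + e"] e by (metis less_add_same_cancel1)
  have er: "emb r Z \<phi>\<^sub>1 \<phi>\<^sub>2" by (rule emb_mono[OF es rs])
  define a where "a = X.bm s - X.bm r"
  define b where "b = Y.bm s - Y.bm r"
  have ab: "0 \<le> a" "0 \<le> b" using X.bm_mono Y.bm_mono rs by (auto simp: a_def b_def mono_def)
  have \<epsilon>0: "0 < \<epsilon>" using pr by (simp add: prok_def)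
  have "prok Z (m1 r Z \<phi>\<^sub>1) (m2 r Z \<phi>\<^sub>2) (\<epsilon> + a + b)"
    unfolding prok_def
  proof (intro conjI allI impI)
    fix A assume A: "closedin (mtopology_of Z) A"
    have Ab: "A \<in> sets (metric_borel Z)" by (rule closed_in_metric_borel[OF A])
    have AM: "A \<subseteq> mspace Z" using closedin_subset[OF A] by simp
    let ?K = "thicken Z A \<epsilon>" and ?K' = "thicken Z A (\<epsilon> + a + b)"
    have Kb: "?K \<in> sets (metric_borel Z)" "?K' \<in> sets (metric_borel Z)" using AM by (auto intro: thicken_borel)
    have KK: "?K \<subseteq> ?K'" by (rule thicken_mono) (use ab in simp)
    note Ar = emb_meas[OF er Ab] and As = emb_meas[OF es Ab]
    note Kr = emb_meas[OF er Kb(2)] and Ks = emb_meas[OF es Kb(1)]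
    have pA: "emeasure (m1 s Z \<phi>\<^sub>1) A \<le> emeasure (m2 s Z \<phi>\<^sub>2) ?K + ennreal \<epsilon>"
      "emeasure (m2 s Z \<phi>\<^sub>2) A \<le> emeasure (m1 s Z \<phi>\<^sub>1) ?K + ennreal \<epsilon>" using pr A by (auto simp: prok_def)
    have X1: "emeasure (X.tm r) {x\<in>X.ts r. \<phi>\<^sub>1 x \<in> A} \<le> emeasure (X.tm s) {x\<in>X.ts s. \<phi>\<^sub>1 x \<in> A}"
      using X.tm_mono[OF Ar(1) rs] As(1) X.ts_mono[OF rs] by (elim order_trans) (intro emeasure_mono, auto)
    have Y1: "emeasure (Y.tm r) {x\<in>Y.ts r. \<phi>\<^sub>2 x \<in> A} \<le> emeasure (Y.tm s) {x\<in>Y.ts s. \<phi>\<^sub>2 x \<in> A}"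
      using Y.tm_mono[OF Ar(2) rs] As(2) Y.ts_mono[OF rs] by (elim order_trans) (intro emeasure_mono, auto)
    have X2: "emeasure (X.tm s) {x\<in>X.ts s. \<phi>\<^sub>1 x \<in> ?K} \<le> emeasure (X.tm r) {x\<in>X.ts r. \<phi>\<^sub>1 x \<in> ?K'} + ennreal a"
    proof -
      have "emeasure (X.tm s) {x\<in>X.ts s. \<phi>\<^sub>1 x \<in> ?K} \<le> emeasure (X.tm r) {x\<in>X.ts s. \<phi>\<^sub>1 x \<in> ?K} + ennreal a"
        unfolding a_def by (rule X.tm_le_tm[OF Ks(1) rs])
      also have "emeasure (X.tm r) {x\<in>X.ts s. \<phi>\<^sub>1 x \<in> ?K} = emeasure (X.tm r) ({x\<in>X.ts s. \<phi>\<^sub>1 x \<in> ?K} \<inter> X.ts r)"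
        by (rule X.tm_ts[OF Ks(1), symmetric])
      also have "\<dots> \<le> emeasure (X.tm r) {x\<in>X.ts r. \<phi>\<^sub>1 x \<in> ?K'}"
        using Kr(1) KK by (intro emeasure_mono) auto
      finally show ?thesis by (simp add: add_right_mono)
    qed
    have Y2: "emeasure (Y.tm s) {x\<in>Y.ts s. \<phi>\<^sub>2 x \<in> ?K} \<le> emeasure (Y.tm r) {x\<in>Y.ts r. \<phi>\<^sub>2 x \<in> ?K'} + ennreal b"
    proof -
      have "emeasure (Y.tm s) {x\<in>Y.ts s. \<phi>\<^sub>2 x \<in> ?K} \<le> emeasure (Y.tm r) {x\<in>Y.ts s. \<phi>\<^sub>2 x \<in> ?K} + ennreal b"
        unfolding b_def by (rule Y.tm_le_tm[OF Ks(2) rs])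
      also have "emeasure (Y.tm r) {x\<in>Y.ts s. \<phi>\<^sub>2 x \<in> ?K} = emeasure (Y.tm r) ({x\<in>Y.ts s. \<phi>\<^sub>2 x \<in> ?K} \<inter> Y.ts r)"
        by (rule Y.tm_ts[OF Ks(2), symmetric])
      also have "\<dots> \<le> emeasure (Y.tm r) {x\<in>Y.ts r. \<phi>\<^sub>2 x \<in> ?K'}"
        using Kr(2) KK by (intro emeasure_mono) auto
      finally show ?thesis by (simp add: add_right_mono)
    qed
    have sum: "ennreal a + ennreal \<epsilon> \<le> ennreal (\<epsilon> + a + b)" "ennreal b + ennreal \<epsilon> \<le> ennreal (\<epsilon> + a + b)"
      using ab \<epsilon>0 by (auto simp flip: ennreal_plus intro!: ennreal_leI)
    have "emeasure (m1 r Z \<phi>\<^sub>1) A \<le> emeasure (m1 s Z \<phi>\<^sub>1) A" unfolding Ar(3) As(3) by (rule X1)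
    also note pA(1)
    also have "emeasure (m2 s Z \<phi>\<^sub>2) ?K + ennreal \<epsilon> \<le> (emeasure (m2 r Z \<phi>\<^sub>2) ?K' + ennreal b) + ennreal \<epsilon>"
      unfolding Kr(4) Ks(4) by (rule add_right_mono[OF Y2])
    also have "\<dots> \<le> emeasure (m2 r Z \<phi>\<^sub>2) ?K' + ennreal (\<epsilon> + a + b)"
      unfolding add.assoc by (rule add_left_mono) (use sum(2) in \<open>simp add: add.assoc\<close>)
    finally show "emeasure (m1 r Z \<phi>\<^sub>1) A \<le> emeasure (m2 r Z \<phi>\<^sub>2) ?K' + ennreal (\<epsilon> + a + b)" .
    have "emeasure (m2 r Z \<phi>\<^sub>2) A \<le> emeasure (m2 s Z \<phi>\<^sub>2) A" unfolding Ar(4) As(4) by (rule Y1)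
    also note pA(2)
    also have "emeasure (m1 s Z \<phi>\<^sub>1) ?K + ennreal \<epsilon> \<le> (emeasure (m1 r Z \<phi>\<^sub>1) ?K' + ennreal a) + ennreal \<epsilon>"
      unfolding Kr(3) Ks(3) by (rule add_right_mono[OF X2])
    also have "\<dots> \<le> emeasure (m1 r Z \<phi>\<^sub>1) ?K' + ennreal (\<epsilon> + a + b)"
      unfolding add.assoc by (rule add_left_mono) (use sum(1) in \<open>simp add: add.assoc\<close>)
    finally show "emeasure (m2 r Z \<phi>\<^sub>2) A \<le> emeasure (m1 r Z \<phi>\<^sub>1) ?K' + ennreal (\<epsilon> + a + b)" .
  qed (use \<epsilon>0 ab in simp)
  from order_trans[OF gpd_le[OF er] dP_le[OF this]]
  show "gpd r \<le> gpd s + (X.bm s - X.bm r) + (Y.bm s - Y.bm r) + e" using \<epsilon> unfolding a_def b_def by linarith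
qed

text \<open>The distance \<open>gpd\<close> becomes monotone after adding the monotone function \<open>bm + bm\<close>; otherwise
  the integral in the definition of \<^const>\<open>dGV\<close> might vanish for want of measurability.\<close>

lemma gpd_measurable: "gpd \<in> borel_measurable borel"
proof -
  have "mono (\<lambda>r. gpd r + (X.bm r + Y.bm r))"
  proof (rule monoI)
    fix r s :: real assume "r \<le> s"
    from gpd_mono[OF this] show "gpd r + (X.bm r + Y.bm r) \<le> gpd s + (X.bm s + Y.bm s)" by linarith
  qed
  then have "(\<lambda>r. gpd r + (X.bm r + Y.bm r)) \<in> borel_measurable borel" by (rule borel_measurable_mono)
  moreover have "X.bm \<in> borel_measurable borel" "Y.bm \<in> borel_measurable borel"
    by (rule borel_measurable_mono, rule X.bm_mono, rule borel_measurable_mono, rule Y.bm_mono)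
  ultimately have "(\<lambda>r. (gpd r + (X.bm r + Y.bm r)) - (X.bm r + Y.bm r)) \<in> borel_measurable borel" by measurable
  then show ?thesis by simp
qed

abbreviation "integrand r \<equiv> indicator {0..} r *\<^sub>R (exp (- r) * min 1 (gpd r))"

lemma integrand_meas: "integrand \<in> borel_measurable lborel"
  using gpd_measurable by measurable

lemma integrand_bounds: "0 \<le> integrand r" "integrand r \<le> indicator {0..} r *\<^sub>R exp (- r)"
  using gpd_nonneg[of r] by (auto split: split_indicator)

lemma dGV_eq: "dGV (T, \<rho>, \<mu>) (T', \<rho>', \<nu>) = (\<integral>r. integrand r \<partial>lborel)"
  by (simp add: dGV_def set_lebesgue_integral_def)

end

lemma integrable_exp_minus: "integrable lborel (\<lambda>r::real. indicator {0..} r *\<^sub>R exp (- r))"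
proof -
  have "(\<lambda>x. exp (-1 * x) :: real) absolutely_integrable_on {0..}"
    by (intro nonnegative_absolutely_integrable_1 integrable_on_exp_minus_to_infinity) auto
  then have "integrable lebesgue (\<lambda>r::real. indicator {0..} r *\<^sub>R exp (- r))"
    by (simp add: set_integrable_def)
  then show ?thesis by (subst (asm) integrable_completion) auto
qed

context good_pair
begin

lemma integrand_integrable: "integrable lborel integrand"
proof (rule Bochner_Integration.integrable_bound[OF integrable_exp_minus integrand_meas])
  show "AE r in lborel. norm (integrand r) \<le> norm (indicator {0..} r *\<^sub>R exp (- r))"
    using integrand_bounds by (intro AE_I2) (simp only: real_norm_def abs_of_nonneg order_trans[OF integrand_bounds])
qed

text \<open>If the distance were at least \<epsilon> on the whole interval, this unit interval alone
  would contribute exp (-(R + 1)) \<epsilon> to the integral.\<close>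

lemma dGV_small:
  assumes d: "dGV (T, \<rho>, \<mu>) (T', \<rho>', \<nu>) < exp (- (R + 1)) * \<epsilon>" and R: "0 \<le> R" and \<epsilon>: "0 < \<epsilon>" "\<epsilon> \<le> 1"
  shows "\<exists>s\<in>{R..R+1}. gpd s < \<epsilon>"
proof (rule ccontr)
  assume "\<not> ?thesis"
  then have ge: "\<epsilon> \<le> gpd s" if "s \<in> {R..R+1}" for s using that by (auto simp: not_less)
  have "exp (- (R + 1)) * \<epsilon> = (\<integral>r. indicator {R..R+1} r *\<^sub>R (exp (- (R + 1)) * \<epsilon>) \<partial>lborel)" by simp
  also have "\<dots> \<le> (\<integral>r. integrand r \<partial>lborel)"
  proof (rule integral_mono[OF _ integrand_integrable])
    show "integrable lborel (\<lambda>r. indicator {R..R+1} r *\<^sub>R (exp (- (R + 1)) * \<epsilon>))"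
      by (intro integrable_scaleR_left integrable_real_indicator) simp_all
    show "indicator {R..R+1} r *\<^sub>R (exp (- (R + 1)) * \<epsilon>) \<le> integrand r" for r
    proof (cases "r \<in> {R..R+1}")
      case True
      have "exp (- (R + 1)) * \<epsilon> \<le> exp (- r) * min 1 (gpd r)"
        using True ge[OF True] \<epsilon> by (intro mult_mono) auto
      then show ?thesis using True R by simp
    next
      case False
      then show ?thesis using integrand_bounds(1)[of r] by simp
    qed
  qed
  finally show False using d unfolding dGV_eq by simp
qed

lemma lclose_of_mclose:
  assumes m: "mclose (X.tm s) (Y.tm s) C e" and R: "R \<le> s"
  shows "lclose T \<rho> \<mu> \<nu> C R e"
  unfolding lclose_def X.sets_mu Y.sets_mu
proof (intro ballI impI)
  fix A B assume A: "A \<in> sets (metric_borel T)" and B: "B \<in> sets (metric_borel T')" and AR: "A \<subseteq> mcball_of T \<rho> R" and AB: "C `` A \<subseteq> B"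
  have "A \<inter> mcball_of T \<rho> s = A" using AR X.ball_mono[OF R] by blast
  then have "emeasure \<mu> A = emeasure (X.tm s) A" using X.tm_eq[OF A, of s] by simp
  also have "\<dots> \<le> emeasure (Y.tm s) B + ennreal e" by (rule mcloseD[OF m]) (use A B AB in simp_all)
  also have "emeasure (Y.tm s) B \<le> emeasure \<nu> B" unfolding Y.tm_eq[OF B] using B by (intro emeasure_mono) auto
  finally show "emeasure \<mu> A \<le> emeasure \<nu> B + ennreal e" by (simp add: add_right_mono)
qed

text \<open>Related points may differ in height by \<epsilon>, so a shell of that width has to be
  given up at radius r. Here and in \<open>mclose_of_lclose2\<close> it is a shell of the first
  tree, later the limit, whose mass is controlled by continuity.\<close>

lemma mclose_of_lclose1:
  assumes l: "lclose T \<rho> \<mu> \<nu> C r \<epsilon>" and C: "gclose T \<rho> T' \<rho>' C \<epsilon>" and \<epsilon>: "0 \<le> \<epsilon>"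
  shows "mclose (X.tm r) (Y.tm r) C (\<epsilon> + (X.bm r - X.bm (r - \<epsilon>)))"
  unfolding mclose_def X.sets_tm Y.sets_tm
proof (intro ballI impI)
  fix A B assume A: "A \<in> sets (metric_borel T)" and B: "B \<in> sets (metric_borel T')" and AB: "C `` A \<subseteq> B"
  let ?b = "X.bm r - X.bm (r - \<epsilon>)"
  have b: "0 \<le> ?b" using X.bm_mono \<epsilon> by (simp add: mono_def)
  have "emeasure (X.tm r) A \<le> emeasure (X.tm (r - \<epsilon>)) A + ennreal ?b" by (rule X.tm_le_tm[OF A]) (use \<epsilon> in simp)
  also have "emeasure (X.tm (r - \<epsilon>)) A = emeasure \<mu> (A \<inter> mcball_of T \<rho> (r - \<epsilon>))" by (rule X.tm_eq[OF A])
  also have "\<dots> \<le> emeasure \<nu> (B \<inter> mcball_of T' \<rho>' r) + ennreal \<epsilon>"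
  proof (rule lcloseD[OF l])
    show "A \<inter> mcball_of T \<rho> (r - \<epsilon>) \<subseteq> mcball_of T \<rho> r" using X.ball_mono[of "r - \<epsilon>" r] \<epsilon> by auto
    show "C `` (A \<inter> mcball_of T \<rho> (r - \<epsilon>)) \<subseteq> B \<inter> mcball_of T' \<rho>' r"
    proof
      fix y assume "y \<in> C `` (A \<inter> mcball_of T \<rho> (r - \<epsilon>))"
      then obtain x where x: "(x, y) \<in> C" "x \<in> A" "mdist T \<rho> x \<le> r - \<epsilon>" by auto
      have "mdist T' \<rho>' y \<le> r" using gclose_ht[OF C x(1)] x(3) by linarith
      then show "y \<in> B \<inter> mcball_of T' \<rho>' r" using x AB gclose_in[OF C x(1)] Y.root by auto
    qed
  qed (use A B in auto)
  also have "emeasure \<nu> (B \<inter> mcball_of T' \<rho>' r) = emeasure (Y.tm r) B" by (rule Y.tm_eq[OF B, symmetric])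
  finally have "emeasure (X.tm r) A \<le> emeasure (Y.tm r) B + ennreal \<epsilon> + ennreal ?b" by (simp add: add_right_mono)
  then show "emeasure (X.tm r) A \<le> emeasure (Y.tm r) B + ennreal (\<epsilon> + ?b)" using b \<epsilon> by (simp add: add.assoc)
qed

lemma mclose_of_lclose2:
  assumes l: "lclose T' \<rho>' \<nu> \<mu> (C\<inverse>) r \<epsilon>" and C: "gclose T \<rho> T' \<rho>' C \<epsilon>" and \<epsilon>: "0 \<le> \<epsilon>"
  shows "mclose (Y.tm r) (X.tm r) (C\<inverse>) (\<epsilon> + (X.bm (r + \<epsilon>) - X.bm r))"
  unfolding mclose_def X.sets_tm Y.sets_tm
proof (intro ballI impI)
  fix A B assume A: "A \<in> sets (metric_borel T')" and B: "B \<in> sets (metric_borel T)" and AB: "C\<inverse> `` A \<subseteq> B"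
  let ?b = "X.bm (r + \<epsilon>) - X.bm r"
  have b: "0 \<le> ?b" using X.bm_mono \<epsilon> by (simp add: mono_def)
  have "emeasure (Y.tm r) A = emeasure \<nu> (A \<inter> mcball_of T' \<rho>' r)" by (rule Y.tm_eq[OF A])
  also have "\<dots> \<le> emeasure \<mu> (B \<inter> mcball_of T \<rho> (r + \<epsilon>)) + ennreal \<epsilon>"
  proof (rule lcloseD[OF l])
    show "C\<inverse> `` (A \<inter> mcball_of T' \<rho>' r) \<subseteq> B \<inter> mcball_of T \<rho> (r + \<epsilon>)"
    proof
      fix x assume "x \<in> C\<inverse> `` (A \<inter> mcball_of T' \<rho>' r)"
      then obtain y where x: "(x, y) \<in> C" "y \<in> A" "mdist T' \<rho>' y \<le> r" by auto
      have "mdist T \<rho> x \<le> r + \<epsilon>" using gclose_ht[OF C x(1)] x(3) by linarith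
      then show "x \<in> B \<inter> mcball_of T \<rho> (r + \<epsilon>)" using x AB gclose_in[OF C x(1)] X.root by auto
    qed
  qed (use A B in auto)
  also have "emeasure \<mu> (B \<inter> mcball_of T \<rho> (r + \<epsilon>)) = emeasure (X.tm (r + \<epsilon>)) B" by (rule X.tm_eq[OF B, symmetric])
  also have "\<dots> \<le> emeasure (X.tm r) B + ennreal ?b" by (rule X.tm_le_tm[OF B]) (use \<epsilon> in simp)
  finally have "emeasure (Y.tm r) A \<le> emeasure (X.tm r) B + ennreal ?b + ennreal \<epsilon>" by (simp add: add_right_mono)
  then show "emeasure (Y.tm r) A \<le> emeasure (X.tm r) B + ennreal (\<epsilon> + ?b)" using b \<epsilon> by (simp add: ac_simps)
qed

end

definition locally_close :: "'a metric \<Rightarrow> 'a \<Rightarrow> 'a measure \<Rightarrow> 'b metric \<Rightarrow> 'b \<Rightarrow> 'b measure \<Rightarrow> real \<Rightarrow> real \<Rightarrow> bool" where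
  "locally_close T \<rho> \<mu> T' \<rho>' \<nu> R \<epsilon> \<longleftrightarrow> (\<exists>C. gclose T \<rho> T' \<rho>' C \<epsilon> \<and> lclose T \<rho> \<mu> \<nu> C R \<epsilon> \<and> lclose T' \<rho>' \<nu> \<mu> (C\<inverse>) R \<epsilon>)"

lemma GV_imp_locally_close:
  assumes g: "good_tree T \<rho> \<mu>" and gn: "\<And>n. good_tree (Tn n) (\<rho>n n) (\<mu>n n)"
    and GV: "GV_converges (\<lambda>n. (Tn n, \<rho>n n, \<mu>n n)) (T, \<rho>, \<mu>)" and \<epsilon>: "\<epsilon> > 0"
  shows "\<forall>\<^sub>F n in sequentially. locally_close T \<rho> \<mu> (Tn n) (\<rho>n n) (\<mu>n n) R \<epsilon>"
proof -
  define R' where "R' = max R 0"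
  define e where "e = min 1 (\<epsilon> / 2)"
  have e: "0 < e" "e \<le> 1" "2 * e \<le> \<epsilon>" "e \<le> \<epsilon>" using \<epsilon> by (auto simp: e_def)
  have "\<forall>\<^sub>F n in sequentially. dGV (Tn n, \<rho>n n, \<mu>n n) (T, \<rho>, \<mu>) < exp (- (R' + 1)) * e"
    using GV unfolding GV_converges_def by (rule order_tendstoD) (use e in simp)
  then show ?thesis
  proof (rule eventually_mono)
    fix n assume d: "dGV (Tn n, \<rho>n n, \<mu>n n) (T, \<rho>, \<mu>) < exp (- (R' + 1)) * e"
    interpret P: good_pair "Tn n" "\<rho>n n" "\<mu>n n" T \<rho> \<mu> by (intro good_pair.intro good.intro g gn)
    interpret P': good_pair T \<rho> \<mu> "Tn n" "\<rho>n n" "\<mu>n n" by (intro good_pair.intro good.intro g gn)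
    obtain s where s: "R' \<le> s" "P.gpd s < e" using P.dGV_small[OF d _ e(1,2)] by (auto simp: R'_def)
    obtain C where C: "gclose (Tn n) (\<rho>n n) T \<rho> C (2 * e)" "mclose (P.X.tm s) (P.Y.tm s) C e" "mclose (P.Y.tm s) (P.X.tm s) (C\<inverse>) e"
      using P.gpd_close[OF s(2)] by blast
    have Rs: "R \<le> s" using s by (simp add: R'_def)
    have "gclose T \<rho> (Tn n) (\<rho>n n) (C\<inverse>) \<epsilon>" by (rule gclose_mono[OF gclose_converse[OF C(1)] e(3)])
    moreover have "lclose T \<rho> \<mu> (\<mu>n n) (C\<inverse>) R \<epsilon>"
      by (rule lclose_mono[OF P'.lclose_of_mclose[OF C(3) Rs] e(4)])
    moreover have "lclose (Tn n) (\<rho>n n) (\<mu>n n) \<mu> C R \<epsilon>"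
      by (rule lclose_mono[OF P.lclose_of_mclose[OF C(2) Rs] e(4)])
    ultimately show "locally_close T \<rho> \<mu> (Tn n) (\<rho>n n) (\<mu>n n) R \<epsilon>"
      unfolding locally_close_def by (intro exI[of _ "C\<inverse>"]) simp
  qed
qed

text \<open>At a continuity point of the ball mass of the limit, thin shells have small mass and the
  truncated distances tend to 0. There are only countably many other radii, and dominated
  convergence finishes the argument.\<close>

lemma locally_close_imp_GV:
  assumes g: "good_tree T \<rho> \<mu>" and gn: "\<And>n. good_tree (Tn n) (\<rho>n n) (\<mu>n n)"
    and cl: "\<And>R \<epsilon>. \<epsilon> > 0 \<Longrightarrow> \<forall>\<^sub>F n in sequentially. locally_close T \<rho> \<mu> (Tn n) (\<rho>n n) (\<mu>n n) R \<epsilon>"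
  shows "GV_converges (\<lambda>n. (Tn n, \<rho>n n, \<mu>n n)) (T, \<rho>, \<mu>)"
proof -
  interpret Y: good T \<rho> \<mu> by (rule good.intro[OF g])
  have gp: "good_pair (Tn n) (\<rho>n n) (\<mu>n n) T \<rho> \<mu>" for n by (intro good_pair.intro good.intro g gn)
  let ?gpd = "\<lambda>n r. dGP (trunc_tree r (Tn n, \<rho>n n, \<mu>n n)) (trunc_tree r (T, \<rho>, \<mu>))"
  have lim: "(\<lambda>n. ?gpd n r) \<longlonglongrightarrow> 0" if cont: "isCont Y.bm r" for r
  proof (rule tendstoI)
    fix e :: real assume e: "e > 0"
    obtain d where d: "d > 0" "\<And>s. \<bar>s - r\<bar> < d \<Longrightarrow> \<bar>Y.bm s - Y.bm r\<bar> < e / 8"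
    proof -
      have "\<exists>d>0. \<forall>s. norm (s - r) < d \<longrightarrow> norm (Y.bm s - Y.bm r) < e / 8"
        using cont e unfolding isCont_def LIM_eq by (metis diff_self divide_pos_pos norm_zero zero_less_numeral)
      then show ?thesis using that by (auto simp: real_norm_def)
    qed
    define \<epsilon> where "\<epsilon> = min (d / 2) (e / 8)"
    have \<epsilon>: "0 < \<epsilon>" "\<epsilon> < d" "\<epsilon> \<le> e / 8" using d e by (auto simp: \<epsilon>_def)
    have "\<bar>Y.bm (r - \<epsilon>) - Y.bm r\<bar> < e / 8" by (rule d(2)) (use \<epsilon> in simp)
    then have b1: "Y.bm r - Y.bm (r - \<epsilon>) \<le> e / 8" by linarith
    have "\<bar>Y.bm (r + \<epsilon>) - Y.bm r\<bar> < e / 8" by (rule d(2)) (use \<epsilon> in simp)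
    then have b2: "Y.bm (r + \<epsilon>) - Y.bm r \<le> e / 8" by linarith
    show "\<forall>\<^sub>F n in sequentially. dist (?gpd n r) 0 < e"
      using cl[OF \<epsilon>(1), of r]
    proof (rule eventually_mono)
      fix n assume "locally_close T \<rho> \<mu> (Tn n) (\<rho>n n) (\<mu>n n) r \<epsilon>"
      then obtain C where C: "gclose T \<rho> (Tn n) (\<rho>n n) C \<epsilon>" "lclose T \<rho> \<mu> (\<mu>n n) C r \<epsilon>" "lclose (Tn n) (\<rho>n n) (\<mu>n n) \<mu> (C\<inverse>) r \<epsilon>"
        unfolding locally_close_def by blast
      interpret P: good_pair "Tn n" "\<rho>n n" "\<mu>n n" T \<rho> \<mu> by (rule gp)
      interpret P': good_pair T \<rho> \<mu> "Tn n" "\<rho>n n" "\<mu>n n" by (intro good_pair.intro good.intro g gn)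
      have a: "mclose (Y.tm r) (P.X.tm r) C (e / 4)"
        by (rule mclose_mono[OF P'.mclose_of_lclose1[OF C(2,1)]]) (use \<epsilon> b1 in simp_all)
      have b: "mclose (P.X.tm r) (Y.tm r) (C\<inverse>) (e / 4)"
        by (rule mclose_mono[OF P'.mclose_of_lclose2[OF C(3,1)]]) (use \<epsilon> b2 in simp_all)
      have c: "gclose (Tn n) (\<rho>n n) T \<rho> (C\<inverse>) (e / 4)"
        by (rule gclose_mono[OF gclose_converse[OF C(1)]]) (use \<epsilon> e in simp)
      have "P.gpd r \<le> 2 * (e / 4)"
        by (rule P.close_gpd[OF c _ b]) (use a e in simp_all)
      then show "dist (P.gpd r) 0 < e" using P.gpd_nonneg[of r] e by (simp add: dist_real_def)
    qed
  qed
  have "(\<lambda>n. \<integral>r. indicator {0..} r *\<^sub>R (exp (- r) * min 1 (?gpd n r)) \<partial>lborel) \<longlonglongrightarrow> integral\<^sup>L lborel (\<lambda>r::real. 0)"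
  proof (rule integral_dominated_convergence[where w="\<lambda>r. indicator {0..} r *\<^sub>R exp (- r)"])
    show "integrable lborel (\<lambda>r::real. indicator {0..} r *\<^sub>R exp (- r))" by (rule integrable_exp_minus)
    show "(\<lambda>r. indicator {0..} r *\<^sub>R (exp (- r) * min 1 (?gpd n r))) \<in> borel_measurable lborel" for n
      by (rule good_pair.integrand_meas[OF gp])
    show "AE r in lborel. norm (indicator {0..} r *\<^sub>R (exp (- r) * min 1 (?gpd n r))) \<le> indicator {0..} r *\<^sub>R exp (- r)" for n
      using good_pair.integrand_bounds[OF gp[of n]] by (intro AE_I2) (simp only: real_norm_def abs_of_nonneg)
    have "{r. \<not> isCont Y.bm r} \<in> null_sets lborel"
      by (intro countable_imp_null_set_lborel mono_ctble_discont Y.bm_mono)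
    then show "AE r in lborel. (\<lambda>n. indicator {0..} r *\<^sub>R (exp (- r) * min 1 (?gpd n r))) \<longlonglongrightarrow> 0"
    proof (rule AE_I'[OF _ subsetI])
      fix r assume "r \<in> {r \<in> space lborel. \<not> (\<lambda>n. indicator {0..} r *\<^sub>R (exp (- r) * min 1 (?gpd n r))) \<longlonglongrightarrow> 0}"
      moreover have "(\<lambda>n. indicator {0..} r *\<^sub>R (exp (- r) * min 1 (?gpd n r))) \<longlonglongrightarrow> 0" if "isCont Y.bm r"
      proof -
        have "(\<lambda>n. indicator {0..} r *\<^sub>R (exp (- r) * min 1 (?gpd n r))) \<longlonglongrightarrow> indicator {0..} r *\<^sub>R (exp (- r) * min 1 0)"
          by (intro tendsto_intros tendsto_min lim that)
        then show ?thesis by simp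
      qed
      ultimately show "r \<in> {r. \<not> isCont Y.bm r}" by blast
    qed
  qed simp
  then show ?thesis
    unfolding GV_converges_def good_pair.dGV_eq[OF gp] by simp
qed

section \<open>Cut-off\<close>

lemma emeasure_mrestrict:
  "A \<in> sets \<mu> \<Longrightarrow> B \<in> sets \<mu> \<Longrightarrow> emeasure (mrestrict \<mu> B) A = emeasure \<mu> (A \<inter> B)"
  unfolding mrestrict_def by (subst emeasure_restricted) (simp_all add: Int_commute)

section \<open>Cut sets and measures with atoms at the cut points\<close>

context rooted_rtree
begin

text \<open>A point above height q lies above exactly one point of the sphere, its ancestor at
  height q. This trades an uncountable union for the finitely many sets above
  \<open>D\<close>.\<close>

lemma Cut_iff:
  assumes D: "D \<subseteq> msphere_of T \<rho> q" and q: "0 \<le> q"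
  shows "x \<in> Cut T \<rho> q D \<longleftrightarrow> x \<in> mspace T \<and> (ht x \<le> q \<or> (\<forall>\<sigma>\<in>D. x \<notin> above T \<rho> \<sigma>))"
proof
  assume x: "x \<in> Cut T \<rho> q D"
  have "x \<notin> above T \<rho> \<sigma>" if s: "\<sigma> \<in> D" and gt: "\<not> ht x \<le> q" for \<sigma>
  proof
    assume a: "x \<in> above T \<rho> \<sigma>"
    obtain \<tau> where t: "\<tau> \<in> msphere_of T \<rho> q" "\<tau> \<notin> D" "x \<in> above T \<rho> \<tau>"
      using x gt by (auto simp: Cut_def)
    have "ht \<sigma> = q" "ht \<tau> = q" using s t(1) D by (auto simp: msphere_of_def)
    then have "\<sigma> = \<tau>" using a t(3) by (simp add: above_iff')
    then show False using s t(2) by simp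
  qed
  moreover have "x \<in> mspace T" using x above_sub by (auto simp: Cut_def)
  ultimately show "x \<in> mspace T \<and> (ht x \<le> q \<or> (\<forall>\<sigma>\<in>D. x \<notin> above T \<rho> \<sigma>))" by blast
next
  assume x: "x \<in> mspace T \<and> (ht x \<le> q \<or> (\<forall>\<sigma>\<in>D. x \<notin> above T \<rho> \<sigma>))"
  show "x \<in> Cut T \<rho> q D"
  proof (cases "ht x \<le> q")
    case True then show ?thesis using x by (simp add: Cut_def)
  next
    case False
    then have a: "x \<in> above T \<rho> (pt x q)" and p: "pt x q \<in> msphere_of T \<rho> q"
      using x q above_pt[of x q] pt_in[of x q] ht_pt[of x q] by (simp_all add: msphere_of_def)
    then have "pt x q \<notin> D" using x False by blast
    then show ?thesis using a p by (auto simp: Cut_def)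
  qed
qed

lemma Cut_sub: "D \<subseteq> msphere_of T \<rho> q \<Longrightarrow> 0 \<le> q \<Longrightarrow> Cut T \<rho> q D \<subseteq> mspace T"
  by (auto simp: Cut_iff)

lemma Cut_borel:
  assumes D: "D \<subseteq> msphere_of T \<rho> q" and q: "0 \<le> q" and fin: "finite D"
  shows "Cut T \<rho> q D \<in> sets (metric_borel T)"
proof -
  have "Cut T \<rho> q D = mcball_of T \<rho> q \<union> (mspace T - (\<Union>\<sigma>\<in>D. above T \<rho> \<sigma>))"
    by (auto simp: Cut_iff[OF D q])
  also have "\<dots> \<in> sets (metric_borel T)"
    using fin by (intro sets.Un sets.Diff sets.finite_UN) simp_all
  finally show ?thesis .
qed

lemma above_low_Cut:
  assumes D: "D \<subseteq> msphere_of T \<rho> q" and q: "0 \<le> q" and x: "ht x < q" "D \<inter> above T \<rho> x = {}"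
  shows "above T \<rho> x \<subseteq> Cut T \<rho> q D"
proof
  fix y assume y: "y \<in> above T \<rho> x"
  have "y \<notin> above T \<rho> \<sigma>" if s: "\<sigma> \<in> D" for \<sigma>
  proof
    assume "y \<in> above T \<rho> \<sigma>"
    moreover have "ht \<sigma> = q" using s D by (auto simp: msphere_of_def)
    ultimately have "\<sigma> \<in> above T \<rho> x" using above_comparable[OF y] x by simp
    then show False using s x by blast
  qed
  then show "y \<in> Cut T \<rho> q D" using y above_sub[of x] by (auto simp: Cut_iff[OF D q])
qed

end

text \<open>The atoms of size \<open>M \<ge> h\<close> keep the points below \<open>D\<close> in \<open>R\<close>.\<close>

definition cut_measure :: "'a metric \<Rightarrow> 'a \<Rightarrow> 'a measure \<Rightarrow> real \<Rightarrow> 'a set \<Rightarrow> real \<Rightarrow> 'a measure" where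
  "cut_measure T \<rho> \<mu> q D M = measure_of (mspace T) (sets (metric_borel T))
     (\<lambda>A. emeasure \<mu> (A \<inter> Cut T \<rho> q D) + infsum (\<lambda>_. ennreal M) (D \<inter> A))"

context tree_measure
begin

lemma pj_in_above: "x \<in> mspace T \<Longrightarrow> \<sigma> \<in> R h \<Longrightarrow> x \<in> above T \<rho> \<sigma> \<Longrightarrow> pj h x \<in> above T \<rho> \<sigma>"
  using tree_proj_above_iff[OF rsub_Rh closed_Rh] Rh_sub by blast

lemma sets_cut_measure: "sets (cut_measure T \<rho> \<mu> q D M) = sets (metric_borel T)"
  and space_cut_measure: "space (cut_measure T \<rho> \<mu> q D M) = mspace T"
  unfolding cut_measure_def using sets.space_closed[of "metric_borel T"] sets.sets_measure_of_eq[of "metric_borel T"]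
  by simp_all

lemma cut_measure_eq:
  assumes D: "D \<subseteq> msphere_of T \<rho> q" and q: "0 \<le> q" and fin: "finite D" and A: "A \<in> sets (metric_borel T)"
  shows "emeasure (cut_measure T \<rho> \<mu> q D M) A = emeasure \<mu> (A \<inter> Cut T \<rho> q D) + of_nat (card (D \<inter> A)) * ennreal M"
proof -
  let ?f = "\<lambda>A. emeasure \<mu> (A \<inter> Cut T \<rho> q D) + infsum (\<lambda>_. ennreal M) (D \<inter> A)"
  have "emeasure (cut_measure T \<rho> \<mu> q D M) A = ?f A"
  proof (rule emeasure_measure_of[OF cut_measure_def])
    show "sets (metric_borel T) \<subseteq> Pow (mspace T)" using sets.space_closed[of "metric_borel T"] by simp
    show "positive (sets (cut_measure T \<rho> \<mu> q D M)) ?f" by (simp add: positive_def)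
    have "countably_additive (sets \<mu>) (\<lambda>A. emeasure \<mu> (A \<inter> Cut T \<rho> q D))"
      by (intro countably_additive_Int emeasure_countably_additive sets.Int) (simp_all add: Cut_borel[OF D q fin])
    then show "countably_additive (sets (cut_measure T \<rho> \<mu> q D M)) ?f"
      unfolding sets_cut_measure by (intro countably_additive_add countably_additive_infsum) simp
    show "A \<in> sets (cut_measure T \<rho> \<mu> q D M)" using A by (simp add: sets_cut_measure)
  qed
  then show ?thesis using fin by simp
qed

lemma cut_measure_finite:
  assumes D: "D \<subseteq> msphere_of T \<rho> q" and q: "0 \<le> q" and fin: "finite D" and c: "emeasure \<mu> (Cut T \<rho> q D) < \<infinity>"
  shows "finite_tree_measure T \<rho> (cut_measure T \<rho> \<mu> q D M)"
proof
  show "borel_measure_on T (cut_measure T \<rho> \<mu> q D M)" by (simp add: borel_measure_on_def sets_cut_measure space_cut_measure)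
  have "mspace T \<inter> Cut T \<rho> q D = Cut T \<rho> q D" using Cut_sub[OF D q] by blast
  then show "emeasure (cut_measure T \<rho> \<mu> q D M) (mspace T) < \<infinity>"
    using c by (simp add: cut_measure_eq[OF D q fin] ennreal_mult_less_top of_nat_less_top)
qed

lemma cut_measure_above:
  assumes D: "D \<subseteq> msphere_of T \<rho> q" and q: "0 \<le> q" and fin: "finite D" and x: "x \<in> mspace T" "ht x < q"
  shows "D \<inter> above T \<rho> x = {} \<Longrightarrow> emeasure (cut_measure T \<rho> \<mu> q D M) (above T \<rho> x) = emeasure \<mu> (above T \<rho> x)"
    and "D \<inter> above T \<rho> x \<noteq> {} \<Longrightarrow> ennreal M \<le> emeasure (cut_measure T \<rho> \<mu> q D M) (above T \<rho> x)"
proof -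
  assume "D \<inter> above T \<rho> x = {}"
  moreover have "above T \<rho> x \<inter> Cut T \<rho> q D = above T \<rho> x" using above_low_Cut[OF D q x(2) calculation] by blast
  ultimately show "emeasure (cut_measure T \<rho> \<mu> q D M) (above T \<rho> x) = emeasure \<mu> (above T \<rho> x)"
    by (simp add: cut_measure_eq[OF D q fin])
next
  assume "D \<inter> above T \<rho> x \<noteq> {}"
  then have "1 \<le> card (D \<inter> above T \<rho> x)" using fin by (simp add: Suc_le_eq card_gt_0_iff)
  then have "(1::ennreal) \<le> of_nat (card (D \<inter> above T \<rho> x))" by (metis of_nat_1 of_nat_mono)
  then have "1 * ennreal M \<le> of_nat (card (D \<inter> above T \<rho> x)) * ennreal M" by (rule mult_right_mono) simp
  then show "ennreal M \<le> emeasure (cut_measure T \<rho> \<mu> q D M) (above T \<rho> x)"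
    using x by (simp add: cut_measure_eq[OF D q fin] add_increasing)
qed

text \<open>Below height q both measures have the same R: sets theta_x that avoid \<open>D\<close>
  have equal mass, and the others have mass at least h on either side. \<open>Psi_local\<close> then
  applies with the slack q - r as upward neighbourhood.\<close>

lemma erase_cut_measure:
  assumes D: "D \<subseteq> msphere_of T \<rho> q" and fin: "finite D" and c: "emeasure \<mu> (Cut T \<rho> q D) < \<infinity>"
    and h: "h > 0" "h \<le> M" and Dh: "\<And>\<sigma>. \<sigma> \<in> D \<Longrightarrow> ennreal h \<le> emeasure \<mu> (above T \<rho> \<sigma>)"
    and A: "A \<in> sets (metric_borel T)" "A \<subseteq> mcball_of T \<rho> r" and rq: "r < q" and q: "0 < q"
  shows "emeasure (erase T \<rho> h \<mu>) A = emeasure (erase T \<rho> h (cut_measure T \<rho> \<mu> q D M)) A"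
proof -
  let ?\<nu> = "cut_measure T \<rho> \<mu> q D M"
  note q0 = less_imp_le[OF q]
  interpret N: finite_tree_measure T \<rho> ?\<nu> by (rule cut_measure_finite[OF D q0 fin c])
  have low: "ennreal h \<le> emeasure \<mu> (above T \<rho> x) \<longleftrightarrow> ennreal h \<le> emeasure ?\<nu> (above T \<rho> x)"
    if x: "x \<in> mspace T" "ht x < q" for x
  proof (cases "D \<inter> above T \<rho> x = {}")
    case True then show ?thesis using cut_measure_above(1)[OF D q0 fin x] by simp
  next
    case False
    then obtain \<sigma> where s: "\<sigma> \<in> D" "\<sigma> \<in> above T \<rho> x" by blast
    have "ennreal h \<le> emeasure \<mu> (above T \<rho> \<sigma>)" by (rule Dh[OF s(1)])
    also have "\<dots> \<le> emeasure \<mu> (above T \<rho> x)" by (intro emeasure_mono above_mono s) simp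
    finally have "ennreal h \<le> emeasure \<mu> (above T \<rho> x)" .
    moreover have "ennreal h \<le> emeasure ?\<nu> (above T \<rho> x)"
      by (rule order_trans[OF ennreal_leI[OF h(2)] cut_measure_above(2)[OF D q0 fin x False]])
    ultimately show ?thesis by simp
  qed
  have tot: "ennreal h \<le> emeasure \<mu> (mspace T) \<longleftrightarrow> ennreal h \<le> emeasure ?\<nu> (mspace T)"
    using low[of \<rho>] q by (simp add: above_root)
  show ?thesis
  proof (cases "ennreal h \<le> emeasure \<mu> (mspace T)")
    case False
    have "emeasure \<mu> (mspace T) < ennreal h" using False by (simp only: not_le)
    moreover have "emeasure ?\<nu> (mspace T) < ennreal h" using False unfolding tot by (simp only: not_le)
    ultimately show ?thesis by (simp add: erase_small N.erase_small)
  next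
    case True
    have "Psi h A = N.Psi h A"
    proof (rule Psi_local[where V="mcball_of T \<rho> r" and V'="{x\<in>mspace T. ht x < q}"])
      show "tree_measure T \<rho> \<mu>" "tree_measure T \<rho> ?\<nu>" by unfold_locales
      show "mcball_of T \<rho> r \<subseteq> {x\<in>mspace T. ht x < q}" using rq by auto
      show "R h \<inter> {x\<in>mspace T. ht x < q} = N.R h \<inter> {x\<in>mspace T. ht x < q}"
        using low by (auto simp: Rh_iff N.Rh_iff)
      show "\<exists>d>0. \<forall>t. ht y \<le> t \<longrightarrow> t < ht y + d \<longrightarrow> t \<le> ht z \<longrightarrow> pt z t \<in> {x\<in>mspace T. ht x < q}"
        if y: "y \<in> mcball_of T \<rho> r" and z: "z \<in> above T \<rho> y" for y z
      proof (intro exI[of _ "q - r"] conjI allI impI)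
        fix t assume t: "ht y \<le> t" "t < ht y + (q - r)" "t \<le> ht z"
        have "z \<in> mspace T" "0 \<le> t" using z t(1) above_sub[of y] by (auto intro: order_trans[OF _ t(1)])
        then show "pt z t \<in> {x\<in>mspace T. ht x < q}" using t y pt_in[of z t] ht_pt[of z t] by simp
      qed (use rq in simp)
      fix B assume B: "B \<in> sets (metric_borel T)" and Bp: "\<And>x. x \<in> B \<Longrightarrow> pj h x \<in> mcball_of T \<rho> r"
      \<comment> \<open>The cut points belong to R, so whatever lies above them projects to height
        at least q and contributes nothing inside the ball.\<close>
      have nab: "x \<notin> above T \<rho> \<sigma>" if x: "x \<in> B" and s: "\<sigma> \<in> D" for x \<sigma>
      proof
        assume a: "x \<in> above T \<rho> \<sigma>"
        have sm: "\<sigma> \<in> mspace T" "ht \<sigma> = q" using s D by (auto simp: msphere_of_def)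
        have "x \<in> mspace T" using a above_sub[of \<sigma>] by blast
        moreover have "\<sigma> \<in> R h" using Dh[OF s] sm by (simp add: Rh_iff)
        ultimately have "pj h x \<in> above T \<rho> \<sigma>" using a by (rule pj_in_above)
        then have "q \<le> ht (pj h x)" using above_ht sm by metis
        then show False using Bp[OF x] rq by simp
      qed
      have BT: "B \<subseteq> mspace T" using sets.sets_into_space[OF B] by simp
      have "B \<subseteq> Cut T \<rho> q D" using nab BT by (auto simp: Cut_iff[OF D q0])
      moreover have "D \<inter> B = {}" using nab above_refl BT by blast
      ultimately show "emeasure \<mu> B = emeasure ?\<nu> B"
        by (simp add: cut_measure_eq[OF D q0 fin B] Int_absorb2)
    qed (use h A in auto)
    then show ?thesis
      using erase_Psi(2)[OF h(1) True A(1)] N.erase_Psi(2)[OF h(1) tot[THEN iffD1, OF True] A(1)] by simp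
  qed
qed

text \<open>The region is closed upwards, so by \<open>Psi_local\<close> the erased measure there is
  determined by the restriction of \<mu> to it. For this finite restriction erasure cannot increase
  the total mass.\<close>

lemma erase_tail_le:
  assumes D: "D \<subseteq> msphere_of T \<rho> q" and q: "0 \<le> q" and fin: "finite D" and h: "h > 0" and R: "q \<le> r"
  shows "emeasure (erase T \<rho> h \<mu>) (Cut T \<rho> q D - mcball_of T \<rho> r) \<le> emeasure \<mu> (Cut T \<rho> q D - mcball_of T \<rho> r)"
proof -
  let ?V = "Cut T \<rho> q D - mcball_of T \<rho> r"
  let ?\<nu> = "mrestrict \<mu> ?V"
  have Vb: "?V \<in> sets (metric_borel T)" using Cut_borel[OF D q fin] by auto
  have V: "x \<in> ?V \<longleftrightarrow> x \<in> mspace T \<and> r < ht x \<and> (\<forall>\<sigma>\<in>D. x \<notin> above T \<rho> \<sigma>)" for x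
    using R by (auto simp: Cut_iff[OF D q])
  have up: "above T \<rho> x \<subseteq> ?V" if x: "x \<in> ?V" for x
  proof
    fix y assume y: "y \<in> above T \<rho> x"
    have xV: "r < ht x" "\<forall>\<sigma>\<in>D. x \<notin> above T \<rho> \<sigma>" using x unfolding V by simp_all
    have "y \<notin> above T \<rho> \<sigma>" if s: "\<sigma> \<in> D" for \<sigma>
    proof
      assume a: "y \<in> above T \<rho> \<sigma>"
      have "ht \<sigma> = q" using s D by (auto simp: msphere_of_def)
      then have "x \<in> above T \<rho> \<sigma>" using above_comparable[OF a y] xV(1) R by simp
      then show False using s xV(2) by simp
    qed
    moreover have "y \<in> mspace T" using y above_sub[of x] by blast
    ultimately show "y \<in> ?V" unfolding V using above_ht[OF y] xV(1) by simp
  qed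
  have r0: "\<rho> \<notin> ?V" unfolding V using R q by simp
  show ?thesis
  proof (cases "emeasure \<mu> ?V < \<infinity>")
    case False
    then have "emeasure \<mu> ?V = \<infinity>" by (simp add: less_top[symmetric])
    then show ?thesis by simp
  next
    case fV: True
    have nu: "emeasure ?\<nu> A = emeasure \<mu> (A \<inter> ?V)" if "A \<in> sets (metric_borel T)" for A
      using that Vb by (intro emeasure_mrestrict) simp_all
    have snu: "sets ?\<nu> = sets (metric_borel T)" "space ?\<nu> = mspace T" by (simp_all add: mrestrict_def)
    have VT: "mspace T \<inter> ?V = ?V" using Cut_sub[OF D q] by blast
    interpret N: finite_tree_measure T \<rho> ?\<nu>
    proof
      show "borel_measure_on T ?\<nu>" using snu by (simp add: borel_measure_on_def)
      show "emeasure ?\<nu> (mspace T) < \<infinity>" using fV by (simp add: nu VT)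
    qed
    show ?thesis
    proof (cases "ennreal h \<le> emeasure \<mu> (mspace T)")
      case False
      then have "emeasure \<mu> (mspace T) < ennreal h" by (simp add: not_le)
      then show ?thesis by (simp add: erase_small)
    next
      case True
      have RV: "x \<in> R h \<longleftrightarrow> x \<in> N.R h" if x: "x \<in> ?V" for x
      proof -
        have "emeasure ?\<nu> (above T \<rho> x) = emeasure \<mu> (above T \<rho> x)" using up[OF x] by (simp add: nu Int_absorb2)
        then show ?thesis by (simp add: Rh_iff N.Rh_iff)
      qed
      have "emeasure (erase T \<rho> h \<mu>) ?V = Psi h ?V" using erase_Psi(2)[OF h True Vb] r0 by simp
      also have "Psi h ?V = N.Psi h ?V"
      proof (rule Psi_local[where V="?V" and V'="?V"])
        show "tree_measure T \<rho> \<mu>" "tree_measure T \<rho> ?\<nu>" by unfold_locales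
        show "R h \<inter> ?V = N.R h \<inter> ?V" using RV by blast
        show "\<exists>d>0. \<forall>t. ht y \<le> t \<longrightarrow> t < ht y + d \<longrightarrow> t \<le> ht z \<longrightarrow> pt z t \<in> ?V"
          if y: "y \<in> ?V" and z: "z \<in> above T \<rho> y" for y z
        proof (intro exI[of _ 1] conjI allI impI)
          fix t assume "ht y \<le> t" "t < ht y + 1" "t \<le> ht z"
          then show "pt z t \<in> ?V" using above_Int_pt[OF z, of t] up[OF y] by blast
        qed simp
        fix B assume B: "B \<in> sets (metric_borel T)" and Bp: "\<And>x. x \<in> B \<Longrightarrow> pj h x \<in> ?V"
        have "B \<subseteq> ?V"
        proof
          fix x assume x: "x \<in> B"
          have "x \<in> mspace T" using x sets.sets_into_space[OF B] by auto
          then have "x \<in> above T \<rho> (pj h x)" by (rule tree_proj_below[OF rsub_Rh closed_Rh])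
          then show "x \<in> ?V" using up[OF Bp[OF x]] by blast
        qed
        then show "emeasure \<mu> B = emeasure ?\<nu> B" using B by (simp add: nu Int_absorb2)
      qed (use h Vb in auto)
      \<comment> \<open>If the restricted measure has total mass below h, its subtree R consists of
        the root, which lies outside the region, and \<open>Psi\<close> vanishes there.\<close>
      also have "\<dots> \<le> emeasure \<mu> ?V"
      proof (cases "ennreal h \<le> emeasure ?\<nu> (mspace T)")
        case t: True
        have "N.Psi h ?V = emeasure (erase T \<rho> h ?\<nu>) ?V" using N.erase_Psi(2)[OF h t Vb] r0 by simp
        also have "\<dots> \<le> emeasure (erase T \<rho> h ?\<nu>) (above T \<rho> \<rho>)"
          using N.sets_erase[OF h] by (intro emeasure_mono) (use Cut_sub[OF D q] in \<open>auto simp: above_root\<close>)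
        also have "\<dots> = emeasure ?\<nu> (mspace T) - ennreal h" using N.erase_above[OF h root_in] by (simp add: above_root)
        also have "\<dots> \<le> emeasure \<mu> ?V" by (simp add: nu VT diff_le_self_ennreal)
        finally show ?thesis .
      next
        case False
        have "x \<notin> N.R h" if x: "x \<in> ?V" for x
        proof
          assume "x \<in> N.R h"
          then have "ennreal h \<le> emeasure ?\<nu> (above T \<rho> x)" using x r0 by (auto simp: N.Rh_iff)
          also have "\<dots> \<le> emeasure ?\<nu> (mspace T)" using above_sub[of x] by (intro emeasure_mono) simp_all
          finally show False using False by simp
        qed
        then have "N.R h \<inter> ?V = {}" by blast
        then have e: "{x\<in>mspace T. N.pj h x \<in> ?V \<inter> (N.R h - leaves (N.R h))} = {}" "leaves (N.R h) \<inter> ?V = {}" "bpoints (N.R h) \<inter> ?V = {}"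
          by (auto simp: leaves_def bpoints_def)
        show ?thesis unfolding N.Psi_def e using r0 by simp
      qed
      finally show ?thesis .
    qed
  qed
qed

end

lemma b_tight_erase:
  assumes tm: "\<And>n. tree_measure (Tn n) (\<rho>n n) (\<mu>n n)" and D: "\<And>n. D n \<subseteq> msphere_of (Tn n) (\<rho>n n) q"
    and fin: "\<And>n. finite (D n)" and q: "0 \<le> q" and h: "h > 0"
    and b: "b_tight (\<lambda>n. (Tn n, \<rho>n n, mrestrict (\<mu>n n) (Cut (Tn n) (\<rho>n n) q (D n))))"
  shows "b_tight (\<lambda>n. (Tn n, \<rho>n n, mrestrict (erase (Tn n) (\<rho>n n) h (\<mu>n n)) (Cut (Tn n) (\<rho>n n) q (D n))))"
proof -
  let ?C = "\<lambda>n. Cut (Tn n) (\<rho>n n) q (D n)" and ?B = "\<lambda>n r. mspace (Tn n) - mcball_of (Tn n) (\<rho>n n) r"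
  let ?g = "\<lambda>r. limsup (\<lambda>n. emeasure (mrestrict (\<mu>n n) (?C n)) (?B n r))"
  let ?f = "\<lambda>r. limsup (\<lambda>n. emeasure (mrestrict (erase (Tn n) (\<rho>n n) h (\<mu>n n)) (?C n)) (?B n r))"
  have le: "emeasure (mrestrict (erase (Tn n) (\<rho>n n) h (\<mu>n n)) (?C n)) (?B n r) \<le> emeasure (mrestrict (\<mu>n n) (?C n)) (?B n r)"
    if r: "q \<le> r" for n r
  proof -
    interpret tree_measure "Tn n" "\<rho>n n" "\<mu>n n" by (rule tm)
    have C: "?C n \<in> sets (metric_borel (Tn n))" by (rule Cut_borel[OF D q fin])
    have e: "?B n r \<inter> ?C n = ?C n - mcball_of (Tn n) (\<rho>n n) r" using Cut_sub[OF D q] by blast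
    have B: "?B n r \<in> sets (metric_borel (Tn n))" by (intro sets.Diff mspace_borel ball_borel)
    have 1: "emeasure (mrestrict (erase (Tn n) (\<rho>n n) h (\<mu>n n)) (?C n)) (?B n r) = emeasure (erase (Tn n) (\<rho>n n) h (\<mu>n n)) (?C n - mcball_of (Tn n) (\<rho>n n) r)"
      using B C by (subst emeasure_mrestrict) (simp_all only: sets_erase[OF h] e)
    have 2: "emeasure (mrestrict (\<mu>n n) (?C n)) (?B n r) = emeasure (\<mu>n n) (?C n - mcball_of (Tn n) (\<rho>n n) r)"
      using B C by (subst emeasure_mrestrict) (simp_all only: sets_eq e)
    show ?thesis unfolding 1 2 by (rule erase_tail_le[OF D q fin h r])
  qed
  have "(?f \<longlongrightarrow> 0) at_top"
  proof (rule tendsto_sandwich[where f="\<lambda>_. 0" and h="?g"])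
    show "\<forall>\<^sub>F r in at_top. ?f r \<le> ?g r"
      using eventually_ge_at_top[of q] by eventually_elim (intro Limsup_mono always_eventually allI le)
    show "(?g \<longlongrightarrow> 0) at_top" using b by (simp add: b_tight_def)
  qed simp_all
  then show ?thesis by (simp add: b_tight_def)
qed

section \<open>Discretely infinite measures\<close>

lemma closedin_of_mcomplete:
  assumes c: "mcomplete_of (submetric T S)" and S: "S \<subseteq> mspace T"
  shows "closedin (mtopology_of T) S"
proof -
  interpret Submetric "mspace T" "mdist T" S
    using S by (intro Submetric.intro Submetric_axioms.intro Metric_space_mspace_mdist)
  have "sub.mcomplete" using c S by (simp add: mcomplete_of_def Int_absorb2)
  then show ?thesis using mcomplete_imp_closedin by (simp add: mtopology_of_def)
qed

lemma is_segment_submetric: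
  assumes S: "S \<subseteq> mspace T"
  shows "is_segment (submetric T S) x y A \<longleftrightarrow> is_segment T x y A \<and> A \<subseteq> S"
proof
  assume "is_segment (submetric T S) x y A"
  then obtain \<phi> l where "0 \<le> l" "\<phi> ` {0..l} \<subseteq> S \<inter> mspace T" "\<forall>s\<in>{0..l}. \<forall>t\<in>{0..l}. mdist T (\<phi> s) (\<phi> t) = \<bar>s - t\<bar>"
    "\<phi> 0 = x" "\<phi> l = y" "A = \<phi> ` {0..l::real}"
    unfolding is_segment_def mspace_submetric mdist_submetric by auto
  then show "is_segment T x y A \<and> A \<subseteq> S"
    unfolding is_segment_def by (intro conjI exI[of _ \<phi>] exI[of _ l]) auto
next
  assume "is_segment T x y A \<and> A \<subseteq> S"
  then show "is_segment (submetric T S) x y A"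
    unfolding is_segment_def mspace_submetric mdist_submetric by blast
qed

lemma sets_restrict_metric_borel:
  assumes S: "S \<in> sets (metric_borel T)" and \<nu>: "sets \<nu> = sets (metric_borel T)"
  shows "sets (restrict_space \<nu> S) = sets (metric_borel (submetric T S))"
proof -
  have ST: "S \<subseteq> mspace T" using sets.sets_into_space[OF S] by simp
  have "(\<inter>) S ` {U. openin (mtopology_of T) U} = {U. openin (mtopology_of (submetric T S)) U}"
    by (auto simp: mtopology_of_submetric openin_subtopology image_iff Int_commute)
  then have "sets (metric_borel (submetric T S)) = sigma_sets S ((\<inter>) S ` {U. openin (mtopology_of T) U})"
    using ST by (simp add: sets_metric_borel Int_absorb2)
  also have "\<dots> = (\<inter>) S ` sigma_sets (mspace T) {U. openin (mtopology_of T) U}"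
    using S ST unfolding sets_metric_borel by (rule sigma_sets_Int[symmetric])
  finally show ?thesis by (simp add: sets_restrict_space \<nu> sets_metric_borel)
qed

lemma gprod_submetric [simp]: "gprod (submetric T S) = gprod T"
  by (intro ext) (simp add: gprod_def)

text \<open>Pairs that leave the subtrees are dropped from the relation. Partners outside
  \<open>S'\<close> do no harm, since they lie in a null set that can be added to
  \<open>B\<close>.\<close>

lemma lclose_submetric:
  assumes S: "S \<in> sets (metric_borel T)" and S': "S' \<in> sets (metric_borel T')"
    and sm: "sets \<mu> = sets (metric_borel T)" "sets \<nu> = sets (metric_borel T')"
    and null: "emeasure \<nu> (mspace T' - S') = 0" and l: "lclose T \<rho> \<mu> \<nu> C R \<epsilon>" and C: "C \<subseteq> mspace T \<times> mspace T'"
  shows "lclose (submetric T S) \<rho> (restrict_space \<mu> S) (restrict_space \<nu> S') (C \<inter> S \<times> S') R \<epsilon>"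
  unfolding lclose_def
proof (intro ballI impI)
  fix A B assume A: "A \<in> sets (restrict_space \<mu> S)" and B: "B \<in> sets (restrict_space \<nu> S')"
    and AR: "A \<subseteq> mcball_of (submetric T S) \<rho> R" and AB: "(C \<inter> S \<times> S') `` A \<subseteq> B"
  have S1: "S \<inter> space \<mu> \<in> sets \<mu>" "S' \<inter> space \<nu> \<in> sets \<nu>" using S S' sm by auto
  have A': "A \<in> sets \<mu>" "A \<subseteq> S" using A S1 by (auto simp: sets_restrict_space_iff)
  have B': "B \<in> sets \<nu>" "B \<subseteq> S'" using B S1 by (auto simp: sets_restrict_space_iff)
  have N: "mspace T' - S' \<in> sets \<nu>" unfolding sm(2) using S' by (intro sets.Diff mspace_borel)
  have "emeasure (restrict_space \<mu> S) A = emeasure \<mu> A" using S1 A' by (simp add: emeasure_restrict_space)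
  also have "\<dots> \<le> emeasure \<nu> (B \<union> (mspace T' - S')) + ennreal \<epsilon>"
  proof (rule lcloseD[OF l A'(1)])
    show "A \<subseteq> mcball_of T \<rho> R" using AR by auto
    show "C `` A \<subseteq> B \<union> (mspace T' - S')" using A'(2) C AB by blast
    show "B \<union> (mspace T' - S') \<in> sets \<nu>" using B'(1) N by (rule sets.Un)
  qed
  also have "emeasure \<nu> (B \<union> (mspace T' - S')) \<le> emeasure \<nu> B + emeasure \<nu> (mspace T' - S')"
    by (rule emeasure_subadditive[OF B'(1) N])
  also have "\<dots> = emeasure (restrict_space \<nu> S') B" using S1 B' null by (simp add: emeasure_restrict_space)
  finally show "emeasure (restrict_space \<mu> S) A \<le> emeasure (restrict_space \<nu> S') B + ennreal \<epsilon>"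
    by (simp add: add_right_mono)
qed

lemma locally_close_submetric:
  assumes S: "S \<in> sets (metric_borel T)" and S': "S' \<in> sets (metric_borel T')"
    and sm: "sets \<mu> = sets (metric_borel T)" "sets \<nu> = sets (metric_borel T')"
    and null: "emeasure \<mu> (mspace T - S) = 0" "emeasure \<nu> (mspace T' - S') = 0"
    and l: "locally_close T \<rho> \<mu> T' \<rho>' \<nu> R \<epsilon>"
  shows "locally_close (submetric T S) \<rho> (restrict_space \<mu> S) (submetric T' S') \<rho>' (restrict_space \<nu> S') R \<epsilon>"
proof -
  obtain C where C: "gclose T \<rho> T' \<rho>' C \<epsilon>" "lclose T \<rho> \<mu> \<nu> C R \<epsilon>" "lclose T' \<rho>' \<nu> \<mu> (C\<inverse>) R \<epsilon>"
    using l unfolding locally_close_def by blast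
  have CT: "C \<subseteq> mspace T \<times> mspace T'" using C(1) by (simp add: gclose_def)
  have "gclose T \<rho> T' \<rho>' (C \<inter> S \<times> S') \<epsilon>" by (rule gclose_subset[OF C(1)]) blast
  then have "gclose (submetric T S) \<rho> (submetric T' S') \<rho>' (C \<inter> S \<times> S') \<epsilon>" by (auto simp: gclose_def)
  moreover have "(C \<inter> S \<times> S')\<inverse> = C\<inverse> \<inter> S' \<times> S" by blast
  ultimately show ?thesis
    unfolding locally_close_def
    using lclose_submetric[OF S S' sm null(2) C(2) CT] lclose_submetric[OF S' S sm(2,1) null(1) C(3)] CT
    by (intro exI[of _ "C \<inter> S \<times> S'"]) auto
qed

context separable_rtree
begin

lemma good_submetric:
  assumes S: "rsub S" "closedin (mtopology_of T) S" and \<nu>: "\<nu> \<in> M_bf T"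
  shows "good_tree (submetric T S) \<rho> (restrict_space \<nu> S)"
proof -
  have ST: "S \<subseteq> mspace T" "S \<inter> mspace T = S" "\<rho> \<in> S" using S(1) by (auto simp: rsub_def)
  note Sb = closed_in_metric_borel[OF S(2)]
  have n: "sets \<nu> = sets (metric_borel T)" "space \<nu> = mspace T" "emeasure \<nu> (mcball_of T \<rho> r) < \<infinity>" for r
    using M_bfD[OF \<nu> root_in] by (auto simp: borel_measure_on_def)
  have seg: "seg (submetric T S) \<rho> x = seg T \<rho> x" "seg T \<rho> x \<subseteq> S" "x \<in> seg T \<rho> x" if x: "x \<in> S" for x
  proof -
    have xT: "x \<in> mspace T" using x ST by blast
    show sub: "seg T \<rho> x \<subseteq> S" using S(1) x unfolding seg_eq[OF xT] by (auto simp: rsub_def)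
    have "x = pt x (ht x)" "ht x \<in> {0..ht x}" using pt_ht[OF xT] by simp_all
    then show "x \<in> seg T \<rho> x" unfolding seg_eq[OF xT] by (rule image_eqI)
    show "seg (submetric T S) \<rho> x = seg T \<rho> x"
      unfolding seg_def[of "submetric T S"] is_segment_submetric[OF ST(1)]
    proof (rule the_equality)
      show "is_segment T \<rho> x (seg T \<rho> x) \<and> seg T \<rho> x \<subseteq> S" using is_segment_seg[OF xT] sub by blast
      show "A = seg T \<rho> x" if "is_segment T \<rho> x A \<and> A \<subseteq> S" for A using is_segment_unique[OF _ xT] that by blast
    qed
  qed
  have "restrict_space \<nu> S \<in> M_bf (submetric T S)"
  proof (rule M_bfI[where \<rho>=\<rho>])
    show "borel_measure_on (submetric T S) (restrict_space \<nu> S)"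
      using sets_restrict_metric_borel[OF Sb n(1)] by (simp add: borel_measure_on_def space_restrict_space n)
    show "\<rho> \<in> mspace (submetric T S)" using ST by simp
    show "emeasure (restrict_space \<nu> S) (mcball_of (submetric T S) \<rho> r) < \<infinity>" for r
    proof -
      have e: "mcball_of (submetric T S) \<rho> r = S \<inter> mcball_of T \<rho> r"
        by (rule set_eqI) (simp only: in_mcball_of mspace_submetric mdist_submetric ST Int_iff root_in simp_thms, use ST in blast)
      have "emeasure (restrict_space \<nu> S) (mcball_of (submetric T S) \<rho> r) = emeasure \<nu> (S \<inter> mcball_of T \<rho> r)"
        unfolding e using Sb ST n by (intro emeasure_restrict_space) auto
      also have "\<dots> \<le> emeasure \<nu> (mcball_of T \<rho> r)" using n by (intro emeasure_mono) auto
      finally show ?thesis using n(3)[of r] by (rule le_less_trans)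
    qed
  qed
  then show ?thesis
    unfolding good_tree_def using ST seg separable_submetric[OF separable] by simp
qed

text \<open>For t below the height of a limit point x, every point close enough to x has the same
  ancestor at height t.\<close>

lemma rsub_closure:
  assumes S: "rsub S"
  shows "rsub (mtopology_of T closure_of S)"
  unfolding rsub_def
proof (intro conjI ballI allI impI)
  have ST: "S \<subseteq> mspace T" "\<rho> \<in> S" using S by (auto simp: rsub_def)
  have sub: "S \<subseteq> mtopology_of T closure_of S" using ST by (intro closure_of_subset) simp
  then show "\<rho> \<in> mtopology_of T closure_of S" using ST by blast
  show cT: "mtopology_of T closure_of S \<subseteq> mspace T" using closure_of_subset_topspace[of "mtopology_of T"] by simp
  fix x t assume x: "x \<in> mtopology_of T closure_of S" and t: "0 \<le> t" "t \<le> ht x"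
  have xT: "x \<in> mspace T" using x cT by blast
  show "pt x t \<in> mtopology_of T closure_of S"
  proof (cases "t = ht x")
    case True then show ?thesis using x pt_ht[OF xT] by simp
  next
    case False
    have "openin (mtopology_of T) {y\<in>mspace T. t < gp x y}"
      by (rule openin_greater_lipschitz[OF gp_lipschitz]) (use xT in auto)
    moreover have "x \<in> {y\<in>mspace T. t < gp x y}" using xT t False gp_self[OF xT] by simp
    ultimately obtain z where z: "z \<in> S" "t < gp x z"
      using x[unfolded in_closure_of, THEN conjunct2, rule_format, of "{y\<in>mspace T. t < gp x y}"] by auto
    have zT: "z \<in> mspace T" using z ST by blast
    have tz: "t \<le> ht z" using gp_le2[OF xT zT] z(2) by linarith
    then have "pt x t = pt z t" using z(2) t by (simp add: pt_eq_iff[OF xT zT])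
    moreover have "pt z t \<in> S" using S z(1) t(1) tz by (simp add: rsub_def)
    ultimately show ?thesis using sub by auto
  qed
qed

text \<open>Two points of the sphere separate at a branch point below it, so a point is determined by the
  branches that contain it.\<close>

lemma finite_discrete_sphere:
  assumes S: "rsub S" and disc: "discrete_rtree (submetric T S) \<rho>" and q: "q > 0"
  shows "finite (msphere_of T \<rho> q \<inter> S)"
proof -
  let ?T = "submetric T S"
  have ST: "S \<subseteq> mspace T" "\<rho> \<in> S" using S by (auto simp: rsub_def)
  define B where "B = Bp ?T \<rho> \<inter> mcball_of ?T \<rho> q"
  have lt: "ncomp ?T \<rho> + infsum (ncomp ?T) B < \<infinity>" using disc q unfolding discrete_rtree_def B_def by blast
  \<comment> \<open>Every branch point contributes at least 3 to the sum.\<close>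
  have fB: "finite B"
  proof (rule ccontr)
    assume "infinite B"
    then have "infsum (ncomp ?T) B = \<infinity>"
      by (intro infsum_superconst_infinite_enat[where b=3]) (auto simp: B_def Bp_def)
    then show False using lt by simp
  qed
  define F where "F = insert \<rho> B"
  have FS: "\<tau> \<in> S" if "\<tau> \<in> F" for \<tau> using that ST by (auto simp: F_def B_def Bp_def)
  have fb: "finite (branches T \<rho> S \<tau>)" if t: "\<tau> \<in> F" for \<tau>
  proof -
    have "ncomp ?T \<tau> < \<infinity>"
    proof (cases "\<tau> = \<rho>")
      case True then show ?thesis using lt by (cases "ncomp ?T \<rho>") auto
    next
      case False
      then have "\<tau> \<in> B" using t by (simp add: F_def)
      then have "ncomp ?T \<tau> \<le> infsum (ncomp ?T) B" using fB by (simp add: member_le_sum)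
      also have "\<dots> < \<infinity>" using lt by (cases "infsum (ncomp ?T) B") auto
      finally show ?thesis .
    qed
    then show ?thesis unfolding ncomp_branches[OF S FS[OF t]] by (auto simp: ecard_def split: if_splits)
  qed
  define f where "f x = (\<lambda>\<tau>\<in>F. if x \<in> above T \<rho> \<tau> \<and> x \<noteq> \<tau> then branch T \<rho> \<tau> x else {})" for x
  have inj: "inj_on f (msphere_of T \<rho> q \<inter> S)"
  proof (rule inj_onI, rule ccontr)
    fix x y assume x: "x \<in> msphere_of T \<rho> q \<inter> S" and y: "y \<in> msphere_of T \<rho> q \<inter> S" and e: "f x = f y" and ne: "x \<noteq> y"
    have xm: "x \<in> mspace T" "ht x = q" "x \<in> S" and ym: "y \<in> mspace T" "ht y = q" "y \<in> S"
      using x y by (auto simp: msphere_of_def)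
    define g where "g = gp x y"
    have g0: "0 \<le> g" "g \<le> q" using gp_nonneg[OF xm(1) ym(1)] gp_le1[OF xm(1) ym(1)] xm by (simp_all add: g_def)
    have "g \<noteq> q"
    proof
      assume "g = q"
      then have "pt x q = pt y q" using pt_gp[OF xm(1) ym(1)] by (simp add: g_def)
      then show False using pt_ht[OF xm(1)] pt_ht[OF ym(1)] xm ym ne by simp
    qed
    then have gq: "g < q" using g0 by simp
    define \<tau> where "\<tau> = pt x g"
    have ty: "\<tau> = pt y g" using pt_gp[OF xm(1) ym(1)] by (simp add: \<tau>_def g_def)
    have tm: "\<tau> \<in> mspace T" "ht \<tau> = g" using pt_in[OF xm(1)] ht_pt[OF xm(1)] g0 xm by (auto simp: \<tau>_def)
    have tS: "\<tau> \<in> S" using S xm g0 by (auto simp: rsub_def \<tau>_def)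
    have ax: "x \<in> above T \<rho> \<tau>" unfolding \<tau>_def by (rule above_pt[OF xm(1)]) (use g0 xm in auto)
    have ay: "y \<in> above T \<rho> \<tau>" unfolding ty by (rule above_pt[OF ym(1)]) (use g0 ym in auto)
    have nx: "x \<noteq> \<tau>" "y \<noteq> \<tau>" using tm xm ym gq by auto
    have nb: "branch T \<rho> \<tau> x \<noteq> branch T \<rho> \<tau> y"
      using branch_eq_iff[OF ax ay nx(1)] tm by (simp add: g_def)
    have "\<tau> \<in> F"
    proof (cases "\<tau> = \<rho>")
      case True then show ?thesis by (simp add: F_def)
    next
      case False
      have "{branch T \<rho> \<tau> x, branch T \<rho> \<tau> y} \<subseteq> branches T \<rho> S \<tau>"
        unfolding branches_def using ax ay nx xm ym by blast
      then have "2 \<le> ecard (branches T \<rho> S \<tau>)"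
        using nb card_mono[of "branches T \<rho> S \<tau>" "{branch T \<rho> \<tau> x, branch T \<rho> \<tau> y}"] by (auto simp: ecard_def numeral_eq_enat)
      then have "\<tau> \<in> bpoints S" using tS False by (simp add: bpoints_def)
      then have "\<tau> \<in> Bp ?T \<rho>" by (simp add: Bp_bpoints[OF S])
      then show ?thesis using tm tS gq ST by (simp add: F_def B_def)
    qed
    then show False using fun_cong[OF e, of \<tau>] ax ay nx nb by (simp add: f_def)
  qed
  have "f ` (msphere_of T \<rho> q \<inter> S) \<subseteq> (\<Pi>\<^sub>E \<tau>\<in>F. insert {} (branches T \<rho> S \<tau>))"
    by (auto simp: f_def branches_def split: if_splits)
  moreover have "finite \<dots>" using fB fb by (intro finite_PiE) (auto simp: F_def)
  ultimately have "finite (f ` (msphere_of T \<rho> q \<inter> S))" by (rule finite_subset)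
  then show ?thesis using inj by (rule finite_imageD)
qed

end

section \<open>Trees with finite or discretely infinite measures\<close>

locale di_tree =
  fixes T :: "'a metric" and \<rho> :: 'a and \<mu> :: "'a measure"
  assumes polish: "polish_rtree T \<rho>" and di: "\<mu> \<in> M_di T \<rho>"

sublocale di_tree \<subseteq> separable_rtree
  using polish by unfold_locales (auto simp: polish_rtree_def)

context di_tree
begin

lemma di_cases:
  obtains "finite_tree_measure T \<rho> \<mu>" | "discretely_infinite T \<rho> \<mu>"
proof (cases "discretely_infinite T \<rho> \<mu>")
  case False
  then have "finite_tree_measure T \<rho> \<mu>" using di by unfold_locales (auto simp: M_di_def M_fin_def)
  then show ?thesis by (rule that(1))
qed (rule that(2))

text \<open>A discrete tree is complete by definition, so the skeleton is closed in T.\<close>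

lemma di_tree_measure: "tree_measure T \<rho> \<mu>"
proof (cases rule: di_cases)
  case 1
  then interpret finite_tree_measure T \<rho> \<mu> .
  show ?thesis by unfold_locales
next
  case 2
  then have "discrete_rtree (submetric T (Skel T \<rho> \<mu>)) \<rho>" by (simp add: discretely_infinite_def)
  then have "mcomplete_of (submetric T (Skel T \<rho> \<mu>))" by (simp add: discrete_rtree_def)
  then have "closedin (mtopology_of T) (Skel T \<rho> \<mu>)" by (rule closedin_of_mcomplete) (auto simp: Skel_def)
  moreover have "\<mu> \<in> M_bf T" using 2 by (simp add: discretely_infinite_def)
  ultimately show ?thesis by unfold_locales
qed

end

sublocale di_tree \<subseteq> tree_measure
  by (rule di_tree_measure)

context di_tree
begin

abbreviation "sk q \<equiv> skel_sphere T \<rho> \<mu> q"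

lemma sk_sub: "sk q \<subseteq> msphere_of T \<rho> q"
  by (simp add: skel_sphere_def)

lemma sk_iff: "q > 0 \<Longrightarrow> \<sigma> \<in> sk q \<longleftrightarrow> \<sigma> \<in> mspace T \<and> ht \<sigma> = q \<and> emeasure \<mu> (above T \<rho> \<sigma>) = \<infinity>"
  by (auto simp: skel_sphere_def msphere_of_def Skel_def)

lemma rsub_Skel: "rsub (Skel T \<rho> \<mu>)"
  unfolding rsub_def
proof (intro conjI ballI allI impI)
  show S: "Skel T \<rho> \<mu> \<subseteq> mspace T" "\<rho> \<in> Skel T \<rho> \<mu>" by (auto simp: Skel_def)
  fix x t assume x: "x \<in> Skel T \<rho> \<mu>" and t: "0 \<le> t" "t \<le> ht x"
  have xT: "x \<in> mspace T" using x S by blast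
  show "pt x t \<in> Skel T \<rho> \<mu>"
  proof (cases "x = \<rho>")
    case True then show ?thesis using t pt_0[OF xT] by (simp add: Skel_def)
  next
    case False
    then have "\<infinity> = emeasure \<mu> (above T \<rho> x)" using x by (simp add: Skel_def)
    also have "\<dots> \<le> emeasure \<mu> (above T \<rho> (pt x t))"
      by (intro emeasure_mono above_mono above_pt xT t) simp
    finally show ?thesis using pt_in[OF xT t] by (simp add: Skel_def top_unique)
  qed
qed

lemma sk_finite: assumes q: "q > 0" shows "finite (sk q)"
proof (cases rule: di_cases)
  case 1
  then have "sk q = {}" using q by (auto simp: skel_sphere_def finite_tree_measure.Skel_finite msphere_of_def)
  then show ?thesis by simp
next
  case 2
  then show ?thesis unfolding skel_sphere_def discretely_infinite_def using finite_discrete_sphere[OF rsub_Skel _ q] by simp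
qed

lemma cut_finite: assumes q: "q > 0" shows "emeasure \<mu> (Cut T \<rho> q (sk q)) < \<infinity>"
proof (cases rule: di_cases)
  case 1
  have "emeasure \<mu> (Cut T \<rho> q (sk q)) \<le> emeasure \<mu> (mspace T)"
    using Cut_sub[OF sk_sub] q by (intro emeasure_mono) auto
  also have "\<dots> < \<infinity>" using 1 by (simp add: finite_tree_measure_def finite_tree_measure_axioms_def)
  finally show ?thesis .
next
  case 2
  let ?U = "\<Union>\<sigma>\<in>msphere_of T \<rho> q \<inter> F_part T \<rho> \<mu>. above T \<rho> \<sigma>"
  \<comment> \<open>The union may be uncountable; it is measurable as a superlevel set of the height
    minus finitely many sets theta.\<close>
  have Um: "?U = {x\<in>mspace T. q \<le> ht x} - (\<Union>\<sigma>\<in>sk q. above T \<rho> \<sigma>)"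
  proof (intro equalityI subsetI)
    fix x assume "x \<in> ?U"
    then obtain \<sigma> where s: "\<sigma> \<in> mspace T" "ht \<sigma> = q" "\<sigma> \<notin> Skel T \<rho> \<mu>" "x \<in> above T \<rho> \<sigma>"
      by (auto simp: msphere_of_def F_part_def)
    have "x \<notin> above T \<rho> \<tau>" if t: "\<tau> \<in> sk q" for \<tau>
    proof
      assume "x \<in> above T \<rho> \<tau>"
      moreover have "ht \<tau> = q" using t by (simp add: sk_iff[OF q])
      ultimately have "\<tau> = \<sigma>" using s(2,4) by (simp add: above_iff')
      then show False using t s(3) by (simp add: skel_sphere_def)
    qed
    then show "x \<in> {x\<in>mspace T. q \<le> ht x} - (\<Union>\<sigma>\<in>sk q. above T \<rho> \<sigma>)"
      using s above_ht[OF s(4)] above_sub[of \<sigma>] by auto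
  next
    fix x assume x: "x \<in> {x\<in>mspace T. q \<le> ht x} - (\<Union>\<sigma>\<in>sk q. above T \<rho> \<sigma>)"
    then have xT: "x \<in> mspace T" "q \<le> ht x" by auto
    have p: "x \<in> above T \<rho> (pt x q)" "pt x q \<in> mspace T" "ht (pt x q) = q"
      using above_pt[OF xT(1)] pt_in[OF xT(1)] ht_pt[OF xT(1)] xT q by auto
    have "pt x q \<notin> sk q" using x p(1) by blast
    then have "pt x q \<in> msphere_of T \<rho> q \<inter> F_part T \<rho> \<mu>" using p by (simp add: skel_sphere_def msphere_of_def F_part_def)
    then show "x \<in> ?U" using p(1) by blast
  qed
  have "{x\<in>mspace T. q \<le> ht x} \<in> sets (metric_borel T)"
    by (intro closed_in_metric_borel closedin_ge_lipschitz ht_lipschitz)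
  then have Ub: "?U \<in> sets (metric_borel T)" unfolding Um by (intro sets.Diff sets.finite_UN sk_finite q above_borel)
  have "Cut T \<rho> q (sk q) = mcball_of T \<rho> q \<union> ?U"
    unfolding Cut_def by (rule arg_cong2[where f="(\<union>)"]) (auto simp: skel_sphere_def F_part_def msphere_of_def)
  then have "emeasure \<mu> (Cut T \<rho> q (sk q)) \<le> emeasure \<mu> (mcball_of T \<rho> q) + emeasure \<mu> ?U"
    using Ub by (simp add: emeasure_subadditive)
  also have "\<dots> < \<infinity>" using 2 q ball_finite[of q] by (simp add: discretely_infinite_def)
  finally show ?thesis .
qed

abbreviation "cutm q M \<equiv> cut_measure T \<rho> \<mu> q (sk q) M"

lemma cutm_finite: assumes q: "q > 0" shows "finite_tree_measure T \<rho> (cutm q M)"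
  using q by (intro cut_measure_finite sk_sub sk_finite cut_finite) auto

lemma erase_cutm:
  assumes h: "0 < h" "h \<le> M" and A: "A \<in> sets (metric_borel T)" "A \<subseteq> mcball_of T \<rho> r" and q: "r < q" "0 < q"
  shows "emeasure (erase T \<rho> h \<mu>) A = emeasure (erase T \<rho> h (cutm q M)) A"
  by (rule erase_cut_measure[OF sk_sub sk_finite cut_finite h _ A q]) (simp_all add: q sk_iff)

text \<open>On a ball the erased measure agrees with that of a finite cut measure, and erasure of a
  finite measure does not increase its total mass.\<close>

lemma erase_bf:
  assumes h: "h > 0" shows "erase T \<rho> h \<mu> \<in> M_bf T"
proof (rule M_bfI[OF _ root_in])
  have "space (erase T \<rho> h \<mu>) = mspace T" using sets_eq_imp_space_eq[OF sets_erase[OF h]] by simp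
  then show "borel_measure_on T (erase T \<rho> h \<mu>)" by (simp add: borel_measure_on_def sets_erase[OF h])
  fix r :: real
  define q where "q = \<bar>r\<bar> + 1"
  have q: "r < q" "0 < q" by (auto simp: q_def)
  interpret N: finite_tree_measure T \<rho> "cutm q h" by (rule cutm_finite[OF q(2)])
  have "emeasure (erase T \<rho> h \<mu>) (mcball_of T \<rho> r) = emeasure (erase T \<rho> h (cutm q h)) (mcball_of T \<rho> r)"
    by (rule erase_cutm[OF h order_refl ball_borel order_refl q])
  also have "\<dots> \<le> emeasure (erase T \<rho> h (cutm q h)) (above T \<rho> \<rho>)"
    using N.sets_erase[OF h] by (intro emeasure_mono) (auto simp: above_root)
  also have "\<dots> \<le> emeasure (cutm q h) (mspace T)" using N.erase_above[OF h root_in] by (simp add: above_root diff_le_self_ennreal)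
  also have "\<dots> < \<infinity>" by (rule N.finite_mass)
  finally show "emeasure (erase T \<rho> h \<mu>) (mcball_of T \<rho> r) < \<infinity>" .
qed

abbreviation "Rp h \<equiv> Rh_plus T \<rho> \<mu> h"

lemma rsub_Rp: "rsub (Rp h)"
  unfolding Rh_plus_def
proof (rule rsub_closure)
  show "rsub (\<Union>h'\<in>{h<..}. R h')" using rsub_Rh unfolding rsub_def by (fastforce intro: gt_ex)
qed

lemma closed_Rp: "closedin (mtopology_of T) (Rp h)"
  by (simp add: Rh_plus_def)

text \<open>The mixture uses the levels h / v with v < 1, all strictly above h. Its projections
  therefore end in sets R_{h'} with h' > h, which explains why R_{h+} carries the erased
  measure.\<close>

lemma erase_Rp_null:
  assumes h: "h > 0" shows "emeasure (erase T \<rho> h \<mu>) (mspace T - Rp h) = 0"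
proof -
  let ?A = "\<lambda>n. (mspace T - Rp h) \<inter> mcball_of T \<rho> (real n)"
  have Rpb: "Rp h \<in> sets (metric_borel T)" by (rule closed_in_metric_borel[OF closed_Rp])
  have Ab: "?A n \<in> sets (metric_borel T)" for n using Rpb by (intro sets.Int sets.Diff mspace_borel ball_borel)
  have "emeasure (erase T \<rho> h \<mu>) (?A n) = 0" for n
  proof -
    define q where "q = real n + 1"
    have q: "real n < q" "0 < q" by (auto simp: q_def)
    interpret N: finite_tree_measure T \<rho> "cutm q h" by (rule cutm_finite[OF q(2)])
    have emp: "{x\<in>mspace T. N.pj (h / v) x \<in> ?A n} = {}" if v: "v \<in> N.levels h" for v
    proof -
      have hv: "h < h / v" using v h by (simp add: less_divide_eq)
      have "N.pj (h / v) x \<notin> ?A n" if x: "x \<in> mspace T" for x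
      proof
        define y where "y = N.pj (h / v) x"
        assume "N.pj (h / v) x \<in> ?A n"
        then have y: "y \<in> mspace T" "y \<notin> Rp h" "ht y < q" using q by (auto simp: y_def)
        have yR: "y \<in> N.R (h / v)" unfolding y_def by (rule tree_proj_in[OF N.rsub_Rh N.closed_Rh x])
        \<comment> \<open>Transfers membership from the cut measure to \<mu>: the mass above y is
          either the same or, below a skeleton point, infinite.\<close>
        have "y \<in> R (h / v)"
        proof (cases "sk q \<inter> above T \<rho> y = {}")
          case True
          then have "emeasure (cutm q h) (above T \<rho> y) = emeasure \<mu> (above T \<rho> y)"
            using q y by (intro cut_measure_above(1) sk_sub sk_finite) auto
          then show ?thesis using yR by (simp add: Rh_iff N.Rh_iff)
        next
          case False
          then obtain \<sigma> where s: "\<sigma> \<in> sk q" "\<sigma> \<in> above T \<rho> y" by blast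
          have "\<infinity> = emeasure \<mu> (above T \<rho> \<sigma>)" using s(1) by (simp add: sk_iff[OF q(2)])
          also have "\<dots> \<le> emeasure \<mu> (above T \<rho> y)" by (intro emeasure_mono above_mono s) simp
          finally show ?thesis using y(1) by (simp add: Rh_iff top_unique)
        qed
        then have "y \<in> (\<Union>h'\<in>{h<..}. R h')" using hv by blast
        moreover have "(\<Union>h'\<in>{h<..}. R h') \<subseteq> Rp h"
          unfolding Rh_plus_def using Rh_sub by (intro closure_of_subset) auto
        ultimately show False using y(2) by blast
      qed
      then show ?thesis by blast
    qed
    have "emeasure (erase T \<rho> h \<mu>) (?A n) = emeasure (erase T \<rho> h (cutm q h)) (?A n)"
      by (rule erase_cutm[OF h order_refl Ab _ q]) blast
    also have "\<dots> = (\<integral>\<^sup>+v. emeasure (cutm q h) {x\<in>mspace T. N.pj (h / v) x \<in> ?A n} * indicator (N.levels h) v \<partial>lborel)"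
      by (rule N.erase_layers(1)[OF h Ab])
    also have "\<dots> = integral\<^sup>N lborel (\<lambda>v::real. 0)"
    proof (rule nn_integral_cong)
      fix v :: real
      show "emeasure (cutm q h) {x\<in>mspace T. N.pj (h / v) x \<in> ?A n} * indicator (N.levels h) v = 0"
      proof (cases "v \<in> N.levels h")
        case True show ?thesis unfolding emp[OF True] by simp
      qed simp
    qed
    finally show ?thesis by simp
  qed
  moreover have "(\<Union>n. ?A n) = mspace T - Rp h"
  proof (intro equalityI subsetI)
    fix x assume x: "x \<in> mspace T - Rp h"
    obtain n :: nat where "ht x \<le> real n" using real_arch_simple by blast
    then show "x \<in> (\<Union>n. ?A n)" using x by auto
  qed auto
  ultimately show ?thesis
    using emeasure_UN_eq_0[of "erase T \<rho> h \<mu>" ?A] Ab by (simp add: sets_erase[OF h] image_subset_iff)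
qed

lemma erase_tree_good:
  assumes "h > 0"
  shows "good_tree (submetric T (Rp h)) \<rho> (restrict_space (erase T \<rho> h \<mu>) (Rp h))"
  by (rule good_submetric[OF rsub_Rp closed_Rp erase_bf[OF assms]])

lemma di_good: "good_tree T \<rho> \<mu>"
proof -
  have "x \<in> seg T \<rho> x \<and> seg T \<rho> x \<subseteq> mspace T" if x: "x \<in> mspace T" for x
  proof -
    have "x = pt x (ht x)" "ht x \<in> {0..ht x}" using pt_ht[OF x] by simp_all
    then have "x \<in> seg T \<rho> x" unfolding seg_eq[OF x] by (rule image_eqI)
    then show ?thesis using pt_in[OF x] unfolding seg_eq[OF x] by auto
  qed
  then show ?thesis using bf separable by (simp add: good_tree_def)
qed

end

lemma GV_converges_erase:
  assumes T: "di_tree T \<rho> \<mu>" and Tn: "\<And>n. di_tree (Tn n) (\<rho>n n) (\<mu>n n)" and h: "h > 0" "\<And>n. hn n > 0"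
    and cl: "\<And>R \<epsilon>. \<epsilon> > 0 \<Longrightarrow> \<forall>\<^sub>F n in sequentially.
      locally_close T \<rho> (erase T \<rho> h \<mu>) (Tn n) (\<rho>n n) (erase (Tn n) (\<rho>n n) (hn n) (\<mu>n n)) R \<epsilon>"
  shows "GV_converges (\<lambda>n. erase_tree (hn n) (Tn n, \<rho>n n, \<mu>n n)) (erase_tree h (T, \<rho>, \<mu>))"
  unfolding erase_tree_def prod.case
proof (rule locally_close_imp_GV)
  interpret X: di_tree T \<rho> \<mu> by (rule T)
  show "good_tree (submetric T (X.Rp h)) \<rho> (restrict_space (erase T \<rho> h \<mu>) (X.Rp h))" by (rule X.erase_tree_good[OF h(1)])
  show "good_tree (submetric (Tn n) (Rh_plus (Tn n) (\<rho>n n) (\<mu>n n) (hn n))) (\<rho>n n)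
     (restrict_space (erase (Tn n) (\<rho>n n) (hn n) (\<mu>n n)) (Rh_plus (Tn n) (\<rho>n n) (\<mu>n n) (hn n)))" for n
    by (rule di_tree.erase_tree_good[OF Tn h(2)])
  fix R \<epsilon> :: real assume "\<epsilon> > 0"
  from cl[OF this, of R]
  show "\<forall>\<^sub>F n in sequentially. locally_close (submetric T (X.Rp h)) \<rho> (restrict_space (erase T \<rho> h \<mu>) (X.Rp h))
     (submetric (Tn n) (Rh_plus (Tn n) (\<rho>n n) (\<mu>n n) (hn n))) (\<rho>n n)
     (restrict_space (erase (Tn n) (\<rho>n n) (hn n) (\<mu>n n)) (Rh_plus (Tn n) (\<rho>n n) (\<mu>n n) (hn n))) R \<epsilon>"
  proof eventually_elim
    case (elim n)
    interpret Y: di_tree "Tn n" "\<rho>n n" "\<mu>n n" by (rule Tn)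
    show ?case
      by (rule locally_close_submetric[OF closed_in_metric_borel[OF X.closed_Rp] closed_in_metric_borel[OF Y.closed_Rp]
          X.sets_erase[OF h(1)] Y.sets_erase[OF h(2)] X.erase_Rp_null[OF h(1)] Y.erase_Rp_null[OF h(2)] elim])
  qed
qed

section \<open>Closeness of the cut measures\<close>

lemma ennreal_le_cancel: "ennreal a + ennreal b \<le> x + ennreal b \<Longrightarrow> ennreal a \<le> x"
  using ennreal_add_left_cancel_le[of "ennreal b" "ennreal a" x] by (simp add: add.commute)

text \<open>One late member of the sequence, with all constants already chosen.
  \<open>Z \<sigma>\<close> is a reference point above the skeleton point sigma, \<eta> a margin for
  Gromov products that exceeds the distortion e. The mass K + M + 2 is large enough that, after
  losing 1/2 to \<open>inner\<close> and 1/2 to the comparison, more than the cut bound K and at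
  least the atom size M remains.\<close>

locale cut_pair = X: di_tree T \<rho> \<mu> + Y: tree_measure T' \<rho>' \<nu>
  for T :: "'a metric" and \<rho> \<mu> and T' :: "'b metric" and \<rho>' \<nu> +
  fixes q S \<eta> e \<epsilon> M K :: real and C :: "('a \<times> 'b) set" and D' :: "'b set" and Z :: "'a \<Rightarrow> 'a"
  assumes par: "0 < q" "0 < e" "e < \<eta>" "e \<le> 1 / 2" "0 < \<epsilon>" "\<epsilon> \<le> 1 / 2" "0 \<le> M" "0 \<le> K"
    and D': "D' \<subseteq> msphere_of T' \<rho>' q" "finite D'" "card D' \<le> card (X.sk q)"
    and Z: "\<And>\<sigma>. \<sigma> \<in> X.sk q \<Longrightarrow> Z \<sigma> \<in> above T \<rho> \<sigma>"
    and inner: "\<And>\<sigma>. \<sigma> \<in> X.sk q \<Longrightarrow>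
      emeasure \<mu> ({y\<in>above T \<rho> \<sigma>. gprod T \<rho> (Z \<sigma>) y < q + \<eta>} \<inter> mcball_of T \<rho> (S + 1)) \<le> ennreal \<epsilon>"
    and outer: "\<And>\<sigma>. \<sigma> \<in> X.sk q \<Longrightarrow>
      emeasure \<mu> ({y\<in>mspace T - above T \<rho> \<sigma>. q - \<eta> \<le> gprod T \<rho> \<sigma> y} \<inter> mcball_of T \<rho> (S + 1)) \<le> ennreal \<epsilon>"
    and apart: "\<And>\<sigma> \<sigma>'. \<sigma> \<in> X.sk q \<Longrightarrow> \<sigma>' \<in> X.sk q \<Longrightarrow> \<sigma> \<noteq> \<sigma>' \<Longrightarrow> gprod T \<rho> \<sigma> \<sigma>' < q - \<eta>"
    and sphere_null: "emeasure \<mu> (msphere_of T \<rho> q) = 0"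
    and C: "gclose T \<rho> T' \<rho>' C e" "lclose T \<rho> \<mu> \<nu> C (S + 1) e" "lclose T' \<rho>' \<nu> \<mu> (C\<inverse>) (S + 1) e"
    and tails: "emeasure \<mu> (Cut T \<rho> q (X.sk q) - mcball_of T \<rho> S) \<le> ennreal \<epsilon>"
      "emeasure \<nu> (Cut T' \<rho>' q D' - mcball_of T' \<rho>' S) \<le> ennreal \<epsilon>"
    and bound: "emeasure \<nu> (Cut T' \<rho>' q D') \<le> ennreal K"
    and big: "\<And>\<sigma>. \<sigma> \<in> X.sk q \<Longrightarrow> ennreal (K + M + 2) \<le> emeasure \<mu> (above T \<rho> \<sigma> \<inter> mcball_of T \<rho> S)"
begin

text \<open>\<open>upper\<close> is the stable part above sigma. The zones \<open>low\<close> and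
  \<open>side\<close>, just above the cut and just beside it, are where a related point can end up
  on the wrong side; both have small mass in the ball.\<close>

definition upper :: "'a \<Rightarrow> 'a set" where
  "upper \<sigma> = {y\<in>above T \<rho> \<sigma>. q + \<eta> \<le> X.gp (Z \<sigma>) y}"

definition low :: "'a \<Rightarrow> 'a set" where
  "low \<sigma> = {y\<in>above T \<rho> \<sigma>. X.gp (Z \<sigma>) y < q + \<eta>}"

definition side :: "'a \<Rightarrow> 'a set" where
  "side \<sigma> = {y\<in>mspace T - above T \<rho> \<sigma>. q - \<eta> \<le> X.gp \<sigma> y}"

lemma sk_in: "\<sigma> \<in> X.sk q \<Longrightarrow> \<sigma> \<in> mspace T" "\<sigma> \<in> X.sk q \<Longrightarrow> X.ht \<sigma> = q"
  using X.sk_iff[OF par(1)] by auto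

lemma Z_in: "\<sigma> \<in> X.sk q \<Longrightarrow> Z \<sigma> \<in> mspace T"
  using Z X.above_sub by blast

lemma sets_regions:
  assumes s: "\<sigma> \<in> X.sk q"
  shows "upper \<sigma> \<in> sets (metric_borel T)" "low \<sigma> \<in> sets (metric_borel T)" "side \<sigma> \<in> sets (metric_borel T)"
proof -
  have u: "upper \<sigma> = above T \<rho> \<sigma> \<inter> {y\<in>mspace T. q + \<eta> \<le> X.gp (Z \<sigma>) y}" using X.above_sub by (auto simp: upper_def)
  have l: "low \<sigma> = above T \<rho> \<sigma> \<inter> {y\<in>mspace T. X.gp (Z \<sigma>) y < q + \<eta>}" using X.above_sub by (auto simp: low_def)
  have d: "side \<sigma> = {y\<in>mspace T. q - \<eta> \<le> X.gp \<sigma> y} - above T \<rho> \<sigma>" by (auto simp: side_def)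
  show "upper \<sigma> \<in> sets (metric_borel T)" unfolding u
    by (intro sets.Int X.above_borel closed_in_metric_borel closedin_ge_lipschitz X.gp_lipschitz Z_in[OF s])
  show "low \<sigma> \<in> sets (metric_borel T)" unfolding l
    by (intro sets.Int X.above_borel open_in_metric_borel openin_less_lipschitz X.gp_lipschitz Z_in[OF s])
  show "side \<sigma> \<in> sets (metric_borel T)" unfolding d
    by (intro sets.Diff X.above_borel closed_in_metric_borel closedin_ge_lipschitz X.gp_lipschitz sk_in[OF s])
qed

lemma ball_sub: "mcball_of T \<rho> S \<subseteq> mcball_of T \<rho> (S + 1)"
  by auto

lemma upper_big:
  assumes s: "\<sigma> \<in> X.sk q"
  shows "ennreal (K + M + 3 / 2) \<le> emeasure \<mu> (upper \<sigma> \<inter> mcball_of T \<rho> S)"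
proof -
  have "ennreal (K + M + 3 / 2) + ennreal (1 / 2) = ennreal (K + M + 2)" using par by (subst ennreal_plus[symmetric]) simp_all
  also have "\<dots> \<le> emeasure \<mu> (above T \<rho> \<sigma> \<inter> mcball_of T \<rho> S)" by (rule big[OF s])
  also have "\<dots> \<le> emeasure \<mu> ((upper \<sigma> \<inter> mcball_of T \<rho> S) \<union> (low \<sigma> \<inter> mcball_of T \<rho> (S + 1)))"
  proof (rule emeasure_mono)
    show "above T \<rho> \<sigma> \<inter> mcball_of T \<rho> S \<subseteq> (upper \<sigma> \<inter> mcball_of T \<rho> S) \<union> (low \<sigma> \<inter> mcball_of T \<rho> (S + 1))"
      by (auto simp: upper_def low_def)
    show "(upper \<sigma> \<inter> mcball_of T \<rho> S) \<union> (low \<sigma> \<inter> mcball_of T \<rho> (S + 1)) \<in> sets \<mu>"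
      unfolding X.sets_eq by (intro sets.Un sets.Int sets_regions[OF s] X.ball_borel)
  qed
  also have "\<dots> \<le> emeasure \<mu> (upper \<sigma> \<inter> mcball_of T \<rho> S) + emeasure \<mu> (low \<sigma> \<inter> mcball_of T \<rho> (S + 1))"
    by (rule emeasure_subadditive; unfold X.sets_eq; intro sets.Int sets_regions[OF s] X.ball_borel)
  also have "emeasure \<mu> (low \<sigma> \<inter> mcball_of T \<rho> (S + 1)) \<le> ennreal (1 / 2)"
    using inner[OF s] ennreal_leI[OF par(6)] unfolding low_def by (rule order_trans)
  finally have "ennreal (K + M + 3 / 2) + ennreal (1 / 2) \<le> emeasure \<mu> (upper \<sigma> \<inter> mcball_of T \<rho> S) + ennreal (1 / 2)"
    by (simp add: add_left_mono)
  then show ?thesis by (rule ennreal_le_cancel)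
qed

text \<open>If no related pair started in \<open>upper\<close>, its mass in the ball would be at
  most e <= 1/2.\<close>

lemma partner_ex:
  assumes s: "\<sigma> \<in> X.sk q"
  shows "\<exists>p\<in>C. fst p \<in> upper \<sigma>"
proof (rule ccontr)
  assume "\<not> ?thesis"
  then have em: "C `` (upper \<sigma> \<inter> mcball_of T \<rho> S) \<subseteq> {}" by force
  have "emeasure \<mu> (upper \<sigma> \<inter> mcball_of T \<rho> S) \<le> emeasure \<nu> {} + ennreal e"
    by (rule lcloseD[OF C(2) _ _ _ em]) (use sets_regions[OF s] ball_sub in auto)
  also have "\<dots> \<le> ennreal (1 / 2)" unfolding emeasure_empty add_0 by (rule ennreal_leI[OF par(4)])
  finally have "ennreal (K + M + 3 / 2) \<le> ennreal (1 / 2)" using upper_big[OF s] by (rule order_trans[rotated])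
  then have "K + M + 3 / 2 \<le> 1 / 2" by (subst (asm) ennreal_le_iff) simp_all
  then show False using par by linarith
qed

definition partner :: "'a \<Rightarrow> 'a \<times> 'b" where
  "partner \<sigma> = (SOME p. p \<in> C \<and> fst p \<in> upper \<sigma>)"

abbreviation "px \<sigma> \<equiv> fst (partner \<sigma>)"
abbreviation "px' \<sigma> \<equiv> snd (partner \<sigma>)"

lemma partner:
  assumes s: "\<sigma> \<in> X.sk q"
  shows "(px \<sigma>, px' \<sigma>) \<in> C" "px \<sigma> \<in> upper \<sigma>"
proof -
  have "partner \<sigma> \<in> C \<and> px \<sigma> \<in> upper \<sigma>"
    unfolding partner_def by (rule someI_ex) (use partner_ex[OF s] in blast)
  then show "(px \<sigma>, px' \<sigma>) \<in> C" "px \<sigma> \<in> upper \<sigma>" by auto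
qed

lemma px_facts:
  assumes s: "\<sigma> \<in> X.sk q"
  shows "px \<sigma> \<in> mspace T" "px' \<sigma> \<in> mspace T'" "q + \<eta> \<le> X.ht (px \<sigma>)" "q < Y.ht (px' \<sigma>)" "X.pt (px \<sigma>) q = \<sigma>"
    "q \<le> X.ht (px \<sigma>)"
proof -
  note p = partner[OF s]
  show m: "px \<sigma> \<in> mspace T" "px' \<sigma> \<in> mspace T'" using gclose_in[OF C(1) p(1)] by auto
  have a: "px \<sigma> \<in> above T \<rho> \<sigma>" "q + \<eta> \<le> X.gp (Z \<sigma>) (px \<sigma>)" using p(2) by (auto simp: upper_def)
  show h: "q + \<eta> \<le> X.ht (px \<sigma>)" using X.gp_le2[OF Z_in[OF s] m(1)] a(2) by simp
  show "q < Y.ht (px' \<sigma>)" using gclose_ht[OF C(1) p(1)] h par by linarith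
  show "X.pt (px \<sigma>) q = \<sigma>" using a(1) sk_in[OF s] by (simp add: X.above_iff')
  show "q \<le> X.ht (px \<sigma>)" using h par by linarith
qed

text \<open>The point of the second sphere that matches sigma: the ancestor at height q of a partner
  of some point in \<open>upper\<close>.\<close>

definition sn :: "'a \<Rightarrow> 'b" where "sn \<sigma> = Y.pt (px' \<sigma>) q"

lemma sn_sphere:
  assumes s: "\<sigma> \<in> X.sk q" shows "sn \<sigma> \<in> msphere_of T' \<rho>' q"
  unfolding sn_def using px_facts[OF s] par by (simp add: msphere_of_def Y.pt_in Y.ht_pt)

lemma above_sn_iff:
  assumes s: "\<sigma> \<in> X.sk q" and y: "y \<in> mspace T'"
  shows "y \<in> above T' \<rho>' (sn \<sigma>) \<longleftrightarrow> q \<le> Y.gp (px' \<sigma>) y"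
  unfolding sn_def using px_facts[OF s] par y by (intro Y.above_pt_iff) auto

text \<open>Two points of \<open>upper\<close> share a path up to height q + \<eta> at least,
  through their common path with \<open>Z \<sigma>\<close>. Since e < \<eta>, partners still agree
  strictly beyond q; in particular \<open>sn\<close> does not depend on the chosen partner.\<close>

lemma upper_partner:
  assumes s: "\<sigma> \<in> X.sk q" and x: "x \<in> upper \<sigma>" and xy: "(x, y) \<in> C"
  shows "q < Y.gp (px' \<sigma>) y"
proof -
  note p = partner[OF s] and f = px_facts[OF s]
  have xm: "x \<in> mspace T" using gclose_in[OF C(1) xy] by simp
  have "min (X.gp (px \<sigma>) (Z \<sigma>)) (X.gp (Z \<sigma>) x) \<le> X.gp (px \<sigma>) x" by (rule X.gp_ultra[OF f(1) Z_in[OF s] xm])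
  then have "q + \<eta> \<le> X.gp (px \<sigma>) x" using p(2) x X.gp_sym[of "px \<sigma>" "Z \<sigma>"] by (auto simp: upper_def min_def split: if_splits)
  then show ?thesis using gcloseD[OF C(1) p(1) xy] par by linarith
qed

lemma sn_big:
  assumes s: "\<sigma> \<in> X.sk q" shows "ennreal (K + M + 1) \<le> emeasure \<nu> (above T' \<rho>' (sn \<sigma>))"
proof -
  have "ennreal (K + M + 1) + ennreal (1 / 2) = ennreal (K + M + 3 / 2)" using par by (subst ennreal_plus[symmetric]) simp_all
  also have "\<dots> \<le> emeasure \<mu> (upper \<sigma> \<inter> mcball_of T \<rho> S)" by (rule upper_big[OF s])
  also have "\<dots> \<le> emeasure \<nu> (above T' \<rho>' (sn \<sigma>)) + ennreal e"
  proof (rule lcloseD[OF C(2)])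
    show "C `` (upper \<sigma> \<inter> mcball_of T \<rho> S) \<subseteq> above T' \<rho>' (sn \<sigma>)"
    proof
      fix y assume "y \<in> C `` (upper \<sigma> \<inter> mcball_of T \<rho> S)"
      then obtain x where x: "x \<in> upper \<sigma>" "(x, y) \<in> C" by blast
      show "y \<in> above T' \<rho>' (sn \<sigma>)"
        using upper_partner[OF s x] gclose_in(2)[OF C(1) x(2)] by (simp add: above_sn_iff[OF s])
    qed
  qed (use sets_regions[OF s] ball_sub in auto)
  also have "\<dots> \<le> emeasure \<nu> (above T' \<rho>' (sn \<sigma>)) + ennreal (1 / 2)"
    by (intro add_left_mono ennreal_leI par)
  finally show ?thesis by (rule ennreal_le_cancel)
qed

text \<open>Were the matching point not a cut point, everything above it would belong to the cut
  set, whose mass is at most K.\<close>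

lemma sn_D': assumes s: "\<sigma> \<in> X.sk q" shows "sn \<sigma> \<in> D'"
proof (rule ccontr)
  assume "sn \<sigma> \<notin> D'"
  then have sub: "above T' \<rho>' (sn \<sigma>) \<subseteq> Cut T' \<rho>' q D'" using sn_sphere[OF s] by (auto simp: Cut_def)
  have "ennreal (K + M + 1) \<le> emeasure \<nu> (above T' \<rho>' (sn \<sigma>))" by (rule sn_big[OF s])
  also have "\<dots> \<le> emeasure \<nu> (Cut T' \<rho>' q D')" using sub par by (intro emeasure_mono) (simp_all add: Y.Cut_borel[OF D'(1) _ D'(2)])
  also have "\<dots> \<le> ennreal K" by (rule bound)
  finally show False using par by (simp add: ennreal_le_iff)
qed

text \<open>Distinct skeleton points separate more than \<eta> below q, which a distortion e <
  \<eta> cannot close.\<close>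

lemma inj_sn: "inj_on sn (X.sk q)"
proof (rule inj_onI, rule ccontr)
  fix \<sigma> \<tau> assume s: "\<sigma> \<in> X.sk q" and t: "\<tau> \<in> X.sk q" and e: "sn \<sigma> = sn \<tau>" and ne: "\<sigma> \<noteq> \<tau>"
  note f = px_facts[OF s] and g = px_facts[OF t]
  have "q \<le> Y.gp (px' \<sigma>) (px' \<tau>)"
    using Y.pt_eq_iff[OF f(2) g(2), of q] e f(4) g(4) par by (simp add: sn_def)
  moreover have "X.gp \<sigma> \<tau> = min q (X.gp (px \<sigma>) (px \<tau>))"
    using X.gp_pt2[OF f(1) g(1), of q q] f(5,6) g(5,6) par by simp
  moreover have "X.gp \<sigma> \<tau> < q - \<eta>" by (rule apart[OF s t ne])
  ultimately show False using gcloseD[OF C(1) partner(1)[OF s] partner(1)[OF t]] par by linarith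
qed

text \<open>The matching points are cut points and are as many as the skeleton points; there is no
  room for further cut points.\<close>

lemma D'_eq: "D' = sn ` X.sk q"
proof (rule card_seteq[OF D'(2), symmetric])
  show "sn ` X.sk q \<subseteq> D'" using sn_D' by blast
  show "card D' \<le> card (sn ` X.sk q)" using D'(3) by (simp add: card_image[OF inj_sn])
qed

lemma D'_big: assumes "\<tau> \<in> D'" shows "ennreal M \<le> emeasure \<nu> (above T' \<rho>' \<tau>)"
proof -
  obtain \<sigma> where s: "\<sigma> \<in> X.sk q" "\<tau> = sn \<sigma>" using assms by (auto simp: D'_eq)
  have "ennreal M \<le> ennreal (K + M + 1)" using par by (intro ennreal_leI) simp
  also have "\<dots> \<le> emeasure \<nu> (above T' \<rho>' \<tau>)" unfolding s(2) by (rule sn_big[OF s(1)])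
  finally show ?thesis .
qed

text \<open>The added pairs are invisible to \<mu> and \<nu> but carry the atoms of the cut measures
  to each other.\<close>

definition "C' = C \<union> (\<lambda>\<sigma>. (\<sigma>, sn \<sigma>)) ` X.sk q"

text \<open>The added pairs consist of ancestors at the common height q of related points, so
  \<open>gclose_down\<close> bounds their distortion too.\<close>

lemma gclose_C': "gclose T \<rho> T' \<rho>' C' e"
proof -
  have "C' \<subseteq> down T \<rho> T' \<rho>' C e"
  proof
    fix p assume "p \<in> C'"
    then consider x y where "p = (x, y)" "(x, y) \<in> C" | \<sigma> where "\<sigma> \<in> X.sk q" "p = (\<sigma>, sn \<sigma>)"
      unfolding C'_def by (cases p) auto
    then show "p \<in> down T \<rho> T' \<rho>' C e"
    proof cases
      case 1
      have m: "x \<in> mspace T" "y \<in> mspace T'" using gclose_in[OF C(1) 1(2)] by auto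
      have "p = (X.pt x (X.ht x), Y.pt y (Y.ht y))" using 1(1) X.pt_ht[OF m(1)] Y.pt_ht[OF m(2)] by simp
      moreover have "\<bar>X.ht x - Y.ht y\<bar> \<le> e" by (rule gclose_ht[OF C(1) 1(2)])
      ultimately show ?thesis unfolding down_def using 1(2) by fastforce
    next
      case 2
      note f = px_facts[OF 2(1)]
      have "p = (X.pt (px \<sigma>) q, Y.pt (px' \<sigma>) q)" using 2(2) f(5) by (simp add: sn_def)
      then show ?thesis unfolding down_def using partner(1)[OF 2(1)] f(4,6) par by fastforce
    qed
  qed
  then show ?thesis
    using gclose_subset[OF gclose_down[OF X.rtree Y.rtree C(1), of e]] by simp
qed

text \<open>One \<epsilon> for the tail, one for the unstable zone at each skeleton point, and e for
  the comparison of the measures.\<close>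

abbreviation "\<delta> \<equiv> (real (card (X.sk q)) + 1) * \<epsilon> + e"

lemma fin_sk: "finite (X.sk q)"
  by (rule X.sk_finite[OF par(1)])

lemma sum_regions:
  assumes F: "\<And>\<sigma>. \<sigma> \<in> X.sk q \<Longrightarrow> F \<sigma> \<in> sets (metric_borel T)" "\<And>\<sigma>. \<sigma> \<in> X.sk q \<Longrightarrow> emeasure \<mu> (F \<sigma>) \<le> ennreal \<epsilon>"
  shows "emeasure \<mu> (\<Union>\<sigma>\<in>X.sk q. F \<sigma>) \<le> ennreal (real (card (X.sk q)) * \<epsilon>)"
proof -
  have "emeasure \<mu> (\<Union>\<sigma>\<in>X.sk q. F \<sigma>) \<le> (\<Sum>\<sigma>\<in>X.sk q. emeasure \<mu> (F \<sigma>))"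
    using F(1) by (intro emeasure_subadditive_finite fin_sk) auto
  also have "\<dots> \<le> of_nat (card (X.sk q)) * ennreal \<epsilon>" by (rule sum_bounded_above[OF F(2)])
  finally show ?thesis using par by (simp add: ennreal_mult ennreal_of_nat_eq_real_of_nat)
qed

lemma Cut_sets: "Cut T \<rho> q (X.sk q) \<in> sets (metric_borel T)" "Cut T' \<rho>' q D' \<in> sets (metric_borel T')"
  using par by (auto intro!: X.Cut_borel Y.Cut_borel X.sk_sub fin_sk D')

lemma mclose_cut:
  "mclose (cut_measure T \<rho> \<mu> q (X.sk q) M) (cut_measure T' \<rho>' \<nu> q D' M) C' \<delta>"
  unfolding mclose_def X.sets_cut_measure Y.sets_cut_measure
proof (intro ballI impI)
  fix A B assume A: "A \<in> sets (metric_borel T)" and B: "B \<in> sets (metric_borel T')" and AB: "C' `` A \<subseteq> B"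
  let ?Cut = "Cut T \<rho> q (X.sk q)" and ?Cut' = "Cut T' \<rho>' q D'"
  define N where "N = (\<Union>\<sigma>\<in>X.sk q. side \<sigma> \<inter> mcball_of T \<rho> (S + 1))"
  \<comment> \<open>What remains is stable: partners of these points stay in the other cut set. The
    tail, the \<open>side\<close> zones and the null sphere are paid for separately.\<close>
  define A1 where "A1 = (A \<inter> ?Cut \<inter> mcball_of T \<rho> S) - N - msphere_of T \<rho> q"
  have sph: "msphere_of T \<rho> q \<in> sets (metric_borel T)" by (rule msphere_of_borel) simp
  have Nb: "N \<in> sets (metric_borel T)" unfolding N_def
    by (intro sets.finite_UN fin_sk sets.Int sets_regions X.ball_borel)
  have A1b: "A1 \<in> sets (metric_borel T)" unfolding A1_def
    by (intro sets.Diff sets.Int A Cut_sets X.ball_borel Nb sph)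
  have tb: "?Cut - mcball_of T \<rho> S \<in> sets (metric_borel T)" by (intro sets.Diff Cut_sets X.ball_borel)
  have "emeasure \<mu> (A \<inter> ?Cut) \<le> emeasure \<mu> (A1 \<union> ((?Cut - mcball_of T \<rho> S) \<union> (N \<union> msphere_of T \<rho> q)))"
    using A1b tb Nb sph by (intro emeasure_mono) (auto simp: A1_def)
  also have "\<dots> \<le> emeasure \<mu> A1 + (emeasure \<mu> (?Cut - mcball_of T \<rho> S) + (emeasure \<mu> N + emeasure \<mu> (msphere_of T \<rho> q)))"
    using A1b tb Nb sph
    by (intro order_trans[OF emeasure_subadditive] add_left_mono) (auto intro!: order_trans[OF emeasure_subadditive])
  also have "\<dots> \<le> (emeasure \<nu> (B \<inter> ?Cut') + ennreal e) + (ennreal \<epsilon> + (ennreal (real (card (X.sk q)) * \<epsilon>) + 0))"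
  proof (intro add_mono)
    show "emeasure \<mu> (?Cut - mcball_of T \<rho> S) \<le> ennreal \<epsilon>" by (rule tails)
    show "emeasure \<mu> (msphere_of T \<rho> q) \<le> 0" by (simp add: sphere_null)
    show "emeasure \<mu> N \<le> ennreal (real (card (X.sk q)) * \<epsilon>)" unfolding N_def
      by (rule sum_regions[OF sets.Int[OF sets_regions(3) X.ball_borel] outer[folded side_def]])
    show "emeasure \<mu> A1 \<le> emeasure \<nu> (B \<inter> ?Cut') + ennreal e"
    proof (rule lcloseD[OF C(2)])
      show "A1 \<subseteq> mcball_of T \<rho> (S + 1)" using ball_sub by (auto simp: A1_def)
      show "C `` A1 \<subseteq> B \<inter> ?Cut'"
      proof
        fix y assume "y \<in> C `` A1"
        then obtain x where x: "x \<in> A1" "(x, y) \<in> C" by blast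
        have m: "x \<in> mspace T" "y \<in> mspace T'" using gclose_in[OF C(1) x(2)] by auto
        have xA: "x \<in> A" "x \<in> ?Cut" "x \<in> mcball_of T \<rho> S" "x \<notin> N" "X.ht x \<noteq> q"
          using x(1) m by (auto simp: A1_def msphere_of_def)
        have "y \<notin> above T' \<rho>' (sn \<sigma>)" if s: "\<sigma> \<in> X.sk q" for \<sigma>
        proof
          assume "y \<in> above T' \<rho>' (sn \<sigma>)"
          then have "q \<le> Y.gp (px' \<sigma>) y" by (simp add: above_sn_iff[OF s m(2)])
          then have "q - \<eta> \<le> X.gp (px \<sigma>) x" using gcloseD[OF C(1) partner(1)[OF s] x(2)] par by linarith
          moreover have "X.gp \<sigma> x = min q (X.gp (px \<sigma>) x)"
            using X.gp_pt[OF px_facts(1)[OF s] m(1), of q] px_facts(5,6)[OF s] par by simp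
          ultimately have g: "q - \<eta> \<le> X.gp \<sigma> x" using par by simp
          \<comment> \<open>A skeleton point belongs to \<open>Cut\<close> as a point of the ball
            and also to its own theta; off the sphere the two exclude each other.\<close>
          have "x \<notin> above T \<rho> \<sigma>"
          proof
            assume a: "x \<in> above T \<rho> \<sigma>"
            then have "q < X.ht x" using X.above_ht[OF a] sk_in(2)[OF s] xA(5) by linarith
            then show False using xA(2) a s X.Cut_iff[OF X.sk_sub, of q x] par by auto
          qed
          then have "x \<in> side \<sigma>" using g m by (simp add: side_def)
          then show False using xA(3,4) s ball_sub by (auto simp: N_def)
        qed
        then have "y \<in> ?Cut'" using Y.Cut_iff[OF D'(1), of y] m(2) par by (auto simp: D'_eq)
        moreover have "y \<in> B" using AB x(2) xA(1) by (auto simp: C'_def)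
        ultimately show "y \<in> B \<inter> ?Cut'" by simp
      qed
    qed (use A1b B Cut_sets in auto)
  qed
  also have "\<dots> = emeasure \<nu> (B \<inter> ?Cut') + ennreal \<delta>"
  proof -
    have "ennreal e + (ennreal \<epsilon> + (ennreal (real (card (X.sk q)) * \<epsilon>) + 0)) = ennreal \<delta>"
      using par by (simp flip: ennreal_plus add: algebra_simps)
    then show ?thesis by (simp only: add.assoc)
  qed
  finally have 1: "emeasure \<mu> (A \<inter> ?Cut) \<le> emeasure \<nu> (B \<inter> ?Cut') + ennreal \<delta>" .
  have "card (X.sk q \<inter> A) = card (sn ` (X.sk q \<inter> A))"
    by (rule card_image[symmetric]) (rule inj_on_subset[OF inj_sn], blast)
  also have "\<dots> \<le> card (D' \<inter> B)"
    using AB D'(2) by (intro card_mono) (auto simp: D'_eq C'_def)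
  finally have 2: "of_nat (card (X.sk q \<inter> A)) * ennreal M \<le> of_nat (card (D' \<inter> B)) * ennreal M"
    by (intro mult_right_mono of_nat_mono) simp_all
  have q0: "0 \<le> q" using par by simp
  show "emeasure (cut_measure T \<rho> \<mu> q (X.sk q) M) A \<le> emeasure (cut_measure T' \<rho>' \<nu> q D' M) B + ennreal \<delta>"
    unfolding X.cut_measure_eq[OF X.sk_sub q0 fin_sk A] Y.cut_measure_eq[OF D'(1) q0 D'(2) B]
    using add_mono[OF 1 2] by (simp only: ac_simps)
qed

lemma mclose_cut_converse:
  "mclose (cut_measure T' \<rho>' \<nu> q D' M) (cut_measure T \<rho> \<mu> q (X.sk q) M) (C'\<inverse>) \<delta>"
  unfolding mclose_def X.sets_cut_measure Y.sets_cut_measure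
proof (intro ballI impI)
  fix B A assume B: "B \<in> sets (metric_borel T')" and A: "A \<in> sets (metric_borel T)" and AB: "C'\<inverse> `` B \<subseteq> A"
  let ?Cut = "Cut T \<rho> q (X.sk q)" and ?Cut' = "Cut T' \<rho>' q D'"
  define N where "N = (\<Union>\<sigma>\<in>X.sk q. low \<sigma> \<inter> mcball_of T \<rho> (S + 1))"
  define B1 where "B1 = B \<inter> ?Cut' \<inter> mcball_of T' \<rho>' S"
  have Nb: "N \<in> sets (metric_borel T)" unfolding N_def
    by (intro sets.finite_UN fin_sk sets.Int sets_regions X.ball_borel)
  have B1b: "B1 \<in> sets (metric_borel T')" unfolding B1_def by (intro sets.Int B Cut_sets Y.ball_borel)
  have tb: "?Cut' - mcball_of T' \<rho>' S \<in> sets (metric_borel T')" by (intro sets.Diff Cut_sets Y.ball_borel)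
  have ACb: "A \<inter> ?Cut \<in> sets (metric_borel T)" by (intro sets.Int A Cut_sets)
  have "emeasure \<nu> (B \<inter> ?Cut') \<le> emeasure \<nu> (B1 \<union> (?Cut' - mcball_of T' \<rho>' S))"
    using B1b tb by (intro emeasure_mono) (auto simp: B1_def)
  also have "\<dots> \<le> emeasure \<nu> B1 + emeasure \<nu> (?Cut' - mcball_of T' \<rho>' S)"
    using B1b tb by (intro emeasure_subadditive) simp_all
  also have "\<dots> \<le> (emeasure \<mu> ((A \<inter> ?Cut) \<union> N) + ennreal e) + ennreal \<epsilon>"
  proof (intro add_mono tails(2), rule lcloseD[OF C(3)])
    show "B1 \<subseteq> mcball_of T' \<rho>' (S + 1)" by (auto simp: B1_def)
    show "C\<inverse> `` B1 \<subseteq> (A \<inter> ?Cut) \<union> N"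
    proof
      fix x assume "x \<in> C\<inverse> `` B1"
      then obtain y where y: "y \<in> B1" "(x, y) \<in> C" by blast
      have m: "x \<in> mspace T" "y \<in> mspace T'" using gclose_in[OF C(1) y(2)] by auto
      have yB: "y \<in> B" "y \<in> ?Cut'" "y \<in> mcball_of T' \<rho>' S" using y(1) by (auto simp: B1_def)
      have "x \<in> A" using AB y(2) yB(1) by (auto simp: C'_def)
      moreover have "x \<in> N" if nc: "x \<notin> ?Cut"
      proof -
        obtain \<sigma> where s: "\<sigma> \<in> X.sk q" "x \<in> above T \<rho> \<sigma>"
          using nc X.Cut_iff[OF X.sk_sub, of q x] m par by auto
        \<comment> \<open>A point of \<open>upper\<close> has its partner strictly above the
          matching cut point, hence outside the other cut set.\<close>
        have "x \<in> low \<sigma>"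
        proof (rule ccontr)
          assume "x \<notin> low \<sigma>"
          then have "x \<in> upper \<sigma>" using s(2) by (auto simp: low_def upper_def)
          then have g: "q < Y.gp (px' \<sigma>) y" by (rule upper_partner[OF s(1) _ y(2)])
          then have "y \<in> above T' \<rho>' (sn \<sigma>)" by (simp add: above_sn_iff[OF s(1) m(2)])
          moreover have "q < Y.ht y" using g Y.gp_le2[OF px_facts(2)[OF s(1)] m(2)] by simp
          ultimately show False using yB(2) sn_D'[OF s(1)] par by (auto simp: Y.Cut_iff[OF D'(1)])
        qed
        \<comment> \<open>Passing to a related point may raise the height by e, which is why the
          zones are controlled in the ball of radius S + 1.\<close>
        moreover have "X.ht x \<le> S + 1" using gclose_ht[OF C(1) y(2)] yB(3) par by auto
        ultimately show ?thesis using s(1) m by (auto simp: N_def)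
      qed
      ultimately show "x \<in> (A \<inter> ?Cut) \<union> N" by blast
    qed
  qed (use B1b ACb Nb in auto)
  also have "emeasure \<mu> ((A \<inter> ?Cut) \<union> N) \<le> emeasure \<mu> (A \<inter> ?Cut) + ennreal (real (card (X.sk q)) * \<epsilon>)"
  proof -
    have "emeasure \<mu> N \<le> ennreal (real (card (X.sk q)) * \<epsilon>)" unfolding N_def
      by (rule sum_regions[OF sets.Int[OF sets_regions(2) X.ball_borel] inner[folded low_def]])
    moreover have "emeasure \<mu> ((A \<inter> ?Cut) \<union> N) \<le> emeasure \<mu> (A \<inter> ?Cut) + emeasure \<mu> N"
      using ACb Nb by (intro emeasure_subadditive) simp_all
    ultimately show ?thesis by (meson add_left_mono order_trans)
  qed
  finally have "emeasure \<nu> (B \<inter> ?Cut') \<le> emeasure \<mu> (A \<inter> ?Cut) + ennreal (real (card (X.sk q)) * \<epsilon>) + ennreal e + ennreal \<epsilon>"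
    by (simp add: add_right_mono)
  also have "\<dots> = emeasure \<mu> (A \<inter> ?Cut) + ennreal \<delta>"
  proof -
    have "ennreal (real (card (X.sk q)) * \<epsilon>) + (ennreal e + ennreal \<epsilon>) = ennreal \<delta>"
      using par by (simp flip: ennreal_plus add: algebra_simps)
    then show ?thesis by (simp only: add.assoc)
  qed
  finally have 1: "emeasure \<nu> (B \<inter> ?Cut') \<le> emeasure \<mu> (A \<inter> ?Cut) + ennreal \<delta>" .
  have "D' \<inter> B \<subseteq> sn ` (X.sk q \<inter> A)" using AB by (auto simp: D'_eq C'_def)
  then have "card (D' \<inter> B) \<le> card (X.sk q \<inter> A)"
    using fin_sk by (intro surj_card_le) auto
  then have 2: "of_nat (card (D' \<inter> B)) * ennreal M \<le> of_nat (card (X.sk q \<inter> A)) * ennreal M"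
    by (intro mult_right_mono of_nat_mono) simp_all
  have q0: "0 \<le> q" using par by simp
  show "emeasure (cut_measure T' \<rho>' \<nu> q D' M) B \<le> emeasure (cut_measure T \<rho> \<mu> q (X.sk q) M) A + ennreal \<delta>"
    unfolding X.cut_measure_eq[OF X.sk_sub q0 fin_sk A] Y.cut_measure_eq[OF D'(1) q0 D'(2) B]
    using add_mono[OF 1 2] by (simp only: ac_simps)
qed

end

text \<open>Continuity from above along \<eta> = 1 / (n + 1). The set \<open>S\<close> of finite
  mass makes it applicable, and monotonicity passes from the sequence to all small \<eta>.\<close>

lemma eventually_shrinking_null:
  fixes F :: "real \<Rightarrow> 'a set" and \<epsilon> :: real
  assumes meas: "\<And>\<eta>. F \<eta> \<in> sets M" and mono: "\<And>\<eta> \<eta>'. \<eta> \<le> \<eta>' \<Longrightarrow> F \<eta> \<subseteq> F \<eta>'"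
    and S: "S \<in> sets M" "emeasure M S < \<infinity>"
    and N: "N \<in> sets M" "emeasure M N = 0" "\<And>x. x \<in> S \<Longrightarrow> (\<And>\<eta>. 0 < \<eta> \<Longrightarrow> x \<in> F \<eta>) \<Longrightarrow> x \<in> N"
    and \<epsilon>: "\<epsilon> > 0"
  shows "\<forall>\<^sub>F \<eta> in at_right 0. emeasure M (F \<eta> \<inter> S) \<le> ennreal \<epsilon>"
proof -
  define A where "A n = F (inverse (real (Suc n))) \<inter> S" for n
  have Am: "A n \<in> sets M" for n using meas S by (simp add: A_def)
  have dec: "decseq A"
    unfolding decseq_def A_def by (intro allI impI Int_mono mono order_refl) (simp add: field_simps)
  have fin: "emeasure M (A n) \<noteq> \<infinity>" for n
  proof -
    have "emeasure M (A n) \<le> emeasure M S" using S by (intro emeasure_mono) (auto simp: A_def)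
    then show ?thesis using S(2) by auto
  qed
  have "(\<Inter>n. A n) \<subseteq> N"
  proof
    fix x assume x: "x \<in> (\<Inter>n. A n)"
    have "x \<in> F \<eta>" if e: "0 < \<eta>" for \<eta>
    proof -
      obtain n where "inverse (real (Suc n)) < \<eta>" using reals_Archimedean[OF e] by blast
      then have "F (inverse (real (Suc n))) \<subseteq> F \<eta>" by (intro mono) simp
      then show ?thesis using x by (auto simp: A_def)
    qed
    moreover have "x \<in> S" using x by (auto simp: A_def)
    ultimately show "x \<in> N" using N(3) by blast
  qed
  then have "emeasure M (\<Inter>n. A n) \<le> emeasure M N" by (rule emeasure_mono[OF _ N(1)])
  then have "emeasure M (\<Inter>n. A n) = 0" using N(2) by simp
  then have lim: "(\<lambda>n. emeasure M (A n)) \<longlonglongrightarrow> 0"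
    using Lim_emeasure_decseq[of A M] Am dec fin by (simp add: image_subset_iff)
  have "0 < ennreal \<epsilon>" using \<epsilon> by simp
  then have "\<forall>\<^sub>F n in sequentially. emeasure M (A n) < ennreal \<epsilon>" by (rule order_tendstoD(2)[OF lim])
  then obtain n where n: "emeasure M (A n) < ennreal \<epsilon>" using eventually_happens'[OF sequentially_bot] by blast
  have "\<forall>\<^sub>F \<eta> in at_right 0. \<eta> \<in> {0<..<inverse (real (Suc n))}" by (rule eventually_at_right_real) simp
  then show ?thesis
  proof eventually_elim
    case (elim \<eta>)
    then have "F \<eta> \<subseteq> F (inverse (real (Suc n)))" by (intro mono) simp
    then have "F \<eta> \<inter> S \<subseteq> A n" unfolding A_def by (rule Int_mono) simp
    then have "emeasure M (F \<eta> \<inter> S) \<le> emeasure M (A n)" using Am by (rule emeasure_mono)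
    from order_trans[OF this less_imp_le[OF n]] show ?case .
  qed
qed

section \<open>The margin at a nice radius\<close>

context di_tree
begin

text \<open>Since the sphere is null, infinite mass above sigma forces points strictly above it. As
  sigma is not a branch point, all of them lie in one branch, and any of them can serve as
  z.\<close>

lemma sk_above_ex:
  assumes q: "nice_radius (T, \<rho>, \<mu>) q" and s: "\<sigma> \<in> sk q"
  shows "\<exists>z\<in>above T \<rho> \<sigma>. q < ht z \<and> (\<forall>y\<in>above T \<rho> \<sigma> - {\<sigma>}. q < gp z y)"
proof -
  have q0: "q > 0" and null: "emeasure \<mu> (msphere_of T \<rho> q) = 0" and nb: "msphere_of T \<rho> q \<inter> Bp T \<rho> = {}"
    using q by (auto simp: nice_radius_def)
  have sm: "\<sigma> \<in> mspace T" "ht \<sigma> = q" "emeasure \<mu> (above T \<rho> \<sigma>) = \<infinity>" using s sk_iff[OF q0] by auto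
  have ss: "\<sigma> \<in> msphere_of T \<rho> q" using s sk_sub by blast
  have "\<not> above T \<rho> \<sigma> \<subseteq> {\<sigma>}"
  proof
    assume "above T \<rho> \<sigma> \<subseteq> {\<sigma>}"
    then have "emeasure \<mu> (above T \<rho> \<sigma>) \<le> emeasure \<mu> (msphere_of T \<rho> q)"
      using ss msphere_of_borel[OF root_in] by (intro emeasure_mono) auto
    then show False using null sm(3) by simp
  qed
  then obtain z where z: "z \<in> above T \<rho> \<sigma>" "z \<noteq> \<sigma>" by blast
  have "q < gp z y" if y: "y \<in> above T \<rho> \<sigma>" "y \<noteq> \<sigma>" for y
  proof (rule ccontr)
    assume "\<not> q < gp z y"
    then have ne: "branch T \<rho> \<sigma> z \<noteq> branch T \<rho> \<sigma> y" using branch_eq_iff[OF z(1) y(1) z(2)] sm by simp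
    have r: "rsub (mspace T)" by (simp add: rsub_def pt_in)
    have "{branch T \<rho> \<sigma> z, branch T \<rho> \<sigma> y} \<subseteq> branches T \<rho> (mspace T) \<sigma>"
      unfolding branches_def using z y above_sub[of \<sigma>] by blast
    then have "2 \<le> ecard (branches T \<rho> (mspace T) \<sigma>)"
      using ne card_mono[of "branches T \<rho> (mspace T) \<sigma>" "{branch T \<rho> \<sigma> z, branch T \<rho> \<sigma> y}"]
      by (auto simp: ecard_def numeral_eq_enat)
    then have "\<sigma> \<in> bpoints (mspace T)" using sm q0 by (auto simp: bpoints_def)
    then have "\<sigma> \<in> Bp T \<rho>" using Bp_bpoints[OF r] by simp
    then show False using nb ss by blast
  qed
  moreover have "q < ht z"
    using above_ht[OF z(1)] above_antisym[OF z(1)] z(2) sm(2) by (cases "ht z \<le> q") auto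
  ultimately show ?thesis using z(1) by blast
qed

text \<open>As \<eta> decreases to 0, the zone above the cut shrinks to sigma, a null set by
  niceness, and the zone beside it to the empty set. Finitely many skeleton points allow a common
  \<eta>.\<close>

lemma nice_cut:
  assumes q: "nice_radius (T, \<rho>, \<mu>) q" and \<epsilon>: "\<epsilon> > 0"
  shows "\<exists>\<eta> Z. \<eta> > 0 \<and> (\<forall>\<sigma>\<in>sk q. Z \<sigma> \<in> above T \<rho> \<sigma> \<and>
    emeasure \<mu> ({y\<in>above T \<rho> \<sigma>. gp (Z \<sigma>) y < q + \<eta>} \<inter> mcball_of T \<rho> S) \<le> ennreal \<epsilon> \<and>
    emeasure \<mu> ({y\<in>mspace T - above T \<rho> \<sigma>. q - \<eta> \<le> gp \<sigma> y} \<inter> mcball_of T \<rho> S) \<le> ennreal \<epsilon> \<and>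
    (\<forall>\<sigma>'\<in>sk q. \<sigma> \<noteq> \<sigma>' \<longrightarrow> gp \<sigma> \<sigma>' < q - \<eta>))"
proof -
  have q0: "q > 0" and null: "emeasure \<mu> (msphere_of T \<rho> q) = 0" using q by (auto simp: nice_radius_def)
  define Z where "Z \<sigma> = (SOME z. z \<in> above T \<rho> \<sigma> \<and> q < ht z \<and> (\<forall>y\<in>above T \<rho> \<sigma> - {\<sigma>}. q < gp z y))" for \<sigma>
  have Z: "Z \<sigma> \<in> above T \<rho> \<sigma> \<and> q < ht (Z \<sigma>) \<and> (\<forall>y\<in>above T \<rho> \<sigma> - {\<sigma>}. q < gp (Z \<sigma>) y)" if s: "\<sigma> \<in> sk q" for \<sigma>
    unfolding Z_def by (rule someI_ex) (use sk_above_ex[OF q s] in blast)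
  have inner: "\<forall>\<^sub>F \<eta> in at_right 0. emeasure \<mu> ({y\<in>above T \<rho> \<sigma>. gp (Z \<sigma>) y < q + \<eta>} \<inter> mcball_of T \<rho> S) \<le> ennreal \<epsilon>"
    if s: "\<sigma> \<in> sk q" for \<sigma>
  proof (rule eventually_shrinking_null[where N="msphere_of T \<rho> q"])
    have ZT: "Z \<sigma> \<in> mspace T" using Z[OF s] above_sub[of \<sigma>] by blast
    have "{y\<in>above T \<rho> \<sigma>. gp (Z \<sigma>) y < q + \<eta>} = above T \<rho> \<sigma> \<inter> {y\<in>mspace T. gp (Z \<sigma>) y < q + \<eta>}" for \<eta>
      using above_sub by auto
    then show "{y\<in>above T \<rho> \<sigma>. gp (Z \<sigma>) y < q + \<eta>} \<in> sets \<mu>" for \<eta>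
      by (simp only: sets_eq) (intro sets.Int above_borel open_in_metric_borel openin_less_lipschitz gp_lipschitz ZT)
    show "emeasure \<mu> (mcball_of T \<rho> S) < \<infinity>" by (rule ball_finite)
    fix x assume F: "\<And>\<eta>. 0 < \<eta> \<Longrightarrow> x \<in> {y\<in>above T \<rho> \<sigma>. gp (Z \<sigma>) y < q + \<eta>}"
    have "gp (Z \<sigma>) x \<le> q" by (rule field_le_epsilon) (use F in \<open>auto intro: less_imp_le\<close>)
    moreover have "x \<in> above T \<rho> \<sigma>" using F[of 1] by simp
    ultimately have "x = \<sigma>" using Z[OF s] by force
    then show "x \<in> msphere_of T \<rho> q" using s sk_sub by blast
  qed (use null \<epsilon> msphere_of_borel[OF root_in] in auto)
  have outer: "\<forall>\<^sub>F \<eta> in at_right 0. emeasure \<mu> ({y\<in>mspace T - above T \<rho> \<sigma>. q - \<eta> \<le> gp \<sigma> y} \<inter> mcball_of T \<rho> S) \<le> ennreal \<epsilon>"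
    if s: "\<sigma> \<in> sk q" for \<sigma>
  proof (rule eventually_shrinking_null[where N="{}"])
    have sm: "\<sigma> \<in> mspace T" "ht \<sigma> = q" using s sk_iff[OF q0] by auto
    have "{y\<in>mspace T - above T \<rho> \<sigma>. q - \<eta> \<le> gp \<sigma> y} = {y\<in>mspace T. q - \<eta> \<le> gp \<sigma> y} - above T \<rho> \<sigma>" for \<eta> by auto
    then show "{y\<in>mspace T - above T \<rho> \<sigma>. q - \<eta> \<le> gp \<sigma> y} \<in> sets \<mu>" for \<eta>
      by (simp only: sets_eq) (intro sets.Diff above_borel closed_in_metric_borel closedin_ge_lipschitz gp_lipschitz sm)
    show "emeasure \<mu> (mcball_of T \<rho> S) < \<infinity>" by (rule ball_finite)
    fix x assume F: "\<And>\<eta>. 0 < \<eta> \<Longrightarrow> x \<in> {y\<in>mspace T - above T \<rho> \<sigma>. q - \<eta> \<le> gp \<sigma> y}"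
    \<comment> \<open>A point separating from sigma at no height below q would lie above
      sigma.\<close>
    have "q \<le> gp \<sigma> x"
    proof (rule field_le_epsilon)
      show "q \<le> gp \<sigma> x + \<eta>" if "0 < \<eta>" for \<eta> using F[OF that] by simp
    qed
    then show "x \<in> {}" using F[of 1] sm by (simp add: above_iff)
  qed (use \<epsilon> in auto)
  have apart: "\<forall>\<^sub>F \<eta> in at_right 0. gp \<sigma> \<sigma>' < q - \<eta>" if s: "\<sigma> \<in> sk q" "\<sigma>' \<in> sk q" "\<sigma> \<noteq> \<sigma>'" for \<sigma> \<sigma>'
  proof -
    have sm: "\<sigma> \<in> mspace T" "ht \<sigma> = q" "\<sigma>' \<in> mspace T" "ht \<sigma>' = q" using s sk_iff[OF q0] by auto
    have "\<not> q \<le> gp \<sigma> \<sigma>'"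
    proof
      assume "q \<le> gp \<sigma> \<sigma>'"
      then have "\<sigma>' \<in> above T \<rho> \<sigma>" using sm by (simp add: above_iff)
      from above_antisym[OF this] show False using sm s(3) by simp
    qed
    then have "0 < q - gp \<sigma> \<sigma>'" by simp
    from eventually_at_right_real[OF this] show ?thesis by eventually_elim simp
  qed
  have "\<forall>\<^sub>F \<eta> in at_right 0. \<forall>\<sigma>\<in>sk q. Z \<sigma> \<in> above T \<rho> \<sigma> \<and>
    emeasure \<mu> ({y\<in>above T \<rho> \<sigma>. gp (Z \<sigma>) y < q + \<eta>} \<inter> mcball_of T \<rho> S) \<le> ennreal \<epsilon> \<and>
    emeasure \<mu> ({y\<in>mspace T - above T \<rho> \<sigma>. q - \<eta> \<le> gp \<sigma> y} \<inter> mcball_of T \<rho> S) \<le> ennreal \<epsilon> \<and>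
    (\<forall>\<sigma>'\<in>sk q. \<sigma> \<noteq> \<sigma>' \<longrightarrow> gp \<sigma> \<sigma>' < q - \<eta>)"
  proof (rule eventually_ball_finite[OF sk_finite[OF q0] ballI])
    fix \<sigma> assume s: "\<sigma> \<in> sk q"
    have "\<forall>\<^sub>F \<eta> in at_right 0. \<forall>\<sigma>'\<in>sk q. \<sigma> \<noteq> \<sigma>' \<longrightarrow> gp \<sigma> \<sigma>' < q - \<eta>"
    proof (rule eventually_ball_finite[OF sk_finite[OF q0] ballI])
      fix \<sigma>' assume s': "\<sigma>' \<in> sk q"
      show "\<forall>\<^sub>F \<eta> in at_right 0. \<sigma> \<noteq> \<sigma>' \<longrightarrow> gp \<sigma> \<sigma>' < q - \<eta>"
        using apart[OF s s'] by (cases "\<sigma> = \<sigma>'") simp_all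
    qed
    with inner[OF s] outer[OF s]
    show "\<forall>\<^sub>F \<eta> in at_right 0. Z \<sigma> \<in> above T \<rho> \<sigma> \<and>
      emeasure \<mu> ({y\<in>above T \<rho> \<sigma>. gp (Z \<sigma>) y < q + \<eta>} \<inter> mcball_of T \<rho> S) \<le> ennreal \<epsilon> \<and>
      emeasure \<mu> ({y\<in>mspace T - above T \<rho> \<sigma>. q - \<eta> \<le> gp \<sigma> y} \<inter> mcball_of T \<rho> S) \<le> ennreal \<epsilon> \<and>
      (\<forall>\<sigma>'\<in>sk q. \<sigma> \<noteq> \<sigma>' \<longrightarrow> gp \<sigma> \<sigma>' < q - \<eta>)"
    proof eventually_elim
      case (elim \<eta>)
      with Z[OF s] show ?case by (intro conjI) simp_all
    qed
  qed
  with eventually_at_right_less[of 0] have "\<exists>\<eta>. 0 < \<eta> \<and> (\<forall>\<sigma>\<in>sk q. Z \<sigma> \<in> above T \<rho> \<sigma> \<and>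
    emeasure \<mu> ({y\<in>above T \<rho> \<sigma>. gp (Z \<sigma>) y < q + \<eta>} \<inter> mcball_of T \<rho> S) \<le> ennreal \<epsilon> \<and>
    emeasure \<mu> ({y\<in>mspace T - above T \<rho> \<sigma>. q - \<eta> \<le> gp \<sigma> y} \<inter> mcball_of T \<rho> S) \<le> ennreal \<epsilon> \<and>
    (\<forall>\<sigma>'\<in>sk q. \<sigma> \<noteq> \<sigma>' \<longrightarrow> gp \<sigma> \<sigma>' < q - \<eta>))"
    by (intro eventually_happens'[OF trivial_limit_at_right_real] eventually_conj)
  then show ?thesis by (elim exE) (intro exI)
qed

end

section \<open>Convergence of the erased trees\<close>

text \<open>Partners of points in the ball of radius R stay within R + d <= R', where the second
  measure is still represented by its finite substitute.\<close>

lemma lclose_of_local: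
  assumes C: "gclose T \<rho> T' \<rho>' C d" and m: "mclose \<alpha>' \<beta>' C d" and \<rho>': "\<rho>' \<in> mspace T'"
    and s: "sets \<alpha> = sets (metric_borel T)" "sets \<beta> = sets (metric_borel T')"
      "sets \<alpha>' = sets (metric_borel T)" "sets \<beta>' = sets (metric_borel T')"
    and loc: "\<And>A. A \<in> sets (metric_borel T) \<Longrightarrow> A \<subseteq> mcball_of T \<rho> R \<Longrightarrow> emeasure \<alpha> A = emeasure \<alpha>' A"
      "\<And>B. B \<in> sets (metric_borel T') \<Longrightarrow> B \<subseteq> mcball_of T' \<rho>' R' \<Longrightarrow> emeasure \<beta> B = emeasure \<beta>' B"
    and R: "R + d \<le> R'" and d: "d \<le> \<delta>"
  shows "lclose T \<rho> \<alpha> \<beta> C R \<delta>"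
  unfolding lclose_def s
proof (intro ballI impI)
  fix A B assume A: "A \<in> sets (metric_borel T)" and B: "B \<in> sets (metric_borel T')" and AR: "A \<subseteq> mcball_of T \<rho> R" and AB: "C `` A \<subseteq> B"
  let ?B = "B \<inter> mcball_of T' \<rho>' R'"
  have Bb: "?B \<in> sets (metric_borel T')" using B mcball_of_borel[OF \<rho>'] by (rule sets.Int)
  have "emeasure \<alpha> A = emeasure \<alpha>' A" by (rule loc(1)[OF A AR])
  also have "\<dots> \<le> emeasure \<beta>' ?B + ennreal d"
  proof (rule mcloseD[OF m])
    show "C `` A \<subseteq> ?B"
    proof
      fix y assume "y \<in> C `` A"
      then obtain x where x: "x \<in> A" "(x, y) \<in> C" by blast
      have "mdist T' \<rho>' y \<le> R'" using gclose_ht[OF C x(2)] x(1) AR R by fastforce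
      then show "y \<in> ?B" using x AB \<rho>' gclose_in[OF C x(2)] by auto
    qed
  qed (use A Bb s in auto)
  also have "emeasure \<beta>' ?B = emeasure \<beta> ?B" by (rule loc(2)[OF Bb, symmetric]) blast
  also have "emeasure \<beta> ?B + ennreal d \<le> emeasure \<beta> B + ennreal \<delta>"
    using B s(2) d by (intro add_mono emeasure_mono ennreal_leI) auto
  finally show "emeasure \<alpha> A \<le> emeasure \<beta> B + ennreal \<delta>" .
qed

lemma (in tree_measure) mrestrict_Cut_tail:
  assumes D: "D \<subseteq> msphere_of T \<rho> q" and q: "0 \<le> q" and fin: "finite D"
  shows "emeasure (mrestrict \<mu> (Cut T \<rho> q D)) (mspace T - mcball_of T \<rho> r) = emeasure \<mu> (Cut T \<rho> q D - mcball_of T \<rho> r)"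
proof -
  have "(mspace T - mcball_of T \<rho> r) \<inter> Cut T \<rho> q D = Cut T \<rho> q D - mcball_of T \<rho> r" using Cut_sub[OF D q] by blast
  moreover have "mspace T - mcball_of T \<rho> r \<in> sets \<mu>" unfolding sets_eq by (intro sets.Diff mspace_borel ball_borel)
  ultimately show ?thesis using Cut_borel[OF D q fin] by (simp add: emeasure_mrestrict)
qed

lemma (in di_tree) eventually_mass:
  assumes q: "q > 0" and \<epsilon>: "\<epsilon> > 0"
  shows "\<forall>\<^sub>F S in at_top. emeasure \<mu> (Cut T \<rho> q (sk q) - mcball_of T \<rho> S) \<le> ennreal \<epsilon>"
    and "\<sigma> \<in> sk q \<Longrightarrow> \<forall>\<^sub>F S in at_top. ennreal K \<le> emeasure \<mu> (above T \<rho> \<sigma> \<inter> mcball_of T \<rho> S)"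
proof -
  let ?Cut = "Cut T \<rho> q (sk q)"
  have q0: "0 \<le> q" using q by simp
  \<comment> \<open>With atoms of size 0 this is the finite restriction of \<mu> to the cut set,
    used only for its tail.\<close>
  interpret N: finite_tree_measure T \<rho> "cutm q 0" by (rule cutm_finite[OF q])
  have Cb: "?Cut \<in> sets (metric_borel T)" by (rule Cut_borel[OF sk_sub q0 sk_finite[OF q]])
  have htm: "(\<lambda>x. ht x) \<in> borel_measurable (cutm q 0)"
    using ht_meas measurable_cong_sets[OF sets_cut_measure refl] by blast
  obtain L where L: "emeasure (cutm q 0) {x\<in>space (cutm q 0). L < ht x} \<le> ennreal \<epsilon>"
    using N.tail_small[OF htm \<epsilon>] by blast
  have Lb: "{x\<in>mspace T. L < ht x} \<in> sets (metric_borel T)"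
    by (intro open_in_metric_borel openin_greater_lipschitz ht_lipschitz)
  have "emeasure \<mu> (?Cut - mcball_of T \<rho> S) \<le> ennreal \<epsilon>" if S: "L \<le> S" for S
  proof -
    have "emeasure \<mu> (?Cut - mcball_of T \<rho> S) \<le> emeasure \<mu> ({x\<in>mspace T. L < ht x} \<inter> ?Cut)"
      using S Cut_sub[OF sk_sub q0] Lb Cb by (intro emeasure_mono) auto
    also have "\<dots> \<le> emeasure (cutm q 0) {x\<in>mspace T. L < ht x}"
      by (simp add: cut_measure_eq[OF sk_sub q0 sk_finite[OF q] Lb])
    also have "\<dots> \<le> ennreal \<epsilon>" using L by (simp add: space_cut_measure)
    finally show ?thesis .
  qed
  then show "\<forall>\<^sub>F S in at_top. emeasure \<mu> (?Cut - mcball_of T \<rho> S) \<le> ennreal \<epsilon>"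
    by (rule eventually_mono[OF eventually_ge_at_top])
  assume s: "\<sigma> \<in> sk q"
  let ?A = "\<lambda>n::nat. above T \<rho> \<sigma> \<inter> mcball_of T \<rho> (real n)"
  have "(\<Union>n. ?A n) = above T \<rho> \<sigma>"
  proof (intro equalityI subsetI)
    fix x assume x: "x \<in> above T \<rho> \<sigma>"
    obtain n :: nat where "ht x \<le> real n" using real_arch_simple by blast
    then show "x \<in> (\<Union>n. ?A n)" using x above_sub[of \<sigma>] by auto
  qed blast
  then have "(SUP n. emeasure \<mu> (?A n)) = emeasure \<mu> (above T \<rho> \<sigma>)"
    by (subst SUP_emeasure_incseq) (auto simp: incseq_def)
  also have "\<dots> = \<infinity>" using s sk_iff[OF q] by simp
  finally have sup: "(SUP n. emeasure \<mu> (?A n)) = \<infinity>" .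
  have "ennreal K < (SUP n. emeasure \<mu> (?A n))" unfolding sup by simp
  then obtain n where n: "ennreal K < emeasure \<mu> (?A n)" by (auto simp: less_SUP_iff)
  have "ennreal K \<le> emeasure \<mu> (above T \<rho> \<sigma> \<inter> mcball_of T \<rho> S)" if "real n \<le> S" for S
  proof -
    have "emeasure \<mu> (?A n) \<le> emeasure \<mu> (above T \<rho> \<sigma> \<inter> mcball_of T \<rho> S)"
      using that by (intro emeasure_mono) auto
    then show ?thesis using n by (meson less_imp_le order_trans)
  qed
  then show "\<forall>\<^sub>F S in at_top. ennreal K \<le> emeasure \<mu> (above T \<rho> \<sigma> \<inter> mcball_of T \<rho> S)"
    by (rule eventually_mono[OF eventually_ge_at_top])
qed

text \<open>The constants depend on each other in this order: the tolerance \<epsilon>0 of finite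
  erasure, then \<epsilon>, the mass bound K, the radius S, the margin \<eta>, the distortion e, and
  at last n. Tightness supplies K and S uniformly in n.\<close>

lemma erase_locally_close:
  assumes X: "di_tree T \<rho> \<mu>" and Y: "\<And>n. di_tree (Tn n) (\<rho>n n) (\<mu>n n)"
    and nice: "nice_radius (T, \<rho>, \<mu>) q"
    and D: "\<And>n. D n \<subseteq> msphere_of (Tn n) (\<rho>n n) q" "\<And>n. finite (D n)" "\<And>n. card (D n) \<le> card (skel_sphere T \<rho> \<mu> q)"
    and h: "h > 0" "\<And>n. hn n > 0" "hn \<longlonglongrightarrow> h"
    and GV: "GV_converges (\<lambda>n. (Tn n, \<rho>n n, \<mu>n n)) (T, \<rho>, \<mu>)"
    and tight: "b_tight (\<lambda>n. (Tn n, \<rho>n n, mrestrict (\<mu>n n) (Cut (Tn n) (\<rho>n n) q (D n))))"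
    and R: "R < q" and \<delta>: "\<delta> > 0"
  shows "\<forall>\<^sub>F n in sequentially. locally_close T \<rho> (erase T \<rho> h \<mu>) (Tn n) (\<rho>n n) (erase (Tn n) (\<rho>n n) (hn n) (\<mu>n n)) R \<delta>"
proof -
  interpret X: di_tree T \<rho> \<mu> by (rule X)
  have q: "q > 0" and null: "emeasure \<mu> (msphere_of T \<rho> q) = 0" using nice by (auto simp: nice_radius_def)
  then have q0: "0 \<le> q" by simp
  have tm: "tree_measure (Tn n) (\<rho>n n) (\<mu>n n)" for n by (rule di_tree.di_tree_measure[OF Y])
  have lc: "\<forall>\<^sub>F n in sequentially. locally_close T \<rho> \<mu> (Tn n) (\<rho>n n) (\<mu>n n) S e" if "e > 0" for S e
    by (rule GV_imp_locally_close[OF X.di_good di_tree.di_good[OF Y] GV that])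
  let ?tail = "\<lambda>n S. emeasure (\<mu>n n) (Cut (Tn n) (\<rho>n n) q (D n) - mcball_of (Tn n) (\<rho>n n) S)"
  have tail: "\<forall>\<^sub>F S in at_top. \<forall>\<^sub>F n in sequentially. ?tail n S \<le> ennreal e" if e: "e > 0" for e
  proof -
    have "((\<lambda>S. limsup (\<lambda>n. ?tail n S)) \<longlongrightarrow> 0) at_top"
      using tight by (simp add: b_tight_def tree_measure.mrestrict_Cut_tail[OF tm D(1) q0 D(2)])
    moreover have "0 < ennreal e" using e by simp
    ultimately have "\<forall>\<^sub>F S in at_top. limsup (\<lambda>n. ?tail n S) < ennreal e" by (rule order_tendstoD(2))
    then show ?thesis
    proof eventually_elim
      case (elim S)
      from Limsup_lessD[OF this] show ?case by (rule eventually_mono) simp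
    qed
  qed
  define c where "c = real (card (X.sk q)) + 1"
  have c: "c > 0" by (simp add: c_def)
  \<comment> \<open>R' lies halfway between R and q, so heights may change by d without reaching the
    cut.\<close>
  define d where "d = min \<delta> ((q - R) / 2)"
  define R' where "R' = (R + q) / 2"
  have d: "0 < d" "d \<le> \<delta>" "R + d \<le> R'" "R' < q" "R' + d \<le> q" "R < R'"
    using \<delta> R by (auto simp: d_def R'_def min_def field_simps)
  obtain \<epsilon>0 where \<epsilon>0: "\<epsilon>0 > 0" and cont: "\<And>T' \<rho>' \<nu> h' C. finite_tree_measure T' (\<rho>' :: 'b) \<nu> \<Longrightarrow> gclose T \<rho> T' \<rho>' C \<epsilon>0 \<Longrightarrow>
     mclose (X.cutm q (2 * h)) \<nu> C \<epsilon>0 \<Longrightarrow> mclose \<nu> (X.cutm q (2 * h)) (C\<inverse>) \<epsilon>0 \<Longrightarrow> \<bar>h - h'\<bar> \<le> \<epsilon>0 \<Longrightarrow>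
     \<exists>C'. gclose T \<rho> T' \<rho>' C' d \<and> mclose (erase T \<rho> h (X.cutm q (2 * h))) (erase T' \<rho>' h' \<nu>) C' d \<and>
       mclose (erase T' \<rho>' h' \<nu>) (erase T \<rho> h (X.cutm q (2 * h))) (C'\<inverse>) d"
    using erase_continuous[OF X.cutm_finite[OF q] h(1) d(1), where 'b='b] by metis
  \<comment> \<open>Half of \<epsilon>0 pays for the c regions of mass \<epsilon>, the other half
    for the distortion e.\<close>
  define \<epsilon> where "\<epsilon> = min (1 / 2) (\<epsilon>0 / (2 * c))"
  have \<epsilon>: "0 < \<epsilon>" "\<epsilon> \<le> 1 / 2" using \<epsilon>0 c by (auto simp: \<epsilon>_def)
  have c\<epsilon>: "c * \<epsilon> \<le> \<epsilon>0 / 2"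
  proof -
    have "c * \<epsilon> \<le> c * (\<epsilon>0 / (2 * c))" using c by (intro mult_left_mono) (auto simp: \<epsilon>_def)
    then show ?thesis using c by simp
  qed
  obtain S0 where S0: "\<forall>\<^sub>F n in sequentially. ?tail n S0 \<le> ennreal 1"
    using eventually_happens'[OF trivial_limit_at_top_linorder tail[of 1]] by auto
  \<comment> \<open>The two units are the comparison error and the tail beyond S0. K has to be fixed
    before S, because S must be large enough for mass K + 2 h + 2 above each skeleton point.\<close>
  define K where "K = measure \<mu> (mcball_of T \<rho> (S0 + 1)) + 2"
  have K: "0 \<le> K" by (simp add: K_def add_nonneg_nonneg)
  have bound: "\<forall>\<^sub>F n in sequentially. emeasure (\<mu>n n) (Cut (Tn n) (\<rho>n n) q (D n)) \<le> ennreal K"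
    using S0 lc[OF zero_less_one, of S0]
  proof eventually_elim
    case (elim n)
    interpret Y: di_tree "Tn n" "\<rho>n n" "\<mu>n n" by (rule Y)
    obtain C where C: "gclose T \<rho> (Tn n) (\<rho>n n) C 1" "lclose (Tn n) (\<rho>n n) (\<mu>n n) \<mu> (C\<inverse>) S0 1"
      using elim(2) unfolding locally_close_def by blast
    have "emeasure (\<mu>n n) (mcball_of (Tn n) (\<rho>n n) S0) \<le> emeasure \<mu> (mcball_of T \<rho> (S0 + 1)) + ennreal 1"
    proof (rule lcloseD[OF C(2)])
      show "C\<inverse> `` mcball_of (Tn n) (\<rho>n n) S0 \<subseteq> mcball_of T \<rho> (S0 + 1)"
      proof
        fix x assume "x \<in> C\<inverse> `` mcball_of (Tn n) (\<rho>n n) S0"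
        then obtain y where y: "(x, y) \<in> C" "mdist (Tn n) (\<rho>n n) y \<le> S0" by auto
        have "X.ht x \<le> S0 + 1" using gclose_ht[OF C(1) y(1)] y(2) by linarith
        then show "x \<in> mcball_of T \<rho> (S0 + 1)" using gclose_in[OF C(1) y(1)] by simp
      qed
    qed simp_all
    also have "emeasure \<mu> (mcball_of T \<rho> (S0 + 1)) = ennreal (K - 2)"
      unfolding K_def using X.ball_finite[of "S0 + 1"] by (subst emeasure_eq_ennreal_measure) simp_all
    finally have b: "emeasure (\<mu>n n) (mcball_of (Tn n) (\<rho>n n) S0) \<le> ennreal (K - 2) + ennreal 1" .
    have Cb: "Cut (Tn n) (\<rho>n n) q (D n) \<in> sets (metric_borel (Tn n))" by (rule Y.Cut_borel[OF D(1) q0 D(2)])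
    have "emeasure (\<mu>n n) (Cut (Tn n) (\<rho>n n) q (D n)) \<le> emeasure (\<mu>n n)
        (mcball_of (Tn n) (\<rho>n n) S0 \<union> (Cut (Tn n) (\<rho>n n) q (D n) - mcball_of (Tn n) (\<rho>n n) S0))"
      using Cb by (intro emeasure_mono sets.Un sets.Diff) auto
    also have "\<dots> \<le> emeasure (\<mu>n n) (mcball_of (Tn n) (\<rho>n n) S0) + ?tail n S0"
      using Cb by (intro emeasure_subadditive sets.Diff) simp_all
    also have "\<dots> \<le> (ennreal (K - 2) + ennreal 1) + ennreal 1" by (rule add_mono[OF b elim(1)])
    also have "\<dots> = ennreal K"
    proof -
      have "0 \<le> K - 2" by (simp add: K_def)
      then show ?thesis by (simp add: ennreal_plus[symmetric] del: ennreal_1 ennreal_plus)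
    qed
    finally show ?case .
  qed
  have "\<forall>\<^sub>F S in at_top. emeasure \<mu> (Cut T \<rho> q (X.sk q) - mcball_of T \<rho> S) \<le> ennreal \<epsilon> \<and>
      (\<forall>\<sigma>\<in>X.sk q. ennreal (K + 2 * h + 2) \<le> emeasure \<mu> (above T \<rho> \<sigma> \<inter> mcball_of T \<rho> S)) \<and>
      (\<forall>\<^sub>F n in sequentially. ?tail n S \<le> ennreal \<epsilon>)"
    by (intro eventually_conj eventually_ball_finite ballI X.sk_finite[OF q] X.eventually_mass[OF q \<epsilon>(1)] tail[OF \<epsilon>(1)])
  from eventually_happens'[OF trivial_limit_at_top_linorder this]
  obtain S where S: "emeasure \<mu> (Cut T \<rho> q (X.sk q) - mcball_of T \<rho> S) \<le> ennreal \<epsilon>"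
      "\<And>\<sigma>. \<sigma> \<in> X.sk q \<Longrightarrow> ennreal (K + 2 * h + 2) \<le> emeasure \<mu> (above T \<rho> \<sigma> \<inter> mcball_of T \<rho> S)"
      "\<forall>\<^sub>F n in sequentially. ?tail n S \<le> ennreal \<epsilon>" by blast
  obtain \<eta> Z where \<eta>: "\<eta> > 0" and Z: "\<And>\<sigma>. \<sigma> \<in> X.sk q \<Longrightarrow> Z \<sigma> \<in> above T \<rho> \<sigma> \<and>
    emeasure \<mu> ({y\<in>above T \<rho> \<sigma>. X.gp (Z \<sigma>) y < q + \<eta>} \<inter> mcball_of T \<rho> (S + 1)) \<le> ennreal \<epsilon> \<and>
    emeasure \<mu> ({y\<in>mspace T - above T \<rho> \<sigma>. q - \<eta> \<le> X.gp \<sigma> y} \<inter> mcball_of T \<rho> (S + 1)) \<le> ennreal \<epsilon> \<and>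
    (\<forall>\<sigma>'\<in>X.sk q. \<sigma> \<noteq> \<sigma>' \<longrightarrow> X.gp \<sigma> \<sigma>' < q - \<eta>)"
    using X.nice_cut[OF nice \<epsilon>(1), of "S + 1"] by auto
  define e where "e = min (1 / 2) (min (\<epsilon>0 / 2) (\<eta> / 2))"
  have e: "0 < e" "e < \<eta>" "e \<le> 1 / 2" "e \<le> \<epsilon>0 / 2" using \<epsilon>0 \<eta> by (auto simp: e_def min_def)
  \<comment> \<open>Closeness within h gives h_n <= 2 h, so the atoms are large enough for the
    erasure level of T_n as well.\<close>
  have hn: "\<forall>\<^sub>F n in sequentially. \<bar>hn n - h\<bar> < min \<epsilon>0 h"
    using tendstoD[OF h(3), of "min \<epsilon>0 h"] \<epsilon>0 h(1) by (simp add: dist_real_def)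
  show ?thesis
    using lc[OF e(1), of "S + 1"] S(3) bound hn
  proof eventually_elim
    case (elim n)
    interpret Y: di_tree "Tn n" "\<rho>n n" "\<mu>n n" by (rule Y)
    obtain C where C: "gclose T \<rho> (Tn n) (\<rho>n n) C e" "lclose T \<rho> \<mu> (\<mu>n n) C (S + 1) e" "lclose (Tn n) (\<rho>n n) (\<mu>n n) \<mu> (C\<inverse>) (S + 1) e"
      using elim(1) unfolding locally_close_def by blast
    interpret P: cut_pair T \<rho> \<mu> "Tn n" "\<rho>n n" "\<mu>n n" q S \<eta> e \<epsilon> "2 * h" K C "D n" Z
      by unfold_locales (use q e \<epsilon> h(1) K D Z null C S elim(2,3) in auto)
    have le: "P.\<delta> \<le> \<epsilon>0" using c\<epsilon> e(4) by (simp add: c_def)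
    have hh: "hn n \<le> 2 * h" "\<bar>h - hn n\<bar> \<le> \<epsilon>0" using elim(4) by (auto simp: abs_if split: if_splits)
    let ?\<nu> = "cut_measure (Tn n) (\<rho>n n) (\<mu>n n) q (D n) (2 * h)"
    have cf: "emeasure (\<mu>n n) (Cut (Tn n) (\<rho>n n) q (D n)) < \<infinity>" using elim(3) by (auto simp: le_less_trans)
    interpret N: finite_tree_measure "Tn n" "\<rho>n n" ?\<nu> by (rule Y.cut_measure_finite[OF D(1) q0 D(2) cf])
    interpret M: finite_tree_measure T \<rho> "X.cutm q (2 * h)" by (rule X.cutm_finite[OF q])
    obtain C' where C': "gclose T \<rho> (Tn n) (\<rho>n n) C' d"
        "mclose (erase T \<rho> h (X.cutm q (2 * h))) (erase (Tn n) (\<rho>n n) (hn n) ?\<nu>) C' d"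
        "mclose (erase (Tn n) (\<rho>n n) (hn n) ?\<nu>) (erase T \<rho> h (X.cutm q (2 * h))) (C'\<inverse>) d"
      using cont[OF N.finite_tree_measure_axioms gclose_mono[OF P.gclose_C'] mclose_mono[OF P.mclose_cut le]
          mclose_mono[OF P.mclose_cut_converse le] hh(2)] e(4) \<epsilon>0 by auto
    have locX: "emeasure (erase T \<rho> h \<mu>) A = emeasure (erase T \<rho> h (X.cutm q (2 * h))) A"
      if "A \<in> sets (metric_borel T)" "A \<subseteq> mcball_of T \<rho> r" "r < q" for A r
      by (rule X.erase_cutm[OF h(1) _ that q]) (use h(1) in simp)
    have locY: "emeasure (erase (Tn n) (\<rho>n n) (hn n) (\<mu>n n)) B = emeasure (erase (Tn n) (\<rho>n n) (hn n) ?\<nu>) B"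
      if B: "B \<in> sets (metric_borel (Tn n))" "B \<subseteq> mcball_of (Tn n) (\<rho>n n) r" "r < q" for B r
    proof (rule Y.erase_cut_measure[OF D(1) D(2) cf h(2) hh(1) _ B q])
      fix \<sigma> assume "\<sigma> \<in> D n"
      from order_trans[OF ennreal_leI[OF hh(1)] P.D'_big[OF this]]
      show "ennreal (hn n) \<le> emeasure (\<mu>n n) (above (Tn n) (\<rho>n n) \<sigma>)" .
    qed
    note sets = X.sets_erase[OF h(1)] Y.sets_erase[OF h(2)] M.sets_erase[OF h(1)] N.sets_erase[OF h(2)]
    have "lclose T \<rho> (erase T \<rho> h \<mu>) (erase (Tn n) (\<rho>n n) (hn n) (\<mu>n n)) C' R \<delta>"
      by (rule lclose_of_local[OF C'(1,2) Y.root_in sets locX locY d(3,2)]) (use R d in auto)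
    moreover have "lclose (Tn n) (\<rho>n n) (erase (Tn n) (\<rho>n n) (hn n) (\<mu>n n)) (erase T \<rho> h \<mu>) (C'\<inverse>) R \<delta>"
      by (rule lclose_of_local[OF gclose_converse[OF C'(1)] C'(3) X.root_in sets(2,1,4,3) locY locX d(3,2)]) (use R d in auto)
    moreover have "gclose T \<rho> (Tn n) (\<rho>n n) C' \<delta>" by (rule gclose_mono[OF C'(1) d(2)])
    ultimately show ?case unfolding locally_close_def by blast
  qed
qed

lemma T_min_di_di_tree: "(T, \<rho>, \<mu>) \<in> T_min_di \<Longrightarrow> di_tree T \<rho> \<mu>"
  by unfold_locales (auto simp: T_min_di_def)

theorem theorem2p18:
  fixes T :: "'a metric" and \<rho> :: 'a and \<mu> :: "'a measure"
    and Tn :: "nat \<Rightarrow> 'b metric" and \<rho>n :: "nat \<Rightarrow> 'b" and \<mu>n :: "nat \<Rightarrow> 'b measure"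
    and r :: "nat \<Rightarrow> real" and D :: "nat \<Rightarrow> nat \<Rightarrow> 'b set"
    and h :: real and hn :: "nat \<Rightarrow> real"
  assumes "(T, \<rho>, \<mu>) \<in> T_min_di"
    and "\<And>n. (Tn n, \<rho>n n, \<mu>n n) \<in> T_min_di"
    and "incseq r" and "filterlim r at_top sequentially"
    and "\<And>k. nice_radius (T, \<rho>, \<mu>) (r k)"
    and "\<And>n k. compatible (skel_sphere T \<rho> \<mu> (r k)) (Tn n) (\<rho>n n) (r k) (D n k)"
    and "h > 0" and "\<And>n. hn n > 0"
    and "GV_converges (\<lambda>n. (Tn n, \<rho>n n, \<mu>n n)) (T, \<rho>, \<mu>)"
    and "\<And>k. b_tight (\<lambda>n. (Tn n, \<rho>n n,
               mrestrict (\<mu>n n) (Cut (Tn n) (\<rho>n n) (r k) (D n k))))"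
    and "hn \<longlonglongrightarrow> h"
  shows "GV_converges (\<lambda>n. erase_tree (hn n) (Tn n, \<rho>n n, \<mu>n n)) (erase_tree h (T, \<rho>, \<mu>)) \<and>
         (\<forall>k. b_tight (\<lambda>n. (Tn n, \<rho>n n,
               mrestrict (erase (Tn n) (\<rho>n n) h (\<mu>n n)) (Cut (Tn n) (\<rho>n n) (r k) (D n k)))))"
proof (intro conjI allI)
  note X = T_min_di_di_tree[OF assms(1)] and Y = T_min_di_di_tree[OF assms(2)]
  have r: "0 < r k" for k using assms(5)[of k] by (simp add: nice_radius_def)
  have D: "D n k \<subseteq> msphere_of (Tn n) (\<rho>n n) (r k)" "finite (D n k)" for n k
    using assms(6)[of k n] by (auto simp: compatible_def cutoff_points_def)
  \<comment> \<open>The minimum in \<open>compatible\<close> bounds the number of cut points by the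
    finite number of skeleton points; this is the count that identifies them with the matching
    points.\<close>
  have cD: "card (D n k) \<le> card (skel_sphere T \<rho> \<mu> (r k))" for n k
  proof -
    have "ecard (D n k) \<le> ecard (skel_sphere T \<rho> \<mu> (r k))" using assms(6)[of k n] by (simp add: compatible_def)
    then show ?thesis using D(2) di_tree.sk_finite[OF X r] by (simp add: ecard_def)
  qed
  show "b_tight (\<lambda>n. (Tn n, \<rho>n n, mrestrict (erase (Tn n) (\<rho>n n) h (\<mu>n n)) (Cut (Tn n) (\<rho>n n) (r k) (D n k))))" for k
    by (rule b_tight_erase[OF di_tree.di_tree_measure[OF Y] D less_imp_le[OF r] assms(7) assms(10)])
  show "GV_converges (\<lambda>n. erase_tree (hn n) (Tn n, \<rho>n n, \<mu>n n)) (erase_tree h (T, \<rho>, \<mu>))"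
  proof (rule GV_converges_erase[OF X Y assms(7,8)])
    fix R \<epsilon> :: real assume \<epsilon>: "\<epsilon> > 0"
    \<comment> \<open>For the ball of radius R a single nice radius beyond R suffices.\<close>
    have "\<forall>\<^sub>F k in sequentially. R < r k" using assms(4) by (simp add: filterlim_at_top_dense)
    then obtain k where k: "R < r k" using eventually_happens'[OF sequentially_bot] by blast
    show "\<forall>\<^sub>F n in sequentially. locally_close T \<rho> (erase T \<rho> h \<mu>) (Tn n) (\<rho>n n) (erase (Tn n) (\<rho>n n) (hn n) (\<mu>n n)) R \<epsilon>"
      by (rule erase_locally_close[OF X Y assms(5) D cD assms(7,8,11,9,10) k \<epsilon>])
  qed
qed

end
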